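(* Let $k$ be a field. For a finite poset $T$ and $n\ge0$ let $\Lambda_n^{(T)}$ be an index set for the isomorphism classes of simple modules of $P_n^{(T)}(\mathbf Q)$. (i) $|\Lambda_0^{(T)}|=1$. Now let $T=\underline 2$, $n\ge1$, $\mathbf Q=(Q_1,Q_2)\in k^2$ with $Q_1Q_2$ invertible in $k$, and suppose that $kS[\lambda]$ is semisimple for every propagating index $\lambda$ with $\#^{env}(\lambda)\le n$. Then (ii) one may take $\Lambda_n^{(\underline 2)}=\Lambda_{n-1}^{(\underline 2)}\cup\Gamma_n=\bigcup_{0\le i\le n}\Gamma_i$ (a disjoint union), and (iii) $\{\operatorname{head}\mathcal S_\Theta(n)\;|\;\Theta\in\Lambda_n^{(\underline 2)}\}$ is a complete set of representatives of the isomorphism classes of simple modules of $P_n^{(\underline 2)}(\mathbf Q)$ (one for each $\Theta$, pairwise non-isomorphic).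
   Context: Write $\underline n=\{1,\ldots,n\}$, and let $\underline n'$, $\underline n''$ be disjoint (primed, doubly primed) copies. $p_n$ is the set of partitions of $\underline n\cup\underline n'$ (identified with equivalence relations; $p_0$ has one element). For $a,b\in p_n$ let $b^{+}$ be the partition of $\underline n'\cup\underline n''$ obtained from $b$ by renaming $i\mapsto i'$, $i'\mapsto i''$; let $d_u(ab)$ be the equivalence relation on $\underline n\cup\underline n'\cup\underline n''$ generated by $a$ and $b^{+}$; $c(a,b)$ is the number of parts of $d_u(ab)$ contained in $\underline n'$; $d(ab)\in p_n$ is obtained by restricting $d_u(ab)$ to $\underline n\cup\underline n''$ and renaming $i''\mapsto i'$. For a finite poset $T$ and $\mathbf Q=(Q_t)_{t\in T}$ in $k$, $p_n^{(T)}$ is the set of tuples $(a_t)_{t\in T}$ in $p_n$ such that $t\le t'$ implies $a_t$ is a refinement of $a_{t'}$ (each part of $a_{t'}$ is a union of parts of $a_t$). $P_n^{(T)}(\mathbf Q)$ is the $k$-algebra with basis $p_n^{(T)}$ and product $ab=\left(\prod_tQ_t^{c(a_t,b_t)}\right)(d(a_tb_t))_{t\in T}$. $\underline 2$ denotes $\{1,2\}$ with $1\le2$; then elements are pairs $(a_1,a_2)$ with $a_1$ (inner) refining $a_2$ (outer). Put $P=P_n^{(\underline 2)}(\mathbf Q)$. A part of a partition is propagating if it meets both $\underline n$ and $\underline n'$. The propagating index of $a\in p_n^{(\underline 2)}$ is the list, in weakly decreasing order, of the numbers of propagating parts of $a_1|_q$, where $q$ runs over the propagating parts of $a_2$ (zeros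 kept). The set of all propagating indices consists of the finite weakly decreasing sequences of non-negative integers, including $()$. $p(\mu)$ is the set of $a\in p_n^{(\underline 2)}$ with propagating index $\mu$. $\#^{env}(\lambda)=\sum_i\max(1,\lambda_i)$. The partial order $\le$ on propagating indices is the transitive closure of $\rho$, where $\lambda'\rho\lambda$ if $\lambda'=\lambda$; or (up to reordering) $\lambda'$ is obtained from $\lambda$ by replacing a positive entry $\lambda_i$ by $\lambda_i-1$, or by replacing two entries $\lambda_i,\lambda_j$ by the single entry $\lambda_i+\lambda_j$; or $\lambda'=()$, $\lambda=(0)$. For $\lambda=(\lambda_1,\ldots,\lambda_l)$ with $e=\#^{env}(\lambda)\le n$, split $\{1,\ldots,e\}$ into consecutive intervals $B_1,\ldots,B_l$ with $|B_i|=\max(1,\lambda_i)$. $\mathcal I_\lambda\in p(\lambda)$ has inner parts $\{j,j'\}$ for $j\in B_i$ with $\lambda_i\ge1$, and $\{j\},\{j'\}$ for all other $j$; and outer parts $B_i\cup B_i'$ and $\{j\},\{j'\}$ for $j>e$. $S[\lambda]$ is the group of permutations $w$ of $\underline n$ fixing all $j>e$ and mapping each block $B_i$ onto some block $B_j$ with $\lambda_i=\lambda_j$; thus, independently of $n$, $S[\lambda]\cong\prod_iS_{u_i}\wr S_{m_i}$ where $u_1,u_2,\ldots$ are the distinct entries of $\lambda$, with multiplicities $m_i$, and $S_0$ is trivial. It embeds in $P$ by sending a permutation, viewed as the partition $\bar w$ into the corresponding pairs $\{i,j'\}$ (in the standard way so that this is a group homomorphism), to $(\bar w,\bar w)$;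 these elements commute with $\mathcal I_\lambda$. $J_{<\lambda}$ is the two-sided ideal of $P$ spanned by all $p(\mu)$ with $\mu<\lambda$; $P[\lambda]'=(P\mathcal I_\lambda+J_{<\lambda})/J_{<\lambda}$ is a $(P,kS[\lambda])$-bimodule. $\Gamma_i$ is the set of all $\Theta=(\lambda,[L_\Theta])$ with $\lambda$ a propagating index with $\#^{env}(\lambda)=i$ and $[L_\Theta]$ an isomorphism class of simple left $kS[\lambda]$-modules (these classes are indexed by tuples of multipartitions, via the classification of simple modules of wreath products of symmetric groups; $\Gamma_0$ has one element). For $\Theta\in\Gamma_i$, $i\le n$, $\mathcal S_\Theta(n)=P[\lambda]'\otimes_{kS[\lambda]}L_\Theta$. The head of a module is its quotient by its radical. *)

theory Defs
  imports
    "HOL-Algebra.Module"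
    "HOL-Algebra.AbelCoset"
    "HOL-Algebra.Generated_Groups"
    "HOL-Algebra.Free_Abelian_Groups"
    "HOL-Combinatorics.Permutations"
    "HOL-Library.FuncSet"
    "HOL-Library.Multiset"
begin

section \<open>Left modules over a not necessarily commutative ring\<close>

text \<open>The library locale \<open>module\<close> requires a commutative ring of scalars. The record type is
  shared with it; its fields \<open>monoid.mult\<close> and \<open>one\<close> play no role for modules.\<close>

locale left_module = R?: ring R + M?: abelian_group M
  for R (structure) and M :: "('a, 'b, 'c) module_scheme" (structure) +
  assumes smult_closed [simp, intro]:
      "\<lbrakk>a \<in> carrier R; x \<in> carrier M\<rbrakk> \<Longrightarrow> a \<odot>\<^bsub>M\<^esub> x \<in> carrier M"
    and smult_l_distr:
      "\<lbrakk>a \<in> carrier R; b \<in> carrier R; x \<in> carrier M\<rbrakk> \<Longrightarrow>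
        (a \<oplus> b) \<odot>\<^bsub>M\<^esub> x = a \<odot>\<^bsub>M\<^esub> x \<oplus>\<^bsub>M\<^esub> b \<odot>\<^bsub>M\<^esub> x"
    and smult_r_distr:
      "\<lbrakk>a \<in> carrier R; x \<in> carrier M; y \<in> carrier M\<rbrakk> \<Longrightarrow>
        a \<odot>\<^bsub>M\<^esub> (x \<oplus>\<^bsub>M\<^esub> y) = a \<odot>\<^bsub>M\<^esub> x \<oplus>\<^bsub>M\<^esub> a \<odot>\<^bsub>M\<^esub> y"
    and smult_assoc:
      "\<lbrakk>a \<in> carrier R; b \<in> carrier R; x \<in> carrier M\<rbrakk> \<Longrightarrow>
        (a \<otimes> b) \<odot>\<^bsub>M\<^esub> x = a \<odot>\<^bsub>M\<^esub> (b \<odot>\<^bsub>M\<^esub> x)"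
    and smult_one [simp]: "x \<in> carrier M \<Longrightarrow> \<one> \<odot>\<^bsub>M\<^esub> x = x"

definition mk_module :: "'b set \<Rightarrow> 'b \<Rightarrow> ('b \<Rightarrow> 'b \<Rightarrow> 'b) \<Rightarrow> ('a \<Rightarrow> 'b \<Rightarrow> 'b) \<Rightarrow> ('a, 'b) module"
  where "mk_module C z p s =
    \<lparr>carrier = C, monoid.mult = undefined, one = undefined, ring.zero = z, add = p, smult = s\<rparr>"

definition regular_module :: "('a, 'c) ring_scheme \<Rightarrow> ('a, 'a) module"
  where "regular_module R = mk_module (carrier R) \<zero>\<^bsub>R\<^esub> (add R) (monoid.mult R)"

definition quotient_module :: "('a, 'b, 'c) module_scheme \<Rightarrow> 'b set \<Rightarrow> ('a, 'b set) module"
  where "quotient_module M N =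
    mk_module (a_rcosets\<^bsub>M\<^esub> N) N (set_add M) (\<lambda>r X. \<Union>x\<in>X. N +>\<^bsub>M\<^esub> (r \<odot>\<^bsub>M\<^esub> x))"

definition simple_module :: "('a, 'd) ring_scheme \<Rightarrow> ('a, 'b, 'c) module_scheme \<Rightarrow> bool"
  where "simple_module R M \<longleftrightarrow> left_module R M \<and> carrier M \<noteq> {\<zero>\<^bsub>M\<^esub>} \<and>
    (\<forall>N. submodule N R M \<longrightarrow> N = {\<zero>\<^bsub>M\<^esub>} \<or> N = carrier M)"

definition semisimple_module :: "('a, 'd) ring_scheme \<Rightarrow> ('a, 'b, 'c) module_scheme \<Rightarrow> bool"
  where "semisimple_module R M \<longleftrightarrow> left_module R M \<and>
    (\<forall>N. submodule N R M \<longrightarrow>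
      (\<exists>N'. submodule N' R M \<and> N \<inter> N' = {\<zero>\<^bsub>M\<^esub>} \<and> N <+>\<^bsub>M\<^esub> N' = carrier M))"

definition semisimple_ring :: "('a, 'd) ring_scheme \<Rightarrow> bool"
  where "semisimple_ring R \<longleftrightarrow> semisimple_module R (regular_module R)"

definition module_iso ::
    "('a, 'd) ring_scheme \<Rightarrow> ('a, 'b, 'c) module_scheme \<Rightarrow> ('a, 'e, 'f) module_scheme \<Rightarrow> bool"
  where "module_iso R M N \<longleftrightarrow> (\<exists>f. bij_betw f (carrier M) (carrier N) \<and>
    (\<forall>x\<in>carrier M. \<forall>y\<in>carrier M. f (x \<oplus>\<^bsub>M\<^esub> y) = f x \<oplus>\<^bsub>N\<^esub> f y) \<and>
    (\<forall>r\<in>carrier R. \<forall>x\<in>carrier M. f (r \<odot>\<^bsub>M\<^esub> x) = r \<odot>\<^bsub>N\<^esub> f x))"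

definition maximal_submodule ::
    "'b set \<Rightarrow> ('a, 'd) ring_scheme \<Rightarrow> ('a, 'b, 'c) module_scheme \<Rightarrow> bool"
  where "maximal_submodule N R M \<longleftrightarrow> submodule N R M \<and> N \<noteq> carrier M \<and>
    (\<forall>N'. submodule N' R M \<and> N \<subseteq> N' \<longrightarrow> N' = N \<or> N' = carrier M)"

definition module_radical :: "('a, 'd) ring_scheme \<Rightarrow> ('a, 'b, 'c) module_scheme \<Rightarrow> 'b set"
  where "module_radical R M = carrier M \<inter> \<Inter>{N. maximal_submodule N R M}"

definition module_head ::
    "('a, 'd) ring_scheme \<Rightarrow> ('a, 'b, 'c) module_scheme \<Rightarrow> ('a, 'b set) module"
  where "module_head R M = quotient_module M (module_radical R M)"

text \<open>Isomorphism classes of simple modules. Up to isomorphism every simple module, over any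
  carrier type, has its elements in the type of sets of ring elements; see
  \<open>simple_module_copy\<close> below.\<close>

definition simple_classes :: "('a, 'd) ring_scheme \<Rightarrow> ('a, 'a set) module set set"
  where "simple_classes R = {M. simple_module R M} //
    {(M, N). simple_module R M \<and> simple_module R N \<and> module_iso R M N}"

subsection \<open>Simple modules over any carrier type\<close>

lemma simple_module_transfer:
  fixes M :: "('a, 'b, 'c) module_scheme" and N :: "('a, 'e, 'f) module_scheme"
  assumes M: "simple_module R M"
    and bij: "bij_betw f (carrier M) (carrier N)"
    and f_add: "\<And>x y. \<lbrakk>x \<in> carrier M; y \<in> carrier M\<rbrakk> \<Longrightarrow> f (x \<oplus>\<^bsub>M\<^esub> y) = f x \<oplus>\<^bsub>N\<^esub> f y"
    and f_smult: "\<And>r x. \<lbrakk>r \<in> carrier R; x \<in> carrier M\<rbrakk> \<Longrightarrow> f (r \<odot>\<^bsub>M\<^esub> x) = r \<odot>\<^bsub>N\<^esub> f x"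
    and f_zero: "f \<zero>\<^bsub>M\<^esub> = \<zero>\<^bsub>N\<^esub>"
  shows "simple_module R N"
proof -
  interpret M: left_module R M using M by (simp add: simple_module_def)
  have inj: "inj_on f (carrier M)" and img: "carrier N = f ` carrier M"
    using bij by (auto simp: bij_betw_def)
  have "abelian_group N"
  proof (rule abelian_groupI)
    show "\<exists>y\<in>carrier N. y \<oplus>\<^bsub>N\<^esub> x = \<zero>\<^bsub>N\<^esub>" if x: "x \<in> carrier N" for x
    proof -
      obtain u where u: "u \<in> carrier M" "x = f u" using x img by auto
      then have "f (\<ominus>\<^bsub>M\<^esub> u) \<oplus>\<^bsub>N\<^esub> x = \<zero>\<^bsub>N\<^esub>"
        using f_add[of "\<ominus>\<^bsub>M\<^esub> u" u] by (simp add: M.M.l_neg f_zero)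
      then show ?thesis using u img by auto
    qed
  next
    fix x y z assume "x \<in> carrier N" "y \<in> carrier N" "z \<in> carrier N"
    then show "x \<oplus>\<^bsub>N\<^esub> y \<oplus>\<^bsub>N\<^esub> z = x \<oplus>\<^bsub>N\<^esub> (y \<oplus>\<^bsub>N\<^esub> z)"
      using img by (auto simp flip: f_add simp: M.M.a_assoc)
  next
    fix x y assume "x \<in> carrier N" "y \<in> carrier N"
    then show "x \<oplus>\<^bsub>N\<^esub> y = y \<oplus>\<^bsub>N\<^esub> x"
      using img by (auto simp flip: f_add intro: arg_cong[OF M.M.a_comm])
  qed (use img in \<open>auto simp flip: f_add f_zero\<close>)
  then have N: "left_module R N"
  proof (intro left_module.intro left_module_axioms.intro)
    show "ring R" by (rule M.R.ring_axioms)
  qed (use img in \<open>auto simp flip: f_add f_smult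
         simp: M.smult_l_distr M.smult_r_distr M.smult_assoc\<close>)
  interpret N: left_module R N by (rule N)
  have "carrier N \<noteq> {\<zero>\<^bsub>N\<^esub>}"
  proof
    assume "carrier N = {\<zero>\<^bsub>N\<^esub>}"
    then have "\<forall>x\<in>carrier M. f x = f \<zero>\<^bsub>M\<^esub>" using img f_zero by auto
    then have "carrier M \<subseteq> {\<zero>\<^bsub>M\<^esub>}" using inj by (auto dest: inj_onD)
    then show False using M M.M.zero_closed unfolding simple_module_def by blast
  qed
  moreover have "K = {\<zero>\<^bsub>N\<^esub>} \<or> K = carrier N" if K: "submodule K R N" for K
  proof -
    let ?K = "{x \<in> carrier M. f x \<in> K}"
    interpret K: submodule K R N by (rule K)
    have K_sub: "K \<subseteq> carrier N" using K.subset by simp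
    have K_zero: "\<zero>\<^bsub>N\<^esub> \<in> K" using K.one_closed by simp
    have K_add: "x \<oplus>\<^bsub>N\<^esub> y \<in> K" if "x \<in> K" "y \<in> K" for x y
      using K.m_closed[OF that] by simp
    have K_neg: "\<ominus>\<^bsub>N\<^esub> x \<in> K" if "x \<in> K" for x
      using K.m_inv_closed[OF that] by (simp add: a_inv_def)
    have f_neg: "f (\<ominus>\<^bsub>M\<^esub> x) = \<ominus>\<^bsub>N\<^esub> f x" if "x \<in> carrier M" for x
    proof (rule N.M.minus_equality[symmetric])
      show "f (\<ominus>\<^bsub>M\<^esub> x) \<oplus>\<^bsub>N\<^esub> f x = \<zero>\<^bsub>N\<^esub>"
        using that f_add[of "\<ominus>\<^bsub>M\<^esub> x" x] by (simp add: M.M.l_neg f_zero)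
    qed (use that img in auto)
    have "submodule ?K R M"
    proof (intro submodule.intro subgroup.intro submodule_axioms.intro)
      fix x assume "x \<in> ?K"
      then show "inv\<^bsub>add_monoid M\<^esub> x \<in> ?K"
        using K_neg f_neg M.M.a_inv_closed by (auto simp flip: a_inv_def)
    qed (auto simp: f_add f_smult f_zero K_add K_zero)
    then have "?K = {\<zero>\<^bsub>M\<^esub>} \<or> ?K = carrier M" using M by (simp add: simple_module_def)
    moreover have f_K: "f ` ?K = K" using K_sub img by auto
    moreover have "K = {\<zero>\<^bsub>N\<^esub>}" if "?K = {\<zero>\<^bsub>M\<^esub>}"
      using f_K[unfolded that] f_zero by simp
    moreover have "K = carrier N" if "?K = carrier M"
      using f_K[unfolded that] img by simp
    ultimately show ?thesis by argo
  qed
  ultimately show ?thesis using N unfolding simple_module_def by blast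
qed

lemma simple_module_copy:
  fixes M :: "('a, 'b, 'c) module_scheme"
  assumes "simple_module R M"
  obtains N :: "('a, 'a set) module" where "simple_module R N" "module_iso R M N"
proof -
  interpret M: left_module R M using assms by (simp add: simple_module_def)
  obtain x where x: "x \<in> carrier M" "x \<noteq> \<zero>\<^bsub>M\<^esub>"
    using assms M.M.zero_closed unfolding simple_module_def by blast
  let ?X = "(\<lambda>r. r \<odot>\<^bsub>M\<^esub> x) ` carrier R"
  have neg: "\<ominus>\<^bsub>M\<^esub> (r \<odot>\<^bsub>M\<^esub> x) = (\<ominus>\<^bsub>R\<^esub> r) \<odot>\<^bsub>M\<^esub> x" if "r \<in> carrier R" for r
  proof (rule M.M.minus_equality)
    have z: "\<zero>\<^bsub>R\<^esub> \<odot>\<^bsub>M\<^esub> x = \<zero>\<^bsub>M\<^esub>"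
      using M.smult_l_distr[of "\<zero>\<^bsub>R\<^esub>" "\<zero>\<^bsub>R\<^esub>" x] x
      by (metis M.M.add.l_cancel_one M.R.l_zero M.R.zero_closed M.smult_closed)
    show "(\<ominus>\<^bsub>R\<^esub> r) \<odot>\<^bsub>M\<^esub> x \<oplus>\<^bsub>M\<^esub> r \<odot>\<^bsub>M\<^esub> x = \<zero>\<^bsub>M\<^esub>"
      using that x M.smult_l_distr[of "\<ominus>\<^bsub>R\<^esub> r" r x] by (simp add: M.R.l_neg z)
  qed (use that x in auto)
  have zero: "\<zero>\<^bsub>M\<^esub> \<in> ?X"
  proof -
    have "x \<oplus>\<^bsub>M\<^esub> \<ominus>\<^bsub>M\<^esub> x = (\<one>\<^bsub>R\<^esub> \<oplus>\<^bsub>R\<^esub> \<ominus>\<^bsub>R\<^esub> \<one>\<^bsub>R\<^esub>) \<odot>\<^bsub>M\<^esub> x"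
      using x neg[of "\<one>\<^bsub>R\<^esub>"] by (simp add: M.smult_l_distr)
    then show ?thesis using x by (metis M.M.r_neg M.R.a_inv_closed M.R.add.m_closed M.R.one_closed image_eqI)
  qed
  have "submodule ?X R M"
  proof (intro submodule.intro subgroup.intro submodule_axioms.intro)
    fix y assume "y \<in> ?X"
    then show "inv\<^bsub>add_monoid M\<^esub> y \<in> ?X" using neg by (auto simp flip: a_inv_def)
  next
    fix y z assume "y \<in> ?X" "z \<in> ?X"
    then obtain r s where "r \<in> carrier R" "s \<in> carrier R" "y = r \<odot>\<^bsub>M\<^esub> x" "z = s \<odot>\<^bsub>M\<^esub> x" by auto
    then show "y \<otimes>\<^bsub>add_monoid M\<^esub> z \<in> ?X"
      using x by (auto simp flip: M.smult_l_distr)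
  next
    fix a y assume "a \<in> carrier R" "y \<in> ?X"
    then show "a \<odot>\<^bsub>M\<^esub> y \<in> ?X" using x by (auto simp flip: M.smult_assoc)
  qed (use x zero in auto)
  moreover have "x \<in> ?X" using x by (metis M.R.one_closed M.smult_one image_eqI)
  ultimately have X: "?X = carrier M"
    using assms x unfolding simple_module_def by blast
  define f where "f = (\<lambda>y. {r \<in> carrier R. r \<odot>\<^bsub>M\<^esub> x = y})"
  define g where "g = (\<lambda>A. (SOME r. r \<in> A) \<odot>\<^bsub>M\<^esub> x)"
  have gf: "g (f y) = y" if "y \<in> carrier M" for y
  proof -
    have "\<exists>r. r \<in> f y" using that unfolding f_def X[symmetric] by blast
    then have "(SOME r. r \<in> f y) \<in> f y" by (rule someI_ex)
    then show ?thesis by (simp add: f_def g_def)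
  qed
  then have inj: "inj_on f (carrier M)" by (rule inj_on_inverseI)
  define N :: "('a, 'a set) module" where
    "N = mk_module (f ` carrier M) (f \<zero>\<^bsub>M\<^esub>) (\<lambda>A B. f (g A \<oplus>\<^bsub>M\<^esub> g B)) (\<lambda>r A. f (r \<odot>\<^bsub>M\<^esub> g A))"
  have bij: "bij_betw f (carrier M) (carrier N)"
    using inj by (simp add: N_def mk_module_def bij_betw_def)
  have add: "f (y \<oplus>\<^bsub>M\<^esub> z) = f y \<oplus>\<^bsub>N\<^esub> f z" if "y \<in> carrier M" "z \<in> carrier M" for y z
    using that gf by (simp add: N_def mk_module_def)
  have smult: "f (r \<odot>\<^bsub>M\<^esub> y) = r \<odot>\<^bsub>N\<^esub> f y" if "y \<in> carrier M" for r y
    using that gf by (simp add: N_def mk_module_def)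
  have "simple_module R N"
    by (rule simple_module_transfer[OF assms bij add smult]) (simp_all add: N_def mk_module_def)
  moreover have "module_iso R M N"
    unfolding module_iso_def using bij add smult by blast
  ultimately show ?thesis by (rule that)
qed

subsection \<open>Tensor products\<close>

record ('a, 'b, 'r) bimodule = "('a, 'b) module" +
  rsmult :: "'b \<Rightarrow> 'r \<Rightarrow> 'b"

definition tensor_relations ::
    "('r, 'd) ring_scheme \<Rightarrow> ('a, 'b, 'r) bimodule \<Rightarrow> ('r, 'l, 'c) module_scheme \<Rightarrow>
      ('b \<times> 'l \<Rightarrow>\<^sub>0 int) set"
  where "tensor_relations A X L =
    {frag_of (x \<oplus>\<^bsub>X\<^esub> y, l) - frag_of (x, l) - frag_of (y, l) | x y l.
       x \<in> carrier X \<and> y \<in> carrier X \<and> l \<in> carrier L} \<union>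
    {frag_of (x, l \<oplus>\<^bsub>L\<^esub> m) - frag_of (x, l) - frag_of (x, m) | x l m.
       x \<in> carrier X \<and> l \<in> carrier L \<and> m \<in> carrier L} \<union>
    {frag_of (rsmult X x a, l) - frag_of (x, a \<odot>\<^bsub>L\<^esub> l) | x a l.
       x \<in> carrier X \<and> a \<in> carrier A \<and> l \<in> carrier L}"

definition tensor_module ::
    "('r, 'd) ring_scheme \<Rightarrow> ('a, 'b, 'r) bimodule \<Rightarrow> ('r, 'l, 'c) module_scheme \<Rightarrow>
      ('a, ('b \<times> 'l \<Rightarrow>\<^sub>0 int) set) module"
  where "tensor_module A X L =
    (let F = free_Abelian_group (carrier X \<times> carrier L);
         H = generate F (tensor_relations A X L)
     in mk_module (carrier (F Mod H)) H (set_mult F)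
          (\<lambda>r C. \<Union>c\<in>C. H #>\<^bsub>F\<^esub> frag_extend (\<lambda>(x, l). frag_of (r \<odot>\<^bsub>X\<^esub> x, l)) c))"

subsection \<open>Algebras given by a finite basis\<close>

text \<open>The algebra with basis \<open>B\<close> in which \<open>a b = s a b \<cdot> m a b\<close> for \<open>a, b \<in> B\<close>, with unit
  \<open>u \<in> B\<close>; an element is its coefficient function, extended by zero outside \<open>B\<close>.\<close>

definition basis_elem :: "'b \<Rightarrow> 'b \<Rightarrow> 'k::field"
  where "basis_elem a = (\<lambda>c. if c = a then 1 else 0)"

definition basis_algebra ::
    "'b set \<Rightarrow> ('b \<Rightarrow> 'b \<Rightarrow> 'k::field) \<Rightarrow> ('b \<Rightarrow> 'b \<Rightarrow> 'b) \<Rightarrow> 'b \<Rightarrow> ('b \<Rightarrow> 'k) ring"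
  where "basis_algebra B s m u =
    \<lparr>carrier = {f. \<forall>c. c \<notin> B \<longrightarrow> f c = 0},
     monoid.mult = (\<lambda>f g c. \<Sum>a\<in>B. \<Sum>b\<in>B. f a * g b * s a b * basis_elem (m a b) c),
     one = basis_elem u,
     ring.zero = (\<lambda>_. 0),
     add = (\<lambda>f g c. f c + g c)\<rparr>"

definition group_algebra :: "('i \<Rightarrow> 'i) set \<Rightarrow> (('i \<Rightarrow> 'i) \<Rightarrow> 'k::field) ring"
  where "group_algebra G = basis_algebra G (\<lambda>_ _. 1) (\<circ>) id"

section \<open>Partition algebras\<close>

text \<open>The vertices \<open>i\<close>, \<open>i'\<close> and \<open>i''\<close> are \<open>(i, 0)\<close>, \<open>(i, 1)\<close> and \<open>(i, 2)\<close>.\<close>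

type_synonym vertex = "nat \<times> nat"

definition row :: "nat \<Rightarrow> nat \<Rightarrow> vertex set"
  where "row n l = {1..n} \<times> {l}"

abbreviation vertices :: "nat \<Rightarrow> vertex set"
  where "vertices n \<equiv> row n 0 \<union> row n 1"

text \<open>A partition is represented by its equivalence relation \<open>a\<close>; its parts are
  \<open>vertices n // a\<close>.\<close>

definition partitions :: "nat \<Rightarrow> vertex rel set"
  where "partitions n = {a. equiv (vertices n) a}"

definition rel_of_parts :: "'v set set \<Rightarrow> 'v rel"
  where "rel_of_parts C = (\<Union>X\<in>C. X \<times> X)"

definition refinement :: "nat \<Rightarrow> vertex rel \<Rightarrow> vertex rel \<Rightarrow> bool"
  where "refinement n a b \<longleftrightarrow>
    (\<forall>q\<in>vertices n // b. \<exists>C. C \<subseteq> vertices n // a \<and> q = \<Union>C)"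

definition shift :: "vertex rel \<Rightarrow> vertex rel"
  where "shift b = map_prod (apsnd Suc) (apsnd Suc) ` b"

definition d_u :: "nat \<Rightarrow> vertex rel \<Rightarrow> vertex rel \<Rightarrow> vertex rel"
  where "d_u n a b =
    \<Inter>{r. equiv (row n 0 \<union> row n 1 \<union> row n 2) r \<and> a \<union> shift b \<subseteq> r}"

definition closed_parts :: "nat \<Rightarrow> vertex rel \<Rightarrow> vertex rel \<Rightarrow> nat"
  where "closed_parts n a b =
    card {X \<in> (row n 0 \<union> row n 1 \<union> row n 2) // d_u n a b. X \<subseteq> row n 1}"

definition d_prod :: "nat \<Rightarrow> vertex rel \<Rightarrow> vertex rel \<Rightarrow> vertex rel"
  where "d_prod n a b =
    (let rename = apsnd (\<lambda>l. if l = 2 then 1 else l)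
     in map_prod rename rename `
          (d_u n a b \<inter> (row n 0 \<union> row n 2) \<times> (row n 0 \<union> row n 2)))"

text \<open>For \<open>w = id\<close> this is the unit of the monoid of partitions. The parts are \<open>{w j, j'}\<close>
  rather than \<open>{j, (w j)'}\<close>, because then \<open>w \<mapsto> perm_partition n w\<close> turns composition of
  functions into the product of partitions.\<close>

definition perm_partition :: "nat \<Rightarrow> (nat \<Rightarrow> nat) \<Rightarrow> vertex rel"
  where "perm_partition n w = rel_of_parts {{(w j, 0), (j, 1)} | j. j \<in> {1..n}}"

definition poset_partitions :: "'t set \<Rightarrow> 't rel \<Rightarrow> nat \<Rightarrow> ('t \<Rightarrow> vertex rel) set"
  where "poset_partitions T leq n =
    {a \<in> T \<rightarrow>\<^sub>E partitions n. \<forall>(t, t')\<in>leq. refinement n (a t) (a t')}"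

definition partition_algebra ::
    "'t set \<Rightarrow> 't rel \<Rightarrow> ('t \<Rightarrow> 'k::field) \<Rightarrow> nat \<Rightarrow> (('t \<Rightarrow> vertex rel) \<Rightarrow> 'k) ring"
  where "partition_algebra T leq Q n = basis_algebra (poset_partitions T leq n)
    (\<lambda>a b. \<Prod>t\<in>T. Q t ^ closed_parts n (a t) (b t))
    (\<lambda>a b. \<lambda>t\<in>T. d_prod n (a t) (b t))
    (\<lambda>t\<in>T. perm_partition n id)"

section \<open>The case of the two-element chain\<close>

type_synonym pair_partition = "nat \<Rightarrow> vertex rel"

definition two :: "nat set"
  where "two = {1, 2}"

definition two_le :: "nat rel"
  where "two_le = {(s, t). s \<in> two \<and> t \<in> two \<and> s \<le> t}"

definition mk_pair :: "vertex rel \<Rightarrow> vertex rel \<Rightarrow> pair_partition"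
  where "mk_pair a1 a2 = (\<lambda>t\<in>two. if t = 1 then a1 else a2)"

abbreviation pair_partitions :: "nat \<Rightarrow> pair_partition set"
  where "pair_partitions \<equiv> poset_partitions two two_le"

abbreviation pair_algebra :: "(nat \<Rightarrow> 'k::field) \<Rightarrow> nat \<Rightarrow> (pair_partition \<Rightarrow> 'k) ring"
  where "pair_algebra \<equiv> partition_algebra two two_le"

subsection \<open>Propagating indices\<close>

definition prop_indices :: "nat list set"
  where "prop_indices = {l. sorted_wrt (\<ge>) l}"

definition prop_parts :: "nat \<Rightarrow> vertex rel \<Rightarrow> vertex set set"
  where "prop_parts n a = {q \<in> vertices n // a. q \<inter> row n 0 \<noteq> {} \<and> q \<inter> row n 1 \<noteq> {}}"

definition prop_index :: "nat \<Rightarrow> pair_partition \<Rightarrow> nat list"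
  where "prop_index n a = rev (sorted_list_of_multiset
    (image_mset (\<lambda>q. card {r \<in> prop_parts n (a 1). r \<subseteq> q}) (mset_set (prop_parts n (a 2)))))"

definition with_index :: "nat \<Rightarrow> nat list \<Rightarrow> pair_partition set"
  where "with_index n \<mu> = {a \<in> pair_partitions n. prop_index n a = \<mu>}"

definition env :: "nat list \<Rightarrow> nat"
  where "env \<nu> = (\<Sum>x\<leftarrow>\<nu>. max 1 x)"

inductive index_step :: "nat list \<Rightarrow> nat list \<Rightarrow> bool"
  where
    refl: "\<nu> \<in> prop_indices \<Longrightarrow> index_step \<nu> \<nu>"
  | decrease: "\<lbrakk>\<nu> \<in> prop_indices; \<nu>' \<in> prop_indices;
      mset \<nu> = add_mset x X; x > 0; mset \<nu>' = add_mset (x - 1) X\<rbrakk> \<Longrightarrow> index_step \<nu>' \<nu>"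
  | merge: "\<lbrakk>\<nu> \<in> prop_indices; \<nu>' \<in> prop_indices;
      mset \<nu> = add_mset x (add_mset y X); mset \<nu>' = add_mset (x + y) X\<rbrakk> \<Longrightarrow> index_step \<nu>' \<nu>"
  | remove: "index_step [] [0]"

definition index_less :: "nat list \<Rightarrow> nat list \<Rightarrow> bool"
  where "index_less \<mu> \<nu> \<longleftrightarrow> index_step\<^sup>+\<^sup>+ \<mu> \<nu> \<and> \<mu> \<noteq> \<nu>"

text \<open>Entries of \<open>\<nu>\<close>, hence also blocks, are numbered from 0.\<close>

definition block :: "nat list \<Rightarrow> nat \<Rightarrow> nat set"
  where "block \<nu> i = {env (take i \<nu>) + 1 .. env (take (Suc i) \<nu>)}"

definition index_inner :: "nat \<Rightarrow> nat list \<Rightarrow> vertex rel"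
  where "index_inner n \<nu> =
    (let J = \<Union>{block \<nu> i | i. i < length \<nu> \<and> \<nu> ! i \<ge> 1}
     in rel_of_parts ({{(j, 0), (j, 1)} | j. j \<in> J} \<union>
          {{(j, l)} | j l. j \<in> {1..n} - J \<and> l \<in> {0, 1}}))"

definition index_outer :: "nat \<Rightarrow> nat list \<Rightarrow> vertex rel"
  where "index_outer n \<nu> =
    rel_of_parts ({block \<nu> i \<times> {0, 1} | i. i < length \<nu>} \<union>
      {{(j, l)} | j l. env \<nu> < j \<and> j \<le> n \<and> l \<in> {0, 1}})"

definition index_elem :: "nat \<Rightarrow> nat list \<Rightarrow> pair_partition"
  where "index_elem n \<nu> = mk_pair (index_inner n \<nu>) (index_outer n \<nu>)"

definition block_perms :: "nat list \<Rightarrow> (nat \<Rightarrow> nat) set"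
  where "block_perms \<nu> = {w. w permutes {1..env \<nu>} \<and>
    (\<forall>i<length \<nu>. \<exists>j<length \<nu>. \<nu> ! i = \<nu> ! j \<and> w ` block \<nu> i = block \<nu> j)}"

abbreviation block_algebra :: "nat list \<Rightarrow> ((nat \<Rightarrow> nat) \<Rightarrow> 'k::field) ring"
  where "block_algebra \<nu> \<equiv> group_algebra (block_perms \<nu>)"

subsection \<open>Standard modules\<close>

definition embed ::
    "nat \<Rightarrow> nat list \<Rightarrow> ((nat \<Rightarrow> nat) \<Rightarrow> 'k) \<Rightarrow> pair_partition \<Rightarrow> 'k::field"
  where "embed n \<nu> f = (\<lambda>c. \<Sum>w\<in>block_perms \<nu>.
    f w * basis_elem (mk_pair (perm_partition n w) (perm_partition n w)) c)"

definition lower_ideal :: "(nat \<Rightarrow> 'k::field) \<Rightarrow> nat \<Rightarrow> nat list \<Rightarrow> (pair_partition \<Rightarrow> 'k) set"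
  where "lower_ideal Q n \<nu> = {f \<in> carrier (pair_algebra Q n).
    \<forall>a. f a \<noteq> 0 \<longrightarrow> (\<exists>\<mu>\<in>prop_indices. index_less \<mu> \<nu> \<and> a \<in> with_index n \<mu>)}"

definition index_bimodule :: "(nat \<Rightarrow> 'k::field) \<Rightarrow> nat \<Rightarrow> nat list \<Rightarrow>
    (pair_partition \<Rightarrow> 'k, (pair_partition \<Rightarrow> 'k) set, (nat \<Rightarrow> nat) \<Rightarrow> 'k) bimodule"
  where "index_bimodule Q n \<nu> =
    (let P = pair_algebra Q n;
         J = lower_ideal Q n \<nu>;
         PI = {x \<otimes>\<^bsub>P\<^esub> basis_elem (index_elem n \<nu>) | x. x \<in> carrier P}
     in module.extend (quotient_module ((regular_module P)\<lparr>carrier := PI <+>\<^bsub>P\<^esub> J\<rparr>) J)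
          (bimodule.fields (\<lambda>X f. \<Union>x\<in>X. J +>\<^bsub>P\<^esub> (x \<otimes>\<^bsub>P\<^esub> embed n \<nu> f))))"

type_synonym 'k block_module =
  "((nat \<Rightarrow> nat) \<Rightarrow> 'k, ((nat \<Rightarrow> nat) \<Rightarrow> 'k) set) module"

type_synonym 'k simple_label = "nat list \<times> 'k block_module set"

definition labels :: "nat \<Rightarrow> ('k::field) simple_label set"
  where "labels i = {(\<nu>, C). \<nu> \<in> prop_indices \<and> env \<nu> = i \<and>
    C \<in> simple_classes (block_algebra \<nu> :: ((nat \<Rightarrow> nat) \<Rightarrow> 'k) ring)}"

definition standard_module :: "(nat \<Rightarrow> 'k::field) \<Rightarrow> nat \<Rightarrow> nat list \<Rightarrow> 'k block_module \<Rightarrow>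
    (pair_partition \<Rightarrow> 'k,
     ((pair_partition \<Rightarrow> 'k) set \<times> ((nat \<Rightarrow> nat) \<Rightarrow> 'k) set \<Rightarrow>\<^sub>0 int) set) module"
  where "standard_module Q n \<nu> L =
    tensor_module (block_algebra \<nu>) (index_bimodule Q n \<nu>) L"

end

theory Submission
  imports Defs "HOL-Algebra.Ideal" "HOL-Combinatorics.List_Permutation"
begin

text \<open>The argument is that of Clifford, Munn and Ponizovskii for finite semigroups. Since \<open>Q 1\<close>
  and \<open>Q 2\<close> are invertible, a multiple \<open>e\<close> of \<open>\<I>_\<nu>\<close> is idempotent, and modulo \<open>J_{<\<nu>}\<close> the corner
  \<open>e P e\<close> is the group algebra of \<open>S[\<nu>]\<close>: an element \<open>\<I>_\<nu> a \<I>_\<nu>\<close> of index \<open>\<nu>\<close> equals \<open>w \<I>_\<nu>\<close> for a unique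
  \<open>w \<in> S[\<nu>]\<close>. The vectors \<open>s\<close> of a standard module with \<open>e r s = 0\<close> for all \<open>r\<close> therefore form its
  only maximal submodule, and the corner of the simple head is the given module of \<open>S[\<nu>]\<close>.
  Conversely, propagating indices do not increase under multiplication and every element of index
  \<open>\<nu>\<close> factors through \<open>\<I>_\<nu>\<close>. Hence a simple module \<open>M\<close> has a least index \<open>\<nu>\<close> whose idempotent does
  not annihilate it, \<open>J_{<\<nu>}\<close> annihilates it, and \<open>M\<close> is the head of the standard module induced
  from the simple module \<open>e M\<close>.\<close>

section \<open>Modules and their quotients\<close>

text \<open>Partitions enter the representation theory only through the axioms of the locales
  \<open>apex\<close> and \<open>apex_family\<close>, so corners, heads and apexes are treated over
  an arbitrary ring. The scalar in e comes from the middle row of the diagram of \<I>_\<nu>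
  \<I>_\<nu>: its isolated vertices are closed parts, so the product is \<I>_\<nu> times a monomial
  in Q 1 and Q 2, and e divides by this monomial. The obstacle on the diagram side is that
  multiplication discards the middle row, while associativity and the exponents of Q depend on what
  passed through it. Both bracketings of a triple product are therefore compared with one
  equivalence relation on four rows: its restriction to the outer rows gives associativity, and the
  count of its parts inside the two inner rows gives the cocycle identity of the exponents. The two
  levels of \<I>_\<nu> have one shape, identity strands grouped by a label and singletons elsewhere;
  the computations with \<I>_\<nu> are made for this shape and then specialised to the inner and the
  outer level.\<close>

lemma (in abelian_group) minus_zero_right: "x \<in> carrier G \<Longrightarrow> x \<ominus> \<zero> = x"
  by (metis a_inv_closed a_minus_def l_neg r_zero zero_closed)

lemma (in abelian_group) minus_eq_zero_iff:
  "x \<in> carrier G \<Longrightarrow> y \<in> carrier G \<Longrightarrow> x \<ominus> y = \<zero> \<longleftrightarrow> x = y"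
  by (metis a_inv_closed a_minus_def minus_equality minus_minus r_neg)

context left_module
begin

lemma smult_zero_left [simp]: "x \<in> carrier M \<Longrightarrow> \<zero> \<odot>\<^bsub>M\<^esub> x = \<zero>\<^bsub>M\<^esub>"
  using smult_l_distr[of "\<zero>" "\<zero>" x]
  by (metis M.add.l_cancel_one R.l_zero R.zero_closed smult_closed)

lemma smult_zero_right [simp]: "a \<in> carrier R \<Longrightarrow> a \<odot>\<^bsub>M\<^esub> \<zero>\<^bsub>M\<^esub> = \<zero>\<^bsub>M\<^esub>"
  using smult_r_distr[of a "\<zero>\<^bsub>M\<^esub>" "\<zero>\<^bsub>M\<^esub>"]
  by (metis M.add.l_cancel_one M.l_zero M.zero_closed smult_closed)

lemma smult_minus_left:
  "a \<in> carrier R \<Longrightarrow> x \<in> carrier M \<Longrightarrow> (\<ominus> a) \<odot>\<^bsub>M\<^esub> x = \<ominus>\<^bsub>M\<^esub> (a \<odot>\<^bsub>M\<^esub> x)"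
  using smult_l_distr[of "\<ominus> a" a x]
  by (metis M.minus_equality R.a_inv_closed R.l_neg smult_closed smult_zero_left)

lemma smult_minus_right:
  "a \<in> carrier R \<Longrightarrow> x \<in> carrier M \<Longrightarrow> a \<odot>\<^bsub>M\<^esub> (\<ominus>\<^bsub>M\<^esub> x) = \<ominus>\<^bsub>M\<^esub> (a \<odot>\<^bsub>M\<^esub> x)"
  using smult_r_distr[of a "\<ominus>\<^bsub>M\<^esub> x" x]
  by (metis M.minus_equality M.a_inv_closed M.l_neg smult_closed smult_zero_right)

lemma smult_diff_left:
  "a \<in> carrier R \<Longrightarrow> b \<in> carrier R \<Longrightarrow> x \<in> carrier M \<Longrightarrow>
    (a \<ominus> b) \<odot>\<^bsub>M\<^esub> x = a \<odot>\<^bsub>M\<^esub> x \<ominus>\<^bsub>M\<^esub> b \<odot>\<^bsub>M\<^esub> x"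
  by (simp add: a_minus_def smult_l_distr smult_minus_left)

lemma smult_diff_right:
  "a \<in> carrier R \<Longrightarrow> x \<in> carrier M \<Longrightarrow> y \<in> carrier M \<Longrightarrow>
    a \<odot>\<^bsub>M\<^esub> (x \<ominus>\<^bsub>M\<^esub> y) = a \<odot>\<^bsub>M\<^esub> x \<ominus>\<^bsub>M\<^esub> a \<odot>\<^bsub>M\<^esub> y"
  by (simp add: a_minus_def smult_r_distr smult_minus_right)

text \<open>Closure under negation is the action of the scalar \<open>\<ominus> \<one>\<close>, so
  it is no separate condition.\<close>

lemma submoduleI:
  assumes "H \<subseteq> carrier M" "\<zero>\<^bsub>M\<^esub> \<in> H"
    and "\<And>x y. x \<in> H \<Longrightarrow> y \<in> H \<Longrightarrow> x \<oplus>\<^bsub>M\<^esub> y \<in> H"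
    and "\<And>a x. a \<in> carrier R \<Longrightarrow> x \<in> H \<Longrightarrow> a \<odot>\<^bsub>M\<^esub> x \<in> H"
  shows "submodule H R M"
proof (intro submodule.intro subgroup.intro submodule_axioms.intro)
  fix x assume x: "x \<in> H"
  have "(\<ominus> \<one>) \<odot>\<^bsub>M\<^esub> x = \<ominus>\<^bsub>M\<^esub> x"
    using x assms(1) smult_minus_left[of \<one> x] by auto
  then show "inv\<^bsub>add_monoid M\<^esub> x \<in> H"
    using assms(4)[of "\<ominus> \<one>" x] x by (simp add: a_inv_def)
qed (use assms in auto)

lemma submoduleD:
  assumes "submodule H R M"
  shows "H \<subseteq> carrier M" "\<zero>\<^bsub>M\<^esub> \<in> H"
    and "\<And>x y. x \<in> H \<Longrightarrow> y \<in> H \<Longrightarrow> x \<oplus>\<^bsub>M\<^esub> y \<in> H"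
    and "\<And>x y. x \<in> H \<Longrightarrow> y \<in> H \<Longrightarrow> x \<ominus>\<^bsub>M\<^esub> y \<in> H"
    and "\<And>a x. a \<in> carrier R \<Longrightarrow> x \<in> H \<Longrightarrow> a \<odot>\<^bsub>M\<^esub> x \<in> H"
proof -
  interpret H: submodule H R M by fact
  show "H \<subseteq> carrier M" using H.subset by simp
  show "\<zero>\<^bsub>M\<^esub> \<in> H" using H.one_closed by simp
  show p: "x \<oplus>\<^bsub>M\<^esub> y \<in> H" if "x \<in> H" "y \<in> H" for x y using H.m_closed[OF that] by simp
  show "x \<ominus>\<^bsub>M\<^esub> y \<in> H" if "x \<in> H" "y \<in> H" for x y
    using p[OF that(1), of "\<ominus>\<^bsub>M\<^esub> y"] H.m_inv_closed[OF that(2)]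
    by (simp add: a_minus_def a_inv_def)
  show "a \<odot>\<^bsub>M\<^esub> x \<in> H" if "a \<in> carrier R" "x \<in> H" for a x using that by auto
qed

lemma submodule_abelian_subgroup: "submodule N R M \<Longrightarrow> abelian_subgroup N M"
  by (simp add: M.abelian_group_axioms abelian_subgroupI3 additive_subgroupI submodule_def)

end

lemma abelian_group_homD:
  assumes "abelian_group M" "abelian_group N"
    and "f \<in> carrier M \<rightarrow> carrier N"
    and "\<And>x y. \<lbrakk>x \<in> carrier M; y \<in> carrier M\<rbrakk> \<Longrightarrow> f (x \<oplus>\<^bsub>M\<^esub> y) = f x \<oplus>\<^bsub>N\<^esub> f y"
  shows "f \<zero>\<^bsub>M\<^esub> = \<zero>\<^bsub>N\<^esub>"
    and "x \<in> carrier M \<Longrightarrow> f (\<ominus>\<^bsub>M\<^esub> x) = \<ominus>\<^bsub>N\<^esub> f x"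
    and "x \<in> carrier M \<Longrightarrow> y \<in> carrier M \<Longrightarrow> f (x \<ominus>\<^bsub>M\<^esub> y) = f x \<ominus>\<^bsub>N\<^esub> f y"
proof -
  interpret M: abelian_group M by fact
  interpret N: abelian_group N by fact
  have c: "f x \<in> carrier N" if "x \<in> carrier M" for x using assms(3) that by auto
  show z: "f \<zero>\<^bsub>M\<^esub> = \<zero>\<^bsub>N\<^esub>"
    using assms(4)[of "\<zero>\<^bsub>M\<^esub>" "\<zero>\<^bsub>M\<^esub>"] c[of "\<zero>\<^bsub>M\<^esub>"] by simp
  show m: "f (\<ominus>\<^bsub>M\<^esub> x) = \<ominus>\<^bsub>N\<^esub> f x" if "x \<in> carrier M" for x
    using that assms(4)[of "\<ominus>\<^bsub>M\<^esub> x" x] c[of x] c[of "\<ominus>\<^bsub>M\<^esub> x"]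
    by (metis M.a_inv_closed M.l_neg N.minus_equality z)
  show "f (x \<ominus>\<^bsub>M\<^esub> y) = f x \<ominus>\<^bsub>N\<^esub> f y" if "x \<in> carrier M" "y \<in> carrier M"
    using that assms(4) m by (simp add: a_minus_def)
qed

text \<open>The module axioms are equations, so they pass to every image under a map that respects
  the operations. Applied to coset maps, which are not injective.\<close>

lemma left_module_image:
  fixes M :: "('a, 'b, 'c) module_scheme" and N :: "('a, 'e, 'f) module_scheme"
  assumes M: "left_module R M"
    and img: "carrier N = f ` carrier M"
    and f_add: "\<And>x y. \<lbrakk>x \<in> carrier M; y \<in> carrier M\<rbrakk> \<Longrightarrow> f (x \<oplus>\<^bsub>M\<^esub> y) = f x \<oplus>\<^bsub>N\<^esub> f y"
    and f_smult: "\<And>r x. \<lbrakk>r \<in> carrier R; x \<in> carrier M\<rbrakk> \<Longrightarrow> f (r \<odot>\<^bsub>M\<^esub> x) = r \<odot>\<^bsub>N\<^esub> f x"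
    and f_zero: "f \<zero>\<^bsub>M\<^esub> = \<zero>\<^bsub>N\<^esub>"
  shows "left_module R N"
proof -
  interpret M: left_module R M by fact
  have "abelian_group N"
  proof (rule abelian_groupI)
    show "\<exists>y\<in>carrier N. y \<oplus>\<^bsub>N\<^esub> x = \<zero>\<^bsub>N\<^esub>" if x: "x \<in> carrier N" for x
    proof -
      obtain u where u: "u \<in> carrier M" "x = f u" using x img by auto
      then have "f (\<ominus>\<^bsub>M\<^esub> u) \<oplus>\<^bsub>N\<^esub> x = \<zero>\<^bsub>N\<^esub>"
        using f_add[of "\<ominus>\<^bsub>M\<^esub> u" u] by (simp add: M.M.l_neg f_zero)
      then show ?thesis using u img by auto
    qed
  next
    fix x y z assume "x \<in> carrier N" "y \<in> carrier N" "z \<in> carrier N"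
    then show "x \<oplus>\<^bsub>N\<^esub> y \<oplus>\<^bsub>N\<^esub> z = x \<oplus>\<^bsub>N\<^esub> (y \<oplus>\<^bsub>N\<^esub> z)"
      using img by (auto simp flip: f_add simp: M.M.a_assoc)
  next
    fix x y assume "x \<in> carrier N" "y \<in> carrier N"
    then show "x \<oplus>\<^bsub>N\<^esub> y = y \<oplus>\<^bsub>N\<^esub> x"
      using img by (auto simp flip: f_add intro: arg_cong[OF M.M.a_comm])
  qed (use img in \<open>auto simp flip: f_add f_zero\<close>)
  then show "left_module R N"
  proof (intro left_module.intro left_module_axioms.intro)
    show "ring R" by (rule M.R.ring_axioms)
  qed (use img in \<open>auto simp flip: f_add f_smult
         simp: M.smult_l_distr M.smult_r_distr M.smult_assoc\<close>)
qed

lemma left_module_restrict: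
  assumes "left_module R M" "submodule H R M"
  shows "left_module R (M\<lparr>carrier := H\<rparr>)"
proof -
  interpret M: left_module R M by fact
  note H = M.submoduleD[OF assms(2)]
  have sub: "x \<in> carrier M" if "x \<in> H" for x using H that by auto
  have "abelian_group (M\<lparr>carrier := H\<rparr>)"
  proof (rule abelian_groupI)
    show "\<exists>y\<in>carrier (M\<lparr>carrier := H\<rparr>). y \<oplus>\<^bsub>M\<lparr>carrier := H\<rparr>\<^esub> x = \<zero>\<^bsub>M\<lparr>carrier := H\<rparr>\<^esub>"
      if "x \<in> carrier (M\<lparr>carrier := H\<rparr>)" for x
      using that H(4)[of "\<zero>\<^bsub>M\<^esub>" x] H(2) sub
      by (auto simp: a_minus_def M.M.l_neg intro!: bexI[of _ "\<ominus>\<^bsub>M\<^esub> x"])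
  qed (use H sub M.M.a_assoc M.M.a_comm in auto)
  then show ?thesis
    by (intro left_module.intro left_module_axioms.intro M.R.ring_axioms)
      (use H sub M.smult_l_distr M.smult_r_distr M.smult_assoc in auto)
qed

lemma left_module_regular: "ring R \<Longrightarrow> left_module R (regular_module R)"
proof -
  assume "ring R"
  then interpret ring R .
  have "abelian_group (regular_module R)"
  proof (rule abelian_groupI)
    show "\<exists>y\<in>carrier (regular_module R). y \<oplus>\<^bsub>regular_module R\<^esub> x = \<zero>\<^bsub>regular_module R\<^esub>"
      if "x \<in> carrier (regular_module R)" for x
      using that by (auto simp: regular_module_def mk_module_def intro!: bexI[of _ "\<ominus>\<^bsub>R\<^esub> x"] l_neg)
  qed (auto simp: regular_module_def mk_module_def add.m_assoc add.m_comm add.m_lcomm)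
  then show ?thesis
    by (intro left_module.intro left_module_axioms.intro ring_axioms)
      (auto simp: regular_module_def mk_module_def l_distr r_distr m_assoc)
qed

text \<open>\<open>quotient_module\<close> defines the action as a union over the representatives of
  a coset. All members of the union agree, because r (y - x) lies in N whenever y - x does; so the
  action may be computed on one representative.\<close>

lemma quotient_module_simps:
  assumes "left_module R M" "submodule N R M"
  shows "carrier (quotient_module M N) = (\<lambda>x. N +>\<^bsub>M\<^esub> x) ` carrier M"
    and "\<zero>\<^bsub>quotient_module M N\<^esub> = N +>\<^bsub>M\<^esub> \<zero>\<^bsub>M\<^esub>"
    and "\<And>x y. x \<in> carrier M \<Longrightarrow> y \<in> carrier M \<Longrightarrow>
      (N +>\<^bsub>M\<^esub> x) \<oplus>\<^bsub>quotient_module M N\<^esub> (N +>\<^bsub>M\<^esub> y) = N +>\<^bsub>M\<^esub> (x \<oplus>\<^bsub>M\<^esub> y)"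
    and "\<And>r x. r \<in> carrier R \<Longrightarrow> x \<in> carrier M \<Longrightarrow>
      r \<odot>\<^bsub>quotient_module M N\<^esub> (N +>\<^bsub>M\<^esub> x) = N +>\<^bsub>M\<^esub> (r \<odot>\<^bsub>M\<^esub> x)"
    and "\<And>x y. x \<in> carrier M \<Longrightarrow> y \<in> carrier M \<Longrightarrow>
      N +>\<^bsub>M\<^esub> x = N +>\<^bsub>M\<^esub> y \<longleftrightarrow> x \<ominus>\<^bsub>M\<^esub> y \<in> N"
    and "\<And>x y. x \<in> carrier M \<Longrightarrow> y \<in> N +>\<^bsub>M\<^esub> x \<longleftrightarrow> y \<in> carrier M \<and> y \<ominus>\<^bsub>M\<^esub> x \<in> N"
proof -
  interpret M: left_module R M by fact
  interpret N: abelian_subgroup N M by (rule M.submodule_abelian_subgroup) fact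
  note H = M.submoduleD[OF assms(2)]
  show "carrier (quotient_module M N) = (\<lambda>x. N +>\<^bsub>M\<^esub> x) ` carrier M"
    by (auto simp: quotient_module_def mk_module_def A_RCOSETS_def')
  show "\<zero>\<^bsub>quotient_module M N\<^esub> = N +>\<^bsub>M\<^esub> \<zero>\<^bsub>M\<^esub>"
    using H(1) by (simp add: quotient_module_def mk_module_def)
  show "(N +>\<^bsub>M\<^esub> x) \<oplus>\<^bsub>quotient_module M N\<^esub> (N +>\<^bsub>M\<^esub> y) = N +>\<^bsub>M\<^esub> (x \<oplus>\<^bsub>M\<^esub> y)"
    if "x \<in> carrier M" "y \<in> carrier M" for x y
    using that by (simp add: quotient_module_def mk_module_def N.a_rcos_sum)
  show mem: "y \<in> N +>\<^bsub>M\<^esub> x \<longleftrightarrow> y \<in> carrier M \<and> y \<ominus>\<^bsub>M\<^esub> x \<in> N" if x: "x \<in> carrier M" for x y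
  proof -
    have "y = (y \<ominus>\<^bsub>M\<^esub> x) \<oplus>\<^bsub>M\<^esub> x" if "y \<in> carrier M"
      using that x by (simp add: a_minus_def M.M.a_assoc M.M.l_neg)
    moreover have "(h \<oplus>\<^bsub>M\<^esub> x) \<ominus>\<^bsub>M\<^esub> x = h" if "h \<in> N" for h
      using that x H(1) by (auto simp: a_minus_def M.M.a_assoc M.M.r_neg)
    ultimately show ?thesis using x H(1) by (auto simp: a_r_coset_def')
  qed
  show eq: "N +>\<^bsub>M\<^esub> x = N +>\<^bsub>M\<^esub> y \<longleftrightarrow> x \<ominus>\<^bsub>M\<^esub> y \<in> N" if "x \<in> carrier M" "y \<in> carrier M" for x y
    using that mem M.M.a_repr_independence[of x N y] N.a_rcos_self N.a_subgroup by auto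
  show "r \<odot>\<^bsub>quotient_module M N\<^esub> (N +>\<^bsub>M\<^esub> x) = N +>\<^bsub>M\<^esub> (r \<odot>\<^bsub>M\<^esub> x)"
    if rx: "r \<in> carrier R" "x \<in> carrier M" for r x
  proof -
    have "N +>\<^bsub>M\<^esub> (r \<odot>\<^bsub>M\<^esub> y) = N +>\<^bsub>M\<^esub> (r \<odot>\<^bsub>M\<^esub> x)" if "y \<in> N +>\<^bsub>M\<^esub> x" for y
      using that rx mem H(5)[of r "y \<ominus>\<^bsub>M\<^esub> x"] by (subst eq) (auto simp: M.smult_diff_right)
    moreover have "x \<in> N +>\<^bsub>M\<^esub> x" using rx N.a_rcos_self by simp
    ultimately have "(\<Union>y\<in>N +>\<^bsub>M\<^esub> x. N +>\<^bsub>M\<^esub> (r \<odot>\<^bsub>M\<^esub> y)) = N +>\<^bsub>M\<^esub> (r \<odot>\<^bsub>M\<^esub> x)"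
      by (intro UN_constant_eq ballI)
    then show ?thesis by (simp add: quotient_module_def mk_module_def)
  qed
qed

lemma left_module_quotient:
  assumes "left_module R M" "submodule N R M"
  shows "left_module R (quotient_module M N)"
  by (rule left_module_image[OF assms(1), where f = "\<lambda>x. N +>\<^bsub>M\<^esub> x"])
    (simp_all add: quotient_module_simps[OF assms])

text \<open>The preimage of a submodule of the quotient contains N, so maximality leaves only N and
  the whole module for it.\<close>

lemma simple_quotient:
  assumes "left_module R M" "maximal_submodule N R M"
  shows "simple_module R (quotient_module M N)"
proof -
  interpret M: left_module R M by fact
  have N: "submodule N R M" using assms(2) by (simp add: maximal_submodule_def)
  note H = M.submoduleD[OF N]
  note Q = quotient_module_simps[OF assms(1) N]
  interpret Q: left_module R "quotient_module M N" by (rule left_module_quotient) fact+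
  have memN: "N +>\<^bsub>M\<^esub> x = N +>\<^bsub>M\<^esub> \<zero>\<^bsub>M\<^esub> \<longleftrightarrow> x \<in> N" if "x \<in> carrier M" for x
    using that by (subst Q(5)) (auto simp: M.M.minus_zero_right)
  have nontrivial: "carrier (quotient_module M N) \<noteq> {\<zero>\<^bsub>quotient_module M N\<^esub>}"
  proof -
    obtain x where "x \<in> carrier M" "x \<notin> N"
      using assms(2) H(1) by (auto simp: maximal_submodule_def)
    then have "N +>\<^bsub>M\<^esub> x \<in> carrier (quotient_module M N)"
      "N +>\<^bsub>M\<^esub> x \<noteq> \<zero>\<^bsub>quotient_module M N\<^esub>"
      using memN by (simp_all add: Q(1,2))
    then show ?thesis by auto
  qed
  have only: "K = {\<zero>\<^bsub>quotient_module M N\<^esub>} \<or> K = carrier (quotient_module M N)"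
    if K: "submodule K R (quotient_module M N)" for K
  proof -
    note HK = Q.submoduleD[OF K]
    let ?K = "{x \<in> carrier M. N +>\<^bsub>M\<^esub> x \<in> K}"
    have "submodule ?K R M"
    proof (rule M.submoduleI)
      show "x \<oplus>\<^bsub>M\<^esub> y \<in> ?K" if "x \<in> ?K" "y \<in> ?K" for x y
        using that HK(3)[of "N +>\<^bsub>M\<^esub> x" "N +>\<^bsub>M\<^esub> y"] by (auto simp: Q)
      show "a \<odot>\<^bsub>M\<^esub> x \<in> ?K" if "a \<in> carrier R" "x \<in> ?K" for a x
        using that HK(5)[of a "N +>\<^bsub>M\<^esub> x"] by (auto simp: Q)
    qed (use HK(2) Q(2) in auto)
    moreover have "N \<subseteq> ?K"
    proof
      fix x assume x: "x \<in> N"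
      then have "N +>\<^bsub>M\<^esub> x = \<zero>\<^bsub>quotient_module M N\<^esub>" using memN H(1) Q(2) by auto
      then show "x \<in> ?K" using HK(2) x H(1) by auto
    qed
    ultimately have "?K = N \<or> ?K = carrier M"
      using assms(2) by (simp add: maximal_submodule_def)
    then show ?thesis
    proof
      assume *: "?K = N"
      have "x = \<zero>\<^bsub>quotient_module M N\<^esub>" if "x \<in> K" for x
      proof -
        obtain y where "y \<in> carrier M" "x = N +>\<^bsub>M\<^esub> y" using \<open>x \<in> K\<close> HK(1) Q(1) by auto
        then show ?thesis using that * memN Q(2) by auto
      qed
      then show ?thesis using HK(2) by blast
    next
      assume *: "?K = carrier M"
      have "carrier (quotient_module M N) \<subseteq> K"
        unfolding Q(1) using * by blast
      then show ?thesis using HK(1) by blast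
    qed
  qed
  show ?thesis
    unfolding simple_module_def by (intro conjI allI impI nontrivial only Q.left_module_axioms)
qed

text \<open>First isomorphism theorem, with the isomorphism directed from the image to the quotient,
  as the classification needs it.\<close>

lemma quotient_module_iso:
  assumes "left_module R M" "left_module R M'" "submodule N R M"
    and img: "f ` carrier M = carrier M'"
    and f_add: "\<And>x y. \<lbrakk>x \<in> carrier M; y \<in> carrier M\<rbrakk> \<Longrightarrow> f (x \<oplus>\<^bsub>M\<^esub> y) = f x \<oplus>\<^bsub>M'\<^esub> f y"
    and f_smult: "\<And>r x. \<lbrakk>r \<in> carrier R; x \<in> carrier M\<rbrakk> \<Longrightarrow> f (r \<odot>\<^bsub>M\<^esub> x) = r \<odot>\<^bsub>M'\<^esub> f x"
    and ker: "\<And>x. x \<in> carrier M \<Longrightarrow> f x = \<zero>\<^bsub>M'\<^esub> \<longleftrightarrow> x \<in> N"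
  shows "module_iso R M' (quotient_module M N)"
proof -
  interpret M: left_module R M by fact
  interpret M': left_module R M' by fact
  note Q = quotient_module_simps[OF assms(1,3)]
  have fc: "f \<in> carrier M \<rightarrow> carrier M'" using img by auto
  note hom = abelian_group_homD[OF M.M.abelian_group_axioms M'.M.abelian_group_axioms fc f_add]
  have eq: "f x = f y \<longleftrightarrow> N +>\<^bsub>M\<^esub> x = N +>\<^bsub>M\<^esub> y" if "x \<in> carrier M" "y \<in> carrier M" for x y
    using that ker[of "x \<ominus>\<^bsub>M\<^esub> y"] hom(3)[of x y] fc M'.M.minus_eq_zero_iff[of "f x" "f y"]
    by (auto simp: Q(5))
  \<comment> \<open>Any preimage will do: two preimages of one vector differ by an element of the
    kernel, which is N.\<close>
  define g where "g = (\<lambda>y. N +>\<^bsub>M\<^esub> (SOME x. x \<in> carrier M \<and> f x = y))"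
  have g: "g (f x) = N +>\<^bsub>M\<^esub> x" if "x \<in> carrier M" for x
    unfolding g_def
    by (rule someI2[of "\<lambda>z. z \<in> carrier M \<and> f z = f x" x]) (use that eq in auto)
  have "bij_betw g (carrier M') (carrier (quotient_module M N))"
    unfolding bij_betw_def inj_on_def img[symmetric] Q(1) using g eq by (auto simp: image_image)
  moreover have "g (u \<oplus>\<^bsub>M'\<^esub> v) = g u \<oplus>\<^bsub>quotient_module M N\<^esub> g v"
    if "u \<in> carrier M'" "v \<in> carrier M'" for u v
    using that unfolding img[symmetric] by (auto simp flip: f_add simp: g Q(3))
  moreover have "g (r \<odot>\<^bsub>M'\<^esub> u) = r \<odot>\<^bsub>quotient_module M N\<^esub> g u"
    if "r \<in> carrier R" "u \<in> carrier M'" for r u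
    using that unfolding img[symmetric] by (auto simp flip: f_smult simp: g Q(4))
  ultimately show ?thesis unfolding module_iso_def by blast
qed

lemma module_iso_refl: "module_iso R M M"
  unfolding module_iso_def by (rule exI[of _ id]) auto

lemma module_iso_trans:
  assumes "module_iso R M N" "module_iso R N K"
  shows "module_iso R M K"
proof -
  obtain f g where f: "bij_betw f (carrier M) (carrier N)"
    "\<forall>x\<in>carrier M. \<forall>y\<in>carrier M. f (x \<oplus>\<^bsub>M\<^esub> y) = f x \<oplus>\<^bsub>N\<^esub> f y"
    "\<forall>r\<in>carrier R. \<forall>x\<in>carrier M. f (r \<odot>\<^bsub>M\<^esub> x) = r \<odot>\<^bsub>N\<^esub> f x"
    and g: "bij_betw g (carrier N) (carrier K)"
    "\<forall>x\<in>carrier N. \<forall>y\<in>carrier N. g (x \<oplus>\<^bsub>N\<^esub> y) = g x \<oplus>\<^bsub>K\<^esub> g y"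
    "\<forall>r\<in>carrier R. \<forall>x\<in>carrier N. g (r \<odot>\<^bsub>N\<^esub> x) = r \<odot>\<^bsub>K\<^esub> g x"
    using assms unfolding module_iso_def by blast
  have "f x \<in> carrier N" if "x \<in> carrier M" for x using f(1) that by (auto simp: bij_betw_def)
  then show ?thesis
    unfolding module_iso_def using f g bij_betw_trans[OF f(1) g(1)]
    by (intro exI[of _ "g \<circ> f"]) simp
qed

lemma module_iso_sym:
  assumes "module_iso R M N" "left_module R M"
  shows "module_iso R N M"
proof -
  interpret M: left_module R M by fact
  obtain f where f: "bij_betw f (carrier M) (carrier N)"
    "\<forall>x\<in>carrier M. \<forall>y\<in>carrier M. f (x \<oplus>\<^bsub>M\<^esub> y) = f x \<oplus>\<^bsub>N\<^esub> f y"
    "\<forall>r\<in>carrier R. \<forall>x\<in>carrier M. f (r \<odot>\<^bsub>M\<^esub> x) = r \<odot>\<^bsub>N\<^esub> f x"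
    using assms unfolding module_iso_def by blast
  let ?g = "inv_into (carrier M) f"
  have gf: "?g (f x) = x" if "x \<in> carrier M" for x
    using f(1) that by (simp add: bij_betw_inv_into_left)
  have N: "carrier N = f ` carrier M" using f(1) by (simp add: bij_betw_def)
  have "?g (f x \<oplus>\<^bsub>N\<^esub> f y) = x \<oplus>\<^bsub>M\<^esub> y" if "x \<in> carrier M" "y \<in> carrier M" for x y
    using that f(2) gf by (metis M.M.add.m_closed)
  moreover have "?g (r \<odot>\<^bsub>N\<^esub> f x) = r \<odot>\<^bsub>M\<^esub> x" if "r \<in> carrier R" "x \<in> carrier M" for x r
    using that f(3) gf by (metis M.smult_closed)
  ultimately show ?thesis
    unfolding module_iso_def using bij_betw_inv_into[OF f(1)] N gf
    by (intro exI[of _ ?g]) auto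
qed

lemma simple_module_iso:
  assumes "simple_module R M" "module_iso R M N" "left_module R N"
  shows "simple_module R N"
proof -
  obtain f where f: "bij_betw f (carrier M) (carrier N)"
    "\<forall>x\<in>carrier M. \<forall>y\<in>carrier M. f (x \<oplus>\<^bsub>M\<^esub> y) = f x \<oplus>\<^bsub>N\<^esub> f y"
    "\<forall>r\<in>carrier R. \<forall>x\<in>carrier M. f (r \<odot>\<^bsub>M\<^esub> x) = r \<odot>\<^bsub>N\<^esub> f x"
    using assms unfolding module_iso_def by blast
  interpret M: left_module R M using assms(1) by (simp add: simple_module_def)
  interpret N: left_module R N by fact
  have "f \<zero>\<^bsub>M\<^esub> = \<zero>\<^bsub>N\<^esub>"
    by (rule abelian_group_homD(1)[OF M.M.abelian_group_axioms N.M.abelian_group_axioms])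
      (use f in \<open>auto simp: bij_betw_def\<close>)
  then show ?thesis by (intro simple_module_transfer[OF assms(1) f(1)]) (use f in auto)
qed

lemma simple_cyclic:
  assumes "simple_module R M" "x \<in> carrier M" "x \<noteq> \<zero>\<^bsub>M\<^esub>" "submodule N R M" "x \<in> N"
  shows "N = carrier M"
  using assms unfolding simple_module_def by blast

lemma cyclic_submodule:
  assumes "left_module R M" "x \<in> carrier M"
  shows "submodule ((\<lambda>r. r \<odot>\<^bsub>M\<^esub> x) ` carrier R) R M"
    and "x \<in> (\<lambda>r. r \<odot>\<^bsub>M\<^esub> x) ` carrier R"
proof -
  interpret M: left_module R M by fact
  show "x \<in> (\<lambda>r. r \<odot>\<^bsub>M\<^esub> x) ` carrier R"
    using assms(2) by (metis M.R.one_closed M.smult_one image_eqI)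
  show "submodule ((\<lambda>r. r \<odot>\<^bsub>M\<^esub> x) ` carrier R) R M"
  proof (rule M.submoduleI)
    show "\<zero>\<^bsub>M\<^esub> \<in> (\<lambda>r. r \<odot>\<^bsub>M\<^esub> x) ` carrier R"
      using assms(2) M.smult_zero_left M.R.zero_closed by (metis image_eqI)
  qed (use assms(2) in \<open>auto simp flip: M.smult_l_distr M.smult_assoc\<close>)
qed

lemma simple_generated:
  assumes "simple_module R M" "x \<in> carrier M" "x \<noteq> \<zero>\<^bsub>M\<^esub>" "y \<in> carrier M"
  obtains r where "r \<in> carrier R" "y = r \<odot>\<^bsub>M\<^esub> x"
proof -
  have "left_module R M" using assms(1) by (simp add: simple_module_def)
  from simple_cyclic[OF assms(1-3) cyclic_submodule[OF this assms(2)]] assms(4) that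
  show ?thesis by auto
qed

section \<open>Isomorphism classes of simple modules\<close>

lemma simple_classes_equiv:
  "equiv {M. simple_module R M}
    {(M, N). simple_module R M \<and> simple_module R N \<and> module_iso R M N}"
proof (rule equivI)
  show "sym {(M, N). simple_module R M \<and> simple_module R N \<and> module_iso R M N}"
    by (auto simp: sym_def simple_module_def intro: module_iso_sym)
  show "trans {(M, N). simple_module R M \<and> simple_module R N \<and> module_iso R M N}"
    by (auto simp: trans_def intro: module_iso_trans)
qed (auto simp: refl_on_def module_iso_refl)

lemma simple_classesD:
  assumes "C \<in> simple_classes R"
  shows "C \<noteq> {}" and "L \<in> C \<Longrightarrow> simple_module R L"
    and "L \<in> C \<Longrightarrow> L' \<in> C \<longleftrightarrow> simple_module R L' \<and> module_iso R L L'"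
proof -
  show "C \<noteq> {}" using assms simple_classes_equiv in_quotient_imp_non_empty
    unfolding simple_classes_def by blast
  assume L: "L \<in> C"
  then show s: "simple_module R L"
    using assms in_quotient_imp_subset[OF simple_classes_equiv] unfolding simple_classes_def by blast
  have "C = {(M, N). simple_module R M \<and> simple_module R N \<and> module_iso R M N} `` {L}"
    (is "_ = ?r `` _")
  proof -
    obtain M where M: "C = ?r `` {M}"
      using assms unfolding simple_classes_def by (auto elim: quotientE)
    then have "(M, L) \<in> ?r" using L by blast
    from equiv_class_eq[OF simple_classes_equiv this] show ?thesis using M by simp
  qed
  then show "L' \<in> C \<longleftrightarrow> simple_module R L' \<and> module_iso R L L'" using s by auto
qed

text \<open>The family h may have any carrier type. \<open>simple_module_copy\<close> moves its
  members into the fixed type over which \<open>simple_classes\<close> is formed, so that a list of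
  representatives becomes a bijection with the classes.\<close>

lemma simple_classes_classification:
  fixes h :: "'i \<Rightarrow> ('a, 'b, 'c) module_scheme" and R :: "('a, 'd) ring_scheme"
  assumes simple: "\<And>t. t \<in> I \<Longrightarrow> simple_module R (h t)"
    and distinct: "\<And>t t'. t \<in> I \<Longrightarrow> t' \<in> I \<Longrightarrow> module_iso R (h t) (h t') \<Longrightarrow> t = t'"
    and complete: "\<And>M :: ('a, 'a set) module. simple_module R M \<Longrightarrow>
      \<exists>t\<in>I. module_iso R M (h t)"
  shows "\<exists>f. bij_betw f I (simple_classes R)"
proof -
  let ?r = "{(M, N). simple_module R M \<and> simple_module R N \<and> module_iso R M N}
    :: ('a, 'a set) module rel"
  have "\<exists>N :: ('a, 'a set) module. simple_module R N \<and> module_iso R (h t) N" if "t \<in> I" for t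
    using simple_module_copy[OF simple[OF that]] by metis
  then obtain N :: "'i \<Rightarrow> ('a, 'a set) module"
    where N: "\<And>t. t \<in> I \<Longrightarrow> simple_module R (N t)" "\<And>t. t \<in> I \<Longrightarrow> module_iso R (h t) (N t)"
    by metis
  have lm: "left_module R (h t)" "left_module R (N t)" if "t \<in> I" for t
    using simple[OF that] N(1)[OF that] by (auto simp: simple_module_def)
  have "bij_betw (\<lambda>t. ?r `` {N t}) I (simple_classes R)"
    unfolding bij_betw_def
  proof
    show "inj_on (\<lambda>t. ?r `` {N t}) I"
    proof (rule inj_onI)
      fix t t' assume t: "t \<in> I" "t' \<in> I" "?r `` {N t} = ?r `` {N t'}"
      then have "module_iso R (N t) (N t')"
        using N(1) module_iso_refl by auto
      then have "module_iso R (h t) (h t')"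
        using t N lm module_iso_trans module_iso_sym by meson
      then show "t = t'" using t distinct by blast
    qed
    have "C \<in> (\<lambda>t. ?r `` {N t}) ` I" if C: "C \<in> simple_classes R" for C
    proof -
      obtain M :: "('a, 'a set) module" where M: "simple_module R M" "C = ?r `` {M}"
        using C unfolding simple_classes_def by (auto elim: quotientE)
      obtain t where t: "t \<in> I" "module_iso R M (h t)" using complete M(1) by blast
      then have "(M, N t) \<in> ?r" using M N module_iso_trans by auto blast
      then have "C = ?r `` {N t}" using M(2) equiv_class_eq[OF simple_classes_equiv] by blast
      then show ?thesis using t by blast
    qed
    moreover have "?r `` {N t} \<in> simple_classes R" if "t \<in> I" for t
      unfolding simple_classes_def using N(1)[OF that] by (intro quotientI) simp
    ultimately show "(\<lambda>t. ?r `` {N t}) ` I = simple_classes R" by blast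
  qed
  then show ?thesis by blast
qed

section \<open>Tensor products over a noncommutative ring\<close>

lemma (in abelian_group) add_diff_add_diff:
  assumes "x \<in> carrier G" "y \<in> carrier G" "u \<in> carrier G" "v \<in> carrier G"
  shows "x \<ominus> y \<oplus> (u \<ominus> v) = x \<oplus> u \<ominus> (y \<oplus> v)"
  using assms by (simp add: a_minus_def minus_add a_assoc a_lcomm)

text \<open>\<open>smult_rsmult\<close>, the compatibility of the two actions on X, is what makes
  the action of R respect the balancing relations and so descend to the tensor product.\<close>

locale tensor = X: left_module R X + L: left_module A L
  for R :: "('a, 'd) ring_scheme" and X :: "('a, 'b, 'r) bimodule"
    and A :: "('r, 'e) ring_scheme" and L :: "('r, 'l, 'c) module_scheme" +
  assumes rsmult_closed: "\<lbrakk>x \<in> carrier X; a \<in> carrier A\<rbrakk> \<Longrightarrow> rsmult X x a \<in> carrier X"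
    and smult_rsmult: "\<lbrakk>r \<in> carrier R; x \<in> carrier X; a \<in> carrier A\<rbrakk> \<Longrightarrow>
      r \<odot>\<^bsub>X\<^esub> rsmult X x a = rsmult X (r \<odot>\<^bsub>X\<^esub> x) a"
begin

abbreviation F where "F \<equiv> free_Abelian_group (carrier X \<times> carrier L)"
abbreviation rels where "rels \<equiv> generate F (tensor_relations A X L)"
abbreviation T where "T \<equiv> tensor_module A X L"

definition tens where "tens x l = rels #>\<^bsub>F\<^esub> frag_of (x, l)"

lemma tensor_relations_subset: "tensor_relations A X L \<subseteq> carrier F"
proof -
  have "Poly_Mapping.keys (frag_of p - frag_of q - frag_of r) \<subseteq> carrier X \<times> carrier L"
    if "p \<in> carrier X \<times> carrier L" "q \<in> carrier X \<times> carrier L" "r \<in> carrier X \<times> carrier L"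
    for p q r :: "'b \<times> 'l"
    using that keys_diff[of "frag_of p - frag_of q" "frag_of r"] keys_diff[of "frag_of p" "frag_of q"]
    by auto
  moreover have "Poly_Mapping.keys (frag_of p - frag_of q) \<subseteq> carrier X \<times> carrier L"
    if "p \<in> carrier X \<times> carrier L" "q \<in> carrier X \<times> carrier L" for p q :: "'b \<times> 'l"
    using that keys_diff[of "frag_of p" "frag_of q"] by auto
  ultimately show ?thesis
    unfolding tensor_relations_def by (auto simp: rsmult_closed)
qed

lemma comm_group_F: "comm_group F"
  by (rule abelian_free_Abelian_group)

interpretation F: comm_group F by (rule comm_group_F)

lemma subgroup_rels: "subgroup rels F"
  using tensor_relations_subset by (rule F.generate_is_subgroup)

lemma normal_rels: "rels \<lhd> F"
  using subgroup_rels by (rule F.subgroup_imp_normal)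

interpretation N: normal rels F by (rule normal_rels)

lemma coset_eq_iff:
  assumes "c \<in> carrier F" "d \<in> carrier F"
  shows "rels #>\<^bsub>F\<^esub> c = rels #>\<^bsub>F\<^esub> d \<longleftrightarrow> c - d \<in> rels"
proof -
  have "d \<in> rels #>\<^bsub>F\<^esub> c \<longleftrightarrow> d - c \<in> rels" if "c \<in> carrier F" "d \<in> carrier F" for c d
    using N.rcos_module[OF F.group_axioms that] that by simp
  then show ?thesis
    using assms F.repr_independence[OF _ _ subgroup_rels, of c d] F.rcos_self[OF _ subgroup_rels]
    by (metis minus_diff_eq N.m_inv_closed F.repr_independence subgroup_rels)
qed

lemma carrier_T: "carrier T = (\<lambda>c. rels #>\<^bsub>F\<^esub> c) ` carrier F"
  by (auto simp: tensor_module_def mk_module_def Let_def FactGroup_def RCOSETS_def)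

lemma zero_T: "\<zero>\<^bsub>T\<^esub> = rels #>\<^bsub>F\<^esub> 0"
  using F.coset_mult_one[of rels] N.subset
  by (simp add: tensor_module_def mk_module_def Let_def)

lemma add_T: "c \<in> carrier F \<Longrightarrow> d \<in> carrier F \<Longrightarrow>
    (rels #>\<^bsub>F\<^esub> c) \<oplus>\<^bsub>T\<^esub> (rels #>\<^bsub>F\<^esub> d) = rels #>\<^bsub>F\<^esub> (c + d)"
  using N.rcos_sum[of c d] by (simp add: tensor_module_def mk_module_def Let_def)

definition act where "act r = frag_extend (\<lambda>(x, l). frag_of (r \<odot>\<^bsub>X\<^esub> x, l))"

lemma act_simps:
  "act r (c + d) = act r c + act r d" "act r (c - d) = act r c - act r d"
  "act r (frag_of (x, l)) = frag_of (r \<odot>\<^bsub>X\<^esub> x, l)" "act r 0 = 0"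
  by (auto simp: act_def frag_extend_add frag_extend_diff)

lemma act_closed:
  assumes "r \<in> carrier R" "c \<in> carrier F"
  shows "act r c \<in> carrier F"
proof -
  have c: "Poly_Mapping.keys c \<subseteq> carrier X \<times> carrier L" using assms(2) by simp
  have "Poly_Mapping.keys (act r c) \<subseteq> carrier X \<times> carrier L"
  proof (rule free_Abelian_group_induct[OF c])
    fix x y assume "Poly_Mapping.keys (act r x) \<subseteq> carrier X \<times> carrier L"
      "Poly_Mapping.keys (act r y) \<subseteq> carrier X \<times> carrier L"
    then show "Poly_Mapping.keys (act r (x - y)) \<subseteq> carrier X \<times> carrier L"
      using keys_diff[of "act r x" "act r y"] by (auto simp: act_simps)
  qed (use assms(1) in \<open>auto simp: act_simps\<close>)
  then show ?thesis by simp
qed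

lemma act_relations:
  assumes "r \<in> carrier R" "c \<in> tensor_relations A X L"
  shows "act r c \<in> tensor_relations A X L"
  using assms(2) unfolding tensor_relations_def
proof (elim UnE CollectE exE conjE)
  fix x y l
  assume "c = frag_of (x \<oplus>\<^bsub>X\<^esub> y, l) - frag_of (x, l) - frag_of (y, l)"
    and *: "x \<in> carrier X" "y \<in> carrier X" "l \<in> carrier L"
  then have "act r c = frag_of (r \<odot>\<^bsub>X\<^esub> x \<oplus>\<^bsub>X\<^esub> r \<odot>\<^bsub>X\<^esub> y, l)
      - frag_of (r \<odot>\<^bsub>X\<^esub> x, l) - frag_of (r \<odot>\<^bsub>X\<^esub> y, l)"
    using assms(1) by (simp add: act_simps X.smult_r_distr)
  then show "act r c \<in> {frag_of (x \<oplus>\<^bsub>X\<^esub> y, l) - frag_of (x, l) - frag_of (y, l) | x y l.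
       x \<in> carrier X \<and> y \<in> carrier X \<and> l \<in> carrier L} \<union>
    {frag_of (x, l \<oplus>\<^bsub>L\<^esub> m) - frag_of (x, l) - frag_of (x, m) | x l m.
       x \<in> carrier X \<and> l \<in> carrier L \<and> m \<in> carrier L} \<union>
    {frag_of (rsmult X x a, l) - frag_of (x, a \<odot>\<^bsub>L\<^esub> l) | x a l.
       x \<in> carrier X \<and> a \<in> carrier A \<and> l \<in> carrier L}"
    using * assms(1) X.smult_closed by blast
next
  fix x l m
  assume "c = frag_of (x, l \<oplus>\<^bsub>L\<^esub> m) - frag_of (x, l) - frag_of (x, m)"
    and *: "x \<in> carrier X" "l \<in> carrier L" "m \<in> carrier L"
  then have "act r c = frag_of (r \<odot>\<^bsub>X\<^esub> x, l \<oplus>\<^bsub>L\<^esub> m)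
      - frag_of (r \<odot>\<^bsub>X\<^esub> x, l) - frag_of (r \<odot>\<^bsub>X\<^esub> x, m)"
    by (simp add: act_simps)
  then show "act r c \<in> {frag_of (x \<oplus>\<^bsub>X\<^esub> y, l) - frag_of (x, l) - frag_of (y, l) | x y l.
       x \<in> carrier X \<and> y \<in> carrier X \<and> l \<in> carrier L} \<union>
    {frag_of (x, l \<oplus>\<^bsub>L\<^esub> m) - frag_of (x, l) - frag_of (x, m) | x l m.
       x \<in> carrier X \<and> l \<in> carrier L \<and> m \<in> carrier L} \<union>
    {frag_of (rsmult X x a, l) - frag_of (x, a \<odot>\<^bsub>L\<^esub> l) | x a l.
       x \<in> carrier X \<and> a \<in> carrier A \<and> l \<in> carrier L}"
    using * assms(1) X.smult_closed by blast
next
  fix x a l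
  assume "c = frag_of (rsmult X x a, l) - frag_of (x, a \<odot>\<^bsub>L\<^esub> l)"
    and *: "x \<in> carrier X" "a \<in> carrier A" "l \<in> carrier L"
  then have "act r c = frag_of (rsmult X (r \<odot>\<^bsub>X\<^esub> x) a, l) - frag_of (r \<odot>\<^bsub>X\<^esub> x, a \<odot>\<^bsub>L\<^esub> l)"
    using assms(1) by (simp add: act_simps smult_rsmult)
  then show "act r c \<in> {frag_of (x \<oplus>\<^bsub>X\<^esub> y, l) - frag_of (x, l) - frag_of (y, l) | x y l.
       x \<in> carrier X \<and> y \<in> carrier X \<and> l \<in> carrier L} \<union>
    {frag_of (x, l \<oplus>\<^bsub>L\<^esub> m) - frag_of (x, l) - frag_of (x, m) | x l m.
       x \<in> carrier X \<and> l \<in> carrier L \<and> m \<in> carrier L} \<union>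
    {frag_of (rsmult X x a, l) - frag_of (x, a \<odot>\<^bsub>L\<^esub> l) | x a l.
       x \<in> carrier X \<and> a \<in> carrier A \<and> l \<in> carrier L}"
    using * assms(1) X.smult_closed by blast
qed

text \<open>\<open>act r\<close> is additive, so it is enough that it maps each generating relation
  to a relation.\<close>

lemma act_rels:
  assumes "r \<in> carrier R" "c \<in> rels"
  shows "act r c \<in> rels"
  using assms(2)
proof (induction rule: generate.induct)
  case one
  then show ?case using N.one_closed by (simp add: act_simps)
next
  case (incl h)
  then show ?case using act_relations[OF assms(1)] by (auto intro: generate.incl)
next
  case (inv h)
  then have "Poly_Mapping.keys h \<subseteq> carrier X \<times> carrier L"
    "act r h \<in> rels" "Poly_Mapping.keys (act r h) \<subseteq> carrier X \<times> carrier L"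
    using tensor_relations_subset act_relations[OF assms(1) inv] generate.incl[of _ _ F]
    unfolding carrier_free_Abelian_group_iff[symmetric] by blast+
  then show ?case
    using N.m_inv_closed[of "act r h"] act_simps(2)[of r 0 h] by (simp add: act_simps)
next
  case (eng h1 h2)
  then show ?case using N.m_closed by (simp add: act_simps)
qed

text \<open>The action on the tensor product is defined as a union over the representatives of a
  coset; by \<open>act_rels\<close> all of them give the same coset.\<close>

lemma smult_T:
  assumes "r \<in> carrier R" "c \<in> carrier F"
  shows "r \<odot>\<^bsub>T\<^esub> (rels #>\<^bsub>F\<^esub> c) = rels #>\<^bsub>F\<^esub> act r c"
proof -
  have "rels #>\<^bsub>F\<^esub> act r d = rels #>\<^bsub>F\<^esub> act r c" if "d \<in> rels #>\<^bsub>F\<^esub> c" for d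
  proof -
    have d: "d \<in> carrier F" using that assms(2) F.r_coset_subset_G[OF N.subset] by blast
    then have "d - c \<in> rels"
      using N.rcos_module[OF F.group_axioms assms(2) d] that assms(2) by simp
    then show ?thesis
      using act_rels[OF assms(1)] assms act_closed d by (simp add: coset_eq_iff flip: act_simps del: carrier_free_Abelian_group_iff)
  qed
  moreover have "c \<in> rels #>\<^bsub>F\<^esub> c" using assms(2) subgroup_rels by (rule F.rcos_self)
  ultimately have "(\<Union>d\<in>rels #>\<^bsub>F\<^esub> c. rels #>\<^bsub>F\<^esub> act r d) = rels #>\<^bsub>F\<^esub> act r c"
    by (intro UN_constant_eq ballI)
  then show ?thesis by (simp add: tensor_module_def mk_module_def Let_def act_def)
qed

lemma tens_closed [simp]: "x \<in> carrier X \<Longrightarrow> l \<in> carrier L \<Longrightarrow> tens x l \<in> carrier T"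
  unfolding tens_def carrier_T by (intro imageI) simp

lemma smult_tens:
  "r \<in> carrier R \<Longrightarrow> x \<in> carrier X \<Longrightarrow> l \<in> carrier L \<Longrightarrow> r \<odot>\<^bsub>T\<^esub> tens x l = tens (r \<odot>\<^bsub>X\<^esub> x) l"
  unfolding tens_def by (subst smult_T) (simp_all add: act_simps)

lemma abelian_group_T: "abelian_group T"
proof (rule abelian_groupI)
  note [simp del] = carrier_free_Abelian_group_iff
  have closed: "c + d \<in> carrier F" if "c \<in> carrier F" "d \<in> carrier F" for c d
    using F.m_closed[OF that] by simp
  have zero: "0 \<in> carrier F" using F.one_closed by simp
  show "\<zero>\<^bsub>T\<^esub> \<in> carrier T" unfolding zero_T carrier_T using zero by blast
  fix s t u assume "s \<in> carrier T" "t \<in> carrier T" "u \<in> carrier T"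
  then obtain b c d where c: "b \<in> carrier F" "c \<in> carrier F" "d \<in> carrier F"
    and stu: "s = rels #>\<^bsub>F\<^esub> b" "t = rels #>\<^bsub>F\<^esub> c" "u = rels #>\<^bsub>F\<^esub> d"
    unfolding carrier_T by blast
  show "s \<oplus>\<^bsub>T\<^esub> t \<in> carrier T"
    using c closed unfolding stu by (simp add: add_T) (simp add: carrier_T)
  show "s \<oplus>\<^bsub>T\<^esub> t \<oplus>\<^bsub>T\<^esub> u = s \<oplus>\<^bsub>T\<^esub> (t \<oplus>\<^bsub>T\<^esub> u)"
    using c closed unfolding stu by (simp add: add_T add.assoc)
  show "s \<oplus>\<^bsub>T\<^esub> t = t \<oplus>\<^bsub>T\<^esub> s"
    using c closed unfolding stu by (simp add: add_T add.commute)
  show "\<zero>\<^bsub>T\<^esub> \<oplus>\<^bsub>T\<^esub> s = s"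
    using c zero unfolding stu by (simp add: add_T zero_T)
  have "- b \<in> carrier F"
    using F.inv_closed[OF c(1)] c(1) by (simp add: carrier_free_Abelian_group_iff)
  then show "\<exists>y\<in>carrier T. y \<oplus>\<^bsub>T\<^esub> s = \<zero>\<^bsub>T\<^esub>"
    using c unfolding stu
    by (intro bexI[of _ "rels #>\<^bsub>F\<^esub> (- b)"]) (simp_all add: add_T zero_T carrier_T)
qed

interpretation T: abelian_group T by (rule abelian_group_T)

lemma T_minus:
  assumes "c \<in> carrier F" "d \<in> carrier F"
  shows "(rels #>\<^bsub>F\<^esub> c) \<ominus>\<^bsub>T\<^esub> (rels #>\<^bsub>F\<^esub> d) = rels #>\<^bsub>F\<^esub> (c - d)"
proof -
  have m: "c - d \<in> carrier F" "- d \<in> carrier F" using assms F.m_closed[OF assms(1) F.inv_closed[OF assms(2)]]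
      F.inv_closed[OF assms(2)] by auto
  have "\<ominus>\<^bsub>T\<^esub> (rels #>\<^bsub>F\<^esub> d) = rels #>\<^bsub>F\<^esub> (- d)"
    by (rule T.minus_equality) (use assms m in \<open>auto simp: add_T zero_T carrier_T simp del: carrier_free_Abelian_group_iff\<close>)
  then show ?thesis using assms m by (simp add: a_minus_def add_T del: carrier_free_Abelian_group_iff)
qed

text \<open>Stated with differences instead of sums, so that negatives need no case of their
  own.\<close>

lemma T_induct [consumes 1, case_names zero diff tens]:
  assumes "t \<in> carrier T" "P \<zero>\<^bsub>T\<^esub>"
    and "\<And>s t. \<lbrakk>s \<in> carrier T; t \<in> carrier T; P s; P t\<rbrakk> \<Longrightarrow> P (s \<ominus>\<^bsub>T\<^esub> t)"
    and "\<And>x l. \<lbrakk>x \<in> carrier X; l \<in> carrier L\<rbrakk> \<Longrightarrow> P (tens x l)"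
  shows "P t"
proof -
  obtain c where c: "c \<in> carrier F" "t = rels #>\<^bsub>F\<^esub> c" using assms(1) by (auto simp: carrier_T)
  then have "Poly_Mapping.keys c \<subseteq> carrier X \<times> carrier L" by simp
  then have "P (rels #>\<^bsub>F\<^esub> c)"
  proof (rule free_Abelian_group_induct)
    show "P (rels #>\<^bsub>F\<^esub> 0)" using assms(2) zero_T by simp
  next
    fix x y assume *: "Poly_Mapping.keys x \<subseteq> carrier X \<times> carrier L"
      "Poly_Mapping.keys y \<subseteq> carrier X \<times> carrier L"
      "P (rels #>\<^bsub>F\<^esub> x)" "P (rels #>\<^bsub>F\<^esub> y)"
    then have "x \<in> carrier F" "y \<in> carrier F" by simp_all
    then show "P (rels #>\<^bsub>F\<^esub> (x - y))"
      using assms(3)[of "rels #>\<^bsub>F\<^esub> x" "rels #>\<^bsub>F\<^esub> y"] *(3,4)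
      by (simp add: T_minus carrier_T del: carrier_free_Abelian_group_iff)
  next
    fix a assume "a \<in> carrier X \<times> carrier L"
    then show "P (rels #>\<^bsub>F\<^esub> frag_of a)" using assms(4)[of "fst a" "snd a"] by (auto simp: tens_def)
  qed
  then show ?thesis using c by simp
qed

lemma tens_relations:
  "\<lbrakk>x \<in> carrier X; y \<in> carrier X; l \<in> carrier L\<rbrakk> \<Longrightarrow>
    tens (x \<oplus>\<^bsub>X\<^esub> y) l = tens x l \<oplus>\<^bsub>T\<^esub> tens y l"
  "\<lbrakk>x \<in> carrier X; l \<in> carrier L; m \<in> carrier L\<rbrakk> \<Longrightarrow>
    tens x (l \<oplus>\<^bsub>L\<^esub> m) = tens x l \<oplus>\<^bsub>T\<^esub> tens x m"
  "\<lbrakk>x \<in> carrier X; a \<in> carrier A; l \<in> carrier L\<rbrakk> \<Longrightarrow>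
    tens (rsmult X x a) l = tens x (a \<odot>\<^bsub>L\<^esub> l)"
proof -
  have add: "rels #>\<^bsub>F\<^esub> frag_of p = (rels #>\<^bsub>F\<^esub> frag_of q) \<oplus>\<^bsub>T\<^esub> (rels #>\<^bsub>F\<^esub> frag_of r)"
    if "frag_of p - frag_of q - frag_of r \<in> tensor_relations A X L"
      "p \<in> carrier X \<times> carrier L" "q \<in> carrier X \<times> carrier L" "r \<in> carrier X \<times> carrier L" for p q r
  proof -
    have q: "frag_of q \<in> carrier F" "frag_of r \<in> carrier F" "frag_of p \<in> carrier F" using that by simp_all
    then have qr: "frag_of q + frag_of r \<in> carrier F" using F.m_closed[of "frag_of q" "frag_of r"] by simp
    have "frag_of p - (frag_of q + frag_of r) \<in> rels"
      using generate.incl[OF that(1), of F] by (simp add: algebra_simps)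
    then show ?thesis using q qr by (simp add: add_T coset_eq_iff del: carrier_free_Abelian_group_iff frag_of_in_free_Abelian_group)
  qed
  show "tens (x \<oplus>\<^bsub>X\<^esub> y) l = tens x l \<oplus>\<^bsub>T\<^esub> tens y l"
    if "x \<in> carrier X" "y \<in> carrier X" "l \<in> carrier L" for x y l
    unfolding tens_def by (rule add) (use that in \<open>auto simp: tensor_relations_def\<close>)
  show "tens x (l \<oplus>\<^bsub>L\<^esub> m) = tens x l \<oplus>\<^bsub>T\<^esub> tens x m"
    if "x \<in> carrier X" "l \<in> carrier L" "m \<in> carrier L" for x l m
    unfolding tens_def by (rule add) (use that in \<open>auto simp: tensor_relations_def\<close>)
  show "tens (rsmult X x a) l = tens x (a \<odot>\<^bsub>L\<^esub> l)"
    if *: "x \<in> carrier X" "a \<in> carrier A" "l \<in> carrier L" for x a l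
  proof -
    have "frag_of (rsmult X x a, l) - frag_of (x, a \<odot>\<^bsub>L\<^esub> l) \<in> rels"
      using * by (intro generate.incl) (auto simp: tensor_relations_def)
    then show ?thesis
      unfolding tens_def using * by (subst coset_eq_iff) (simp_all add: rsmult_closed)
  qed
qed

text \<open>Each scalar acts additively because \<open>act r\<close> is additive. With this known,
  the laws that involve two scalars or the unit only have to be checked on elementary
  tensors.\<close>

lemma left_module_T: "left_module R T"
proof (intro left_module.intro left_module_axioms.intro abelian_group_T X.R.ring_axioms)
  have closed: "r \<odot>\<^bsub>T\<^esub> t \<in> carrier T" if "r \<in> carrier R" "t \<in> carrier T" for r t
    using that act_closed by (auto simp: carrier_T smult_T simp del: carrier_free_Abelian_group_iff)
  show "r \<odot>\<^bsub>T\<^esub> t \<in> carrier T" if "r \<in> carrier R" "t \<in> carrier T" for r t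
    using that by (rule closed)
  have add: "r \<odot>\<^bsub>T\<^esub> (s \<oplus>\<^bsub>T\<^esub> t) = r \<odot>\<^bsub>T\<^esub> s \<oplus>\<^bsub>T\<^esub> r \<odot>\<^bsub>T\<^esub> t"
    if "r \<in> carrier R" "s \<in> carrier T" "t \<in> carrier T" for r s t
  proof -
    obtain c d where c: "c \<in> carrier F" "s = rels #>\<^bsub>F\<^esub> c" and d: "d \<in> carrier F" "t = rels #>\<^bsub>F\<^esub> d"
      using \<open>s \<in> carrier T\<close> \<open>t \<in> carrier T\<close> by (auto simp: carrier_T simp del: carrier_free_Abelian_group_iff)
    then have "c + d \<in> carrier F" using F.m_closed[of c d] by simp
    then show ?thesis
      unfolding c(2) d(2) using act_closed[OF that(1) c(1)] act_closed[OF that(1) d(1)]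
      by (simp only: add_T[OF c(1) d(1)] smult_T[OF that(1)] c(1) d(1) add_T act_simps)
  qed
  show "r \<odot>\<^bsub>T\<^esub> (s \<oplus>\<^bsub>T\<^esub> t) = r \<odot>\<^bsub>T\<^esub> s \<oplus>\<^bsub>T\<^esub> r \<odot>\<^bsub>T\<^esub> t"
    if "r \<in> carrier R" "s \<in> carrier T" "t \<in> carrier T" for r s t
    using that by (rule add)
  have fc: "(\<lambda>t. r \<odot>\<^bsub>T\<^esub> t) \<in> carrier T \<rightarrow> carrier T" if "r \<in> carrier R" for r
    using that closed by auto
  note hom = abelian_group_homD[OF abelian_group_T abelian_group_T fc add]
  show "(a \<oplus>\<^bsub>R\<^esub> b) \<odot>\<^bsub>T\<^esub> t = a \<odot>\<^bsub>T\<^esub> t \<oplus>\<^bsub>T\<^esub> b \<odot>\<^bsub>T\<^esub> t"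
    if "a \<in> carrier R" "b \<in> carrier R" "t \<in> carrier T" for a b t
    using that(3)
  proof (induction rule: T_induct)
    case zero
    then show ?case using that hom(1) by simp
  next
    case (diff s t)
    then show ?case
      using that(1,2) closed by (simp add: hom(3) T.add_diff_add_diff)
  next
    case (tens x l)
    then show ?case
      using that(1,2) by (simp add: smult_tens X.smult_l_distr tens_relations)
  qed
  show "(a \<otimes>\<^bsub>R\<^esub> b) \<odot>\<^bsub>T\<^esub> t = a \<odot>\<^bsub>T\<^esub> (b \<odot>\<^bsub>T\<^esub> t)"
    if "a \<in> carrier R" "b \<in> carrier R" "t \<in> carrier T" for a b t
    using that(3)
  proof (induction rule: T_induct)
    case zero
    then show ?case using that hom(1) by simp
  next
    case (diff s t)
    then show ?case using that(1,2) closed by (simp add: hom(3))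
  next
    case (tens x l)
    then show ?case using that(1,2) by (simp add: smult_tens X.smult_assoc)
  qed
  show "\<one>\<^bsub>R\<^esub> \<odot>\<^bsub>T\<^esub> t = t" if "t \<in> carrier T" for t
    using that
  proof (induction rule: T_induct)
    case zero
    then show ?case using hom(1) by simp
  next
    case (diff s t)
    then show ?case using closed by (simp add: hom(3))
  next
    case (tens x l)
    then show ?case by (simp add: smult_tens)
  qed
qed

text \<open>A balanced biadditive map extends to the free Abelian group, where it kills the defining
  relations and hence the subgroup that they generate.\<close>

lemma tensor_universal:
  assumes "abelian_group G"
    and closed: "\<And>x l. \<lbrakk>x \<in> carrier X; l \<in> carrier L\<rbrakk> \<Longrightarrow> b x l \<in> carrier G"
    and add_left: "\<And>x y l. \<lbrakk>x \<in> carrier X; y \<in> carrier X; l \<in> carrier L\<rbrakk> \<Longrightarrow>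
      b (x \<oplus>\<^bsub>X\<^esub> y) l = b x l \<oplus>\<^bsub>G\<^esub> b y l"
    and add_right: "\<And>x l m. \<lbrakk>x \<in> carrier X; l \<in> carrier L; m \<in> carrier L\<rbrakk> \<Longrightarrow>
      b x (l \<oplus>\<^bsub>L\<^esub> m) = b x l \<oplus>\<^bsub>G\<^esub> b x m"
    and balanced: "\<And>x a l. \<lbrakk>x \<in> carrier X; a \<in> carrier A; l \<in> carrier L\<rbrakk> \<Longrightarrow>
      b (rsmult X x a) l = b x (a \<odot>\<^bsub>L\<^esub> l)"
  obtains \<beta> where "\<beta> \<in> carrier T \<rightarrow> carrier G"
    and "\<And>s t. \<lbrakk>s \<in> carrier T; t \<in> carrier T\<rbrakk> \<Longrightarrow> \<beta> (s \<oplus>\<^bsub>T\<^esub> t) = \<beta> s \<oplus>\<^bsub>G\<^esub> \<beta> t"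
    and "\<And>x l. \<lbrakk>x \<in> carrier X; l \<in> carrier L\<rbrakk> \<Longrightarrow> \<beta> (tens x l) = b x l"
proof -
  interpret G: abelian_group G by fact
  interpret AG: comm_group "add_monoid G" by (rule G.a_comm_group)
  have "(\<lambda>(x, l). b x l) ` (carrier X \<times> carrier L) \<subseteq> carrier (add_monoid G)"
    using closed by auto
  from comm_group.free_Abelian_group_universal[OF G.a_comm_group this]
  obtain h where h: "h \<in> hom F (add_monoid G)"
    and h_of: "\<And>z. z \<in> carrier X \<times> carrier L \<Longrightarrow> h (frag_of z) = (\<lambda>(x, l). b x l) z"
    by blast
  interpret h: group_hom F "add_monoid G" h
    using h by (simp add: group_hom_def group_hom_axioms_def G.a_group F.group_axioms)
  have h_add: "h (c + d) = h c \<oplus>\<^bsub>G\<^esub> h d" if "c \<in> carrier F" "d \<in> carrier F" for c d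
    using h.hom_mult[OF that] by simp
  have h_diff: "h (c - d) = h c \<ominus>\<^bsub>G\<^esub> h d" if "c \<in> carrier F" "d \<in> carrier F" for c d
    using h.hom_mult[OF that(1) F.inv_closed[OF that(2)]] h.hom_inv[OF that(2)] that
    by (simp add: a_minus_def a_inv_def)
  have hc: "h c \<in> carrier G" if "c \<in> carrier F" for c using h.hom_closed[OF that] by simp
  have diff_closed: "c - d \<in> carrier F" if "c \<in> carrier F" "d \<in> carrier F" for c d
    using F.m_closed[OF that(1) F.inv_closed[OF that(2)]] that by simp
  have fr: "frag_of (x, l) \<in> carrier F" if "x \<in> carrier X" "l \<in> carrier L" for x l using that by simp
  have gz: "(u \<oplus>\<^bsub>G\<^esub> v) \<ominus>\<^bsub>G\<^esub> u \<ominus>\<^bsub>G\<^esub> v = \<zero>\<^bsub>G\<^esub>"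
    if "u \<in> carrier G" "v \<in> carrier G" for u v
    using that by (metis G.a_assoc G.a_closed G.a_inv_closed G.minus_add G.r_neg a_minus_def)
  have "h c = \<zero>\<^bsub>G\<^esub>" if "c \<in> tensor_relations A X L" for c
    using that fr closed diff_closed rsmult_closed
    unfolding tensor_relations_def
    by (elim UnE CollectE exE conjE)
      (simp_all add: h_diff h_of add_left add_right balanced gz G.minus_eq_zero_iff
        del: carrier_free_Abelian_group_iff frag_of_in_free_Abelian_group)
  then have "tensor_relations A X L \<subseteq> kernel F (add_monoid G) h"
    using tensor_relations_subset by (auto simp: kernel_def simp del: carrier_free_Abelian_group_iff)
  then have ker: "rels \<subseteq> kernel F (add_monoid G) h"
    using h.subgroup_kernel by (rule F.generate_subgroup_incl)
  \<comment> \<open>Evaluation at an arbitrary representative of the coset is well defined, because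
    h vanishes on \<open>rels\<close>.\<close>
  define \<beta> where "\<beta> = (\<lambda>C. h (SOME c. c \<in> C))"
  have \<beta>: "\<beta> (rels #>\<^bsub>F\<^esub> c) = h c" if c: "c \<in> carrier F" for c
  proof -
    have "(SOME d. d \<in> rels #>\<^bsub>F\<^esub> c) \<in> rels #>\<^bsub>F\<^esub> c"
      using F.rcos_self[OF c subgroup_rels] by (rule someI)
    then obtain r where r: "r \<in> rels" "(SOME d. d \<in> rels #>\<^bsub>F\<^esub> c) = r + c"
      by (auto simp: r_coset_def)
    then have "r \<in> carrier F" "h r = \<zero>\<^bsub>G\<^esub>" using ker by (auto simp: kernel_def)
    then show ?thesis unfolding \<beta>_def r(2) using h_add c hc by simp
  qed
  show thesis
  proof (rule that)
    show "\<beta> \<in> carrier T \<rightarrow> carrier G" using \<beta> hc by (auto simp: carrier_T)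
    show "\<beta> (s \<oplus>\<^bsub>T\<^esub> t) = \<beta> s \<oplus>\<^bsub>G\<^esub> \<beta> t" if "s \<in> carrier T" "t \<in> carrier T" for s t
    proof -
      obtain c d where c: "c \<in> carrier F" "s = rels #>\<^bsub>F\<^esub> c" and d: "d \<in> carrier F" "t = rels #>\<^bsub>F\<^esub> d"
        using \<open>s \<in> carrier T\<close> \<open>t \<in> carrier T\<close>
        by (auto simp: carrier_T simp del: carrier_free_Abelian_group_iff)
      then have "c + d \<in> carrier F" using F.m_closed[of c d] by simp
      then show ?thesis using c d by (simp add: add_T \<beta> h_add del: carrier_free_Abelian_group_iff)
    qed
    show "\<beta> (tens x l) = b x l" if "x \<in> carrier X" "l \<in> carrier L" for x l
      using that \<beta>[OF fr[OF that]] h_of by (simp add: tens_def)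
  qed
qed

end

section \<open>Simple modules with a given apex\<close>

text \<open>The subquotient K / J of the regular module with a right action through \<phi>. For K =
  P \<I>_\<nu> + J it is the \<open>index_bimodule\<close> from which the standard modules are
  induced.\<close>

definition ideal_bimodule ::
    "('a, 'd) ring_scheme \<Rightarrow> 'a set \<Rightarrow> 'a set \<Rightarrow> ('r \<Rightarrow> 'a) \<Rightarrow> ('a, 'a set, 'r) bimodule"
  where "ideal_bimodule R K J \<phi> =
    module.extend (quotient_module ((regular_module R)\<lparr>carrier := K\<rparr>) J)
      (bimodule.fields (\<lambda>X f. \<Union>x\<in>X. J +>\<^bsub>R\<^esub> (x \<otimes>\<^bsub>R\<^esub> \<phi> f)))"

definition annihilates :: "'a set \<Rightarrow> ('a, 'b, 'c) module_scheme \<Rightarrow> bool"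
  where "annihilates J M \<longleftrightarrow> (\<forall>r\<in>J. \<forall>m\<in>carrier M. r \<odot>\<^bsub>M\<^esub> m = \<zero>\<^bsub>M\<^esub>)"

definition corner ::
    "('r \<Rightarrow> 'a) \<Rightarrow> 'a \<Rightarrow> ('a, 'b, 'c) module_scheme \<Rightarrow> ('r, 'b) module"
  where "corner \<phi> e M =
    mk_module ((\<lambda>m. e \<odot>\<^bsub>M\<^esub> m) ` carrier M) \<zero>\<^bsub>M\<^esub> (add M) (\<lambda>f m. \<phi> f \<odot>\<^bsub>M\<^esub> m)"

lemma corner_simps [simp]:
  "carrier (corner \<phi> e M) = (\<lambda>m. e \<odot>\<^bsub>M\<^esub> m) ` carrier M"
  "\<zero>\<^bsub>corner \<phi> e M\<^esub> = \<zero>\<^bsub>M\<^esub>" "add (corner \<phi> e M) = add M"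
  "f \<odot>\<^bsub>corner \<phi> e M\<^esub> m = \<phi> f \<odot>\<^bsub>M\<^esub> m"
  by (simp_all add: corner_def mk_module_def)

text \<open>Expresses that f \<mapsto> \<phi> f e identifies A with the corner e R e modulo J:
  \<open>decomp\<close> is surjectivity, \<open>faithful\<close> is injectivity, and
  \<open>commutes\<close> puts the image into the corner.\<close>

locale apex = ideal J R + A: ring A
  for J :: "'a set" and R :: "('a, 'd) ring_scheme" (structure) and A :: "('r, 'f) ring_scheme" +
  fixes \<phi> :: "'r \<Rightarrow> 'a" and e :: 'a
  assumes e_closed [simp]: "e \<in> carrier R"
    and e_idem: "e \<otimes> e = e"
    and hom: "\<phi> \<in> ring_hom A R"
    and commutes: "f \<in> carrier A \<Longrightarrow> \<phi> f \<otimes> e = e \<otimes> \<phi> f"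
    and decomp: "r \<in> carrier R \<Longrightarrow> \<exists>f\<in>carrier A. e \<otimes> r \<otimes> e \<ominus> \<phi> f \<otimes> e \<in> J"
    and faithful: "f \<in> carrier A \<Longrightarrow> \<phi> f \<otimes> e \<in> J \<Longrightarrow> f = \<zero>\<^bsub>A\<^esub>"
begin

lemma phi_simps [simp]:
  "f \<in> carrier A \<Longrightarrow> \<phi> f \<in> carrier R" "\<phi> \<one>\<^bsub>A\<^esub> = \<one>"
  "f \<in> carrier A \<Longrightarrow> g \<in> carrier A \<Longrightarrow> \<phi> (f \<otimes>\<^bsub>A\<^esub> g) = \<phi> f \<otimes> \<phi> g"
  "f \<in> carrier A \<Longrightarrow> g \<in> carrier A \<Longrightarrow> \<phi> (f \<oplus>\<^bsub>A\<^esub> g) = \<phi> f \<oplus> \<phi> g"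
  using hom by (auto simp: ring_hom_def)

lemma phi_diff:
  "f \<in> carrier A \<Longrightarrow> g \<in> carrier A \<Longrightarrow> \<phi> (f \<ominus>\<^bsub>A\<^esub> g) = \<phi> f \<ominus> \<phi> g"
  by (rule abelian_group_homD(3)[OF A.abelian_group_axioms abelian_group_axioms]) auto

section \<open>Congruence modulo the ideal J\<close>

definition cong (infix "\<simeq>" 50) where
  "x \<simeq> y \<longleftrightarrow> x \<in> carrier R \<and> y \<in> carrier R \<and> x \<ominus> y \<in> J"

lemma J_closed: "x \<in> J \<Longrightarrow> y \<in> J \<Longrightarrow> x \<oplus> y \<in> J" "x \<in> J \<Longrightarrow> \<ominus> x \<in> J"
  using additive_subgroup.a_closed[OF is_additive_subgroup]
    additive_subgroup.a_inv_closed[OF is_additive_subgroup] by auto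

lemma cong_refl: "x \<in> carrier R \<Longrightarrow> x \<simeq> x"
  by (simp add: cong_def r_neg a_minus_def)

lemma cong_sym: "x \<simeq> y \<Longrightarrow> y \<simeq> x"
  unfolding cong_def using J_closed(2)[of "x \<ominus> y"]
  by (auto simp: a_minus_def minus_add add.m_comm)

lemma cong_add: "x \<simeq> y \<Longrightarrow> x' \<simeq> y' \<Longrightarrow> x \<oplus> x' \<simeq> y \<oplus> y'"
  unfolding cong_def using J_closed(1)[of "x \<ominus> y" "x' \<ominus> y'"] by (simp add: add_diff_add_diff)

lemma cong_trans [trans]: "x \<simeq> y \<Longrightarrow> y \<simeq> z \<Longrightarrow> x \<simeq> z"
proof -
  assume *: "x \<simeq> y" "y \<simeq> z"
  have "(x \<ominus> y) \<oplus> (y \<ominus> z) = x \<ominus> z"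
    using * by (simp add: cong_def a_minus_def a_assoc r_neg1)
  then show "x \<simeq> z" using * J_closed(1)[of "x \<ominus> y" "y \<ominus> z"] by (simp add: cong_def)
qed

lemma cong_mult_left: "x \<simeq> y \<Longrightarrow> r \<in> carrier R \<Longrightarrow> r \<otimes> x \<simeq> r \<otimes> y"
  unfolding cong_def using I_l_closed[of "x \<ominus> y" r]
  by (simp add: a_minus_def r_distr r_minus)

lemma cong_mult_right: "x \<simeq> y \<Longrightarrow> r \<in> carrier R \<Longrightarrow> x \<otimes> r \<simeq> y \<otimes> r"
  unfolding cong_def using I_r_closed[of "x \<ominus> y" r]
  by (simp add: a_minus_def l_distr l_minus)

lemma cong_zero_iff: "x \<simeq> \<zero> \<longleftrightarrow> x \<in> J"
  unfolding cong_def using minus_zero_right a_subset by auto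

lemma cong_faithful:
  assumes "f \<in> carrier A" "g \<in> carrier A" "\<phi> f \<otimes> e \<simeq> \<phi> g \<otimes> e"
  shows "f = g"
proof -
  have "(\<phi> f \<ominus> \<phi> g) \<otimes> e = \<phi> f \<otimes> e \<ominus> \<phi> g \<otimes> e"
    using assms by (simp add: a_minus_def l_distr l_minus)
  then have "\<phi> (f \<ominus>\<^bsub>A\<^esub> g) \<otimes> e \<in> J"
    using assms by (simp add: phi_diff cong_def)
  then have "f \<ominus>\<^bsub>A\<^esub> g = \<zero>\<^bsub>A\<^esub>" using assms by (intro faithful) auto
  then show ?thesis using assms A.minus_eq_zero_iff by simp
qed

text \<open>The left ideal R e + J, described by an equation modulo J so that its closure properties
  follow from those of the congruence; \<open>K_eq\<close> shows the agreement.\<close>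

definition K where "K = {x \<in> carrier R. x \<simeq> x \<otimes> e}"

lemma K_eq: "{x \<otimes> e | x. x \<in> carrier R} <+>\<^bsub>R\<^esub> J = K"
proof (intro equalityI subsetI)
  fix y assume "y \<in> {x \<otimes> e | x. x \<in> carrier R} <+>\<^bsub>R\<^esub> J"
  then obtain x j where y: "x \<in> carrier R" "j \<in> J" "y = x \<otimes> e \<oplus> j"
    by (auto simp: set_add_def')
  then have j: "j \<in> carrier R" "j \<simeq> \<zero>" using a_subset cong_zero_iff by auto
  have "y \<otimes> e = x \<otimes> e \<oplus> j \<otimes> e" using y j by (simp add: l_distr m_assoc e_idem)
  moreover have "x \<otimes> e \<oplus> j \<simeq> x \<otimes> e \<oplus> j \<otimes> e"
    using y j cong_mult_right[OF j(2), of e]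
    by (intro cong_add cong_refl) (auto intro: cong_trans cong_sym)
  ultimately show "y \<in> K" using y j by (simp add: K_def)
next
  fix x assume x: "x \<in> K"
  then have "x = x \<otimes> e \<oplus> (x \<ominus> x \<otimes> e)" by (simp add: K_def a_minus_def r_neg2 a_lcomm r_neg)
  moreover have "x \<ominus> x \<otimes> e \<in> J" using x by (simp add: K_def cong_def)
  ultimately show "x \<in> {x \<otimes> e | x. x \<in> carrier R} <+>\<^bsub>R\<^esub> J"
    using x unfolding set_add_def' K_def by blast
qed

lemma K_closed:
  "x \<in> K \<Longrightarrow> y \<in> K \<Longrightarrow> x \<oplus> y \<in> K" "x \<in> K \<Longrightarrow> r \<in> carrier R \<Longrightarrow> r \<otimes> x \<in> K"
  "x \<in> K \<Longrightarrow> f \<in> carrier A \<Longrightarrow> x \<otimes> \<phi> f \<in> K" "x \<in> J \<Longrightarrow> x \<in> K" "\<zero> \<in> K" "e \<in> K"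
  "x \<in> K \<Longrightarrow> x \<in> carrier R"
proof -
  show "x \<oplus> y \<in> K" if "x \<in> K" "y \<in> K" using that cong_add by (auto simp: K_def l_distr)
  show "r \<otimes> x \<in> K" if "x \<in> K" "r \<in> carrier R"
    using that cong_mult_left by (auto simp: K_def m_assoc)
  show "x \<otimes> \<phi> f \<in> K" if "x \<in> K" "f \<in> carrier A"
    using that cong_mult_right[of x "x \<otimes> e" "\<phi> f"] by (auto simp: K_def m_assoc commutes)
  show "x \<in> K" if "x \<in> J"
    using that cong_zero_iff[of x] cong_mult_right[of x \<zero> e] a_subset
    by (auto simp: K_def intro: cong_trans cong_sym)
  show "\<zero> \<in> K" by (simp add: K_def cong_refl)
  show "e \<in> K" by (simp add: K_def cong_refl e_idem)
qed (simp add: K_def)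

section \<open>The bimodule K / J and its projection to A\<close>

abbreviation X where "X \<equiv> ideal_bimodule R K J \<phi>"

definition cl where "cl x = J +> x"

lemma X_simps:
  shows carrier_X: "carrier X = cl ` K"
    and zero_X: "\<zero>\<^bsub>X\<^esub> = cl \<zero>"
    and add_X: "\<And>x y. x \<in> K \<Longrightarrow> y \<in> K \<Longrightarrow> cl x \<oplus>\<^bsub>X\<^esub> cl y = cl (x \<oplus> y)"
    and smult_X: "\<And>r x. r \<in> carrier R \<Longrightarrow> x \<in> K \<Longrightarrow> r \<odot>\<^bsub>X\<^esub> cl x = cl (r \<otimes> x)"
    and cl_eq: "\<And>x y. x \<in> K \<Longrightarrow> y \<in> K \<Longrightarrow> cl x = cl y \<longleftrightarrow> x \<simeq> y"
    and cl_mem: "\<And>x y. x \<in> K \<Longrightarrow> y \<in> cl x \<longleftrightarrow> y \<in> K \<and> y \<simeq> x"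
    and left_module_X: "left_module R X"
proof -
  interpret reg: left_module R "regular_module R" by (rule left_module_regular) (rule ring_axioms)
  have reg_simps: "carrier (regular_module R) = carrier R" "\<zero>\<^bsub>regular_module R\<^esub> = \<zero>"
    "add (regular_module R) = add R" "smult (regular_module R) = monoid.mult R"
    by (simp_all add: regular_module_def mk_module_def)
  let ?M = "(regular_module R)\<lparr>carrier := K\<rparr>"
  have subK: "submodule K R (regular_module R)"
    by (rule reg.submoduleI) (auto simp: reg_simps K_closed)
  have M: "left_module R ?M"
    by (rule left_module_restrict[OF reg.left_module_axioms subK])
  interpret M: left_module R ?M by (rule M)
  have J: "submodule J R ?M"
    by (rule M.submoduleI) (auto simp: reg_simps K_closed I_l_closed)
  have cl: "J +>\<^bsub>?M\<^esub> x = cl x" for x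
    by (simp add: cl_def a_r_coset_def' reg_simps)
  \<comment> \<open>Negation in a restricted module is formed inside the smaller carrier, so its
    agreement with negation in R has to be shown.\<close>
  have minus: "x \<ominus>\<^bsub>?M\<^esub> y = x \<ominus> y" if xy: "x \<in> K" "y \<in> K" for x y
  proof -
    have my: "\<ominus> y \<in> K" using K_closed(2)[OF xy(2), of "\<ominus> \<one>"] xy(2) K_closed(7)[of y]
      by (simp add: l_minus)
    have "\<ominus>\<^bsub>?M\<^esub> y = \<ominus> y"
      by (rule M.M.minus_equality) (use xy my K_closed(7) in \<open>auto simp: reg_simps l_neg\<close>)
    then show ?thesis by (simp add: a_minus_def reg_simps)
  qed
  note Q = quotient_module_simps[OF M J, unfolded cl]
  have X: "carrier X = carrier (quotient_module ?M J)" "\<zero>\<^bsub>X\<^esub> = \<zero>\<^bsub>quotient_module ?M J\<^esub>"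
    "add X = add (quotient_module ?M J)" "smult X = smult (quotient_module ?M J)"
    by (simp_all add: ideal_bimodule_def module.defs bimodule.defs)
  show cX: "carrier X = cl ` K" using Q(1) X by simp
  show zX: "\<zero>\<^bsub>X\<^esub> = cl \<zero>" using Q(2) X by (simp add: reg_simps)
  show aX: "cl x \<oplus>\<^bsub>X\<^esub> cl y = cl (x \<oplus> y)" if "x \<in> K" "y \<in> K" for x y
    using that Q(3)[of x y] X by (simp add: reg_simps)
  show sX: "r \<odot>\<^bsub>X\<^esub> cl x = cl (r \<otimes> x)" if "r \<in> carrier R" "x \<in> K" for r x
    using that Q(4)[of r x] X by (simp add: reg_simps)
  show "cl x = cl y \<longleftrightarrow> x \<simeq> y" if "x \<in> K" "y \<in> K" for x y
    using that Q(5)[of x y] minus K_closed(7) by (auto simp: cong_def)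
  show "y \<in> cl x \<longleftrightarrow> y \<in> K \<and> y \<simeq> x" if "x \<in> K" for x y
    using that Q(6)[of x y] minus[of y x] K_closed(7) by (auto simp: cong_def)
  show "left_module R X"
    by (rule left_module_image[OF M, where f = cl]) (simp_all add: cX zX aX sX reg_simps)
qed

lemma rsmult_X:
  assumes "x \<in> K" "f \<in> carrier A"
  shows "rsmult X (cl x) f = cl (x \<otimes> \<phi> f)"
proof -
  have "cl (y \<otimes> \<phi> f) = cl (x \<otimes> \<phi> f)" if "y \<in> cl x" for y
    using that assms cl_mem cl_eq K_closed(3) cong_mult_right by simp
  moreover have "x \<in> cl x" using assms cl_mem cong_refl K_closed(7) by simp
  ultimately have "(\<Union>y\<in>cl x. cl (y \<otimes> \<phi> f)) = cl (x \<otimes> \<phi> f)" by (intro UN_constant_eq ballI)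
  then show ?thesis
    by (simp add: ideal_bimodule_def module.defs bimodule.defs cl_def)
qed

text \<open>Left multiplication by e as a map from K / J to A: for x in K the element e x is
  congruent to e x e, hence to \<phi> f e for an f that exists by \<open>decomp\<close> and is
  unique by \<open>faithful\<close>.\<close>

definition proj where
  "proj C = (THE f. f \<in> carrier A \<and> (\<forall>x\<in>C. e \<otimes> x \<simeq> \<phi> f \<otimes> e))"

lemma proj_unique:
  assumes "x \<in> K" "f \<in> carrier A" "e \<otimes> x \<simeq> \<phi> f \<otimes> e"
  shows "proj (cl x) = f"
  unfolding proj_def
proof (rule the_equality)
  show "f \<in> carrier A \<and> (\<forall>y\<in>cl x. e \<otimes> y \<simeq> \<phi> f \<otimes> e)"
    using assms cl_mem cong_mult_left cong_trans e_closed by blast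
next
  fix g assume g: "g \<in> carrier A \<and> (\<forall>y\<in>cl x. e \<otimes> y \<simeq> \<phi> g \<otimes> e)"
  have "x \<in> cl x" using assms cl_mem cong_refl K_closed(7) by simp
  then have "\<phi> g \<otimes> e \<simeq> \<phi> f \<otimes> e" using g assms(3) cong_trans cong_sym by blast
  then show "g = f" using g assms(2) by (intro cong_faithful) auto
qed

lemma proj:
  assumes "x \<in> K"
  shows "proj (cl x) \<in> carrier A" "e \<otimes> x \<simeq> \<phi> (proj (cl x)) \<otimes> e"
proof -
  have x: "x \<in> carrier R" "x \<simeq> x \<otimes> e" using assms by (auto simp: K_def)
  obtain f where f: "f \<in> carrier A" "e \<otimes> x \<otimes> e \<ominus> \<phi> f \<otimes> e \<in> J" using decomp x(1) by blast
  have "e \<otimes> x \<simeq> e \<otimes> x \<otimes> e" using cong_mult_left[OF x(2)] x by (simp add: m_assoc)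
  also have "\<dots> \<simeq> \<phi> f \<otimes> e" using f x by (simp add: cong_def)
  finally have "e \<otimes> x \<simeq> \<phi> f \<otimes> e" .
  then show "proj (cl x) \<in> carrier A" "e \<otimes> x \<simeq> \<phi> (proj (cl x)) \<otimes> e"
    using proj_unique[OF assms f(1)] f(1) by auto
qed

text \<open>Additivity and right A-linearity make the map that sends (x, l) to \<open>proj x\<close>
  applied to l balanced; the value at e makes the induced map a left inverse of l \<mapsto> e
  \<otimes> l.\<close>

lemma proj_simps:
  "x \<in> K \<Longrightarrow> y \<in> K \<Longrightarrow> proj (cl (x \<oplus> y)) = proj (cl x) \<oplus>\<^bsub>A\<^esub> proj (cl y)"
  "x \<in> K \<Longrightarrow> f \<in> carrier A \<Longrightarrow> proj (cl (x \<otimes> \<phi> f)) = proj (cl x) \<otimes>\<^bsub>A\<^esub> f"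
  "proj (cl e) = \<one>\<^bsub>A\<^esub>"
proof -
  show "proj (cl (x \<oplus> y)) = proj (cl x) \<oplus>\<^bsub>A\<^esub> proj (cl y)" if "x \<in> K" "y \<in> K"
    by (rule proj_unique)
      (use that proj[of x] proj[of y] K_closed cong_add[OF proj(2)[of x] proj(2)[of y]]
        in \<open>auto simp: r_distr l_distr\<close>)
  show "proj (cl (x \<otimes> \<phi> f)) = proj (cl x) \<otimes>\<^bsub>A\<^esub> f" if "x \<in> K" "f \<in> carrier A"
    by (rule proj_unique)
      (use that proj[of x] K_closed cong_mult_right[OF proj(2)[of x], of "\<phi> f"]
        in \<open>auto simp: m_assoc simp flip: commutes\<close>)
  show "proj (cl e) = \<one>\<^bsub>A\<^esub>"
    by (rule proj_unique) (use K_closed in \<open>auto simp: e_idem cong_refl\<close>)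
qed

section \<open>The corner e M of a module\<close>

lemma e_fixes: "left_module R M \<Longrightarrow> m \<in> carrier (corner \<phi> e M) \<Longrightarrow> e \<odot>\<^bsub>M\<^esub> m = m"
proof -
  assume "left_module R M" and m: "m \<in> carrier (corner \<phi> e M)"
  then interpret M: left_module R M by simp
  show ?thesis using m by (auto simp flip: M.smult_assoc simp: e_idem)
qed

lemma corner_subset: "left_module R M \<Longrightarrow> m \<in> carrier (corner \<phi> e M) \<Longrightarrow> m \<in> carrier M"
  by (auto simp: left_module.smult_closed)

lemma left_module_corner:
  assumes "left_module R M"
  shows "left_module A (corner \<phi> e M)"
proof -
  interpret M: left_module R M by fact
  let ?C = "corner \<phi> e M"
  have sub: "m \<in> carrier M" if "m \<in> carrier ?C" for m using that by auto
  have mem: "m \<in> carrier ?C" if "m \<in> carrier M" "e \<odot>\<^bsub>M\<^esub> m = m" for m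
    using that by (simp add: image_iff) (metis)
  note efix = e_fixes[OF assms]
  have "abelian_group ?C"
  proof (rule abelian_groupI)
    show "x \<oplus>\<^bsub>?C\<^esub> y \<in> carrier ?C" if "x \<in> carrier ?C" "y \<in> carrier ?C" for x y
      using that sub efix by (intro mem) (simp_all del: corner_simps(1) add: M.smult_r_distr)
    show "\<zero>\<^bsub>?C\<^esub> \<in> carrier ?C" by (intro mem) simp_all
    show "\<exists>y\<in>carrier ?C. y \<oplus>\<^bsub>?C\<^esub> x = \<zero>\<^bsub>?C\<^esub>" if x: "x \<in> carrier ?C" for x
    proof
      show "\<ominus>\<^bsub>M\<^esub> x \<in> carrier ?C"
        using x sub efix by (intro mem) (simp_all del: corner_simps(1) add: M.smult_minus_right)
      show "\<ominus>\<^bsub>M\<^esub> x \<oplus>\<^bsub>?C\<^esub> x = \<zero>\<^bsub>?C\<^esub>"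
        using sub[OF x] by (simp add: M.M.l_neg)
    qed
  qed (use sub in \<open>simp_all del: corner_simps(1) add: M.M.a_ac\<close>)
  moreover have "f \<odot>\<^bsub>?C\<^esub> x \<in> carrier ?C" if f: "f \<in> carrier A" and x: "x \<in> carrier ?C" for f x
  proof (rule mem)
    show "f \<odot>\<^bsub>?C\<^esub> x \<in> carrier M" using f sub[OF x] by simp
    show "e \<odot>\<^bsub>M\<^esub> (f \<odot>\<^bsub>?C\<^esub> x) = f \<odot>\<^bsub>?C\<^esub> x"
      using f sub[OF x] efix[OF x] by (simp flip: M.smult_assoc commutes) (simp add: M.smult_assoc)
  qed
  ultimately show ?thesis
    by (intro left_module.intro left_module_axioms.intro A.ring_axioms)
      (use sub in \<open>simp_all del: corner_simps(1)
         add: M.smult_l_distr M.smult_r_distr M.smult_assoc\<close>)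
qed

lemma corner_iso:
  assumes "left_module R M" "left_module R N" "module_iso R M N"
  shows "module_iso A (corner \<phi> e M) (corner \<phi> e N)"
proof -
  interpret M: left_module R M by fact
  interpret N: left_module R N by fact
  obtain f where f: "bij_betw f (carrier M) (carrier N)"
    "\<forall>x\<in>carrier M. \<forall>y\<in>carrier M. f (x \<oplus>\<^bsub>M\<^esub> y) = f x \<oplus>\<^bsub>N\<^esub> f y"
    "\<forall>r\<in>carrier R. \<forall>x\<in>carrier M. f (r \<odot>\<^bsub>M\<^esub> x) = r \<odot>\<^bsub>N\<^esub> f x"
    using assms(3) unfolding module_iso_def by blast
  have N: "carrier N = f ` carrier M" using f(1) by (simp add: bij_betw_def)
  have "inj_on f (carrier (corner \<phi> e M))"
    using f(1) by (rule inj_on_subset[OF bij_betw_imp_inj_on]) auto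
  moreover have "f ` carrier (corner \<phi> e M) = carrier (corner \<phi> e N)"
    using f(3) by (auto simp: N image_image)
  ultimately show ?thesis
    unfolding module_iso_def bij_betw_def
    by (intro exI[of _ f]) (use f corner_subset[OF assms(1)] in auto)
qed

text \<open>Let x and y be in e M with x nonzero. Then y = r x for some r, hence y = e r e x. Modulo
  J, which annihilates M, the element e r e is some \<phi> f e, so y = \<phi> f x: every nonzero
  vector of the corner generates it over A.\<close>

lemma simple_corner:
  assumes M: "simple_module R M" and J: "annihilates J M"
    and nz: "m \<in> carrier M" "e \<odot>\<^bsub>M\<^esub> m \<noteq> \<zero>\<^bsub>M\<^esub>"
  shows "simple_module A (corner \<phi> e M)"
proof -
  interpret M: left_module R M using M by (simp add: simple_module_def)
  let ?C = "corner \<phi> e M"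
  interpret C: left_module A ?C by (rule left_module_corner[OF M.left_module_axioms])
  have C_nz: "carrier ?C \<noteq> {\<zero>\<^bsub>?C\<^esub>}" using nz by auto
  have "N = {\<zero>\<^bsub>?C\<^esub>} \<or> N = carrier ?C" if N: "submodule N A ?C" for N
  proof (cases "N \<subseteq> {\<zero>\<^bsub>?C\<^esub>}")
    case True
    then show ?thesis using C.submoduleD(2)[OF N] by blast
  next
    case False
    note HN = C.submoduleD[OF N]
    obtain x where x: "x \<in> N" "x \<noteq> \<zero>\<^bsub>M\<^esub>" using False by auto
    then have xC: "x \<in> carrier ?C" using HN(1) by blast
    then have xM: "x \<in> carrier M" by (rule corner_subset[OF M.left_module_axioms])
    note ex = e_fixes[OF M.left_module_axioms xC]
    have "y \<in> N" if y: "y \<in> carrier ?C" for y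
    proof -
      have yM: "y \<in> carrier M" using y by (rule corner_subset[OF M.left_module_axioms])
      obtain r where r: "r \<in> carrier R" "y = r \<odot>\<^bsub>M\<^esub> x" using simple_generated[OF M xM x(2) yM] .
      obtain f where f: "f \<in> carrier A" "e \<otimes> r \<otimes> e \<ominus> \<phi> f \<otimes> e \<in> J" using decomp r(1) by blast
      have "(e \<otimes> r \<otimes> e) \<odot>\<^bsub>M\<^esub> x \<ominus>\<^bsub>M\<^esub> (\<phi> f \<otimes> e) \<odot>\<^bsub>M\<^esub> x = \<zero>\<^bsub>M\<^esub>"
        using J f xM r by (simp add: annihilates_def flip: M.smult_diff_left)
      then have "(e \<otimes> r \<otimes> e) \<odot>\<^bsub>M\<^esub> x = (\<phi> f \<otimes> e) \<odot>\<^bsub>M\<^esub> x"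
        using f xM r by (simp add: M.M.minus_eq_zero_iff)
      then have "e \<odot>\<^bsub>M\<^esub> y = \<phi> f \<odot>\<^bsub>M\<^esub> x"
        using f xM r by (simp add: M.smult_assoc ex)
      then have "y = f \<odot>\<^bsub>?C\<^esub> x" using e_fixes[OF M.left_module_axioms y] by simp
      then show ?thesis using HN(5)[OF f(1) x(1)] by simp
    qed
    then show ?thesis using HN(1) by blast
  qed
  then show ?thesis using C_nz C.left_module_axioms unfolding simple_module_def by blast
qed

end

section \<open>The module induced from a simple module, and its head\<close>

locale apex_simple = apex J R A \<phi> e + L: left_module A L
  for J :: "'a set" and R :: "('a, 'd) ring_scheme" (structure) and A :: "('r, 'f) ring_scheme"
    and \<phi> e and L :: "('r, 'l, 'c) module_scheme" +
  assumes L_simple: "simple_module A L"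
begin

sublocale tensor R X A L
proof (intro tensor.intro left_module_X L.left_module_axioms tensor_axioms.intro)
  show "rsmult X x a \<in> carrier X" if "x \<in> carrier X" "a \<in> carrier A" for x a
    using that K_closed by (auto simp: carrier_X rsmult_X)
  show "r \<odot>\<^bsub>X\<^esub> rsmult X x a = rsmult X (r \<odot>\<^bsub>X\<^esub> x) a"
    if "r \<in> carrier R" "x \<in> carrier X" "a \<in> carrier A" for r x a
    using that K_closed by (auto simp: carrier_X rsmult_X smult_X m_assoc)
qed

sublocale T: left_module R T
  by (rule left_module_T)

lemma cl_closed [simp]: "x \<in> K \<Longrightarrow> cl x \<in> carrier X"
  by (simp add: carrier_X)

lemma tens_e_smult:
  assumes "f \<in> carrier A" "l \<in> carrier L"
  shows "tens (cl e) (f \<odot>\<^bsub>L\<^esub> l) = \<phi> f \<odot>\<^bsub>T\<^esub> tens (cl e) l"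
proof -
  have "tens (cl e) (f \<odot>\<^bsub>L\<^esub> l) = tens (cl (\<phi> f \<otimes> e)) l"
    using assms tens_relations(3)[of "cl e" f l] K_closed(6) by (simp add: rsmult_X commutes)
  then show ?thesis using assms K_closed(6) by (simp add: smult_tens smult_X)
qed

text \<open>As x is congruent to x e, the tensor x \<otimes> l equals x (e \<otimes> l): the copy e
  \<otimes> L of L generates the induced module.\<close>

lemma tens_eq: "x \<in> K \<Longrightarrow> l \<in> carrier L \<Longrightarrow> tens (cl x) l = x \<odot>\<^bsub>T\<^esub> tens (cl e) l"
proof -
  assume x: "x \<in> K" and l: "l \<in> carrier L"
  then have "cl x = cl (x \<otimes> e)"
    using K_closed(2)[OF K_closed(6)] by (subst cl_eq) (auto simp: K_def)
  then show "tens (cl x) l = x \<odot>\<^bsub>T\<^esub> tens (cl e) l"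
    using x l K_closed(6,7) by (simp add: smult_tens smult_X)
qed

lemma e_tens:
  assumes "x \<in> K" "l \<in> carrier L"
  shows "e \<odot>\<^bsub>T\<^esub> tens (cl x) l = tens (cl e) (proj (cl x) \<odot>\<^bsub>L\<^esub> l)"
proof -
  have "cl (e \<otimes> x) = cl (\<phi> (proj (cl x)) \<otimes> e)"
    using proj[OF assms(1)] K_closed assms(1) by (subst cl_eq) auto
  then have "e \<odot>\<^bsub>T\<^esub> tens (cl x) l = \<phi> (proj (cl x)) \<odot>\<^bsub>T\<^esub> tens (cl e) l"
    using assms proj[OF assms(1)] K_closed(6) by (simp add: smult_tens smult_X)
  then show ?thesis using tens_e_smult proj(1) assms by simp
qed

lemma T_submodule_top:
  assumes "submodule N R T" "\<And>l. l \<in> carrier L \<Longrightarrow> tens (cl e) l \<in> N"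
  shows "N = carrier T"
proof -
  note N = T.submoduleD[OF assms(1)]
  have "t \<in> N" if "t \<in> carrier T" for t
    using that
  proof (induction rule: T_induct)
    case (tens x l)
    then obtain y where "y \<in> K" "x = cl y" by (auto simp: carrier_X)
    then show ?case using tens assms(2) N(5) tens_eq K_closed(7) by simp
  qed (use N in auto)
  then show ?thesis using N(1) by blast
qed

text \<open>The map from K / J \<otimes> L to A \<otimes> L = L that \<open>proj\<close> induces. By
  \<open>e_act\<close> and \<open>beta_tens_e\<close> it identifies e T with L.\<close>

definition \<beta> where
  "\<beta> = (SOME b. b \<in> carrier T \<rightarrow> carrier L \<and>
    (\<forall>s\<in>carrier T. \<forall>t\<in>carrier T. b (s \<oplus>\<^bsub>T\<^esub> t) = b s \<oplus>\<^bsub>L\<^esub> b t) \<and>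
    (\<forall>x\<in>K. \<forall>l\<in>carrier L. b (tens (cl x) l) = proj (cl x) \<odot>\<^bsub>L\<^esub> l))"

lemma beta_spec:
  "\<beta> \<in> carrier T \<rightarrow> carrier L \<and>
    (\<forall>s\<in>carrier T. \<forall>t\<in>carrier T. \<beta> (s \<oplus>\<^bsub>T\<^esub> t) = \<beta> s \<oplus>\<^bsub>L\<^esub> \<beta> t) \<and>
    (\<forall>x\<in>K. \<forall>l\<in>carrier L. \<beta> (tens (cl x) l) = proj (cl x) \<odot>\<^bsub>L\<^esub> l)"
proof -
  obtain b where "b \<in> carrier T \<rightarrow> carrier L"
    and "\<And>s t. \<lbrakk>s \<in> carrier T; t \<in> carrier T\<rbrakk> \<Longrightarrow> b (s \<oplus>\<^bsub>T\<^esub> t) = b s \<oplus>\<^bsub>L\<^esub> b t"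
    and "\<And>x l. \<lbrakk>x \<in> carrier X; l \<in> carrier L\<rbrakk> \<Longrightarrow> b (tens x l) = proj x \<odot>\<^bsub>L\<^esub> l"
  proof (rule tensor_universal[OF L.M.abelian_group_axioms, of "\<lambda>x l. proj x \<odot>\<^bsub>L\<^esub> l"])
  qed (auto simp: carrier_X add_X rsmult_X proj proj_simps
        L.smult_l_distr L.smult_r_distr L.smult_assoc)
  then have "\<exists>b. b \<in> carrier T \<rightarrow> carrier L \<and>
      (\<forall>s\<in>carrier T. \<forall>t\<in>carrier T. b (s \<oplus>\<^bsub>T\<^esub> t) = b s \<oplus>\<^bsub>L\<^esub> b t) \<and>
      (\<forall>x\<in>K. \<forall>l\<in>carrier L. b (tens (cl x) l) = proj (cl x) \<odot>\<^bsub>L\<^esub> l)"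
    using cl_closed by blast
  then show ?thesis unfolding \<beta>_def by (rule someI_ex)
qed

lemma beta_closed [simp]: "t \<in> carrier T \<Longrightarrow> \<beta> t \<in> carrier L"
  and beta_add: "s \<in> carrier T \<Longrightarrow> t \<in> carrier T \<Longrightarrow> \<beta> (s \<oplus>\<^bsub>T\<^esub> t) = \<beta> s \<oplus>\<^bsub>L\<^esub> \<beta> t"
  and beta_tens: "x \<in> K \<Longrightarrow> l \<in> carrier L \<Longrightarrow> \<beta> (tens (cl x) l) = proj (cl x) \<odot>\<^bsub>L\<^esub> l"
  using beta_spec by auto

lemma beta_tens_e: "l \<in> carrier L \<Longrightarrow> \<beta> (tens (cl e) l) = l"
  by (simp add: beta_tens K_closed proj_simps)

lemmas beta_hom = abelian_group_homD[OF T.M.abelian_group_axioms L.M.abelian_group_axioms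
  conjunct1[OF beta_spec] beta_add]

lemma tens_e_hom:
  shows "tens (cl e) \<zero>\<^bsub>L\<^esub> = \<zero>\<^bsub>T\<^esub>"
    and "\<And>l m. l \<in> carrier L \<Longrightarrow> m \<in> carrier L \<Longrightarrow>
      tens (cl e) (l \<ominus>\<^bsub>L\<^esub> m) = tens (cl e) l \<ominus>\<^bsub>T\<^esub> tens (cl e) m"
  by (rule abelian_group_homD[OF L.M.abelian_group_axioms T.M.abelian_group_axioms];
    simp add: K_closed tens_relations)+

text \<open>Both sides are additive in t. On an elementary tensor, with f =
  \<open>proj (cl x)\<close>, the class of e x is that of \<phi> f e = e \<phi> f, and \<phi> f
  moves across the tensor sign to act on l.\<close>

lemma e_act: "t \<in> carrier T \<Longrightarrow> e \<odot>\<^bsub>T\<^esub> t = tens (cl e) (\<beta> t)"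
proof (induction rule: T_induct)
  case zero
  then show ?case by (simp add: beta_hom(1) tens_e_hom)
next
  case (diff s t)
  then show ?case by (simp add: beta_hom(3) tens_e_hom T.smult_diff_right)
next
  case (tens x l)
  then show ?case by (auto simp: carrier_X e_tens beta_tens)
qed

text \<open>The condition e r t = 0 for all r, written with \<open>\<beta>\<close>: by
  \<open>e_act\<close> and \<open>beta_tens_e\<close>, e s vanishes exactly when
  \<open>\<beta> s\<close> does.\<close>

definition N0 where "N0 = {t \<in> carrier T. \<forall>r\<in>carrier R. \<beta> (r \<odot>\<^bsub>T\<^esub> t) = \<zero>\<^bsub>L\<^esub>}"

lemma submodule_N0: "submodule N0 R T"
proof (rule T.submoduleI)
  show "a \<odot>\<^bsub>T\<^esub> x \<in> N0" if "a \<in> carrier R" "x \<in> N0" for a x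
    using that by (auto simp: N0_def simp flip: T.smult_assoc)
qed (auto simp: N0_def beta_hom(1) T.smult_r_distr beta_add)

lemma beta_N0: "t \<in> N0 \<Longrightarrow> \<beta> t = \<zero>\<^bsub>L\<^esub>"
  unfolding N0_def using T.smult_one one_closed by fastforce

text \<open>A submodule outside \<open>N0\<close> contains some t with \<open>\<beta> t\<close>
  nonzero, hence e t = e \<otimes> \<open>\<beta> t\<close>. Since L is simple, it then contains all
  of e \<otimes> L, which generates everything.\<close>

lemma submodule_dichotomy:
  assumes N: "submodule N R T"
  shows "N \<subseteq> N0 \<or> N = carrier T"
proof (cases "N \<subseteq> N0")
  case False
  note HN = T.submoduleD[OF N]
  obtain s r where "s \<in> N" "r \<in> carrier R" "\<beta> (r \<odot>\<^bsub>T\<^esub> s) \<noteq> \<zero>\<^bsub>L\<^esub>"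
    using False HN(1) by (auto simp: N0_def)
  then obtain t where t: "t \<in> N" "t \<in> carrier T" "\<beta> t \<noteq> \<zero>\<^bsub>L\<^esub>" using HN(1,5) by blast
  have "tens (cl e) l \<in> N" if l: "l \<in> carrier L" for l
  proof -
    obtain f where f: "f \<in> carrier A" "l = f \<odot>\<^bsub>L\<^esub> \<beta> t"
      using simple_generated[OF L_simple _ t(3) l] t(2) by auto
    have "tens (cl e) (\<beta> t) \<in> N" using HN(5)[of e t] t e_act by simp
    then show ?thesis using HN(5) f t tens_e_smult by simp
  qed
  then show ?thesis using T_submodule_top[OF N] by blast
qed simp

lemma nonzero_L: obtains l where "l \<in> carrier L" "l \<noteq> \<zero>\<^bsub>L\<^esub>"
  using L_simple L.M.zero_closed unfolding simple_module_def by blast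

lemma N0_proper: "N0 \<noteq> carrier T"
proof -
  obtain l where "l \<in> carrier L" "l \<noteq> \<zero>\<^bsub>L\<^esub>" by (rule nonzero_L)
  then have "tens (cl e) l \<in> carrier T - N0" using beta_N0 beta_tens_e K_closed(6) by force
  then show ?thesis by blast
qed

lemma maximal_N0: "maximal_submodule N0 R T"
  unfolding maximal_submodule_def using submodule_N0 N0_proper submodule_dichotomy by blast

lemma radical_T: "module_radical R T = N0"
proof -
  have "N = N0" if "maximal_submodule N R T" for N
    using that submodule_dichotomy[of N] submodule_N0 N0_proper
    unfolding maximal_submodule_def by blast
  then have "{N. maximal_submodule N R T} = {N0}" using maximal_N0 by blast
  then show ?thesis unfolding module_radical_def N0_def by auto
qed

abbreviation H where "H \<equiv> module_head R T"

lemma H_eq: "H = quotient_module T N0"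
  by (simp add: module_head_def radical_T)

lemma simple_H: "simple_module R H"
  unfolding H_eq by (rule simple_quotient[OF T.left_module_axioms maximal_N0])

lemmas Q = quotient_module_simps[OF T.left_module_axioms submodule_N0, folded H_eq]

text \<open>J already annihilates the induced module, because J K is contained in J and so becomes
  zero in K / J.\<close>

lemma annihilates_H: "annihilates J H"
proof -
  have "j \<odot>\<^bsub>T\<^esub> t = \<zero>\<^bsub>T\<^esub>" if j: "j \<in> J" and t: "t \<in> carrier T" for j t
    using t
  proof (induction rule: T_induct)
    case (tens x l)
    then obtain y where y: "y \<in> K" "x = cl y" by (auto simp: carrier_X)
    have "cl (j \<otimes> y) = cl \<zero>"
      using y j K_closed I_r_closed cong_zero_iff a_subset by (subst cl_eq) auto
    moreover have "tens (cl \<zero>) l = \<zero>\<^bsub>T\<^esub>"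
      using tens tens_eq[of \<zero> l] K_closed by simp
    ultimately show ?case using tens y j a_subset by (auto simp: smult_tens smult_X)
  qed (use j a_subset in \<open>auto simp: T.smult_diff_right T.M.minus_zero_right\<close>)
  then show ?thesis using a_subset by (auto simp: annihilates_def Q(1,2,4))
qed

text \<open>The map sends l to the class of e \<otimes> l. It is injective because
  \<open>\<beta>\<close> retracts it and vanishes on \<open>N0\<close>; it reaches the whole corner
  because e t = e \<otimes> \<open>\<beta> t\<close>.\<close>

lemma corner_H: "module_iso A L (corner \<phi> e H)"
proof -
  let ?f = "\<lambda>l. N0 +>\<^bsub>T\<^esub> tens (cl e) l"
  have e_closed': "tens (cl e) l \<in> carrier T" if "l \<in> carrier L" for l
    using that K_closed(6) by simp
  have "inj_on ?f (carrier L)"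
  proof (rule inj_onI)
    fix l m assume lm: "l \<in> carrier L" "m \<in> carrier L" "?f l = ?f m"
    then have "tens (cl e) l \<ominus>\<^bsub>T\<^esub> tens (cl e) m \<in> N0" using Q(5) e_closed' by simp
    then have "\<beta> (tens (cl e) (l \<ominus>\<^bsub>L\<^esub> m)) = \<zero>\<^bsub>L\<^esub>" using lm tens_e_hom(2) beta_N0 by simp
    then show "l = m" using lm beta_tens_e L.M.minus_eq_zero_iff by simp
  qed
  moreover have "?f ` carrier L = carrier (corner \<phi> e H)"
  proof -
    have "e \<odot>\<^bsub>H\<^esub> (N0 +>\<^bsub>T\<^esub> t) = ?f (\<beta> t)" if "t \<in> carrier T" for t
      using that Q(4) e_act by simp
    moreover have "\<beta> ` carrier T = carrier L"
    proof -
      have "l \<in> \<beta> ` carrier T" if "l \<in> carrier L" for l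
        using beta_tens_e[OF that] e_closed'[OF that] by (metis imageI)
      then show ?thesis by auto
    qed
    ultimately have "carrier (corner \<phi> e H) = (\<lambda>t. ?f (\<beta> t)) ` carrier T"
      by (simp add: Q(1) image_image)
    then show ?thesis using \<open>\<beta> ` carrier T = carrier L\<close> by (metis image_image)
  qed
  moreover have "?f (l \<oplus>\<^bsub>L\<^esub> m) = ?f l \<oplus>\<^bsub>H\<^esub> ?f m" if "l \<in> carrier L" "m \<in> carrier L" for l m
    using that Q(3) e_closed' tens_relations(2) K_closed(6) by simp
  moreover have "?f (f \<odot>\<^bsub>L\<^esub> l) = \<phi> f \<odot>\<^bsub>H\<^esub> ?f l" if "f \<in> carrier A" "l \<in> carrier L" for f l
    using that Q(4) e_closed' tens_e_smult by simp
  ultimately show ?thesis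
    unfolding module_iso_def bij_betw_def by (intro exI[of _ ?f]) auto
qed

text \<open>Adjunction between induction and the corner: the isomorphism g from L to e M extends to
  the map x \<otimes> l \<mapsto> x g l from the induced module to M. It is onto because M is
  simple, and its kernel turns out to be \<open>N0\<close>.\<close>

lemma head_iso:
  assumes M: "simple_module R M" and J: "annihilates J M"
    and iso: "module_iso A L (corner \<phi> e M)"
  shows "module_iso R M H"
proof -
  interpret M: left_module R M using M by (simp add: simple_module_def)
  obtain g where g: "bij_betw g (carrier L) (carrier (corner \<phi> e M))"
    "\<forall>x\<in>carrier L. \<forall>y\<in>carrier L. g (x \<oplus>\<^bsub>L\<^esub> y) = g x \<oplus>\<^bsub>M\<^esub> g y"
    "\<forall>f\<in>carrier A. \<forall>x\<in>carrier L. g (f \<odot>\<^bsub>L\<^esub> x) = \<phi> f \<odot>\<^bsub>M\<^esub> g x"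
    using iso unfolding module_iso_def by auto
  have gC: "g l \<in> carrier (corner \<phi> e M)" if "l \<in> carrier L" for l
    using g(1) that bij_betwE by blast
  have gM: "g l \<in> carrier M" and eg: "e \<odot>\<^bsub>M\<^esub> g l = g l" if "l \<in> carrier L" for l
    using corner_subset[OF M.left_module_axioms gC] e_fixes[OF M.left_module_axioms gC] that by auto
  \<comment> \<open>Congruent elements act alike on M, so a coset in K / J may act through any
    representative.\<close>
  have cong_act: "x \<odot>\<^bsub>M\<^esub> m = y \<odot>\<^bsub>M\<^esub> m" if "x \<simeq> y" "m \<in> carrier M" for x y m
  proof -
    have "(x \<ominus> y) \<odot>\<^bsub>M\<^esub> m = \<zero>\<^bsub>M\<^esub>" using that J by (simp add: cong_def annihilates_def)
    then show ?thesis
      using that by (simp add: cong_def M.smult_diff_left M.M.minus_eq_zero_iff)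
  qed
  let ?b = "\<lambda>C l. (SOME x. x \<in> C) \<odot>\<^bsub>M\<^esub> g l"
  have b: "(SOME y. y \<in> cl x) \<odot>\<^bsub>M\<^esub> m = x \<odot>\<^bsub>M\<^esub> m" if "x \<in> K" "m \<in> carrier M" for x m
  proof -
    have "x \<in> cl x" using that cl_mem cong_refl K_closed(7) by simp
    then have "(SOME y. y \<in> cl x) \<in> cl x" by (rule someI)
    then show ?thesis using cong_act that cl_mem by simp
  qed
  obtain \<gamma> where \<gamma>: "\<gamma> \<in> carrier T \<rightarrow> carrier M"
    and \<gamma>_add: "\<And>s t. \<lbrakk>s \<in> carrier T; t \<in> carrier T\<rbrakk> \<Longrightarrow> \<gamma> (s \<oplus>\<^bsub>T\<^esub> t) = \<gamma> s \<oplus>\<^bsub>M\<^esub> \<gamma> t"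
    and \<gamma>_tens: "\<And>x l. \<lbrakk>x \<in> carrier X; l \<in> carrier L\<rbrakk> \<Longrightarrow> \<gamma> (tens x l) = ?b x l"
  proof (rule tensor_universal[of M ?b])
  qed (use M.M.abelian_group_axioms gM g in \<open>auto simp: carrier_X b add_X rsmult_X K_closed
         M.smult_l_distr M.smult_r_distr M.smult_assoc\<close>)
  have \<gamma>_closed [simp]: "\<gamma> t \<in> carrier M" if "t \<in> carrier T" for t using \<gamma> that by auto
  note \<gamma>_hom = abelian_group_homD[OF T.M.abelian_group_axioms M.M.abelian_group_axioms \<gamma> \<gamma>_add]
  have \<gamma>_smult: "\<gamma> (r \<odot>\<^bsub>T\<^esub> t) = r \<odot>\<^bsub>M\<^esub> \<gamma> t" if r: "r \<in> carrier R" and t: "t \<in> carrier T" for r t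
    using t
  proof (induction rule: T_induct)
    case zero
    then show ?case using r by (simp add: \<gamma>_hom(1))
  next
    case (diff s t)
    then show ?case using r by (simp add: \<gamma>_hom(3) T.smult_diff_right M.smult_diff_right)
  next
    case (tens x l)
    then show ?case
      using r gM K_closed by (auto simp: carrier_X smult_tens smult_X \<gamma>_tens b M.smult_assoc)
  qed
  obtain l where l: "l \<in> carrier L" "l \<noteq> \<zero>\<^bsub>L\<^esub>" by (rule nonzero_L)
  have \<gamma>_e: "\<gamma> (tens (cl e) m) = g m" if "m \<in> carrier L" for m
    by (rule trans[OF trans[OF \<gamma>_tens[OF cl_closed[OF K_closed(6)] that]
          b[OF K_closed(6) gM[OF that]]] eg[OF that]])
  have "\<gamma> \<zero>\<^bsub>T\<^esub> = \<zero>\<^bsub>M\<^esub>" by (rule \<gamma>_hom(1))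
  then have g0: "g \<zero>\<^bsub>L\<^esub> = \<zero>\<^bsub>M\<^esub>"
    using \<gamma>_e[OF L.M.zero_closed] unfolding tens_e_hom(1) by metis
  have gl: "g l \<noteq> \<zero>\<^bsub>M\<^esub>"
    using l g0 bij_betw_imp_inj_on[OF g(1)] by (metis L.M.zero_closed inj_onD)
  have "submodule (\<gamma> ` carrier T) R M"
  proof (rule M.submoduleI)
    show "\<zero>\<^bsub>M\<^esub> \<in> \<gamma> ` carrier T" using \<gamma>_hom(1) T.M.zero_closed by (metis imageI)
  qed (auto simp flip: \<gamma>_add \<gamma>_smult)
  moreover have "g l \<in> \<gamma> ` carrier T"
    using \<gamma>_e[OF l(1)] l(1) K_closed(6) by (metis cl_closed imageI tens_closed)
  ultimately have img: "\<gamma> ` carrier T = carrier M"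
    using simple_cyclic[OF M gM[OF l(1)] gl] by blast
  have ker: "submodule {t \<in> carrier T. \<gamma> t = \<zero>\<^bsub>M\<^esub>} R T"
    by (rule T.submoduleI) (auto simp: \<gamma>_hom(1) \<gamma>_add \<gamma>_smult)
  have "tens (cl e) l \<in> carrier T - {t \<in> carrier T. \<gamma> t = \<zero>\<^bsub>M\<^esub>}"
    using \<gamma>_e[OF l(1)] gl tens_closed[OF cl_closed[OF K_closed(6)] l(1)] by simp
  then have "{t \<in> carrier T. \<gamma> t = \<zero>\<^bsub>M\<^esub>} \<noteq> carrier T" by blast
  \<comment> \<open>The kernel is a proper submodule, so the dichotomy places it inside
    \<open>N0\<close>.\<close>
  then have ker1: "t \<in> N0" if "t \<in> carrier T" "\<gamma> t = \<zero>\<^bsub>M\<^esub>" for t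
    using submodule_dichotomy[OF ker] that by blast
  have ker2: "\<gamma> t = \<zero>\<^bsub>M\<^esub>" if t: "t \<in> N0" for t
  \<comment> \<open>A nonzero \<open>\<gamma> t\<close> would generate g l, say as r
    (\<open>\<gamma> t\<close>). Then g l = e g l would be the image of e r t, which is zero for t
    in \<open>N0\<close>.\<close>
  proof (rule ccontr)
    assume nz: "\<gamma> t \<noteq> \<zero>\<^bsub>M\<^esub>"
    have tT: "t \<in> carrier T" using t by (simp add: N0_def)
    obtain r where r: "r \<in> carrier R" "g l = r \<odot>\<^bsub>M\<^esub> \<gamma> t"
      using simple_generated[OF M \<gamma>_closed[OF tT] nz gM[OF l(1)]] .
    have "g l = e \<odot>\<^bsub>M\<^esub> (r \<odot>\<^bsub>M\<^esub> \<gamma> t)" using eg[OF l(1)] r by simp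
    also have "\<dots> = \<gamma> (e \<odot>\<^bsub>T\<^esub> (r \<odot>\<^bsub>T\<^esub> t))" using r tT by (simp add: \<gamma>_smult)
    also have "\<dots> = \<zero>\<^bsub>M\<^esub>"
      using r tT t by (subst e_act) (auto simp: N0_def tens_e_hom \<gamma>_hom(1))
    finally show False using gl by simp
  qed
  show ?thesis
    unfolding H_eq using ker1 ker2
    by (intro quotient_module_iso[OF T.left_module_axioms M.left_module_axioms submodule_N0 img
          \<gamma>_add \<gamma>_smult]) auto
qed

end

section \<open>Rings with a family of apexes\<close>

text \<open>The idempotents generate the ring in layers: \<open>generated\<close> recovers
  \<open>J \<nu>\<close> from the idempotents of smaller \<open>size\<close>, and
  \<open>one_generated\<close> recovers the whole ring. \<open>not_le\<close> keeps the layers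
  apart. The numerical \<open>size\<close> permits a minimal choice of \<nu> for a given simple
  module.\<close>

locale apex_family = R?: ring R
  for R :: "('a, 'd) ring_scheme" (structure) +
  fixes I :: "'i set" and le :: "'i \<Rightarrow> 'i \<Rightarrow> bool" and size :: "'i \<Rightarrow> nat"
    and J :: "'i \<Rightarrow> 'a set" and A :: "'i \<Rightarrow> ('r, 'f) ring_scheme"
    and \<phi> :: "'i \<Rightarrow> 'r \<Rightarrow> 'a" and e :: "'i \<Rightarrow> 'a"
  assumes apex: "\<nu> \<in> I \<Longrightarrow> apex (J \<nu>) R (A \<nu>) (\<phi> \<nu>) (e \<nu>)"
    and le_antisym: "le \<nu> \<mu> \<Longrightarrow> le \<mu> \<nu> \<Longrightarrow> \<nu> = \<mu>"
    and not_le: "\<lbrakk>\<nu> \<in> I; \<mu> \<in> I; r \<in> carrier R; \<not> le \<nu> \<mu>\<rbrakk> \<Longrightarrow> e \<mu> \<otimes> r \<otimes> e \<nu> \<in> J \<nu>"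
    and generated: "\<lbrakk>\<nu> \<in> I; ideal K R; \<And>\<mu>. \<mu> \<in> I \<Longrightarrow> size \<mu> < size \<nu> \<Longrightarrow> e \<mu> \<in> K\<rbrakk> \<Longrightarrow> J \<nu> \<subseteq> K"
    and one_generated: "\<lbrakk>ideal K R; \<And>\<mu>. \<mu> \<in> I \<Longrightarrow> e \<mu> \<in> K\<rbrakk> \<Longrightarrow> \<one> \<in> K"
begin

definition std where
  "std \<nu> L = tensor_module (A \<nu>)
    (ideal_bimodule R ({x \<otimes> e \<nu> | x. x \<in> carrier R} <+>\<^bsub>R\<^esub> J \<nu>) (J \<nu>) (\<phi> \<nu>)) L"

text \<open>As M is simple, some r carries e \<nu> m to the vector m', on which e \<mu> is nonzero.
  So e \<mu> r e \<nu> does not annihilate M and cannot lie in \<open>J \<nu>\<close>.\<close>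

lemma apex_unique:
  assumes M: "simple_module R M" and \<nu>: "\<nu> \<in> I" and \<mu>: "\<mu> \<in> I" and J: "annihilates (J \<nu>) M"
    and nz: "m \<in> carrier M" "e \<nu> \<odot>\<^bsub>M\<^esub> m \<noteq> \<zero>\<^bsub>M\<^esub>" "m' \<in> carrier M" "e \<mu> \<odot>\<^bsub>M\<^esub> m' \<noteq> \<zero>\<^bsub>M\<^esub>"
  shows "le \<nu> \<mu>"
proof (rule ccontr)
  assume "\<not> le \<nu> \<mu>"
  note J' = not_le[OF \<nu> \<mu> _ this]
  interpret M: left_module R M using M by (simp add: simple_module_def)
  interpret a: apex "J \<nu>" R "A \<nu>" "\<phi> \<nu>" "e \<nu>" by (rule apex[OF \<nu>])
  interpret b: apex "J \<mu>" R "A \<mu>" "\<phi> \<mu>" "e \<mu>" by (rule apex[OF \<mu>])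
  obtain r where r: "r \<in> carrier R" "m' = r \<odot>\<^bsub>M\<^esub> (e \<nu> \<odot>\<^bsub>M\<^esub> m)"
    using simple_generated[OF M _ nz(2,3)] nz(1) by auto
  have "e \<mu> \<odot>\<^bsub>M\<^esub> m' = (e \<mu> \<otimes> r \<otimes> e \<nu>) \<odot>\<^bsub>M\<^esub> m"
    using r nz by (simp add: M.smult_assoc)
  then show False using J'[OF r(1)] J nz by (simp add: annihilates_def)
qed

lemma annihilator_ideal:
  assumes "left_module R M"
  shows "ideal {r \<in> carrier R. \<forall>m\<in>carrier M. r \<odot>\<^bsub>M\<^esub> m = \<zero>\<^bsub>M\<^esub>} R"
proof -
  interpret M: left_module R M by fact
  show ?thesis
  proof (intro ideal.intro ideal_axioms.intro additive_subgroupI ring_axioms subgroup.intro)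
    fix x assume "x \<in> {r \<in> carrier R. \<forall>m\<in>carrier M. r \<odot>\<^bsub>M\<^esub> m = \<zero>\<^bsub>M\<^esub>}"
    then show "inv\<^bsub>add_monoid R\<^esub> x \<in> {r \<in> carrier R. \<forall>m\<in>carrier M. r \<odot>\<^bsub>M\<^esub> m = \<zero>\<^bsub>M\<^esub>}"
      using M.smult_minus_left M.M.minus_equality[of "\<zero>\<^bsub>M\<^esub>" "\<zero>\<^bsub>M\<^esub>"] by (auto simp flip: a_inv_def)
  qed (auto simp: M.smult_l_distr M.smult_assoc)
qed

text \<open>For \<nu> of least size among the indices whose idempotent acts nontrivially, the
  annihilator of M is an ideal that contains all idempotents of smaller size, hence
  \<open>J \<nu>\<close>.\<close>

lemma apex_exists:
  assumes M: "simple_module R M"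
  obtains \<nu> m where "\<nu> \<in> I" "annihilates (J \<nu>) M" "m \<in> carrier M" "e \<nu> \<odot>\<^bsub>M\<^esub> m \<noteq> \<zero>\<^bsub>M\<^esub>"
proof -
  interpret M: left_module R M using M by (simp add: simple_module_def)
  let ?K = "{r \<in> carrier R. \<forall>m\<in>carrier M. r \<odot>\<^bsub>M\<^esub> m = \<zero>\<^bsub>M\<^esub>}"
  note K = annihilator_ideal[OF M.left_module_axioms]
  have "\<one> \<notin> ?K"
    using M M.M.zero_closed M.smult_one unfolding simple_module_def by fastforce
  then have ex: "\<exists>\<mu>. \<mu> \<in> I \<and> e \<mu> \<notin> ?K" using one_generated[OF K] by blast
  define \<nu> where "\<nu> = (ARG_MIN size \<mu>. \<mu> \<in> I \<and> e \<mu> \<notin> ?K)"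
  have \<nu>: "\<nu> \<in> I" "e \<nu> \<notin> ?K" and least: "\<And>\<mu>. \<mu> \<in> I \<Longrightarrow> e \<mu> \<notin> ?K \<Longrightarrow> size \<nu> \<le> size \<mu>"
    using arg_min_nat_lemma[of "\<lambda>\<mu>. \<mu> \<in> I \<and> e \<mu> \<notin> ?K" _ size] ex unfolding \<nu>_def by blast+
  interpret a: apex "J \<nu>" R "A \<nu>" "\<phi> \<nu>" "e \<nu>" by (rule apex[OF \<nu>(1)])
  have "J \<nu> \<subseteq> ?K"
  proof (rule generated[OF \<nu>(1) K])
    show "e \<mu> \<in> ?K" if "\<mu> \<in> I" "size \<mu> < size \<nu>" for \<mu>
      using least[OF that(1)] that(2) by linarith
  qed
  then have "annihilates (J \<nu>) M" by (auto simp: annihilates_def)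
  then show thesis using that \<nu> by auto
qed

lemma apex_simpleI: "\<nu> \<in> I \<Longrightarrow> simple_module (A \<nu>) L \<Longrightarrow> apex_simple (J \<nu>) R (A \<nu>) (\<phi> \<nu>) (e \<nu>) L"
  by (simp add: apex apex_simple_axioms_def apex_simple_def simple_module_def)

lemma std_head:
  assumes "\<nu> \<in> I" "simple_module (A \<nu>) L"
  shows "simple_module R (module_head R (std \<nu> L))"
    and "annihilates (J \<nu>) (module_head R (std \<nu> L))"
    and "module_iso (A \<nu>) L (corner (\<phi> \<nu>) (e \<nu>) (module_head R (std \<nu> L)))"
    and "\<And>M :: ('a, 'm) module. simple_module R M \<Longrightarrow> annihilates (J \<nu>) M \<Longrightarrow>
      module_iso (A \<nu>) L (corner (\<phi> \<nu>) (e \<nu>) M) \<Longrightarrow> module_iso R M (module_head R (std \<nu> L))"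
proof -
  interpret apex_simple "J \<nu>" R "A \<nu>" "\<phi> \<nu>" "e \<nu>" L by (rule apex_simpleI[OF assms])
  have std: "std \<nu> L = tensor_module (A \<nu>) X L" by (simp add: std_def K_eq)
  show "simple_module R (module_head R (std \<nu> L))"
    "annihilates (J \<nu>) (module_head R (std \<nu> L))"
    "module_iso (A \<nu>) L (corner (\<phi> \<nu>) (e \<nu>) (module_head R (std \<nu> L)))"
    unfolding std by (rule simple_H annihilates_H corner_H)+
  show "module_iso R M (module_head R (std \<nu> L))"
    if "simple_module R M" "annihilates (J \<nu>) M" "module_iso (A \<nu>) L (corner (\<phi> \<nu>) (e \<nu>) M)"
    for M :: "('a, 'm) module"
    unfolding std using that by (rule head_iso)
qed

lemma corner_nonzero:
  assumes "\<nu> \<in> I" "simple_module (A \<nu>) L" "left_module R M"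
    and "module_iso (A \<nu>) L (corner (\<phi> \<nu>) (e \<nu>) M)"
  obtains m where "m \<in> carrier M" "e \<nu> \<odot>\<^bsub>M\<^esub> m \<noteq> \<zero>\<^bsub>M\<^esub>"
proof -
  interpret apex "J \<nu>" R "A \<nu>" "\<phi> \<nu>" "e \<nu>" by (rule apex[OF assms(1)])
  have "simple_module (A \<nu>) (corner (\<phi> \<nu>) (e \<nu>) M)"
    by (rule simple_module_iso[OF assms(2,4) left_module_corner[OF assms(3)]])
  then interpret C: left_module "A \<nu>" "corner (\<phi> \<nu>) (e \<nu>) M" by (simp add: simple_module_def)
  have "\<exists>x\<in>carrier (corner (\<phi> \<nu>) (e \<nu>) M). x \<noteq> \<zero>\<^bsub>corner (\<phi> \<nu>) (e \<nu>) M\<^esub>"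
    using \<open>simple_module (A \<nu>) (corner (\<phi> \<nu>) (e \<nu>) M)\<close> C.M.zero_closed
    unfolding simple_module_def by blast
  then show thesis using that by auto
qed

text \<open>The isomorphism transports vectors that an idempotent does not kill, so
  \<open>apex_unique\<close> applies in both directions and antisymmetry gives \<nu> = \<mu>. The
  corner of the head then recovers L up to isomorphism.\<close>

lemma std_head_distinct:
  assumes \<nu>: "\<nu> \<in> I" "simple_module (A \<nu>) L" and \<mu>: "\<mu> \<in> I" "simple_module (A \<mu>) L'"
    and iso: "module_iso R (module_head R (std \<nu> L)) (module_head R (std \<mu> L'))"
  shows "\<nu> = \<mu>" and "module_iso (A \<nu>) L L'"
proof -
  let ?M = "module_head R (std \<nu> L)" and ?N = "module_head R (std \<mu> L')"
  note M = std_head[OF \<nu>] and N = std_head[OF \<mu>]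
  have lm: "left_module R ?M" "left_module R ?N" using M(1) N(1) by (simp_all add: simple_module_def)
  obtain f where f: "bij_betw f (carrier ?M) (carrier ?N)"
    "\<forall>x\<in>carrier ?M. \<forall>y\<in>carrier ?M. f (x \<oplus>\<^bsub>?M\<^esub> y) = f x \<oplus>\<^bsub>?N\<^esub> f y"
    "\<forall>r\<in>carrier R. \<forall>x\<in>carrier ?M. f (r \<odot>\<^bsub>?M\<^esub> x) = r \<odot>\<^bsub>?N\<^esub> f x"
    using iso unfolding module_iso_def by blast
  interpret M: left_module R ?M by (rule lm)
  interpret N: left_module R ?N by (rule lm)
  have f0: "f \<zero>\<^bsub>?M\<^esub> = \<zero>\<^bsub>?N\<^esub>"
    by (rule abelian_group_homD(1)[OF M.M.abelian_group_axioms N.M.abelian_group_axioms])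
      (use f in \<open>auto simp: bij_betw_def\<close>)
  interpret a: apex "J \<nu>" R "A \<nu>" "\<phi> \<nu>" "e \<nu>" by (rule apex[OF \<nu>(1)])
  interpret b: apex "J \<mu>" R "A \<mu>" "\<phi> \<mu>" "e \<mu>" by (rule apex[OF \<mu>(1)])
  obtain m where m: "m \<in> carrier ?M" "e \<nu> \<odot>\<^bsub>?M\<^esub> m \<noteq> \<zero>\<^bsub>?M\<^esub>"
    by (rule corner_nonzero[OF \<nu> lm(1) M(3)])
  obtain m' where m': "m' \<in> carrier ?N" "e \<mu> \<odot>\<^bsub>?N\<^esub> m' \<noteq> \<zero>\<^bsub>?N\<^esub>"
    by (rule corner_nonzero[OF \<mu> lm(2) N(3)])
  have fm: "f m \<in> carrier ?N" "e \<nu> \<odot>\<^bsub>?N\<^esub> f m \<noteq> \<zero>\<^bsub>?N\<^esub>"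
  proof -
    show "f m \<in> carrier ?N" using f(1) m(1) bij_betwE by blast
    have "f (e \<nu> \<odot>\<^bsub>?M\<^esub> m) \<noteq> f \<zero>\<^bsub>?M\<^esub>"
      using inj_on_eq_iff[OF bij_betw_imp_inj_on[OF f(1)]
          M.smult_closed[OF a.e_closed m(1)] M.M.zero_closed] m(2) by blast
    then show "e \<nu> \<odot>\<^bsub>?N\<^esub> f m \<noteq> \<zero>\<^bsub>?N\<^esub>" using f(3) f0 m by simp
  qed
  obtain u where u: "u \<in> carrier ?M" "m' = f u" using f(1) m'(1) by (auto simp: bij_betw_def)
  have eu: "e \<mu> \<odot>\<^bsub>?M\<^esub> u \<noteq> \<zero>\<^bsub>?M\<^esub>"
  proof
    assume "e \<mu> \<odot>\<^bsub>?M\<^esub> u = \<zero>\<^bsub>?M\<^esub>"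
    then have "e \<mu> \<odot>\<^bsub>?N\<^esub> m' = f \<zero>\<^bsub>?M\<^esub>" using f(3)[rule_format, OF b.e_closed u(1)] u(2) by simp
    then show False using m' f0 by simp
  qed
  have "le \<nu> \<mu>" by (rule apex_unique[OF M(1) \<nu>(1) \<mu>(1) M(2) m u(1) eu])
  moreover have "le \<mu> \<nu>" by (rule apex_unique[OF N(1) \<mu>(1) \<nu>(1) N(2) m' fm])
  ultimately show eq: "\<nu> = \<mu>" by (rule le_antisym)
  have L': "left_module (A \<nu>) L'" using \<mu> eq by (simp add: simple_module_def)
  have "module_iso (A \<nu>) L (corner (\<phi> \<nu>) (e \<nu>) ?N)"
    using M(3) a.corner_iso[OF lm iso] by (rule module_iso_trans)
  moreover have "module_iso (A \<nu>) (corner (\<phi> \<nu>) (e \<nu>) ?N) L'"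
    using module_iso_sym[OF N(3)] L' eq by simp
  ultimately show "module_iso (A \<nu>) L L'" by (rule module_iso_trans)
qed

text \<open>The corner has the carrier type of M, whereas the labels use another one. The last
  conclusion therefore speaks of every L isomorphic to the corner instead of the corner
  itself.\<close>

lemma std_head_complete:
  assumes M: "simple_module R (M :: ('a, 'm) module)"
  obtains \<nu> where "\<nu> \<in> I" "simple_module (A \<nu>) (corner (\<phi> \<nu>) (e \<nu>) M)"
    "\<And>L. simple_module (A \<nu>) L \<Longrightarrow> module_iso (A \<nu>) L (corner (\<phi> \<nu>) (e \<nu>) M) \<Longrightarrow>
      module_iso R M (module_head R (std \<nu> L))"
proof -
  obtain \<nu> m where \<nu>: "\<nu> \<in> I" "annihilates (J \<nu>) M" "m \<in> carrier M" "e \<nu> \<odot>\<^bsub>M\<^esub> m \<noteq> \<zero>\<^bsub>M\<^esub>"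
    by (rule apex_exists[OF M])
  interpret apex "J \<nu>" R "A \<nu>" "\<phi> \<nu>" "e \<nu>" by (rule apex[OF \<nu>(1)])
  show thesis
    using that[OF \<nu>(1) simple_corner[OF M \<nu>(2-4)]] std_head(4)[OF \<nu>(1) _ M \<nu>(2)] by blast
qed

text \<open>The selection L of representatives is arbitrary. Two labels with the same \<nu> and
  isomorphic representatives are the same class, so distinctness of heads reduces to
  \<open>std_head_distinct\<close>.\<close>

theorem simple_modules_classified:
  fixes L :: "'i \<times> ('r, 'r set) module set \<Rightarrow> ('r, 'r set) module"
  defines "\<Lambda> \<equiv> {(\<nu>, C). \<nu> \<in> I \<and> C \<in> simple_classes (A \<nu>)}"
  assumes L: "\<And>\<Theta>. \<Theta> \<in> \<Lambda> \<Longrightarrow> L \<Theta> \<in> snd \<Theta>"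
  defines "head_of \<equiv> \<lambda>\<Theta>. module_head R (std (fst \<Theta>) (L \<Theta>))"
  shows "\<And>\<Theta>. \<Theta> \<in> \<Lambda> \<Longrightarrow> simple_module R (head_of \<Theta>)"
    and "\<And>\<Theta> \<Theta>'. \<Theta> \<in> \<Lambda> \<Longrightarrow> \<Theta>' \<in> \<Lambda> \<Longrightarrow> module_iso R (head_of \<Theta>) (head_of \<Theta>') \<Longrightarrow> \<Theta> = \<Theta>'"
    and "\<And>M :: ('a, 'm) module. simple_module R M \<Longrightarrow> \<exists>\<Theta>\<in>\<Lambda>. module_iso R M (head_of \<Theta>)"
proof -
  have \<Lambda>: "fst \<Theta> \<in> I" "simple_module (A (fst \<Theta>)) (L \<Theta>)" if "\<Theta> \<in> \<Lambda>" for \<Theta>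
    using that L[OF that] simple_classesD(2) by (auto simp: \<Lambda>_def)
  show "simple_module R (head_of \<Theta>)" if "\<Theta> \<in> \<Lambda>" for \<Theta>
    unfolding head_of_def using \<Lambda>[OF that] by (rule std_head(1))
  show "\<Theta> = \<Theta>'" if \<Theta>: "\<Theta> \<in> \<Lambda>" and \<Theta>': "\<Theta>' \<in> \<Lambda>" and iso: "module_iso R (head_of \<Theta>) (head_of \<Theta>')" for \<Theta> \<Theta>'
  proof -
    note d = std_head_distinct[OF \<Lambda>[OF \<Theta>] \<Lambda>[OF \<Theta>'] iso[unfolded head_of_def]]
    have C: "snd \<Theta> \<in> simple_classes (A (fst \<Theta>))" "snd \<Theta>' \<in> simple_classes (A (fst \<Theta>))"
      using \<Theta> \<Theta>' d(1) by (auto simp: \<Lambda>_def)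
    have "L \<Theta>' \<in> snd \<Theta>"
      using simple_classesD(3)[OF C(1) L[OF \<Theta>]] d \<Lambda>(2)[OF \<Theta>'] by simp
    then have "M \<in> snd \<Theta> \<longleftrightarrow> M \<in> snd \<Theta>'" for M
      using simple_classesD(3)[OF C(1)] simple_classesD(3)[OF C(2) L[OF \<Theta>']] by blast
    then show ?thesis using d(1) by (auto simp: prod_eq_iff)
  qed
  show "\<exists>\<Theta>\<in>\<Lambda>. module_iso R M (head_of \<Theta>)" if M: "simple_module R M" for M :: "('a, 'm) module"
  proof -
    obtain \<nu> where \<nu>: "\<nu> \<in> I" "simple_module (A \<nu>) (corner (\<phi> \<nu>) (e \<nu>) M)"
      and iso: "\<And>L :: ('r, 'r set) module. simple_module (A \<nu>) L \<Longrightarrow> module_iso (A \<nu>) L (corner (\<phi> \<nu>) (e \<nu>) M) \<Longrightarrow>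
        module_iso R M (module_head R (std \<nu> L))"
      by (rule std_head_complete[OF M]) blast
    \<comment> \<open>A copy of the corner in the type of the labels, so that its isomorphism class
      C can be formed.\<close>
    obtain N :: "('r, 'r set) module"
      where N: "simple_module (A \<nu>) N" "module_iso (A \<nu>) (corner (\<phi> \<nu>) (e \<nu>) M) N"
      using simple_module_copy[OF \<nu>(2)] .
    define C :: "('r, 'r set) module set" where "C = {L. simple_module (A \<nu>) L \<and> module_iso (A \<nu>) N L}"
    have C: "C = {(M, N). simple_module (A \<nu>) M \<and> simple_module (A \<nu>) N \<and> module_iso (A \<nu>) M N} `` {N}"
      using N(1) by (auto simp: C_def)
    have "C \<in> simple_classes (A \<nu>)"
      unfolding C simple_classes_def using N(1) by (intro quotientI) simp
    then have \<Theta>: "(\<nu>, C) \<in> \<Lambda>" using \<nu>(1) by (simp add: \<Lambda>_def)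
    have "L (\<nu>, C) \<in> C" using L[OF \<Theta>] by simp
    then have LC: "simple_module (A \<nu>) (L (\<nu>, C))" "module_iso (A \<nu>) N (L (\<nu>, C))"
      unfolding C_def by blast+
    have "module_iso (A \<nu>) (corner (\<phi> \<nu>) (e \<nu>) M) (L (\<nu>, C))"
      using N(2) LC(2) by (rule module_iso_trans)
    then have "module_iso (A \<nu>) (L (\<nu>, C)) (corner (\<phi> \<nu>) (e \<nu>) M)"
      using \<nu>(2) unfolding simple_module_def by (blast intro: module_iso_sym)
    from iso[OF LC(1) this] have "module_iso R M (head_of (\<nu>, C))"
      by (simp add: head_of_def)
    then show ?thesis using \<Theta> by blast
  qed
qed

end

section \<open>Gluing partitions\<close>

definition relabel :: "(nat \<Rightarrow> nat) \<Rightarrow> vertex rel \<Rightarrow> vertex rel"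
  where "relabel h g = map_prod (apsnd h) (apsnd h) ` g"

lemma image_filter_row:
  assumes "\<And>x. x \<in> row n i \<Longrightarrow> P x \<longleftrightarrow> Q (apsnd h x)"
  shows "apsnd h ` {x \<in> row n i. P x} = {y \<in> row n (h i). Q y}"
proof -
  have "row n (h i) = apsnd h ` row n i" by (auto simp: row_def image_iff)
  then have "{y \<in> row n (h i). Q y} = {y \<in> apsnd h ` row n i. Q y}" by simp
  also have "\<dots> = apsnd h ` {x \<in> row n i. Q (apsnd h x)}" by blast
  also have "{x \<in> row n i. Q (apsnd h x)} = {x \<in> row n i. P x}" using assms by blast
  finally show ?thesis by simp
qed

text \<open>The increasing injection that misses j, as for coface maps of simplices.
  \<open>skip 0\<close> turns b into its shifted copy, \<open>skip 1\<close> sends the two rows of a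
  product to the outer rows of the three-row diagram, and \<open>skip 1\<close> and
  \<open>skip 2\<close> embed three rows into four.\<close>

definition skip :: "nat \<Rightarrow> nat \<Rightarrow> nat"
  where "skip j k = (if k < j then k else Suc k)"

abbreviation face :: "nat \<Rightarrow> vertex \<Rightarrow> vertex"
  where "face j \<equiv> apsnd (skip j)"

text \<open>Taken over the whole vertex type, hence reflexive everywhere; \<open>d_u_eq\<close>
  restricts it to the three rows.\<close>

definition glue :: "vertex rel \<Rightarrow> vertex rel \<Rightarrow> vertex rel"
  where "glue a b = (a \<union> shift b)\<^sup>*"

lemma inj_skip: "inj (skip j)"
  by (auto simp: inj_def skip_def split: if_splits)

lemma apsnd_inject: "inj h \<Longrightarrow> apsnd h x = apsnd h y \<longleftrightarrow> x = y"
  by (cases x; cases y) (auto dest: injD)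

lemma trans_restrict: "trans r \<Longrightarrow> trans (r \<inter> S \<times> S)"
  by (blast intro: transI dest: transD)

lemma shift_eq: "shift b = relabel (skip 0) b"
  by (simp add: shift_def relabel_def skip_def[abs_def])

lemma mem_relabel': "(u, v) \<in> relabel h g \<longleftrightarrow> (\<exists>x y. u = apsnd h x \<and> v = apsnd h y \<and> (x, y) \<in> g)"
proof
  assume "(u, v) \<in> relabel h g"
  then obtain z where "z \<in> g" "(u, v) = map_prod (apsnd h) (apsnd h) z"
    unfolding relabel_def by (rule imageE)
  then show "\<exists>x y. u = apsnd h x \<and> v = apsnd h y \<and> (x, y) \<in> g"
  proof -
    obtain x y where z: "z = (x, y)" by (cases z)
    with \<open>(u, v) = _\<close> have "u = apsnd h x" "v = apsnd h y" by simp_all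
    with z \<open>z \<in> g\<close> show ?thesis by blast
  qed
next
  assume "\<exists>x y. u = apsnd h x \<and> v = apsnd h y \<and> (x, y) \<in> g"
  then show "(u, v) \<in> relabel h g" unfolding relabel_def by (metis imageI map_prod_simp)
qed

lemma mem_relabel: "inj h \<Longrightarrow> (apsnd h x, apsnd h y) \<in> relabel h g \<longleftrightarrow> (x, y) \<in> g"
  unfolding mem_relabel' by (auto simp: apsnd_inject)

lemma rel_eqI: "(\<And>u v. (u, v) \<in> r \<longleftrightarrow> (u, v) \<in> s) \<Longrightarrow> r = s"
  by auto

lemma relabel_Un: "relabel h (g \<union> g') = relabel h g \<union> relabel h g'"
  unfolding relabel_def by (rule image_Un)

lemma relabel_comp: "relabel h (relabel h' g) = relabel (h \<circ> h') g"
proof (rule rel_eqI)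
  show "(u, v) \<in> relabel h (relabel h' g) \<longleftrightarrow> (u, v) \<in> relabel (h \<circ> h') g" for u v
    unfolding mem_relabel' apsnd_compose[symmetric] by blast
qed

text \<open>Each step of the path comes from a step before relabelling, and injectivity of h makes
  consecutive steps fit together.\<close>

lemma relabel_rtrancl_img:
  assumes "inj h" "(apsnd h x, v) \<in> (relabel h g)\<^sup>*"
  obtains y where "v = apsnd h y" "(x, y) \<in> g\<^sup>*"
proof -
  have "\<exists>y. v = apsnd h y \<and> (x, y) \<in> g\<^sup>*"
    using assms(2)
  proof (induction rule: rtrancl_induct)
    case (step v w)
    then obtain y where y: "v = apsnd h y" "(x, y) \<in> g\<^sup>*" by blast
    from step(2) obtain y' z where z: "v = apsnd h y'" "w = apsnd h z" "(y', z) \<in> g"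
      by (auto simp: mem_relabel')
    then have "y' = y" using y apsnd_inject[OF assms(1)] by metis
    then have "(x, z) \<in> g\<^sup>*" using y z by (metis rtrancl_into_rtrancl)
    then show ?case using z by blast
  qed blast
  then show thesis using that by blast
qed

lemma relabel_rtrancl:
  assumes "inj h"
  shows "(apsnd h x, apsnd h y) \<in> (relabel h g)\<^sup>* \<longleftrightarrow> (x, y) \<in> g\<^sup>*"
proof
  assume "(apsnd h x, apsnd h y) \<in> (relabel h g)\<^sup>*"
  then obtain z where "apsnd h y = apsnd h z" "(x, z) \<in> g\<^sup>*"
    using relabel_rtrancl_img[OF assms] by metis
  then show "(x, y) \<in> g\<^sup>*" unfolding apsnd_inject[OF assms] by simp
next
  assume "(x, y) \<in> g\<^sup>*"
  then show "(apsnd h x, apsnd h y) \<in> (relabel h g)\<^sup>*"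
  proof (induction rule: rtrancl_induct)
    case (step y z)
    then have "(apsnd h y, apsnd h z) \<in> relabel h g" by (simp add: mem_relabel assms)
    with step(3) show ?case by (rule rtrancl_into_rtrancl)
  qed auto
qed

lemma sym_relabel: "sym g \<Longrightarrow> sym (relabel h g)"
  unfolding sym_def mem_relabel' by blast

text \<open>Eliminates the vertices of r outside U. A run of r-steps contracts to one step by
  transitivity, and the ends of a run are ends of the path or vertices of s, hence lie in U.
  Associativity rests on this with U the rows that survive in a product.\<close>

lemma restrict_rtrancl:
  assumes "trans r" "\<And>z. z \<in> Field r \<Longrightarrow> z \<in> Field s \<Longrightarrow> z \<in> U"
    and "(x, y) \<in> (r \<union> s)\<^sup>*" "x \<in> U \<union> Field s" "y \<in> U \<union> Field s"
  shows "(x, y) \<in> (r \<inter> U \<times> U \<union> s)\<^sup>*"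
proof -
  let ?t = "(r \<inter> U \<times> U \<union> s)\<^sup>*"
  have U: "z \<in> U" if "z \<in> Field r" "z \<in> U \<union> Field s" for z using that assms(2) by blast
  \<comment> \<open>The vertex z is where the current run of r-steps began; the case z = y is an
    empty run.\<close>
  have "\<exists>z. (x, z) \<in> ?t \<and> z \<in> U \<union> Field s \<and> (z = y \<or> z \<in> U \<and> (z, y) \<in> r)"
    using assms(3)
  proof (induction rule: rtrancl_induct)
    case base
    then show ?case using assms(4) by blast
  next
    case (step y y')
    then obtain z where z: "(x, z) \<in> ?t" "z \<in> U \<union> Field s" "z = y \<or> z \<in> U \<and> (z, y) \<in> r" by blast
    from step(2) show ?case
    proof
      assume r: "(y, y') \<in> r"
      then have "y \<in> Field r" by (simp add: FieldI1)
      then have "z \<in> U \<and> (z, y') \<in> r"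
        using z r U[of y] transD[OF assms(1)] by metis
      then show ?thesis using z by blast
    next
      assume s: "(y, y') \<in> s"
      have "(x, y) \<in> ?t"
      proof (cases "z = y")
        case False
        then have "(z, y) \<in> r \<inter> U \<times> U" using z s U[of y] by (auto simp: Field_def)
        then show ?thesis using z(1) by (auto intro: rtrancl_into_rtrancl)
      qed (use z in auto)
      then have "(x, y') \<in> ?t" using s by (auto intro: rtrancl_into_rtrancl)
      then show ?thesis using s by (auto simp: Field_def)
    qed
  qed
  then obtain z where z: "(x, z) \<in> ?t" "z = y \<or> z \<in> U \<and> (z, y) \<in> r" by blast
  then show ?thesis
  proof (cases "z = y")
    case False
    then have "(z, y) \<in> r \<inter> U \<times> U" using z U[of y] assms(5) by (auto simp: Field_def)
    then show ?thesis using z(1) by (auto intro: rtrancl_into_rtrancl)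
  qed auto
qed

section \<open>Partitions\<close>

lemma partitionsD:
  assumes "a \<in> partitions n"
  shows "a \<subseteq> vertices n \<times> vertices n" "v \<in> vertices n \<Longrightarrow> (v, v) \<in> a"
    "(u, v) \<in> a \<Longrightarrow> (v, u) \<in> a" "(u, v) \<in> a \<Longrightarrow> (v, w) \<in> a \<Longrightarrow> (u, w) \<in> a"
    "sym a" "trans a" "(u, v) \<in> a \<Longrightarrow> u \<in> vertices n" "(u, v) \<in> a \<Longrightarrow> v \<in> vertices n"
  using assms unfolding partitions_def
  by (auto elim!: equivE simp: refl_on_def dest: symD transD)

lemma partitionsI:
  assumes "a \<subseteq> vertices n \<times> vertices n" "\<And>v. v \<in> vertices n \<Longrightarrow> (v, v) \<in> a"
    "\<And>u v. (u, v) \<in> a \<Longrightarrow> (v, u) \<in> a" "\<And>u v w. (u, v) \<in> a \<Longrightarrow> (v, w) \<in> a \<Longrightarrow> (u, w) \<in> a"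
  shows "a \<in> partitions n"
  unfolding partitions_def mem_Collect_eq
  by (intro equivI refl_onI symI transI) (use assms in blast)+

lemma mem_row [simp]: "(i, k) \<in> row n l \<longleftrightarrow> i \<in> {1..n} \<and> k = l"
  by (auto simp: row_def)

lemma finite_row [simp]: "finite (row n l)"
  by (simp add: row_def)

abbreviation rows3 :: "nat \<Rightarrow> vertex set"
  where "rows3 n \<equiv> row n 0 \<union> row n 1 \<union> row n 2"

lemma glue_sym:
  assumes "a \<in> partitions n" "b \<in> partitions n"
  shows "sym (glue a b)"
  unfolding glue_def shift_eq
  using partitionsD(5)[OF assms(1)] partitionsD(5)[OF assms(2)]
  by (intro sym_rtrancl sym_Un sym_relabel)

lemma glue_trans: "trans (glue a b)"
  unfolding glue_def by (rule trans_rtrancl)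

lemma glue_refl: "(x, x) \<in> glue a b"
  unfolding glue_def by simp

lemma glue_left: "(x, y) \<in> a \<Longrightarrow> (x, y) \<in> glue a b"
  unfolding glue_def by blast

lemma glue_right: "(x, y) \<in> b \<Longrightarrow> (face 0 x, face 0 y) \<in> glue a b"
  unfolding glue_def shift_eq using mem_relabel[OF inj_skip] by blast

lemma shift_subset: "b \<in> partitions n \<Longrightarrow> shift b \<subseteq> (row n 1 \<union> row n 2) \<times> (row n 1 \<union> row n 2)"
  using partitionsD(1) by (fastforce simp: shift_def)

lemma glue_closed:
  assumes "a \<in> partitions n" "b \<in> partitions n" "(x, y) \<in> glue a b" "x \<in> rows3 n"
  shows "y \<in> rows3 n"
  using assms(3,4) unfolding glue_def
proof (induction rule: rtrancl_induct)
  case (step y z)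
  then show ?case using partitionsD(1)[OF assms(1)] shift_subset[OF assms(2)] by auto
qed

text \<open>Both generating relations are symmetric, so their reflexive transitive closure is
  already an equivalence relation; only the restriction to the three rows remains.\<close>

lemma d_u_eq:
  assumes a: "a \<in> partitions n" and b: "b \<in> partitions n"
  shows "d_u n a b = glue a b \<inter> rows3 n \<times> rows3 n"
proof (intro equalityI)
  have "equiv (rows3 n) (glue a b \<inter> rows3 n \<times> rows3 n)"
  proof (rule equivI)
    show "sym (glue a b \<inter> rows3 n \<times> rows3 n)"
      using glue_sym[OF assms] by (blast intro: symI dest: symD)
  qed (auto intro: trans_restrict glue_trans refl_onI glue_refl)
  moreover have "a \<union> shift b \<subseteq> glue a b \<inter> rows3 n \<times> rows3 n"
    using partitionsD(1)[OF a] shift_subset[OF b] unfolding glue_def by blast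
  ultimately show "d_u n a b \<subseteq> glue a b \<inter> rows3 n \<times> rows3 n"
    unfolding d_u_def by blast
  have "glue a b \<inter> rows3 n \<times> rows3 n \<subseteq> r"
    if r: "equiv (rows3 n) r" "a \<union> shift b \<subseteq> r" for r
  proof -
    have "(x, y) \<in> r" if "(x, y) \<in> (a \<union> shift b)\<^sup>*" "x \<in> rows3 n" for x y
      using that
    proof (induction rule: rtrancl_induct)
      case base
      then show ?case using r(1) by (auto elim!: equivE simp: refl_on_def)
    next
      case (step y z)
      then show ?case using r by (meson equivE subsetD transD)
    qed
    then show ?thesis by (auto simp: glue_def)
  qed
  then show "glue a b \<inter> rows3 n \<times> rows3 n \<subseteq> d_u n a b"
    unfolding d_u_def by blast
qed

lemma face1_row: "face 1 u \<in> row n 0 \<union> row n 2 \<longleftrightarrow> u \<in> vertices n"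
  by (cases u) (auto simp: skip_def split: if_splits)

text \<open>\<open>face 1\<close> places the rows of the product in the outer rows of the three-row
  diagram. Later arguments about products start from this rule instead of the renaming in
  \<open>d_prod\<close>.\<close>

lemma mem_d_prod:
  assumes "a \<in> partitions n" "b \<in> partitions n"
  shows "(u, v) \<in> d_prod n a b \<longleftrightarrow>
    u \<in> vertices n \<and> v \<in> vertices n \<and> (face 1 u, face 1 v) \<in> glue a b"
proof -
  let ?f = "apsnd (\<lambda>l. if l = 2 then 1 else l :: nat) :: vertex \<Rightarrow> vertex"
  have f: "face 1 (?f x) = x \<and> ?f x \<in> vertices n" if "x \<in> row n 0 \<union> row n 2" for x
    using that by (cases x) (auto simp: skip_def)
  have g: "?f (face 1 u) = u" if "u \<in> vertices n" for u
    using that by (cases u) (auto simp: skip_def)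
  let ?D = "d_u n a b \<inter> (row n 0 \<union> row n 2) \<times> (row n 0 \<union> row n 2)"
  have "(u, v) \<in> d_prod n a b \<longleftrightarrow> u \<in> vertices n \<and> v \<in> vertices n \<and> (face 1 u, face 1 v) \<in> ?D"
  proof
    assume "(u, v) \<in> d_prod n a b"
    then obtain z where "z \<in> ?D" "(u, v) = map_prod ?f ?f z"
      unfolding d_prod_def Let_def by (rule imageE)
    then have *: "(fst z, snd z) \<in> ?D" "u = ?f (fst z)" "v = ?f (snd z)"
      by (simp_all add: map_prod_def case_prod_unfold)
    then have "fst z \<in> row n 0 \<union> row n 2" "snd z \<in> row n 0 \<union> row n 2" by blast+
    from f[OF this(1)] f[OF this(2)]
    show "u \<in> vertices n \<and> v \<in> vertices n \<and> (face 1 u, face 1 v) \<in> ?D"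
      using *(1) unfolding *(2,3) by simp
  next
    assume *: "u \<in> vertices n \<and> v \<in> vertices n \<and> (face 1 u, face 1 v) \<in> ?D"
    then have "map_prod ?f ?f (face 1 u, face 1 v) \<in> d_prod n a b"
      unfolding d_prod_def Let_def by (intro imageI) blast
    then show "(u, v) \<in> d_prod n a b" using * g by (simp only: map_prod_simp)
  qed
  also have "\<dots> \<longleftrightarrow> u \<in> vertices n \<and> v \<in> vertices n \<and> (face 1 u, face 1 v) \<in> glue a b"
    using face1_row[of u n] face1_row[of v n] unfolding d_u_eq[OF assms] by blast
  finally show ?thesis .
qed

lemma d_prod_partition:
  assumes "a \<in> partitions n" "b \<in> partitions n"
  shows "d_prod n a b \<in> partitions n"
  using mem_d_prod[OF assms] glue_refl glue_sym[OF assms] glue_trans[of a b]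
  by (intro partitionsI) (auto dest: symD transD)

lemma relabel_d_prod:
  assumes "a \<in> partitions n" "b \<in> partitions n"
  shows "relabel (skip 1) (d_prod n a b) =
    glue a b \<inter> (row n 0 \<union> row n 2) \<times> (row n 0 \<union> row n 2)"
proof (rule rel_eqI)
  fix u v
  have *: "\<exists>w. u = face 1 w \<and> w \<in> vertices n" if "u \<in> row n 0 \<union> row n 2" for u
    using that by (intro exI[of _ "(fst u, if snd u = 0 then 0 else 1)"]; cases u) (auto simp: skip_def)
  show "(u, v) \<in> relabel (skip 1) (d_prod n a b) \<longleftrightarrow>
      (u, v) \<in> glue a b \<inter> (row n 0 \<union> row n 2) \<times> (row n 0 \<union> row n 2)"
    unfolding mem_relabel' mem_d_prod[OF assms]
    using *[of u] *[of v] face1_row by (metis (no_types, lifting) Int_iff mem_Sigma_iff)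
qed

section \<open>Associativity\<close>

definition glue3 :: "vertex rel \<Rightarrow> vertex rel \<Rightarrow> vertex rel \<Rightarrow> vertex rel"
  where "glue3 a b c = (a \<union> shift b \<union> shift (shift c))\<^sup>*"

lemma Field_partition:
  assumes "a \<in> partitions n"
  shows "Field a = vertices n"
proof (intro equalityI subsetI)
  fix v assume "v \<in> Field a"
  then obtain w where "(v, w) \<in> a \<or> (w, v) \<in> a" unfolding Field_def by blast
  then show "v \<in> vertices n" using partitionsD(7,8)[OF assms] by blast
next
  fix v assume "v \<in> vertices n"
  then show "v \<in> Field a" using partitionsD(2)[OF assms] by (blast intro: FieldI1)
qed

lemma Field_relabel: "Field (relabel h a) = apsnd h ` Field a"
proof (intro equalityI subsetI)
  fix v assume "v \<in> Field (relabel h a)"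
  then obtain w where "(v, w) \<in> relabel h a \<or> (w, v) \<in> relabel h a" by (auto simp: Field_def)
  then show "v \<in> apsnd h ` Field a" unfolding mem_relabel' Field_def by blast
next
  fix v assume "v \<in> apsnd h ` Field a"
  then obtain x y where "v = apsnd h x" "(x, y) \<in> a \<or> (y, x) \<in> a" by (auto simp: Field_def)
  then show "v \<in> Field (relabel h a)" unfolding Field_def Domain_iff Range_iff Un_iff mem_relabel' by blast
qed

lemma apsnd_row: "apsnd h ` row n k = row n (h k)"
  by (auto simp: row_def image_iff)

lemma Field_shift: "c \<in> partitions n \<Longrightarrow> Field (shift c) = row n 1 \<union> row n 2"
  unfolding shift_eq Field_relabel by (simp add: Field_partition skip_def image_Un apsnd_row numeral_2_eq_2)

lemma Field_shift2: "c \<in> partitions n \<Longrightarrow> Field (shift (shift c)) = row n 2 \<union> row n 3"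
  unfolding shift_eq[of "shift c"] Field_relabel
  by (simp add: Field_shift skip_def image_Un apsnd_row numeral_2_eq_2 numeral_3_eq_3)

lemma rtrancl_Un_absorb: "(r\<^sup>* \<inter> S \<union> s)\<^sup>* = (r \<union> s)\<^sup>*" if "r \<subseteq> S"
proof (rule antisym)
  have "r\<^sup>* \<inter> S \<union> s \<subseteq> (r \<union> s)\<^sup>*" using rtrancl_mono[of r "r \<union> s"] by blast
  then show "(r\<^sup>* \<inter> S \<union> s)\<^sup>* \<subseteq> (r \<union> s)\<^sup>*" by (rule rtrancl_subset_rtrancl)
  show "(r \<union> s)\<^sup>* \<subseteq> (r\<^sup>* \<inter> S \<union> s)\<^sup>*" using that by (intro rtrancl_mono) blast
qed

text \<open>Multiplying a and b first means leaving out row 1 of the four rows, the row that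
  \<open>face 1\<close> skips. That row is invisible to c, which occupies rows 2 and 3, so paths
  through it are contracted by \<open>restrict_rtrancl\<close>.\<close>

lemma glue_d_prod_left:
  assumes a: "a \<in> partitions n" and b: "b \<in> partitions n" and c: "c \<in> partitions n"
    and x: "x \<in> rows3 n" and y: "y \<in> rows3 n"
  shows "(x, y) \<in> glue (d_prod n a b) c \<longleftrightarrow> (face 1 x, face 1 y) \<in> glue3 a b c"
proof -
  let ?U = "row n 0 \<union> row n 2"
  let ?r = "glue a b \<inter> rows3 n \<times> rows3 n" and ?s = "shift (shift c)"
  \<comment> \<open>A cosimplicial identity: c shifted once below the product becomes c shifted
    twice in the four rows.\<close>
  have "skip 1 \<circ> skip 0 = skip 0 \<circ> skip 0" by (auto simp: skip_def)
  then have "relabel (skip 1) (d_prod n a b \<union> shift c) = ?r \<inter> ?U \<times> ?U \<union> ?s"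
    unfolding relabel_Un relabel_d_prod[OF a b] shift_eq relabel_comp by auto
  then have 1: "(x, y) \<in> glue (d_prod n a b) c \<longleftrightarrow> (face 1 x, face 1 y) \<in> (?r \<inter> ?U \<times> ?U \<union> ?s)\<^sup>*"
    unfolding glue_def[of "d_prod n a b"] by (metis inj_skip relabel_rtrancl)
  have W: "(?r \<union> ?s)\<^sup>* = glue3 a b c"
    unfolding glue3_def glue_def
    using partitionsD(1)[OF a] shift_subset[OF b] by (intro rtrancl_Un_absorb) auto
  have F: "Field ?r \<subseteq> rows3 n" by (auto simp: Field_def)
  have sk: "face 1 z \<in> ?U \<union> Field ?s" if "z \<in> rows3 n" for z
    using that by (cases z) (auto simp: Field_shift2[OF c] skip_def)
  have "(face 1 x, face 1 y) \<in> (?r \<inter> ?U \<times> ?U \<union> ?s)\<^sup>*" if "(face 1 x, face 1 y) \<in> (?r \<union> ?s)\<^sup>*"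
  proof (rule restrict_rtrancl[OF _ _ that sk[OF x] sk[OF y]])
    show "trans ?r" by (intro trans_restrict glue_trans)
    show "z \<in> ?U" if "z \<in> Field ?r" "z \<in> Field ?s" for z
      using that F by (cases z) (auto simp: Field_shift2[OF c])
  qed
  moreover have "(?r \<inter> ?U \<times> ?U \<union> ?s)\<^sup>* \<subseteq> (?r \<union> ?s)\<^sup>*" by (rule rtrancl_mono) blast
  ultimately show ?thesis unfolding 1 W by blast
qed

text \<open>Here row 2 is left out. The diagram of b and c occupies rows 1 to 3, and a meets it only
  in row 1.\<close>

lemma glue_d_prod_right:
  assumes a: "a \<in> partitions n" and b: "b \<in> partitions n" and c: "c \<in> partitions n"
    and x: "x \<in> rows3 n" and y: "y \<in> rows3 n"
  shows "(x, y) \<in> glue a (d_prod n b c) \<longleftrightarrow> (face 2 x, face 2 y) \<in> glue3 a b c"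
proof -
  let ?U = "row n 1 \<union> row n 3"
  let ?r = "relabel (skip 0) (glue b c \<inter> rows3 n \<times> rows3 n)"
  have rel_a: "relabel (skip 2) a = a"
  proof (rule rel_eqI)
    fix x y
    have "face 2 u = u" if "u \<in> vertices n" for u using that by (cases u) (auto simp: skip_def)
    moreover have "w = u" if "u \<in> vertices n" "u = face 2 w" for u w
      using that by (cases u; cases w) (auto simp: skip_def split: if_splits)
    ultimately show "(x, y) \<in> relabel (skip 2) a \<longleftrightarrow> (x, y) \<in> a"
      unfolding mem_relabel' using partitionsD(7,8)[OF a] by metis
  qed
  have "skip 2 \<circ> skip 0 = skip 0 \<circ> skip 1" by (auto simp: skip_def)
  then have "relabel (skip 2) (shift (d_prod n b c)) = relabel (skip 0) (relabel (skip 1) (d_prod n b c))"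
    unfolding shift_eq relabel_comp by simp
  also have "\<dots> = ?r \<inter> ?U \<times> ?U"
    unfolding relabel_d_prod[OF b c]
  proof (rule rel_eqI)
    fix x y
    have *: "face 0 w \<in> ?U \<longleftrightarrow> w \<in> row n 0 \<union> row n 2" for w by (cases w) (auto simp: skip_def)
    show "(x, y) \<in> relabel (skip 0) (glue b c \<inter> (row n 0 \<union> row n 2) \<times> (row n 0 \<union> row n 2)) \<longleftrightarrow>
        (x, y) \<in> ?r \<inter> ?U \<times> ?U"
      unfolding mem_relabel' Int_iff mem_Sigma_iff using * by (metis Un_iff)
  qed
  finally have "relabel (skip 2) (a \<union> shift (d_prod n b c)) = ?r \<inter> ?U \<times> ?U \<union> a"
    unfolding relabel_Un rel_a by blast
  then have 1: "(x, y) \<in> glue a (d_prod n b c) \<longleftrightarrow> (face 2 x, face 2 y) \<in> (?r \<inter> ?U \<times> ?U \<union> a)\<^sup>*"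
    unfolding glue_def[of a] by (metis inj_skip relabel_rtrancl)
  have bc: "b \<union> shift c \<subseteq> glue b c \<inter> rows3 n \<times> rows3 n"
    using partitionsD(1)[OF b] shift_subset[OF c] unfolding glue_def by auto
  have W: "(?r \<union> a)\<^sup>* = glue3 a b c"
  proof (rule antisym)
    have "relabel (skip 0) (b \<union> shift c) \<subseteq> ?r" using bc unfolding relabel_def by blast
    then show "glue3 a b c \<subseteq> (?r \<union> a)\<^sup>*"
      unfolding glue3_def relabel_Un shift_eq[symmetric] by (intro rtrancl_mono) blast
    have "?r \<subseteq> glue3 a b c"
    proof (rule subrelI)
      fix x y assume "(x, y) \<in> ?r"
      then obtain u v where "x = face 0 u" "y = face 0 v" "(u, v) \<in> (b \<union> shift c)\<^sup>*"
        unfolding mem_relabel' glue_def by blast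
      then have "(x, y) \<in> (relabel (skip 0) (b \<union> shift c))\<^sup>*"
        using relabel_rtrancl[OF inj_skip] by metis
      then show "(x, y) \<in> glue3 a b c"
        unfolding glue3_def relabel_Un shift_eq[symmetric] by (rule rtrancl_mono[THEN subsetD, rotated]) blast
    qed
    then show "(?r \<union> a)\<^sup>* \<subseteq> glue3 a b c"
      unfolding glue3_def by (intro rtrancl_subset_rtrancl) blast
  qed
  have F: "Field ?r \<subseteq> row n 1 \<union> row n 2 \<union> row n 3"
    unfolding Field_relabel by (auto simp: Field_def skip_def)
  have sk: "face 2 z \<in> ?U \<union> Field a" if "z \<in> rows3 n" for z
    using that by (cases z) (auto simp: Field_partition[OF a] skip_def)
  have "(face 2 x, face 2 y) \<in> (?r \<inter> ?U \<times> ?U \<union> a)\<^sup>*" if "(face 2 x, face 2 y) \<in> (?r \<union> a)\<^sup>*"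
  proof (rule restrict_rtrancl[OF _ _ that sk[OF x] sk[OF y]])
    have tr: "trans (glue b c \<inter> rows3 n \<times> rows3 n)" by (intro trans_restrict glue_trans)
    show "trans ?r"
    proof (rule transI)
      fix x y z assume "(x, y) \<in> ?r" "(y, z) \<in> ?r"
      then obtain u v v' w where "x = face 0 u" "y = face 0 v" "y = face 0 v'" "z = face 0 w"
        "(u, v) \<in> glue b c \<inter> rows3 n \<times> rows3 n" "(v', w) \<in> glue b c \<inter> rows3 n \<times> rows3 n"
        unfolding mem_relabel' by blast
      then show "(x, z) \<in> ?r"
        using transD[OF tr] mem_relabel[OF inj_skip] apsnd_inject[OF inj_skip] by metis
    qed
    show "z \<in> ?U" if "z \<in> Field ?r" "z \<in> Field a" for z
      using that F by (cases z) (auto simp: Field_partition[OF a])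
  qed
  moreover have "(?r \<inter> ?U \<times> ?U \<union> a)\<^sup>* \<subseteq> (?r \<union> a)\<^sup>*" by (rule rtrancl_mono) blast
  ultimately show ?thesis unfolding 1 W by blast
qed

text \<open>On the two rows of a partition, skipping 1 twice and skipping first 1 and then 2 agree:
  both lead to the outer rows 0 and 3, where either product is the restriction of
  \<open>glue3\<close>.\<close>

lemma d_prod_assoc:
  assumes a: "a \<in> partitions n" and b: "b \<in> partitions n" and c: "c \<in> partitions n"
  shows "d_prod n (d_prod n a b) c = d_prod n a (d_prod n b c)"
proof (rule rel_eqI)
  fix x y
  have f: "face 1 u \<in> rows3 n" if "u \<in> vertices n" for u
    using that by (cases u) (auto simp: skip_def)
  have "face 1 (face 1 u) = face 2 (face 1 u)" if "u \<in> vertices n" for u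
    using that by (cases u) (auto simp: skip_def)
  then show "(x, y) \<in> d_prod n (d_prod n a b) c \<longleftrightarrow> (x, y) \<in> d_prod n a (d_prod n b c)"
    unfolding mem_d_prod[OF d_prod_partition[OF a b] c] mem_d_prod[OF a d_prod_partition[OF b c]]
    using f glue_d_prod_left[OF a b c] glue_d_prod_right[OF a b c] by metis
qed

section \<open>The number of closed parts\<close>

text \<open>S and A are kept separate because the cocycle identity also counts classes that meet one
  row and lie within two.\<close>

definition closed_classes :: "'v rel \<Rightarrow> 'v set \<Rightarrow> 'v set \<Rightarrow> 'v set set"
  where "closed_classes w S A = (\<lambda>x. w `` {x}) ` {x \<in> S. w `` {x} \<subseteq> A}"

lemma closed_parts_eq:
  assumes a: "a \<in> partitions n" and b: "b \<in> partitions n"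
  shows "closed_parts n a b = card (closed_classes (glue a b) (row n 1) (row n 1))"
proof -
  have "d_u n a b `` {x} = glue a b `` {x}" if "x \<in> rows3 n" for x
    using that glue_closed[OF a b] unfolding d_u_eq[OF a b] by blast
  then have "rows3 n // d_u n a b = (\<lambda>x. glue a b `` {x}) ` rows3 n"
    unfolding quotient_def by auto
  moreover have "{X \<in> (\<lambda>x. glue a b `` {x}) ` rows3 n. X \<subseteq> row n 1} =
      (\<lambda>x. glue a b `` {x}) ` {x \<in> rows3 n. glue a b `` {x} \<subseteq> row n 1}" by blast
  moreover have "{x \<in> rows3 n. glue a b `` {x} \<subseteq> row n 1} = {x \<in> row n 1. glue a b `` {x} \<subseteq> row n 1}"
    using glue_refl[of _ a b] by blast
  ultimately have "{X \<in> rows3 n // d_u n a b. X \<subseteq> row n 1} =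
      closed_classes (glue a b) (row n 1) (row n 1)"
    unfolding closed_classes_def by simp
  then show ?thesis unfolding closed_parts_def by simp
qed

lemma class_eq_iff:
  assumes "refl w" "sym w" "trans w"
  shows "w `` {x} = w `` {y} \<longleftrightarrow> (x, y) \<in> w"
proof -
  have "equiv UNIV w" using assms by (intro equivI) auto
  then show ?thesis by (simp add: eq_equiv_class_iff)
qed

text \<open>On P the relation g is pulled back from w along f, so f induces a bijection between the
  classes that meet P and those that meet its image.\<close>

lemma card_classes_cong:
  assumes w: "refl w" "sym w" "trans w" and g: "refl g" "sym g" "trans g"
    and iff: "\<And>x y. x \<in> P \<Longrightarrow> y \<in> P \<Longrightarrow> (x, y) \<in> g \<longleftrightarrow> (f x, f y) \<in> w"
  shows "card ((\<lambda>x. g `` {x}) ` P) = card ((\<lambda>x. w `` {x}) ` f ` P)"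
proof -
  let ?F = "\<lambda>X. w `` {f (SOME x. x \<in> P \<and> X = g `` {x})}"
  have F: "?F (g `` {x}) = w `` {f x}" if "x \<in> P" for x
  proof -
    let ?y = "SOME y. y \<in> P \<and> g `` {x} = g `` {y}"
    have "?y \<in> P \<and> g `` {x} = g `` {?y}" by (rule someI[of _ x]) (use that in simp)
    then have "(x, ?y) \<in> g" "?y \<in> P" using class_eq_iff[OF g] by auto
    then have "(f x, f ?y) \<in> w" using iff that by blast
    then show ?thesis using class_eq_iff[OF w] by metis
  qed
  have "bij_betw ?F ((\<lambda>x. g `` {x}) ` P) ((\<lambda>x. w `` {x}) ` f ` P)"
    unfolding bij_betw_def
  proof
    show "inj_on ?F ((\<lambda>x. g `` {x}) ` P)"
    proof (rule inj_onI)
      fix X Y assume "X \<in> (\<lambda>x. g `` {x}) ` P" "Y \<in> (\<lambda>x. g `` {x}) ` P" and eq: "?F X = ?F Y"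
      then obtain x y where xy: "x \<in> P" "X = g `` {x}" "y \<in> P" "Y = g `` {y}" by blast
      then have "w `` {f x} = w `` {f y}"
        using eq unfolding xy(2,4) F[OF xy(1)] F[OF xy(3)] by blast
      then show "X = Y" using xy iff class_eq_iff[OF w] class_eq_iff[OF g] by metis
    qed
    show "?F ` (\<lambda>x. g `` {x}) ` P = (\<lambda>x. w `` {x}) ` f ` P"
      unfolding image_image by (rule image_cong[OF HOL.refl F])
  qed
  then show ?thesis by (rule bij_betw_same_card)
qed

text \<open>A class inside the union either avoids B, and then lies in A, or has a representative in
  B.\<close>

lemma card_closed_classes_Un:
  assumes w: "refl w" "sym w" "trans w" and "finite A" "finite B" "A \<inter> B = {}"
  shows "card (closed_classes w (A \<union> B) (A \<union> B)) =
    card (closed_classes w A A) + card (closed_classes w B (A \<union> B))"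
proof -
  have mem: "x \<in> w `` {x}" for x using w(1) by (simp add: refl_on_def)
  have "closed_classes w (A \<union> B) (A \<union> B) = closed_classes w A A \<union> closed_classes w B (A \<union> B)"
  proof (intro equalityI subsetI)
    fix X assume "X \<in> closed_classes w (A \<union> B) (A \<union> B)"
    then obtain x where x: "X = w `` {x}" "x \<in> A \<union> B" "w `` {x} \<subseteq> A \<union> B"
      unfolding closed_classes_def by auto
    show "X \<in> closed_classes w A A \<union> closed_classes w B (A \<union> B)"
    proof (cases "X \<inter> B = {}")
      case True
      then show ?thesis using x mem[of x] unfolding closed_classes_def by blast
    next
      case False
      then obtain y where y: "y \<in> X" "y \<in> B" by blast
      then have "X = w `` {y}" using x class_eq_iff[OF w] by blast
      then show ?thesis using x y unfolding closed_classes_def by blast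
    qed
  qed (auto simp: closed_classes_def)
  moreover have "closed_classes w A A \<inter> closed_classes w B (A \<union> B) = {}"
  proof -
    have "X \<subseteq> A" if "X \<in> closed_classes w A A" for X using that unfolding closed_classes_def by blast
    moreover have "X \<inter> B \<noteq> {}" if "X \<in> closed_classes w B (A \<union> B)" for X
      using that mem unfolding closed_classes_def by blast
    ultimately show ?thesis using assms(6) by blast
  qed
  moreover have "finite (closed_classes w A A)" "finite (closed_classes w B (A \<union> B))"
    using assms(4,5) by (auto simp: closed_classes_def)
  ultimately show ?thesis by (simp add: card_Un_disjoint)
qed

lemma glue_equiv:
  assumes "a \<in> partitions n" "b \<in> partitions n"
  shows "refl (glue a b)" "sym (glue a b)" "trans (glue a b)"
  using glue_refl glue_sym[OF assms] glue_trans by (auto simp: refl_on_def)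

lemma glue3_equiv:
  assumes "a \<in> partitions n" "b \<in> partitions n" "c \<in> partitions n"
  shows "refl (glue3 a b c)" "sym (glue3 a b c)" "trans (glue3 a b c)"
  unfolding glue3_def shift_eq
  using partitionsD(5)[OF assms(1)] partitionsD(5)[OF assms(2)] partitionsD(5)[OF assms(3)]
  by (auto intro!: sym_rtrancl sym_Un sym_relabel trans_rtrancl refl_rtrancl)

lemma glue3_closed:
  assumes "a \<in> partitions n" "b \<in> partitions n" "c \<in> partitions n"
    and "(x, y) \<in> glue3 a b c" "x \<in> rows3 n \<union> row n 3"
  shows "y \<in> rows3 n \<union> row n 3"
  using assms(4,5) unfolding glue3_def
proof (induction rule: rtrancl_induct)
  case (step y z)
  then have "z \<in> Field a \<union> Field (shift b) \<union> Field (shift (shift c))"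
    by (auto simp: Field_def)
  then show ?case
    unfolding Field_partition[OF assms(1)] Field_shift[OF assms(2)] Field_shift2[OF assms(3)] by auto
qed

text \<open>Both sides count the parts of the four-row diagram that lie inside rows 1 and 2. The
  left side adds those inside row 1 and those that meet row 2; the right side adds those inside row
  2 and those that meet row 1.\<close>

lemma closed_parts_cocycle:
  assumes a: "a \<in> partitions n" and b: "b \<in> partitions n" and c: "c \<in> partitions n"
  shows "closed_parts n a b + closed_parts n (d_prod n a b) c =
    closed_parts n b c + closed_parts n a (d_prod n b c)"
proof -
  let ?w = "glue3 a b c"
  note w = glue3_equiv[OF a b c]
  have ab: "d_prod n a b \<in> partitions n" and bc: "d_prod n b c \<in> partitions n"
    using d_prod_partition assms by auto
  note closed = glue3_closed[OF a b c]
  have row3: "row n 1 \<subseteq> rows3 n" "row n 2 \<subseteq> rows3 n" by auto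
  \<comment> \<open>A part of the diagram of a and b that stays in row 1 is never reached by c, so
    it does not grow in the four rows.\<close>
  have 1: "closed_parts n a b = card (closed_classes ?w (row n 1) (row n 1))"
  proof -
    have sub: "glue a b `` {x} \<subseteq> ?w `` {x}" for x
      unfolding glue_def glue3_def using rtrancl_mono[of "a \<union> shift b" "a \<union> shift b \<union> shift (shift c)"] by blast
    have "?w `` {x} \<subseteq> glue a b `` {x}" if "glue a b `` {x} \<subseteq> row n 1" for x
    proof -
      have "(x, y) \<in> glue a b" if "(x, y) \<in> ?w" for y
        using that unfolding glue3_def
      proof (induction rule: rtrancl_induct)
        case (step y z)
        then have "y \<in> row n 1" using \<open>glue a b `` {x} \<subseteq> row n 1\<close> by blast
        then have "y \<notin> Field (shift (shift c))" unfolding Field_shift2[OF c] by (cases y) auto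
        then have "(y, z) \<in> a \<union> shift b" using step(2) by (auto simp: Field_def)
        then show ?case using step(3) unfolding glue_def by (rule rtrancl_into_rtrancl[rotated])
      qed (simp add: glue_refl)
      then show ?thesis by blast
    qed
    then have "glue a b `` {x} \<subseteq> row n 1 \<longleftrightarrow> ?w `` {x} \<subseteq> row n 1"
      "glue a b `` {x} \<subseteq> row n 1 \<Longrightarrow> glue a b `` {x} = ?w `` {x}" for x
      using sub by blast+
    then have "closed_classes (glue a b) (row n 1) (row n 1) = closed_classes ?w (row n 1) (row n 1)"
      unfolding closed_classes_def by (intro image_cong) auto
    then show ?thesis using closed_parts_eq[OF a b] by simp
  qed
  \<comment> \<open>The middle row of the product with c is row 2 of the four rows; its closed parts
    may have absorbed vertices of the discarded row 1.\<close>
  have 2: "closed_parts n (d_prod n a b) c = card (closed_classes ?w (row n 2) (row n 1 \<union> row n 2))"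
  proof -
    let ?g = "glue (d_prod n a b) c"
    note iff = glue_d_prod_left[OF a b c]
    have "?g `` {x} \<subseteq> row n 1 \<longleftrightarrow> ?w `` {face 1 x} \<subseteq> row n 1 \<union> row n 2" if x: "x \<in> row n 1" for x
    proof
      have x3: "x \<in> rows3 n" "face 1 x \<in> rows3 n \<union> row n 3" "face 1 x = face 1 x"
        using x by (cases x; auto simp: skip_def)+
      show "?w `` {face 1 x} \<subseteq> row n 1 \<union> row n 2" if g: "?g `` {x} \<subseteq> row n 1"
      proof (rule subsetI, rule ccontr)
          fix y assume "y \<in> ?w `` {face 1 x}" and no: "y \<notin> row n 1 \<union> row n 2"
          then have y: "(face 1 x, y) \<in> ?w" by simp
          then have "y \<in> rows3 n \<union> row n 3" using closed x3 by blast
          with no obtain z where z: "y = face 1 z" "z \<in> rows3 n" "z \<notin> row n 1"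
            by (intro that[of "(fst y, if snd y = 0 then 0 else 2)"]; cases y) (auto simp: skip_def)
          then show False using g iff[OF x3(1) z(2)] y(1) x3(3) by auto
      qed
      show "?g `` {x} \<subseteq> row n 1" if h: "?w `` {face 1 x} \<subseteq> row n 1 \<union> row n 2"
      proof
        fix y assume "y \<in> ?g `` {x}"
        then have y: "(x, y) \<in> ?g" by simp
        then have y3: "y \<in> rows3 n" using glue_closed[OF ab c] x3 by blast
        then have "face 1 y \<in> row n 1 \<union> row n 2" using iff[OF x3(1) y3] y h by blast
        then show "y \<in> row n 1" using y3 by (cases y) (auto simp: skip_def split: if_splits)
      qed
    qed
    then have "face 1 ` {x \<in> row n 1. ?g `` {x} \<subseteq> row n 1} = {x \<in> row n (skip 1 1). ?w `` {x} \<subseteq> row n 1 \<union> row n 2}"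
      by (intro image_filter_row)
    then have "face 1 ` {x \<in> row n 1. ?g `` {x} \<subseteq> row n 1} = {x \<in> row n 2. ?w `` {x} \<subseteq> row n 1 \<union> row n 2}"
      by (simp add: skip_def numeral_2_eq_2)
    moreover have "card ((\<lambda>x. ?g `` {x}) ` {x \<in> row n 1. ?g `` {x} \<subseteq> row n 1}) =
      card ((\<lambda>x. ?w `` {x}) ` face 1 ` {x \<in> row n 1. ?g `` {x} \<subseteq> row n 1})"
      using iff by (intro card_classes_cong w glue_equiv[OF ab c]) auto
    ultimately show ?thesis unfolding closed_parts_eq[OF ab c] closed_classes_def by simp
  qed
  \<comment> \<open>The middle row of b and c is also row 2, and a part that stays in it is never
    reached by a.\<close>
  have 3: "closed_parts n b c = card (closed_classes ?w (row n 2) (row n 2))"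
  proof -
    let ?g = "glue b c"
    have W: "relabel (skip 0) (b \<union> shift c) \<subseteq> a \<union> shift b \<union> shift (shift c)"
      unfolding relabel_Un shift_eq by blast
    have sub: "(face 0 x, face 0 y) \<in> ?w" if "(x, y) \<in> ?g" for x y
      using that relabel_rtrancl[OF inj_skip, of 0 x y "b \<union> shift c"] rtrancl_mono[OF W]
      unfolding glue_def glue3_def by blast
    \<comment> \<open>As long as the path stays in row 2 it avoids a, so it lifts step by step to a
      path in the diagram of b and c.\<close>
    have img: "\<exists>z. y = face 0 z \<and> (x, z) \<in> ?g" 
      if "(face 0 x, y) \<in> ?w" "?g `` {x} \<subseteq> row n 1 \<or> ?w `` {face 0 x} \<subseteq> row n 2" for x y
      using that(1) unfolding glue3_def
    proof (induction rule: rtrancl_induct)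
      case base
      then show ?case using glue_refl by blast
    next
      case (step y z)
      then obtain u where u: "y = face 0 u" "(x, u) \<in> ?g" by blast
      have "y \<in> row n 2"
        using that(2)
      proof
        assume "?g `` {x} \<subseteq> row n 1"
        then have "u \<in> row n 1" using u by blast
        then show ?thesis using u(1) by (cases u) (auto simp: skip_def)
      next
        assume "?w `` {face 0 x} \<subseteq> row n 2"
        then show ?thesis using step(1) unfolding glue3_def by blast
      qed
      then have "y \<notin> Field a" unfolding Field_partition[OF a] by (cases y) auto
      then have "(face 0 u, z) \<in> relabel (skip 0) (b \<union> shift c)"
        using step(2) u(1) unfolding relabel_Un shift_eq by (auto simp: Field_def)
      then obtain v where "z = face 0 v" "(u, v) \<in> b \<union> shift c"
        unfolding mem_relabel' using apsnd_inject[OF inj_skip] by metis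
      then show ?case using u(2) unfolding glue_def by (metis rtrancl_into_rtrancl)
    qed
    have row: "face 0 z \<in> row n 2 \<longleftrightarrow> z \<in> row n 1" for z by (cases z) (auto simp: skip_def)
    have "?g `` {x} \<subseteq> row n 1 \<longleftrightarrow> ?w `` {face 0 x} \<subseteq> row n 2" for x
    proof
      show "?w `` {face 0 x} \<subseteq> row n 2" if x: "?g `` {x} \<subseteq> row n 1"
      proof
        fix y assume "y \<in> ?w `` {face 0 x}"
        then obtain z where "y = face 0 z" "(x, z) \<in> ?g" using img[of x y] x by blast
        then show "y \<in> row n 2" using x row by blast
      qed
      show "?g `` {x} \<subseteq> row n 1" if "?w `` {face 0 x} \<subseteq> row n 2"
      proof
        fix y assume "y \<in> ?g `` {x}"
        then show "y \<in> row n 1" using sub that row by blast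
      qed
    qed
    then have "face 0 ` {x \<in> row n 1. ?g `` {x} \<subseteq> row n 1} = {x \<in> row n (skip 0 1). ?w `` {x} \<subseteq> row n 2}"
      by (intro image_filter_row)
    then have "face 0 ` {x \<in> row n 1. ?g `` {x} \<subseteq> row n 1} = {x \<in> row n 2. ?w `` {x} \<subseteq> row n 2}"
      by (simp add: skip_def numeral_2_eq_2)
    moreover have "card ((\<lambda>x. ?g `` {x}) ` {x \<in> row n 1. ?g `` {x} \<subseteq> row n 1}) =
      card ((\<lambda>x. ?w `` {x}) ` face 0 ` {x \<in> row n 1. ?g `` {x} \<subseteq> row n 1})"
    proof (intro card_classes_cong w glue_equiv[OF b c])
      fix x y assume "x \<in> {x \<in> row n 1. ?g `` {x} \<subseteq> row n 1}"
      then show "(x, y) \<in> ?g \<longleftrightarrow> (face 0 x, face 0 y) \<in> ?w"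
        using sub img[of x "face 0 y"] apsnd_inject[OF inj_skip, of 0]
        by (metis (mono_tags, lifting) mem_Collect_eq)
    qed
    ultimately show ?thesis unfolding closed_parts_eq[OF b c] closed_classes_def by simp
  qed
  \<comment> \<open>The middle row is now row 1, and the parts may have absorbed vertices of the
    discarded row 2.\<close>
  have 4: "closed_parts n a (d_prod n b c) = card (closed_classes ?w (row n 1) (row n 2 \<union> row n 1))"
  proof -
    let ?g = "glue a (d_prod n b c)"
    note iff = glue_d_prod_right[OF a b c]
    have f1: "face 2 x = x" if "x \<in> row n 1" for x using that by (cases x) (auto simp: skip_def)
    have "?g `` {x} \<subseteq> row n 1 \<longleftrightarrow> ?w `` {x} \<subseteq> row n 2 \<union> row n 1" if x: "x \<in> row n 1" for x
    proof
      have x3: "x \<in> rows3 n" "x \<in> rows3 n \<union> row n 3" "face 2 x = x" using x f1 by auto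
      show "?w `` {x} \<subseteq> row n 2 \<union> row n 1" if g: "?g `` {x} \<subseteq> row n 1"
      proof (rule subsetI, rule ccontr)
          fix y assume "y \<in> ?w `` {x}" and no: "y \<notin> row n 2 \<union> row n 1"
          then have y: "(x, y) \<in> ?w" by simp
          then have "y \<in> rows3 n \<union> row n 3" using closed x3 by blast
          with no obtain z where z: "y = face 2 z" "z \<in> rows3 n" "z \<notin> row n 1"
            by (intro that[of "(fst y, if snd y = 0 then 0 else 2)"]; cases y) (auto simp: skip_def)
          then show False using g iff[OF x3(1) z(2)] y(1) x3(3) by auto
      qed
      show "?g `` {x} \<subseteq> row n 1" if h: "?w `` {x} \<subseteq> row n 2 \<union> row n 1"
      proof
        fix y assume "y \<in> ?g `` {x}"
        then have y: "(x, y) \<in> ?g" by simp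
        then have y3: "y \<in> rows3 n" using glue_closed[OF a bc] x3 by blast
        then have "face 2 y \<in> row n 2 \<union> row n 1" using iff[OF x3(1) y3] y h x3(3) by auto
        then show "y \<in> row n 1" using y3 by (cases y) (auto simp: skip_def split: if_splits)
      qed
    qed
    then have "{x \<in> row n 1. ?g `` {x} \<subseteq> row n 1} = {x \<in> row n 1. ?w `` {x} \<subseteq> row n 2 \<union> row n 1}"
      by blast
    moreover have "face 2 ` {x \<in> row n 1. ?g `` {x} \<subseteq> row n 1} = {x \<in> row n 1. ?g `` {x} \<subseteq> row n 1}"
      using f1 by (force simp: image_iff)
    moreover have "card ((\<lambda>x. ?g `` {x}) ` {x \<in> row n 1. ?g `` {x} \<subseteq> row n 1}) =
      card ((\<lambda>x. ?w `` {x}) ` face 2 ` {x \<in> row n 1. ?g `` {x} \<subseteq> row n 1})"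
      using iff by (intro card_classes_cong w glue_equiv[OF a bc]) auto
    ultimately show ?thesis unfolding closed_parts_eq[OF a bc] closed_classes_def by simp
  qed
  have disj: "row n 1 \<inter> row n 2 = {}" "row n 2 \<inter> row n 1 = {}" by (auto simp: row_def)
  show ?thesis
    unfolding 1 2 3 4
    using card_closed_classes_Un[OF w finite_row finite_row disj(1)]
      card_closed_classes_Un[OF w finite_row finite_row disj(2)] by (simp add: Un_commute)
qed

section \<open>Reflection and permutations\<close>

text \<open>Reflection of the diagram, which reverses products by \<open>d_prod_flip\<close>. Facts
  about upper rows are derived through it from those about lower rows.\<close>

definition flip :: "vertex rel \<Rightarrow> vertex rel"
  where "flip a = relabel (\<lambda>k. if k \<le> 1 then 1 - k else k) a"

lemma relabel_cong:
  assumes "a \<in> partitions n" "\<And>k. k \<le> 1 \<Longrightarrow> h k = h' k"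
  shows "relabel h a = relabel h' a"
proof (rule rel_eqI)
  have "apsnd h u = apsnd h' u" if "u \<in> vertices n" for u
    using that assms(2) by (cases u) auto
  then show "(u, v) \<in> relabel h a \<longleftrightarrow> (u, v) \<in> relabel h' a" for u v
    unfolding mem_relabel' using partitionsD(7,8)[OF assms(1)] by metis
qed

lemma inj_reverse: "inj (\<lambda>k. if k \<le> m then m - k else k :: nat)"
  by (auto simp: inj_def)

definition swap_rows :: "vertex \<Rightarrow> vertex"
  where "swap_rows u = (fst u, 1 - snd u)"

lemma swap_rows_vertices: "u \<in> vertices n \<longleftrightarrow> swap_rows u \<in> vertices n \<and> snd u \<le> 1"
  by (cases u) (auto simp: swap_rows_def)

lemma mem_flip:
  assumes "a \<in> partitions n"
  shows "(u, v) \<in> flip a \<longleftrightarrow> (swap_rows u, swap_rows v) \<in> a \<and> snd u \<le> 1 \<and> snd v \<le> 1"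
proof -
  let ?h = "\<lambda>k. if k \<le> 1 then 1 - k else k :: nat"
  have h: "apsnd ?h (swap_rows u) = u" if "snd u \<le> 1" for u
    using that by (cases u) (auto simp: swap_rows_def)
  have h': "swap_rows (apsnd ?h x) = x \<and> snd (apsnd ?h x) \<le> 1" if "x \<in> vertices n" for x
    using that by (cases x) (auto simp: swap_rows_def)
  show ?thesis
  proof
    assume "(u, v) \<in> flip a"
    then obtain x y where xy: "u = apsnd ?h x" "v = apsnd ?h y" "(x, y) \<in> a"
      unfolding flip_def mem_relabel' by blast
    with h'[OF partitionsD(7)[OF assms xy(3)]] h'[OF partitionsD(8)[OF assms xy(3)]]
    show "(swap_rows u, swap_rows v) \<in> a \<and> snd u \<le> 1 \<and> snd v \<le> 1" by simp
  next
    assume *: "(swap_rows u, swap_rows v) \<in> a \<and> snd u \<le> 1 \<and> snd v \<le> 1"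
    then have "(apsnd ?h (swap_rows u), apsnd ?h (swap_rows v)) \<in> flip a"
      unfolding flip_def mem_relabel' by blast
    then show "(u, v) \<in> flip a" using * h by simp
  qed
qed

lemma flip_partition:
  assumes "a \<in> partitions n"
  shows "flip a \<in> partitions n"
proof (rule partitionsI)
  note m = mem_flip[OF assms] and p = partitionsD[OF assms]
  show "flip a \<subseteq> vertices n \<times> vertices n"
  proof (rule subrelI)
    fix u v assume "(u, v) \<in> flip a"
    then have *: "(swap_rows u, swap_rows v) \<in> a" "snd u \<le> 1" "snd v \<le> 1" unfolding m by blast+
    have "u \<in> vertices n" "v \<in> vertices n"
      using p(7)[OF *(1)] p(8)[OF *(1)] *(2,3) swap_rows_vertices by blast+
    then show "(u, v) \<in> vertices n \<times> vertices n" by blast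
  qed
  show "(v, v) \<in> flip a" if "v \<in> vertices n" for v
    using that swap_rows_vertices[of v n] p(2) unfolding m by blast
  show "(v, u) \<in> flip a" if "(u, v) \<in> flip a" for u v
    using that p(3) unfolding m by blast
  show "(u, w) \<in> flip a" if "(u, v) \<in> flip a" "(v, w) \<in> flip a" for u v w
    using that p(4) unfolding m by blast
qed

lemma glue_flip:
  assumes a: "a \<in> partitions n" and b: "b \<in> partitions n"
  shows "(apsnd (\<lambda>k. if k \<le> 2 then 2 - k else k) x, apsnd (\<lambda>k. if k \<le> 2 then 2 - k else k) y)
    \<in> glue (flip b) (flip a) \<longleftrightarrow> (x, y) \<in> glue a b"
proof -
  let ?h = "\<lambda>k. if k \<le> 2 then 2 - k else k :: nat"
  have "relabel ?h a = shift (flip a)"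
    unfolding flip_def shift_eq relabel_comp by (rule relabel_cong[OF a]) (auto simp: skip_def)
  moreover have "relabel ?h (shift b) = flip b"
    unfolding flip_def shift_eq relabel_comp by (rule relabel_cong[OF b]) (auto simp: skip_def)
  ultimately have *: "flip b \<union> shift (flip a) = relabel ?h (a \<union> shift b)"
    unfolding relabel_Un by (simp only: Un_commute)
  show ?thesis unfolding glue_def * by (rule relabel_rtrancl[OF inj_reverse])
qed

lemma d_prod_flip:
  assumes a: "a \<in> partitions n" and b: "b \<in> partitions n"
  shows "d_prod n (flip b) (flip a) = flip (d_prod n a b)"
proof (rule rel_eqI)
  fix u v :: vertex
  have f: "face 1 u = apsnd (\<lambda>k. if k \<le> 2 then 2 - k else k) (face 1 (swap_rows u))"
    if "u \<in> vertices n" for u using that by (cases u) (auto simp: skip_def swap_rows_def)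
  show "(u, v) \<in> d_prod n (flip b) (flip a) \<longleftrightarrow> (u, v) \<in> flip (d_prod n a b)"
  proof (cases "u \<in> vertices n \<and> v \<in> vertices n")
    case True
    then have u: "u \<in> vertices n" and v: "v \<in> vertices n" by blast+
    show ?thesis
      unfolding mem_d_prod[OF flip_partition[OF b] flip_partition[OF a]]
        mem_flip[OF d_prod_partition[OF a b]] mem_d_prod[OF a b] f[OF u] f[OF v] glue_flip[OF a b]
      using u v swap_rows_vertices[of u n] swap_rows_vertices[of v n] by blast
  next
    case False
    then show ?thesis
      unfolding mem_d_prod[OF flip_partition[OF b] flip_partition[OF a]]
        mem_flip[OF d_prod_partition[OF a b]] mem_d_prod[OF a b]
      using swap_rows_vertices[of u n] swap_rows_vertices[of v n] by blast
  qed
qed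

text \<open>The upper bound for \<open>glue\<close>: to exclude further pairs, map the vertices of
  all three rows into a known transitive relation t in such a way that the pairs of both factors
  land in t.\<close>

lemma glue_invariant:
  assumes "(x, y) \<in> glue a b" "\<And>u v. (u, v) \<in> a \<Longrightarrow> (f u, f v) \<in> t"
    "\<And>u v. (u, v) \<in> b \<Longrightarrow> (f (face 0 u), f (face 0 v)) \<in> t" "trans t" "(f x, f x) \<in> t"
  shows "(f x, f y) \<in> t"
  using assms(1) unfolding glue_def
proof (induction rule: rtrancl_induct)
  case base
  then show ?case using assms(5) by simp
next
  case (step y z)
  have "(f y, f z) \<in> t"
    using step(2) assms(2,3) unfolding shift_eq Un_iff mem_relabel' by blast
  then show ?case using step(3) assms(4) by (blast dest: transD)
qed

lemma glue_label:
  assumes "(x, y) \<in> glue a b" "\<And>u v. (u, v) \<in> a \<Longrightarrow> f u = f v"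
    "\<And>u v. (u, v) \<in> b \<Longrightarrow> f (face 0 u) = f (face 0 v)"
  shows "f x = f y"
proof -
  have "(f x, f y) \<in> Id"
    by (rule glue_invariant[OF assms(1)]) (simp_all only: pair_in_Id_conv trans_Id assms(2,3))
  then show ?thesis by simp
qed

section \<open>Permutations as partitions\<close>

definition perm_label :: "(nat \<Rightarrow> nat) \<Rightarrow> vertex \<Rightarrow> nat"
  where "perm_label w x = (if snd x = 1 then w (fst x) else fst x)"

text \<open>\<open>perm_label\<close> names the upper end of the strand through a vertex, so two
  vertices lie on one strand exactly when their labels agree.\<close>

lemma mem_perm_partition:
  assumes "w permutes {1..n}"
  shows "(x, y) \<in> perm_partition n w \<longleftrightarrow>
    x \<in> vertices n \<and> y \<in> vertices n \<and> perm_label w x = perm_label w y"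
proof -
  have w: "w i \<in> {1..n} \<longleftrightarrow> i \<in> {1..n}" for i using permutes_in_image[OF assms] by blast
  have inj: "w i = w j \<longleftrightarrow> i = j" for i j using permutes_inj[OF assms] by (auto dest: injD)
  have surj: "\<exists>m. i = w m" for i using permutes_surj[OF assms] by (metis surjD)
  have part: "x \<in> {(w m, 0), (m, 1)} \<longleftrightarrow> x \<in> vertices n \<and> perm_label w x = w m" if "m \<in> {1..n}" for x m
    using that w[of m] by (cases x) (auto simp: perm_label_def inj)
  have "(x, y) \<in> perm_partition n w \<longleftrightarrow>
    (\<exists>m\<in>{1..n}. x \<in> {(w m, 0), (m, 1)} \<and> y \<in> {(w m, 0), (m, 1)})"
    unfolding perm_partition_def rel_of_parts_def by blast
  also have "\<dots> \<longleftrightarrow> (\<exists>m\<in>{1..n}. (x \<in> vertices n \<and> perm_label w x = w m) \<and>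
      (y \<in> vertices n \<and> perm_label w y = w m))"
    using part by (intro bex_cong HOL.refl) (simp only:)
  also have "\<dots> \<longleftrightarrow> x \<in> vertices n \<and> y \<in> vertices n \<and> perm_label w x = perm_label w y"
  proof
    assume *: "x \<in> vertices n \<and> y \<in> vertices n \<and> perm_label w x = perm_label w y"
    obtain m where m: "perm_label w x = w m" by (rule exE[OF surj[of "perm_label w x"]])
    have "x \<in> vertices n" using * by blast
    then have "fst x \<in> {1..n}" by (cases x) auto
    then have "perm_label w x \<in> {1..n}" unfolding perm_label_def using w[of "fst x"] by presburger
    then have "m \<in> {1..n}" unfolding m w .
    then show "\<exists>m\<in>{1..n}. (x \<in> vertices n \<and> perm_label w x = w m) \<and>
      (y \<in> vertices n \<and> perm_label w y = w m)"
      using * m by (intro bexI[of _ m] conjI) (simp_all only:)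
  qed metis
  finally show ?thesis .
qed

lemma perm_partition_in:
  assumes "w permutes {1..n}"
  shows "perm_partition n w \<in> partitions n"
proof (rule partitionsI)
  note m = mem_perm_partition[OF assms]
  show "perm_partition n w \<subseteq> vertices n \<times> vertices n"
  proof (rule subrelI)
    fix x y assume "(x, y) \<in> perm_partition n w"
    then show "(x, y) \<in> vertices n \<times> vertices n" unfolding m by blast
  qed
qed (unfold mem_perm_partition[OF assms], metis+)

definition move_top :: "(nat \<Rightarrow> nat) \<Rightarrow> vertex \<Rightarrow> vertex"
  where "move_top w u = (if snd u = 0 then w (fst u) else fst u, snd u)"

definition move_bot :: "(nat \<Rightarrow> nat) \<Rightarrow> vertex \<Rightarrow> vertex"
  where "move_bot w u = (if snd u = 1 then w (fst u) else fst u, snd u)"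

lemma move_vertices:
  assumes "w permutes {1..n}"
  shows "move_top w u \<in> vertices n \<longleftrightarrow> u \<in> vertices n"
    "move_bot w u \<in> vertices n \<longleftrightarrow> u \<in> vertices n"
  using permutes_in_image[OF assms, of "fst u"]
  by (cases u; auto simp: move_top_def move_bot_def)+

text \<open>Each vertex of b is joined to its renamed copy by a strand of w, or coincides with it;
  this gives one direction. For the other the three-row diagram is retracted onto b.\<close>

lemma perm_left:
  assumes w: "w permutes {1..n}" and b: "b \<in> partitions n" and uv: "u \<in> vertices n" "v \<in> vertices n"
  shows "(move_top w u, move_top w v) \<in> d_prod n (perm_partition n w) b \<longleftrightarrow> (u, v) \<in> b"
proof -
  let ?p = "perm_partition n w"
  note p = perm_partition_in[OF w] and m = mem_perm_partition[OF w]
  have con: "(face 1 (move_top w u), face 0 u) \<in> glue ?p b" if "u \<in> vertices n" for u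
  proof (cases "snd u = 0")
    case True
    then have "(face 1 (move_top w u), face 0 u) \<in> ?p"
      using that permutes_in_image[OF w, of "fst u"]
      by (cases u) (auto simp: move_top_def skip_def m perm_label_def)
    then show ?thesis by (rule glue_left)
  next
    case False
    then have "face 1 (move_top w u) = face 0 u"
      using that by (cases u) (auto simp: move_top_def skip_def)
    then show ?thesis by (simp add: glue_refl)
  qed
  have "(face 0 u, face 0 v) \<in> glue ?p b \<longleftrightarrow> (u, v) \<in> b"
  proof
    \<comment> \<open>Row 0 is pulled back along its strand to row 1; then rows 1 and 2 are read as
      the two rows of b.\<close>
    let ?f = "\<lambda>x. if snd x = 0 then (inv_into UNIV w (fst x), 0) else (fst x, snd x - 1) :: vertex"
    have f0: "?f (face 0 x) = x" for x :: vertex by (cases x) (simp add: skip_def)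
    assume "(face 0 u, face 0 v) \<in> glue ?p b"
    then have "(?f (face 0 u), ?f (face 0 v)) \<in> b"
    proof (rule glue_invariant)
      fix x y assume xy: "(x, y) \<in> ?p"
      have "?f x = (inv_into UNIV w (perm_label w x), 0) \<and> ?f x \<in> vertices n" if "x \<in> vertices n" for x
        using that permutes_inverses[OF w] permutes_in_image[OF permutes_inv[OF w]]
        by (cases x) (auto simp: perm_label_def)
      then have "?f x = ?f y" "?f x \<in> vertices n" using xy unfolding m by metis+
      then show "(?f x, ?f y) \<in> b" using partitionsD(2)[OF b] by simp
    next
      show "(?f (face 0 x), ?f (face 0 y)) \<in> b" if "(x, y) \<in> b" for x y
        unfolding f0 by (rule that)
      show "(?f (face 0 u), ?f (face 0 u)) \<in> b"
        unfolding f0 by (rule partitionsD(2)[OF b uv(1)])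
    qed (rule partitionsD(6)[OF b])
    then show "(u, v) \<in> b" by (simp only: f0)
  qed (rule glue_right)
  then show ?thesis
    unfolding mem_d_prod[OF p b] move_vertices[OF w] using uv con[OF uv(1)] con[OF uv(2)]
      glue_sym[OF p b] glue_trans[of ?p b] by (meson symD transD)
qed

lemma perm_right:
  assumes w: "w permutes {1..n}" and b: "b \<in> partitions n" and uv: "u \<in> vertices n" "v \<in> vertices n"
  shows "(u, v) \<in> d_prod n b (perm_partition n w) \<longleftrightarrow> (move_bot w u, move_bot w v) \<in> b"
proof -
  let ?p = "perm_partition n w"
  note p = perm_partition_in[OF w] and m = mem_perm_partition[OF w]
  have con: "(face 1 u, move_bot w u) \<in> glue b ?p" if u: "u \<in> vertices n" for u
  proof (cases "snd u = 0")
    case False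
    then have "((fst u, 1), (w (fst u), 0)) \<in> ?p"
      using u permutes_in_image[OF w, of "fst u"] by (cases u) (auto simp: m perm_label_def)
    from glue_right[OF this] show ?thesis
      using False u by (cases u) (auto simp: move_bot_def skip_def numeral_2_eq_2)
  next
    case True
    then have "face 1 u = move_bot w u"
      using u by (cases u) (auto simp: move_bot_def skip_def)
    then show ?thesis by (simp add: glue_refl)
  qed
  have "(x, y) \<in> glue b ?p \<longleftrightarrow> (x, y) \<in> b" if xy: "x \<in> vertices n" "y \<in> vertices n" for x y
  proof
    \<comment> \<open>Row 2 is pulled back along its strand to row 1, so that everything lands in
      the two rows of b.\<close>
    let ?f = "\<lambda>x. if snd x = 2 then (w (fst x), 1) else x :: vertex"
    have f0: "?f x = x" if "x \<in> vertices n" for x :: vertex using that by (cases x) auto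
    assume "(x, y) \<in> glue b ?p"
    then have "(?f x, ?f y) \<in> b"
    proof (rule glue_invariant)
      fix x y assume xy: "(x, y) \<in> b"
      then show "(?f x, ?f y) \<in> b"
        unfolding f0[OF partitionsD(7)[OF b xy]] f0[OF partitionsD(8)[OF b xy]] .
    next
      fix x y assume xy: "(x, y) \<in> ?p"
      have "?f (face 0 x) = (perm_label w x, 1) \<and> ?f (face 0 x) \<in> vertices n" if "x \<in> vertices n" for x
        using that permutes_in_image[OF w] by (cases x) (auto simp: perm_label_def skip_def)
      then have E: "?f (face 0 x) = ?f (face 0 y)" "?f (face 0 x) \<in> vertices n" using xy unfolding m by metis+
      show "(?f (face 0 x), ?f (face 0 y)) \<in> b"
        by (simp only: E(1)[symmetric] partitionsD(2)[OF b E(2)])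
    next
      show "(?f x, ?f x) \<in> b" unfolding f0[OF xy(1)] by (rule partitionsD(2)[OF b xy(1)])
    qed (rule partitionsD(6)[OF b])
    then show "(x, y) \<in> b" unfolding f0[OF xy(1)] f0[OF xy(2)] .
  qed (rule glue_left)
  note iff = this[OF move_vertices(2)[OF w, THEN iffD2, OF uv(1)] move_vertices(2)[OF w, THEN iffD2, OF uv(2)]]
  show ?thesis
    unfolding mem_d_prod[OF b p] iff[symmetric] using uv con[OF uv(1)] con[OF uv(2)]
      glue_sym[OF b p] glue_trans[of b ?p] by (meson symD transD)
qed

text \<open>A strand joins each vertex of the middle row to an outer row, so no part can be
  closed.\<close>

lemma closed_parts_perm:
  assumes w: "w permutes {1..n}" and b: "b \<in> partitions n"
  shows "closed_parts n (perm_partition n w) b = 0" "closed_parts n b (perm_partition n w) = 0"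
proof -
  let ?p = "perm_partition n w"
  note p = perm_partition_in[OF w] and m = mem_perm_partition[OF w]
  have "\<not> glue ?p b `` {x} \<subseteq> row n 1" if "x \<in> row n 1" for x
  proof -
    have "(x, (w (fst x), 0)) \<in> ?p"
      using that permutes_in_image[OF w, of "fst x"] by (cases x) (auto simp: m perm_label_def)
    then have "(w (fst x), 0) \<in> glue ?p b `` {x}" using glue_left by blast
    then show ?thesis by auto
  qed
  then show "closed_parts n ?p b = 0"
    unfolding closed_parts_eq[OF p b] closed_classes_def card_eq_0_iff by blast
  have "\<not> glue b ?p `` {x} \<subseteq> row n 1" if "x \<in> row n 1" for x
  proof -
    have i: "fst x \<in> {1..n}" "snd x = 1" using that by (cases x; auto)+
    then have "((fst x, 0), (inv_into UNIV w (fst x), 1)) \<in> ?p"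
      using permutes_in_image[OF permutes_inv[OF w], of "fst x"] permutes_inverses[OF w] by (auto simp: m perm_label_def)
    from glue_right[OF this, of b] have "(inv_into UNIV w (fst x), 2) \<in> glue b ?p `` {x}"
      using i(2) by (cases x) (simp add: skip_def numeral_2_eq_2)
    then show ?thesis by auto
  qed
  then show "closed_parts n b ?p = 0"
    unfolding closed_parts_eq[OF b p] closed_classes_def card_eq_0_iff by blast
qed

lemma perm_prod:
  assumes w: "w permutes {1..n}" and v: "v permutes {1..n}"
  shows "d_prod n (perm_partition n w) (perm_partition n v) = perm_partition n (w \<circ> v)"
proof (rule rel_eqI)
  fix x y :: vertex
  note p = perm_partition_in
  have wv: "w \<circ> v permutes {1..n}" using permutes_compose[OF v w] .
  show "(x, y) \<in> d_prod n (perm_partition n w) (perm_partition n v) \<longleftrightarrow> (x, y) \<in> perm_partition n (w \<circ> v)"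
  proof (cases "x \<in> vertices n \<and> y \<in> vertices n")
    case True
    have "w i = w j \<longleftrightarrow> i = j" for i j using permutes_inj[OF w] by (auto dest: injD)
    moreover have "v i \<in> {1..n} \<longleftrightarrow> i \<in> {1..n}" "w i \<in> {1..n} \<longleftrightarrow> i \<in> {1..n}" for i
      using permutes_in_image[OF v] permutes_in_image[OF w] by blast+
    ultimately show ?thesis
      using True unfolding perm_right[OF v p[OF w] True[THEN conjunct1] True[THEN conjunct2]]
      by (cases x; cases y)
        (auto simp: move_bot_def mem_perm_partition[OF w] mem_perm_partition[OF wv] perm_label_def)
  next
    case False
    then show ?thesis
      using partitionsD(7,8)[OF p[OF wv]] partitionsD(7,8)[OF d_prod_partition[OF p[OF w] p[OF v]]] by blast
  qed
qed

lemma perm_id: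
  assumes "b \<in> partitions n"
  shows "d_prod n (perm_partition n id) b = b" "d_prod n b (perm_partition n id) = b"
proof -
  have id: "id permutes {1..n}" by (rule permutes_id)
  note p = perm_partition_in[OF id]
  have m: "move_top id u = u" "move_bot id u = u" for u by (cases u; simp add: move_top_def move_bot_def)+
  show "d_prod n (perm_partition n id) b = b"
  proof (rule rel_eqI)
    show "(u, v) \<in> d_prod n (perm_partition n id) b \<longleftrightarrow> (u, v) \<in> b" for u v
      using perm_left[OF id assms, of u v] partitionsD(7,8)[OF assms]
        partitionsD(7,8)[OF d_prod_partition[OF p assms]] unfolding m by blast
  qed
  show "d_prod n b (perm_partition n id) = b"
  proof (rule rel_eqI)
    show "(u, v) \<in> d_prod n b (perm_partition n id) \<longleftrightarrow> (u, v) \<in> b" for u v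
      using perm_right[OF id assms, of u v] partitionsD(7,8)[OF assms]
        partitionsD(7,8)[OF d_prod_partition[OF assms p]] unfolding m by blast
  qed
qed

section \<open>The order on propagating indices\<close>

abbreviation index_le :: "nat list \<Rightarrow> nat list \<Rightarrow> bool"
  where "index_le \<equiv> index_step\<^sup>*\<^sup>*"

definition desc_list :: "nat multiset \<Rightarrow> nat list"
  where "desc_list M = rev (sorted_list_of_multiset M)"

lemma mset_desc_list [simp]: "mset (desc_list M) = M"
  by (simp add: desc_list_def)

lemma desc_list_prop_index [simp]: "desc_list M \<in> prop_indices"
  by (simp add: desc_list_def prop_indices_def sorted_wrt_rev)

lemma desc_list_mset: "\<nu> \<in> prop_indices \<Longrightarrow> desc_list (mset \<nu>) = \<nu>"
proof -
  assume "\<nu> \<in> prop_indices"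
  then have "sorted (rev \<nu>)" by (simp add: prop_indices_def sorted_wrt_rev)
  then have "sorted_list_of_multiset (mset \<nu>) = rev \<nu>"
    by (metis mset_rev sorted_list_of_multiset_mset sorted_sort_id)
  then show ?thesis by (simp add: desc_list_def)
qed

lemma index_le_decrease: "y \<le> x \<Longrightarrow> index_le (desc_list (add_mset y X)) (desc_list (add_mset x X))"
proof (induction x)
  case (Suc x)
  show ?case
  proof (cases "y \<le> x")
    case True
    have "index_step (desc_list (add_mset x X)) (desc_list (add_mset (Suc x) X))"
      by (rule index_step.decrease[where x = "Suc x" and X = X]) auto
    then show ?thesis using Suc.IH[OF True] by (rule rtranclp.rtrancl_into_rtrancl[rotated])
  qed (use Suc.prems in \<open>simp add: le_Suc_eq\<close>)
qed simp

lemma index_le_merge: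
  "index_le (desc_list (add_mset (x + y) X)) (desc_list (add_mset x (add_mset y X)))"
  by (rule r_into_rtranclp, rule index_step.merge[where x = x and y = y and X = X]) auto

text \<open>Every entry can be lowered to 0, a 0 disappears when it is merged into another entry,
  and the last 0 goes by \<open>index_step.remove\<close>.\<close>

lemma index_le_Nil: "index_le [] (desc_list M)"
proof (induction M)
  case empty
  then show ?case by (simp add: desc_list_def)
next
  case (add x M)
  have 0: "index_le (desc_list (add_mset 0 M)) (desc_list (add_mset x M))"
    by (rule index_le_decrease) simp
  have "index_le [] (desc_list (add_mset 0 M))"
  proof (cases M)
    case empty
    have "desc_list {#0#} = [0]" by (simp add: desc_list_def)
    then show ?thesis using index_step.remove empty by auto
  next
    case (add y Y)
    then have "index_le (desc_list M) (desc_list (add_mset 0 M))"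
      using index_le_merge[of 0 y Y] by simp
    then show ?thesis using \<open>index_le [] (desc_list M)\<close> by (rule rtranclp_trans[rotated])
  qed
  then show ?case using 0 by (rule rtranclp_trans)
qed

text \<open>X holds the entries that stay untouched; the induction moves the entries already treated
  into it.\<close>

lemma index_le_pointwise:
  assumes "finite S" "\<And>x. x \<in> S \<Longrightarrow> g x \<le> f x"
  shows "index_le (desc_list (image_mset g (mset_set S) + X)) (desc_list (image_mset f (mset_set S) + X))"
  using assms
proof (induction S arbitrary: X rule: finite_induct)
  case (insert x S)
  have "index_le (desc_list (image_mset g (mset_set S) + add_mset (g x) X))
      (desc_list (image_mset f (mset_set S) + add_mset (g x) X))"
    using insert.IH[of "add_mset (g x) X"] insert.prems by blast
  moreover have "index_le (desc_list (add_mset (g x) (image_mset f (mset_set S) + X)))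
      (desc_list (add_mset (f x) (image_mset f (mset_set S) + X)))"
    using insert by (intro index_le_decrease) simp
  ultimately show ?case using insert(1,2) by simp
qed simp

lemma index_le_sum:
  assumes "finite S" "S \<noteq> {}"
  shows "index_le (desc_list (add_mset (sum f S) X)) (desc_list (image_mset f (mset_set S) + X))"
  using assms
proof (induction S arbitrary: X rule: finite_ne_induct)
  case (insert x S)
  have "index_le (desc_list (add_mset (f x + sum f S) X)) (desc_list (add_mset (f x) (add_mset (sum f S) X)))"
    by (rule index_le_merge)
  moreover have "index_le (desc_list (add_mset (sum f S) (add_mset (f x) X)))
      (desc_list (image_mset f (mset_set S) + add_mset (f x) X))"
    by (rule insert.IH)
  ultimately show ?case using insert(1,3) by (simp add: add_mset_commute)
qed simp

text \<open>The entries over each y are merged into their sum, one fibre at a time; Z keeps the sums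
  already formed.\<close>

lemma index_le_fibers:
  assumes "finite Y" "finite X" "h ` X = Y"
  shows "index_le (desc_list (image_mset (\<lambda>y. sum f {x \<in> X. h x = y}) (mset_set Y) + Z))
    (desc_list (image_mset f (mset_set X) + Z))"
  using assms
proof (induction Y arbitrary: X Z rule: finite_induct)
  case (insert y Y)
  let ?F = "{x \<in> X. h x = y}" and ?X = "{x \<in> X. h x \<noteq> y}"
  have X: "X = ?F \<union> ?X" by blast
  have m: "mset_set X = mset_set ?F + mset_set ?X"
    using insert.prems(1) by (subst X, subst mset_set_Union) auto
  have sums: "image_mset (\<lambda>y. sum f {x \<in> ?X. h x = y}) (mset_set Y) =
      image_mset (\<lambda>y. sum f {x \<in> X. h x = y}) (mset_set Y)"
    using insert(1,2) by (intro image_mset_cong arg_cong[where f = "sum f"]) auto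
  have "h ` ?X = Y" using insert.prems(2) insert.hyps(2) by auto
  from insert.IH[OF _ this, of "add_mset (sum f ?F) Z"]
  have "index_le (desc_list (image_mset (\<lambda>y. sum f {x \<in> X. h x = y}) (mset_set Y) + add_mset (sum f ?F) Z))
      (desc_list (image_mset f (mset_set ?X) + add_mset (sum f ?F) Z))"
    using insert.prems(1) unfolding sums by simp
  moreover have "index_le (desc_list (add_mset (sum f ?F) (image_mset f (mset_set ?X) + Z)))
      (desc_list (image_mset f (mset_set ?F) + (image_mset f (mset_set ?X) + Z)))"
  proof (rule index_le_sum)
    have "y \<in> h ` X" using insert.prems(2) by simp
    then show "?F \<noteq> {}" by blast
  qed (use insert.prems(1) in simp)
  ultimately show ?case using insert(1,2) by (simp add: m add.assoc)
qed simp

text \<open>The form in which the order arises from a product: some parts of a factor unite to the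
  parts of the product, the others are lost, and counts may drop. Entries are first merged along
  fibres and then lowered; an empty Y is the case of \<open>index_le_Nil\<close>.\<close>

lemma index_le_surj:
  assumes X: "finite X" and Y: "finite Y" and D: "D \<subseteq> X" "h ` D = Y"
    and le: "\<And>y. y \<in> Y \<Longrightarrow> g y \<le> sum f {x \<in> D. h x = y}"
  shows "index_le (desc_list (image_mset g (mset_set Y))) (desc_list (image_mset f (mset_set X)))"
proof (cases "Y = {}")
  case True
  then show ?thesis using index_le_Nil by (simp add: desc_list_def)
next
  case False
  then obtain y0 where y0: "y0 \<in> Y" by blast
  \<comment> \<open>Lost parts are sent to an arbitrary y0. The extra summands only enlarge a fibre
    sum, which may be lowered again.\<close>
  define h' where "h' = (\<lambda>x. if x \<in> D then h x else y0)"
  have "h' ` X = Y" using D y0 by (auto simp: h'_def)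
  from index_le_fibers[OF Y X this, of f "{#}"]
  have "index_le (desc_list (image_mset (\<lambda>y. sum f {x \<in> X. h' x = y}) (mset_set Y)))
      (desc_list (image_mset f (mset_set X)))" by simp
  moreover have "g y \<le> sum f {x \<in> X. h' x = y}" if "y \<in> Y" for y
  proof -
    have "g y \<le> sum f {x \<in> D. h x = y}" using le that by blast
    also have "\<dots> \<le> sum f {x \<in> X. h' x = y}"
      using D X by (intro sum_mono2) (auto simp: h'_def)
    finally show ?thesis .
  qed
  from index_le_pointwise[OF Y this, where X = "{#}"]
  have "index_le (desc_list (image_mset g (mset_set Y)))
      (desc_list (image_mset (\<lambda>y. sum f {x \<in> X. h' x = y}) (mset_set Y)))" by simp
  ultimately show ?thesis by (rule rtranclp_trans[rotated])
qed

text \<open>Every nontrivial step lowers this number: a decrease lowers the sum, a merge or a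
  removal the length. This yields antisymmetry and a measure for minimal choices.\<close>

definition index_size :: "nat list \<Rightarrow> nat"
  where "index_size \<nu> = size (mset \<nu>) + sum_mset (mset \<nu>)"

lemma index_step_size: "index_step \<mu> \<nu> \<Longrightarrow> \<mu> = \<nu> \<or> index_size \<mu> < index_size \<nu>"
  by (induction rule: index_step.induct) (auto simp: index_size_def)

lemma index_le_size: "index_le \<mu> \<nu> \<Longrightarrow> \<mu> = \<nu> \<or> index_size \<mu> < index_size \<nu>"
proof (induction rule: rtranclp_induct)
  case (step y z)
  then show ?case using index_step_size by fastforce
qed simp

lemma index_less_iff: "index_less \<mu> \<nu> \<longleftrightarrow> index_le \<mu> \<nu> \<and> \<mu> \<noteq> \<nu>"
  unfolding index_less_def by (metis Nitpick.rtranclp_unfold)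

lemma index_le_antisym: "index_le \<mu> \<nu> \<Longrightarrow> index_le \<nu> \<mu> \<Longrightarrow> \<mu> = \<nu>"
  using index_le_size less_asym by metis

section \<open>Pairs of partitions\<close>

lemma refinement_iff:
  assumes a: "a \<in> partitions n" and b: "b \<in> partitions n"
  shows "refinement n a b \<longleftrightarrow> a \<subseteq> b"
proof
  assume r: "refinement n a b"
  show "a \<subseteq> b"
  proof (rule subrelI)
    fix u v assume uv: "(u, v) \<in> a"
    note u = partitionsD(7)[OF a uv] and v = partitionsD(8)[OF a uv]
    have "b `` {u} \<in> vertices n // b" using u by (rule quotientI)
    then obtain C where C: "C \<subseteq> vertices n // a" "b `` {u} = \<Union>C"
      using r unfolding refinement_def by blast
    have "u \<in> \<Union>C" using C(2) partitionsD(2)[OF b u] by blast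
    then obtain X where X: "X \<in> C" "u \<in> X" by blast
    then obtain z where z: "X = a `` {z}" using C(1) by (metis quotientE subsetD)
    then have "v \<in> X" using X(2) uv partitionsD(4)[OF a] by blast
    then show "(u, v) \<in> b" using X(1) C(2) by blast
  qed
next
  assume ab: "a \<subseteq> b"
  show "refinement n a b"
    unfolding refinement_def
  proof
    fix q assume "q \<in> vertices n // b"
    then obtain z where z: "q = b `` {z}" "z \<in> vertices n" by (rule quotientE)
    have in_q: "a `` {u} \<subseteq> q" if "u \<in> q" for u
      using that ab partitionsD(4)[OF b] unfolding z(1) by blast
    have qV: "u \<in> vertices n" if "u \<in> q" for u
      using that partitionsD(8)[OF b] unfolding z(1) by blast
    have q1: "q \<subseteq> \<Union>((\<lambda>u. a `` {u}) ` q)"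
    proof
      fix u assume "u \<in> q"
      then have "u \<in> a `` {u}" using partitionsD(2)[OF a qV] by blast
      then show "u \<in> \<Union>((\<lambda>u. a `` {u}) ` q)" using \<open>u \<in> q\<close> by (rule UN_I[rotated])
    qed
    have q2: "\<Union>((\<lambda>u. a `` {u}) ` q) \<subseteq> q" using in_q by (rule UN_least)
    have q3: "(\<lambda>u. a `` {u}) ` q \<subseteq> vertices n // a"
      by (rule image_subsetI, rule quotientI, erule qV)
    show "\<exists>C. C \<subseteq> vertices n // a \<and> q = \<Union>C"
      by (rule exI[of _ "(\<lambda>u. a `` {u}) ` q"], rule conjI[OF q3 equalityI[OF q1 q2]])
  qed
qed

lemma pair_partitions_iff:
  "a \<in> pair_partitions n \<longleftrightarrow>
    a \<in> extensional two \<and> a 1 \<in> partitions n \<and> a 2 \<in> partitions n \<and> a 1 \<subseteq> a 2"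
proof -
  have le: "two_le = {(1, 1), (1, 2), (2, 2)}" by (auto simp: two_le_def two_def)
  have "a \<in> pair_partitions n \<longleftrightarrow> a \<in> two \<rightarrow>\<^sub>E partitions n \<and>
      refinement n (a 1) (a 1) \<and> refinement n (a 1) (a 2) \<and> refinement n (a 2) (a 2)"
    unfolding poset_partitions_def le by simp
  moreover have "a \<in> two \<rightarrow>\<^sub>E partitions n \<longleftrightarrow> a \<in> extensional two \<and> a 1 \<in> partitions n \<and> a 2 \<in> partitions n"
    by (auto simp: two_def PiE_def)
  ultimately show ?thesis using refinement_iff by blast
qed

lemma pairD:
  assumes "a \<in> pair_partitions n"
  shows "a 1 \<in> partitions n" "a 2 \<in> partitions n" "a 1 \<subseteq> a 2"
    "t \<in> two \<Longrightarrow> a t \<in> partitions n" "a \<in> extensional two"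
  using assms unfolding pair_partitions_iff by (auto simp: two_def)

lemma pair_eqI:
  assumes "a \<in> extensional two" "b \<in> extensional two" "a 1 = b 1" "a 2 = b 2"
  shows "a = b"
  using assms by (intro extensionalityI[of _ two]) (auto simp: two_def)

definition pair_mult :: "nat \<Rightarrow> pair_partition \<Rightarrow> pair_partition \<Rightarrow> pair_partition"
  where "pair_mult n a b = (\<lambda>t\<in>two. d_prod n (a t) (b t))"

lemma pair_mult_simps [simp]:
  "pair_mult n a b 1 = d_prod n (a 1) (b 1)" "pair_mult n a b (Suc 0) = d_prod n (a 1) (b 1)"
  "pair_mult n a b 2 = d_prod n (a 2) (b 2)" "pair_mult n a b \<in> extensional two"
  by (simp_all add: pair_mult_def two_def)

lemma mk_pair_simps [simp]:
  "mk_pair a b 1 = a" "mk_pair a b (Suc 0) = a" "mk_pair a b 2 = b" "mk_pair a b \<in> extensional two"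
  by (simp_all add: mk_pair_def two_def)

text \<open>Ensures that in a product of pairs the inner partition still refines the outer
  one.\<close>

lemma d_prod_mono:
  assumes "a \<in> partitions n" "b \<in> partitions n" "a' \<in> partitions n" "b' \<in> partitions n"
    and "a \<subseteq> a'" "b \<subseteq> b'"
  shows "d_prod n a b \<subseteq> d_prod n a' b'"
proof (rule subrelI)
  fix u v assume "(u, v) \<in> d_prod n a b"
  moreover have "glue a b \<subseteq> glue a' b'"
    unfolding glue_def shift_def using assms(5,6) by (intro rtrancl_mono Un_mono image_mono)
  ultimately show "(u, v) \<in> d_prod n a' b'"
    unfolding mem_d_prod[OF assms(1,2)] mem_d_prod[OF assms(3,4)] by blast
qed

lemma pair_mult_closed:
  assumes "a \<in> pair_partitions n" "b \<in> pair_partitions n"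
  shows "pair_mult n a b \<in> pair_partitions n"
  using pairD[OF assms(1)] pairD[OF assms(2)] d_prod_partition d_prod_mono
  unfolding pair_partitions_iff by simp

lemma mk_pair_closed:
  "a \<in> partitions n \<Longrightarrow> b \<in> partitions n \<Longrightarrow> a \<subseteq> b \<Longrightarrow> mk_pair a b \<in> pair_partitions n"
  unfolding pair_partitions_iff by simp

lemma finite_partitions: "finite (partitions n)"
  by (rule finite_subset[of _ "Pow (vertices n \<times> vertices n)"]) (use partitionsD(1) in \<open>auto simp del: mem_row\<close>)

lemma finite_pair_partitions: "finite (pair_partitions n)"
proof -
  have "finite two" by (simp add: two_def)
  then have "finite (two \<rightarrow>\<^sub>E partitions n)" using finite_partitions by (intro finite_PiE) auto
  then show ?thesis unfolding poset_partitions_def by (rule rev_finite_subset) blast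
qed

section \<open>Parts of a product\<close>

lemma face_row1: "u \<in> row n 1 \<Longrightarrow> face 1 u = face 0 u \<and> face 1 u \<in> row n 2"
  by (cases u) (auto simp: skip_def)

lemma face_row0: "u \<in> row n 0 \<Longrightarrow> face 1 u = u"
  by (cases u) (auto simp: skip_def)

lemma d_prod_top:
  assumes "a \<in> partitions n" "b \<in> partitions n" "(u, v) \<in> a" "u \<in> row n 0" "v \<in> row n 0"
  shows "(u, v) \<in> d_prod n a b"
  unfolding mem_d_prod[OF assms(1,2)] face_row0[OF assms(4)] face_row0[OF assms(5)]
  using assms glue_left by blast

lemma d_prod_bot:
  assumes "a \<in> partitions n" "b \<in> partitions n" "(u, v) \<in> b" "u \<in> row n 1" "v \<in> row n 1"
  shows "(u, v) \<in> d_prod n a b"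
proof -
  have "(face 1 u, face 1 v) \<in> glue a b"
    using glue_right[OF assms(3)] face_row1[OF assms(4)] face_row1[OF assms(5)] by metis
  then show ?thesis unfolding mem_d_prod[OF assms(1,2)] using assms(4,5) by blast
qed

text \<open>Row 2 is out of reach of a, so a path leaves it only along a pair of b.\<close>

lemma glue_step_row2:
  assumes a: "a \<in> partitions n" and b: "b \<in> partitions n"
    and "(face 0 p, z) \<in> a \<union> shift b" "p \<in> row n 1"
  obtains q where "z = face 0 q" "(p, q) \<in> b"
proof -
  have "face 0 p \<notin> vertices n" using assms(4) by (cases p) (auto simp: skip_def)
  then have "(face 0 p, z) \<in> relabel (skip 0) b"
    using assms(3) partitionsD(7)[OF a] unfolding shift_eq by blast
  then obtain p' q where "face 0 p = face 0 p'" "z = face 0 q" "(p', q) \<in> b"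
    unfolding mem_relabel' by blast
  then show thesis using that apsnd_inject[OF inj_skip] by metis
qed

text \<open>A part of b inside its lower row does not touch the middle row, so a path that starts in
  it never leaves it.\<close>

lemma d_prod_bot_part:
  assumes a: "a \<in> partitions n" and b: "b \<in> partitions n"
    and v: "v \<in> row n 1" "b `` {v} \<subseteq> row n 1" and x: "(v, x) \<in> d_prod n a b"
  shows "(v, x) \<in> b"
proof -
  have "\<exists>q. y = face 0 q \<and> (v, q) \<in> b" if "(face 0 v, y) \<in> (a \<union> shift b)\<^sup>*" for y
    using that
  proof (induction rule: rtrancl_induct)
    case base
    then show ?case using partitionsD(2)[OF b] v(1) by blast
  next
    case (step y z)
    then obtain p where p: "y = face 0 p" "(v, p) \<in> b" by blast
    then have "p \<in> row n 1" using v(2) by blast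
    from glue_step_row2[OF a b step(2)[unfolded p(1)] this]
    obtain q where "z = face 0 q" "(p, q) \<in> b" .
    then show ?case using p(2) partitionsD(4)[OF b] by blast
  qed
  moreover have "(face 0 v, face 1 x) \<in> (a \<union> shift b)\<^sup>*"
    using x face_row1[OF v(1)] unfolding mem_d_prod[OF a b] glue_def by metis
  ultimately obtain q where q: "face 1 x = face 0 q" "(v, q) \<in> b" by blast
  then have "q \<in> row n 1" using v(2) by blast
  then have "face 1 x = face 1 q" using face_row1[of q n] q(1) by simp
  then show ?thesis using q(2) apsnd_inject[OF inj_skip] by metis
qed

text \<open>A path from v to the top has to leave row 2, and by \<open>glue_step_row2\<close> it
  does so along a pair of b that ends in the middle row. The vertex from which it leaves serves as
  z.\<close>

lemma d_prod_bot_prop: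
  assumes a: "a \<in> partitions n" and b: "b \<in> partitions n"
    and uv: "(u, v) \<in> d_prod n a b" "u \<in> row n 0" "v \<in> row n 1"
  shows "\<exists>z\<in>row n 1. \<exists>z0\<in>row n 0. (z, v) \<in> d_prod n a b \<and> (z, z0) \<in> b"
proof (rule ccontr)
  assume no: "\<not> ?thesis"
  note D = d_prod_partition[OF a b]
  have "\<exists>p\<in>row n 1. y = face 0 p" if "(face 0 v, y) \<in> (a \<union> shift b)\<^sup>*" for y
    using that
  proof (induction rule: rtrancl_induct)
    case base
    then show ?case using uv(3) by blast
  next
    case (step y z)
    then obtain p where p: "y = face 0 p" "p \<in> row n 1" by blast
    from glue_step_row2[OF a b step(2)[unfolded p(1)] p(2)]
    obtain q where q: "z = face 0 q" "(p, q) \<in> b" .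
    have e: "face 1 v = face 0 v" "face 1 p = face 0 p"
      using face_row1[OF p(2)] face_row1[OF uv(3)] by blast+
    have "(v, p) \<in> d_prod n a b"
      unfolding mem_d_prod[OF a b] glue_def e using step(1) p uv(3) by blast
    then have "(p, v) \<in> d_prod n a b" by (rule partitionsD(3)[OF D])
    then have "q \<notin> row n 0" using no p(2) q(2) by blast
    then show ?case using q partitionsD(8)[OF b q(2)] by blast
  qed
  moreover have "(face 0 v, face 1 u) \<in> (a \<union> shift b)\<^sup>*"
    using partitionsD(3)[OF D uv(1)] face_row1[OF uv(3)] unfolding mem_d_prod[OF a b] glue_def by metis
  ultimately obtain p where "p \<in> row n 1" "face 1 u = face 0 p" by blast
  then show False using uv(2) by (cases u; cases p) (auto simp: skip_def)
qed

lemma swap_rows_row: "u \<in> row n 0 \<Longrightarrow> swap_rows u \<in> row n 1" "u \<in> row n 1 \<Longrightarrow> swap_rows u \<in> row n 0"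
  "u \<in> vertices n \<Longrightarrow> swap_rows (swap_rows u) = u"
  by (cases u; auto simp: swap_rows_def)+

lemma swap_d_prod:
  assumes a: "a \<in> partitions n" and b: "b \<in> partitions n"
    and "u \<in> vertices n" "v \<in> vertices n"
  shows "(swap_rows u, swap_rows v) \<in> d_prod n (flip b) (flip a) \<longleftrightarrow> (u, v) \<in> d_prod n a b"
  unfolding d_prod_flip[OF a b] mem_flip[OF d_prod_partition[OF a b]]
  using assms(3,4) by (simp only: swap_rows_row(3)) (simp add: swap_rows_def)

lemma swap_flip:
  assumes a: "a \<in> partitions n" and "u \<in> vertices n" "v \<in> vertices n"
  shows "(swap_rows u, swap_rows v) \<in> flip a \<longleftrightarrow> (u, v) \<in> a"
  unfolding mem_flip[OF a]
  using assms(2,3) by (simp only: swap_rows_row(3)) (simp add: swap_rows_def)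

lemma d_prod_top_prop:
  assumes a: "a \<in> partitions n" and b: "b \<in> partitions n"
    and uv: "(u, v) \<in> d_prod n a b" "u \<in> row n 1" "v \<in> row n 0"
  shows "\<exists>z\<in>row n 0. \<exists>z1\<in>row n 1. (z, v) \<in> d_prod n a b \<and> (z, z1) \<in> a"
proof -
  have V: "u \<in> vertices n" "v \<in> vertices n" using uv(2,3) by blast+
  have "(swap_rows u, swap_rows v) \<in> d_prod n (flip b) (flip a)"
    unfolding swap_d_prod[OF a b V] by (rule uv(1))
  from d_prod_bot_prop[OF flip_partition[OF b] flip_partition[OF a] this
      swap_rows_row(2)[OF uv(2)] swap_rows_row(1)[OF uv(3)]]
  obtain z z0 where z: "z \<in> row n 1" "z0 \<in> row n 0"
    "(z, swap_rows v) \<in> d_prod n (flip b) (flip a)" "(z, z0) \<in> flip a" by blast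
  have V': "swap_rows z \<in> vertices n" "swap_rows z0 \<in> vertices n"
    using swap_rows_row(2)[OF z(1)] swap_rows_row(1)[OF z(2)] by blast+
  have zz: "swap_rows (swap_rows z) = z" "swap_rows (swap_rows z0) = z0"
    using z(1,2) swap_rows_row(3) by blast+
  have "(swap_rows z, v) \<in> d_prod n a b" "(swap_rows z, swap_rows z0) \<in> a"
    using z(3,4) swap_d_prod[OF a b V'(1) V(2)] swap_flip[OF a V'] unfolding zz by blast+
  then show ?thesis using swap_rows_row(2)[OF z(1)] swap_rows_row(1)[OF z(2)] by blast
qed

lemma d_prod_top_part:
  assumes a: "a \<in> partitions n" and b: "b \<in> partitions n"
    and v: "v \<in> row n 0" "a `` {v} \<subseteq> row n 0" and x: "(v, x) \<in> d_prod n a b"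
  shows "(v, x) \<in> a"
proof -
  have vV: "v \<in> vertices n" using v(1) by blast
  have xV: "x \<in> vertices n" using partitionsD(8)[OF d_prod_partition[OF a b] x] .
  have "flip a `` {swap_rows v} \<subseteq> row n 1"
  proof
    fix y assume "y \<in> flip a `` {swap_rows v}"
    then have y: "(swap_rows v, y) \<in> flip a" by blast
    then have yV: "y \<in> vertices n" using partitionsD(8)[OF flip_partition[OF a]] by blast
    then have "swap_rows y \<in> vertices n" using swap_rows_vertices by blast
    then have "(v, swap_rows y) \<in> a"
      using y swap_flip[OF a vV, of "swap_rows y"] swap_rows_row(3)[OF yV] by metis
    then have "swap_rows y \<in> row n 0" using v(2) by blast
    then show "y \<in> row n 1" using swap_rows_row(1) swap_rows_row(3)[OF yV] by metis
  qed
  moreover have "(swap_rows v, swap_rows x) \<in> d_prod n (flip b) (flip a)"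
    unfolding swap_d_prod[OF a b vV xV] by (rule x)
  ultimately have "(swap_rows v, swap_rows x) \<in> flip a"
    by (rule d_prod_bot_part[OF flip_partition[OF b] flip_partition[OF a] swap_rows_row(1)[OF v(1)]])
  then show ?thesis unfolding swap_flip[OF a vV xV] .
qed

section \<open>The propagating index of a product\<close>

text \<open>The parameter l lets the representative be taken in either row, so that one argument
  serves multiplication from both sides.\<close>

lemma mem_prop_parts:
  assumes a: "a \<in> partitions n" and l: "l \<le> 1"
  shows "q \<in> prop_parts n a \<longleftrightarrow>
    (\<exists>z\<in>row n l. \<exists>z0\<in>row n (1 - l). (z, z0) \<in> a \<and> q = a `` {z})"
proof
  assume q: "q \<in> prop_parts n a"
  then have "q \<in> vertices n // a" by (simp add: prop_parts_def)
  then obtain w where w: "q = a `` {w}" by (rule quotientE)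
  have "q \<inter> row n 0 \<noteq> {}" "q \<inter> row n 1 \<noteq> {}"
    using q unfolding prop_parts_def by blast+
  moreover have "l = 0 \<or> l = 1" using l by auto
  ultimately have "q \<inter> row n l \<noteq> {}" "q \<inter> row n (1 - l) \<noteq> {}" by (metis diff_self_eq_0 diff_zero)+
  then obtain z z0 where z: "z \<in> q" "z \<in> row n l" "z0 \<in> q" "z0 \<in> row n (1 - l)" by blast
  have "q = a `` {z}" using z(1) partitionsD(3,4)[OF a] unfolding w by blast
  then show "\<exists>z\<in>row n l. \<exists>z0\<in>row n (1 - l). (z, z0) \<in> a \<and> q = a `` {z}" using z by blast
next
  assume "\<exists>z\<in>row n l. \<exists>z0\<in>row n (1 - l). (z, z0) \<in> a \<and> q = a `` {z}"
  then obtain z z0 where z: "z \<in> row n l" "z0 \<in> row n (1 - l)" "(z, z0) \<in> a" "q = a `` {z}" by blast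
  have zV: "z \<in> vertices n" using partitionsD(7)[OF a z(3)] .
  have "z \<in> q" "z0 \<in> q" using z partitionsD(2)[OF a zV] by blast+
  moreover have "l = 0 \<or> l = 1" using l by auto
  ultimately have "q \<inter> row n 0 \<noteq> {} \<and> q \<inter> row n 1 \<noteq> {}" using z(1,2) by auto
  then show "q \<in> prop_parts n a"
    unfolding prop_parts_def z(4) using quotientI[OF zV, of a] by blast
qed

lemma prop_parts_eqI:
  assumes "a \<in> partitions n" "q \<in> prop_parts n a" "z \<in> q"
  shows "q = a `` {z}"
proof -
  have "q \<in> vertices n // a" using assms(2) unfolding prop_parts_def by blast
  then obtain w where "q = a `` {w}" by (rule quotientE)
  then show ?thesis using assms(3) partitionsD(3,4)[OF assms(1)] by blast
qed

lemma finite_prop_parts: "finite (prop_parts n a)" if "a \<in> partitions n"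
proof (rule finite_subset)
  show "prop_parts n a \<subseteq> (\<lambda>z. a `` {z}) ` vertices n"
    unfolding prop_parts_def by (auto elim!: quotientE simp del: mem_row)
  show "finite ((\<lambda>z. a `` {z}) ` vertices n)" by simp
qed

definition inner_count :: "nat \<Rightarrow> pair_partition \<Rightarrow> vertex set \<Rightarrow> nat"
  where "inner_count n a q = card {r \<in> prop_parts n (a 1). r \<subseteq> q}"

lemma prop_index_eq:
  "prop_index n a = desc_list (image_mset (inner_count n a) (mset_set (prop_parts n (a 2))))"
  by (simp add: prop_index_def desc_list_def inner_count_def[abs_def])

text \<open>Treats both sides of multiplication at once; l is the row that c shares with its factor
  b. By \<open>sub\<close> the parts of b in row l survive, possibly united, and by
  \<open>prop_lift\<close> each propagating part of c contains a row-l vertex of a propagating part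
  of b. So propagating parts of c arise by uniting those of b, and each inner one uses up at least
  one of b.\<close>

lemma prop_index_le:
  assumes b: "b \<in> pair_partitions n" and c: "c \<in> pair_partitions n" and l: "l \<le> 1"
    and sub: "\<And>t u v. t \<in> two \<Longrightarrow> (u, v) \<in> b t \<Longrightarrow> u \<in> row n l \<Longrightarrow> v \<in> row n l \<Longrightarrow> (u, v) \<in> c t"
    and prop_lift: "\<And>t u v. t \<in> two \<Longrightarrow> (u, v) \<in> c t \<Longrightarrow> u \<in> row n (1 - l) \<Longrightarrow> v \<in> row n l \<Longrightarrow>
      \<exists>z\<in>row n l. \<exists>z0\<in>row n (1 - l). (z, v) \<in> c t \<and> (z, z0) \<in> b t"
  shows "index_le (prop_index n c) (prop_index n b)"
proof -
  have t: "1 \<in> two" "2 \<in> two" by (simp_all add: two_def)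
  note b1 = pairD(1)[OF b] and b2 = pairD(2)[OF b] and c1 = pairD(1)[OF c] and c2 = pairD(2)[OF c]
  let ?X = "prop_parts n (b 2)" and ?Y = "prop_parts n (c 2)"
  \<comment> \<open>The propagating outer parts of b that meet a propagating part of c in row l; h
    sends such a part to the part of c that it meets.\<close>
  define D where "D = {q \<in> ?X. \<exists>y\<in>?Y. \<exists>z\<in>row n l. z \<in> q \<and> z \<in> y}"
  define h where "h q = (SOME y. y \<in> ?Y \<and> (\<exists>z\<in>row n l. z \<in> q \<and> z \<in> y))" for q
  \<comment> \<open>By \<open>sub\<close> the row-l vertices of one part of b lie in one part of c,
    so the value of h does not depend on the choice.\<close>
  have h_eq: "h q = y" if q: "q \<in> ?X" and y: "y \<in> ?Y" and z: "z \<in> row n l" "z \<in> q" "z \<in> y" for q y z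
  proof -
    have "h q \<in> ?Y \<and> (\<exists>z\<in>row n l. z \<in> q \<and> z \<in> h q)"
      unfolding h_def by (rule someI[of _ y]) (use y z in blast)
    then obtain z' where z': "h q \<in> ?Y" "z' \<in> row n l" "z' \<in> q" "z' \<in> h q" by blast
    have "(z, z') \<in> b 2" using prop_parts_eqI[OF b2 q z(2)] z'(3) by blast
    then have "(z, z') \<in> c 2" using sub[OF t(2)] z(1) z'(2) by blast
    then have "z' \<in> y" using prop_parts_eqI[OF c2 y z(3)] by blast
    then show ?thesis using prop_parts_eqI[OF c2 y] prop_parts_eqI[OF c2 z'(1) z'(4)] by blast
  qed
  have lift: "\<exists>z\<in>row n l. \<exists>z0\<in>row n (1 - l). z \<in> y \<and> (z, z0) \<in> b t"
    if tt: "t \<in> two" and y: "y \<in> prop_parts n (c t)" for t y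
  proof -
    note ct = pairD(4)[OF c tt]
    obtain v v0 where v: "v \<in> row n l" "v0 \<in> row n (1 - l)" "(v, v0) \<in> c t" "y = c t `` {v}"
      using y unfolding mem_prop_parts[OF ct l] by blast
    from prop_lift[OF tt partitionsD(3)[OF ct v(3)] v(2,1)]
    obtain z z0 where "z \<in> row n l" "z0 \<in> row n (1 - l)" "(z, v) \<in> c t" "(z, z0) \<in> b t" by blast
    then show ?thesis using v(4) partitionsD(3)[OF ct] by blast
  qed
  have Dh: "b 2 `` {z} \<in> D \<and> h (b 2 `` {z}) = y"
    if y: "y \<in> ?Y" and z: "z \<in> row n l" "z0 \<in> row n (1 - l)" "z \<in> y" "(z, z0) \<in> b 2" for y z z0
  proof -
    have q: "b 2 `` {z} \<in> ?X" unfolding mem_prop_parts[OF b2 l] using z by blast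
    have "z \<in> b 2 `` {z}" using partitionsD(7)[OF b2 z(4)] partitionsD(2)[OF b2] by blast
    then show ?thesis using q y z h_eq[OF q y z(1)] unfolding D_def by blast
  qed
  have "index_le (desc_list (image_mset (inner_count n c) (mset_set ?Y)))
      (desc_list (image_mset (inner_count n b) (mset_set ?X)))"
  proof (rule index_le_surj[where D = D and h = h])
    show "finite ?X" "finite ?Y" by (rule finite_prop_parts[OF b2] finite_prop_parts[OF c2])+
    show "D \<subseteq> ?X" by (auto simp: D_def)
    show "h ` D = ?Y"
    proof (intro equalityI subsetI)
      fix y assume "y \<in> h ` D"
      then obtain q y' z where "q \<in> ?X" "y = h q" "y' \<in> ?Y" "z \<in> row n l" "z \<in> q" "z \<in> y'"
        unfolding D_def by blast
      then show "y \<in> ?Y" using h_eq by metis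
    next
      fix y assume y: "y \<in> ?Y"
      from lift[OF t(2) y] Dh[OF y] show "y \<in> h ` D" by (metis imageI)
    qed
    fix y assume y: "y \<in> ?Y"
    let ?P = "{q \<in> D. h q = y}"
    have "\<exists>z\<in>row n l. \<exists>z0\<in>row n (1 - l). z \<in> r \<and> (z, z0) \<in> b 1" if "r \<in> prop_parts n (c 1)" for r
      using lift[OF t(1) that] .
    \<comment> \<open>Z marks every propagating inner part of c by one of its vertices on a
      propagating inner part of b. Different parts of c give different parts of b, by
      \<open>sub\<close>, which bounds the inner count.\<close>
    then obtain Z where Z: "\<And>r. r \<in> prop_parts n (c 1) \<Longrightarrow>
        Z r \<in> row n l \<and> Z r \<in> r \<and> (\<exists>z0\<in>row n (1 - l). (Z r, z0) \<in> b 1)" by metis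
    let ?R = "{r \<in> prop_parts n (c 1). r \<subseteq> y}"
    have inj: "inj_on (\<lambda>r. b 1 `` {Z r}) ?R"
    proof (rule inj_onI)
      fix r s assume rs: "r \<in> ?R" "s \<in> ?R" and eq: "b 1 `` {Z r} = b 1 `` {Z s}"
      then have r: "r \<in> prop_parts n (c 1)" "s \<in> prop_parts n (c 1)" by blast+
      have "Z s \<in> vertices n" using Z[OF r(2)] partitionsD(7)[OF b1] by blast
      then have "(Z r, Z s) \<in> b 1" using eq partitionsD(2)[OF b1] by blast
      then have "(Z r, Z s) \<in> c 1" using sub[OF t(1)] Z r by blast
      then have "Z s \<in> r" using prop_parts_eqI[OF c1 r(1)] Z[OF r(1)] by blast
      then show "r = s" using prop_parts_eqI[OF c1 r(1)] prop_parts_eqI[OF c1 r(2)] Z[OF r(2)] by metis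
    qed
    have img: "(\<lambda>r. b 1 `` {Z r}) ` ?R \<subseteq> (\<Union>q\<in>?P. {r \<in> prop_parts n (b 1). r \<subseteq> q})"
    proof
      fix s assume "s \<in> (\<lambda>r. b 1 `` {Z r}) ` ?R"
      then obtain r where r: "r \<in> prop_parts n (c 1)" "r \<subseteq> y" "s = b 1 `` {Z r}" by blast
      obtain z0 where z: "Z r \<in> row n l" "Z r \<in> r" "z0 \<in> row n (1 - l)" "(Z r, z0) \<in> b 1"
        using Z[OF r(1)] by blast
      have "s \<in> prop_parts n (b 1)" unfolding mem_prop_parts[OF b1 l] r(3) using z by blast
      moreover have "s \<subseteq> b 2 `` {Z r}" unfolding r(3) using pairD(3)[OF b] by blast
      moreover have "b 2 `` {Z r} \<in> D \<and> h (b 2 `` {Z r}) = y"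
        using Dh[OF y z(1,3)] z r(2) pairD(3)[OF b] by blast
      ultimately show "s \<in> (\<Union>q\<in>?P. {r \<in> prop_parts n (b 1). r \<subseteq> q})" by blast
    qed
    have finP: "finite ?P" using finite_prop_parts[OF b2] by (auto simp: D_def)
    have fin: "finite {r \<in> prop_parts n (b 1). r \<subseteq> q}" for q using finite_prop_parts[OF b1] by simp
    have "inner_count n c y = card ((\<lambda>r. b 1 `` {Z r}) ` ?R)"
      unfolding inner_count_def using card_image[OF inj] by simp
    also have "\<dots> \<le> card (\<Union>q\<in>?P. {r \<in> prop_parts n (b 1). r \<subseteq> q})"
      using finP fin by (intro card_mono[OF _ img]) blast
    also have "\<dots> \<le> sum (inner_count n b) ?P"
      unfolding inner_count_def using finP by (rule card_UN_le)
    finally show "inner_count n c y \<le> sum (inner_count n b) ?P" .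
  qed
  then show ?thesis by (simp add: prop_index_eq)
qed

lemma pair_mult_t: "t \<in> two \<Longrightarrow> pair_mult n a b t = d_prod n (a t) (b t)"
  by (simp add: pair_mult_def)

lemma prop_index_mult_right:
  assumes "a \<in> pair_partitions n" "b \<in> pair_partitions n"
  shows "index_le (prop_index n (pair_mult n a b)) (prop_index n b)"
proof (rule prop_index_le[OF assms(2) pair_mult_closed[OF assms], of 1])
  fix t u v assume t: "t \<in> two"
  note at = pairD(4)[OF assms(1) t] and bt = pairD(4)[OF assms(2) t]
  show "(u, v) \<in> pair_mult n a b t" if "(u, v) \<in> b t" "u \<in> row n 1" "v \<in> row n 1"
    unfolding pair_mult_t[OF t] using d_prod_bot[OF at bt that] .
  show "\<exists>z\<in>row n 1. \<exists>z0\<in>row n (1 - 1). (z, v) \<in> pair_mult n a b t \<and> (z, z0) \<in> b t"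
    if "(u, v) \<in> pair_mult n a b t" "u \<in> row n (1 - 1)" "v \<in> row n 1"
    using that d_prod_bot_prop[OF at bt] unfolding pair_mult_t[OF t] diff_self_eq_0 by blast
qed simp

lemma prop_index_mult_left:
  assumes "a \<in> pair_partitions n" "b \<in> pair_partitions n"
  shows "index_le (prop_index n (pair_mult n a b)) (prop_index n a)"
proof (rule prop_index_le[OF assms(1) pair_mult_closed[OF assms], of 0])
  fix t u v assume t: "t \<in> two"
  note at = pairD(4)[OF assms(1) t] and bt = pairD(4)[OF assms(2) t]
  show "(u, v) \<in> pair_mult n a b t" if "(u, v) \<in> a t" "u \<in> row n 0" "v \<in> row n 0"
    unfolding pair_mult_t[OF t] using d_prod_top[OF at bt that] .
  show "\<exists>z\<in>row n 0. \<exists>z0\<in>row n (1 - 0). (z, v) \<in> pair_mult n a b t \<and> (z, z0) \<in> a t"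
    if "(u, v) \<in> pair_mult n a b t" "u \<in> row n (1 - 0)" "v \<in> row n 0"
    using that d_prod_top_prop[OF at bt] unfolding pair_mult_t[OF t] diff_zero by blast
qed simp

section \<open>Partitions given by labels\<close>

definition kern :: "nat \<Rightarrow> (vertex \<Rightarrow> 'l) \<Rightarrow> vertex rel"
  where "kern n f = {(u, v). u \<in> vertices n \<and> v \<in> vertices n \<and> f u = f v}"

lemma mem_kern: "(u, v) \<in> kern n f \<longleftrightarrow> u \<in> vertices n \<and> v \<in> vertices n \<and> f u = f v"
  by (simp add: kern_def)

lemma kern_partition: "kern n f \<in> partitions n"
proof (rule partitionsI)
  show "kern n f \<subseteq> vertices n \<times> vertices n" unfolding kern_def by blast
qed (unfold mem_kern, metis+)

text \<open>The labelling h of the three rows is constant on the parts of both factors, so glued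
  vertices share a label; \<open>con\<close> supplies the converse on the outer rows.\<close>

lemma kern_prod:
  assumes f: "\<And>u v. u \<in> vertices n \<Longrightarrow> v \<in> vertices n \<Longrightarrow> f u = f v \<Longrightarrow> h u = h v"
    and g: "\<And>u v. u \<in> vertices n \<Longrightarrow> v \<in> vertices n \<Longrightarrow> g u = g v \<Longrightarrow> h (face 0 u) = h (face 0 v)"
    and con: "\<And>u v. u \<in> vertices n \<Longrightarrow> v \<in> vertices n \<Longrightarrow> h (face 1 u) = h (face 1 v) \<Longrightarrow>
      (face 1 u, face 1 v) \<in> glue (kern n f) (kern n g)"
  shows "d_prod n (kern n f) (kern n g) = kern n (\<lambda>u. h (face 1 u))"
proof (rule rel_eqI)
  fix u v
  show "(u, v) \<in> d_prod n (kern n f) (kern n g) \<longleftrightarrow> (u, v) \<in> kern n (\<lambda>u. h (face 1 u))"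
    unfolding mem_d_prod[OF kern_partition kern_partition] mem_kern
    using con glue_label[of "face 1 u" "face 1 v" "kern n f" "kern n g" h] f g mem_kern by metis
qed

section \<open>Partitions with identity strands\<close>

lemma part_kern: "a \<in> partitions n \<Longrightarrow> kern n (\<lambda>u. a `` {u}) = a"
proof (rule rel_eqI)
  fix u v assume a: "a \<in> partitions n"
  show "(u, v) \<in> kern n (\<lambda>u. a `` {u}) \<longleftrightarrow> (u, v) \<in> a"
  proof
    assume "(u, v) \<in> kern n (\<lambda>u. a `` {u})"
    then have "v \<in> vertices n" "a `` {u} = a `` {v}" unfolding mem_kern by blast+
    then show "(u, v) \<in> a" using partitionsD(2)[OF a] by blast
  next
    assume uv: "(u, v) \<in> a"
    have "a `` {u} = a `` {v}" using uv partitionsD(3,4)[OF a] by blast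
    then show "(u, v) \<in> kern n (\<lambda>u. a `` {u})"
      unfolding mem_kern using partitionsD(7,8)[OF a uv] by blast
  qed
qed

lemma class_eq:
  assumes "a \<in> partitions n" "u \<in> vertices n" "v \<in> vertices n"
  shows "a `` {u} = a `` {v} \<longleftrightarrow> (u, v) \<in> a"
  using part_kern[OF assms(1)] assms(2,3) mem_kern by metis

text \<open>A vertex on a strand carries the label of its group, twisted by \<tau> in row k; a
  vertex off J is its own label and so a singleton. With \<tau> = \<open>id\<close> this gives both
  levels of \<I>_\<nu>: groups of one strand inside, blocks outside.\<close>

definition strands :: "nat \<Rightarrow> nat set \<Rightarrow> (nat \<Rightarrow> nat) \<Rightarrow> (nat \<Rightarrow> nat) \<Rightarrow> vertex \<Rightarrow> nat + vertex"
  where "strands k J N \<tau> u =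
    (if fst u \<in> J then Inl (if snd u = k then \<tau> (N (fst u)) else N (fst u)) else Inr u)"

abbreviation unit_kern :: "nat \<Rightarrow> nat set \<Rightarrow> (nat \<Rightarrow> nat) \<Rightarrow> vertex rel"
  where "unit_kern n J N \<equiv> kern n (strands 1 J N id)"

lemma strands_id: "strands k J N id u = (if fst u \<in> J then Inl (N (fst u)) else Inr u)"
  by (simp add: strands_def)

lemma face_simps: "face 1 (i, 0) = (i, 0)" "face 1 (i, 1) = (i, 2)" "face 0 (i, 0) = (i, 1)" "face 0 (i, 1) = (i, 2)"
  by (simp_all add: skip_def)

lemma vertices_cases:
  assumes "u \<in> vertices n"
  obtains i where "i \<in> {1..n}" "u = (i, 0)" | i where "i \<in> {1..n}" "u = (i, 1)"
  using assms by (cases u) auto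

text \<open>The lower row of c already has all cuts and all identifications that
  \<open>unit_kern\<close> would introduce, so nothing changes. Used for \<I>_\<nu> itself and for
  the left factor of a factorization.\<close>

lemma d_prod_unit:
  assumes c: "c \<in> partitions n" and J: "J \<subseteq> {1..n}"
    and sing: "\<And>i u. i \<in> {1..n} - J \<Longrightarrow> (u, (i, 1)) \<in> c \<Longrightarrow> u = (i, 1)"
    and same: "\<And>i j. i \<in> J \<Longrightarrow> j \<in> J \<Longrightarrow> N i = N j \<Longrightarrow> ((i, 1), (j, 1)) \<in> c"
  shows "d_prod n c (unit_kern n J N) = c"
proof -
  let ?e = "unit_kern n J N"
  \<comment> \<open>A vertex on a strand takes the class under c of its copy in the lower row of c.
    The vertices off J in rows 1 and 2 are isolated and label themselves.\<close>
  define h :: "vertex \<Rightarrow> vertex set + vertex" where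
    "h u = (if snd u = 0 then Inl (c `` {u}) else if fst u \<in> J then Inl (c `` {(fst u, 1)})
      else Inr u)" for u
  have h1: "h (i, 1) = (if i \<in> J then Inl (c `` {(i, 1)}) else Inr (i, 1))"
    and h2: "h (i, 2) = (if i \<in> J then Inl (c `` {(i, 1)}) else Inr (i, 2))"
    and h0: "h (i, 0) = Inl (c `` {(i, 0)})" for i
    by (simp_all add: h_def)
  have good: "(face 1 u, u) \<in> glue c ?e \<and> h (face 1 u) = Inl (c `` {u})"
    if u: "u \<in> vertices n" "snd u = 0 \<or> fst u \<in> J" for u
    using u(1)
  proof (cases rule: vertices_cases)
    case (1 i)
    then show ?thesis by (simp only: face_simps glue_refl h0)
  next
    case (2 i)
    then have "i \<in> J" using u(2) by simp
    then have "((i, 1), (i, 0)) \<in> ?e" using 2 unfolding mem_kern strands_id by simp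
    from glue_right[OF this, of c] show ?thesis
      using \<open>i \<in> J\<close> unfolding 2 face_simps h2 by simp
  qed
  have bad: "\<exists>i\<in>{1..n} - J. u = (i, 1) \<and> h (face 1 u) = Inr (i, 2)"
    if u: "u \<in> vertices n" "\<not> (snd u = 0 \<or> fst u \<in> J)" for u
    using u(1)
  proof (cases rule: vertices_cases)
    case (2 i)
    then have "i \<in> {1..n} - J" using u(2) by simp
    then show ?thesis unfolding 2 face_simps h2 by auto
  qed (use u(2) in simp)
  have "d_prod n (kern n (\<lambda>u. c `` {u})) ?e = kern n (\<lambda>u. h (face 1 u))"
  proof (rule kern_prod)
    fix u v assume uv: "u \<in> vertices n" "v \<in> vertices n" "c `` {u} = c `` {v}"
    have "h x = Inl (c `` {x}) \<or> (\<exists>i\<in>{1..n} - J. x = (i, 1))" if "x \<in> vertices n" for x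
      using that by (cases rule: vertices_cases) (simp_all only: h0 h1, auto)
    moreover have "u = v" if "(\<exists>i\<in>{1..n} - J. u = (i, 1)) \<or> (\<exists>i\<in>{1..n} - J. v = (i, 1))"
      using that sing class_eq[OF c uv(1,2)] uv(3) partitionsD(3)[OF c] by metis
    ultimately show "h u = h v" using uv by metis
  next
    fix u v assume uv: "u \<in> vertices n" "v \<in> vertices n" "strands 1 J N id u = strands 1 J N id v"
    have f: "h (face 0 x) = Inl (c `` {(fst x, 1)})" if "x \<in> vertices n" "fst x \<in> J" for x
      using that(1) by (cases rule: vertices_cases) (use that(2) h1 h2 face_simps in auto)
    show "h (face 0 u) = h (face 0 v)"
    proof (cases "fst u \<in> J")
      case True
      then have v: "fst v \<in> J" "N (fst u) = N (fst v)"
        using uv(3) unfolding strands_id by (auto split: if_splits)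
      have "((fst u, 1), (fst v, 1)) \<in> c" by (rule same[OF True v])
      then have "c `` {(fst u, 1)} = c `` {(fst v, 1)}" using partitionsD(3,4)[OF c] by blast
      then show ?thesis using f[OF uv(1) True] f[OF uv(2) v(1)] by simp
    next
      case False
      then have "u = v" using uv(3) unfolding strands_id by (auto split: if_splits)
      then show ?thesis by simp
    qed
  next
    fix u v assume uv: "u \<in> vertices n" "v \<in> vertices n" "h (face 1 u) = h (face 1 v)"
    note g = partitionsD(3)[OF c]
    show "(face 1 u, face 1 v) \<in> glue (kern n (\<lambda>u. c `` {u})) ?e"
      unfolding part_kern[OF c]
    proof (cases "(snd u = 0 \<or> fst u \<in> J) \<and> (snd v = 0 \<or> fst v \<in> J)")
      case True
      then have gu: "(face 1 u, u) \<in> glue c ?e" "(face 1 v, v) \<in> glue c ?e" "c `` {u} = c `` {v}"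
        using good[OF uv(1)] good[OF uv(2)] uv(3) by simp_all
      have "(u, v) \<in> glue c ?e"
        using gu(3) class_eq[OF c uv(1,2)] glue_left by blast
      then show "(face 1 u, face 1 v) \<in> glue c ?e"
        using gu(1,2) symD[OF glue_sym[OF c kern_partition]] transD[OF glue_trans] by meson
    next
      case False
      then have "u = v" using good[OF uv(1)] good[OF uv(2)] bad[OF uv(1)] bad[OF uv(2)] uv(3)
        by (metis Inr_inject prod.inject sum.distinct(1))
      then show "(face 1 u, face 1 v) \<in> glue c ?e" by (simp add: glue_refl)
    qed
  qed
  moreover have "kern n (\<lambda>u. h (face 1 u)) = c"
  proof (rule rel_eqI)
    fix u v
    show "(u, v) \<in> kern n (\<lambda>u. h (face 1 u)) \<longleftrightarrow> (u, v) \<in> c"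
    proof (cases "u \<in> vertices n \<and> v \<in> vertices n")
      case True
      then have V: "u \<in> vertices n" "v \<in> vertices n" by blast+
      show ?thesis
      proof (cases "(snd u = 0 \<or> fst u \<in> J) \<and> (snd v = 0 \<or> fst v \<in> J)")
        case True
        then show ?thesis
          using good[OF V(1)] good[OF V(2)] V class_eq[OF c V] unfolding mem_kern by simp
      next
        case False
        then have "h (face 1 u) = h (face 1 v) \<longleftrightarrow> u = v"
          using good[OF V(1)] good[OF V(2)] bad[OF V(1)] bad[OF V(2)]
          by (metis Inr_inject prod.inject sum.distinct(1))
        moreover have "(u, v) \<in> c \<longleftrightarrow> u = v"
          using False bad[OF V(1)] bad[OF V(2)] sing partitionsD(2)[OF c V(1)] partitionsD(3)[OF c] by metis
        ultimately show ?thesis using V unfolding mem_kern by blast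
      qed
    qed (use partitionsD(7,8)[OF c] in \<open>unfold mem_kern, blast\<close>)
  qed
  ultimately show ?thesis unfolding part_kern[OF c] by simp
qed

lemma unit_idem:
  assumes "J \<subseteq> {1..n}"
  shows "d_prod n (unit_kern n J N) (unit_kern n J N) = unit_kern n J N"
proof (rule d_prod_unit[OF kern_partition assms])
  show "u = (i, 1)" if "i \<in> {1..n} - J" "(u, (i, 1)) \<in> unit_kern n J N" for i u
    using that unfolding mem_kern strands_id by (auto split: if_splits)
  show "((i, 1), (j, 1)) \<in> unit_kern n J N" if "i \<in> J" "j \<in> J" "N i = N j" for i j
    using that assms unfolding mem_kern strands_id by auto
qed

text \<open>The labels of the two factors of \<open>a\<close>: row \<open>k\<close> keeps the parts of \<open>a\<close>, and in the
  other row the strand \<open>i \<in> J\<close> is attached to the propagating part \<open>\<phi> i\<close>.\<close>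

definition half :: "nat \<Rightarrow> vertex rel \<Rightarrow> nat set \<Rightarrow> (nat \<Rightarrow> vertex set) \<Rightarrow> vertex \<Rightarrow> vertex set + vertex"
  where "half k a J \<phi> u = (if snd u = k then Inl (a `` {u}) else if fst u \<in> J then Inl (\<phi> (fst u)) else Inr u)"

lemma factor_unit:
  assumes J: "J \<subseteq> {1..n}" and N: "\<And>i j. i \<in> J \<Longrightarrow> j \<in> J \<Longrightarrow> N i = N j \<Longrightarrow> \<phi> i = \<phi> j"
  shows "d_prod n (kern n (half 0 a J \<phi>)) (unit_kern n J N) = kern n (half 0 a J \<phi>)"
proof (rule d_prod_unit[OF kern_partition J])
  show "u = (i, 1)" if "i \<in> {1..n} - J" "(u, (i, 1)) \<in> kern n (half 0 a J \<phi>)" for i u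
    using that unfolding mem_kern half_def by (auto split: if_splits)
  show "((i, 1), (j, 1)) \<in> kern n (half 0 a J \<phi>)" if "i \<in> J" "j \<in> J" "N i = N j" for i j
    using that N[OF that] J unfolding mem_kern half_def by auto
qed

text \<open>Only a part of a that meets both rows has to cross the middle row. Since \<phi> is onto
  the propagating parts, some strand is attached to that part in both halves and reconnects
  them.\<close>

lemma factor_prod:
  assumes a: "a \<in> partitions n" and J: "J \<subseteq> {1..n}" and \<phi>: "\<phi> ` J = prop_parts n a"
  shows "d_prod n (kern n (half 0 a J \<phi>)) (kern n (half 1 a J \<phi>)) = a"
proof -
  let ?x = "kern n (half 0 a J \<phi>)" and ?y = "kern n (half 1 a J \<phi>)"
  define h :: "vertex \<Rightarrow> vertex set + vertex" where
    "h u = (if snd u = 1 then if fst u \<in> J then Inl (\<phi> (fst u)) else Inr u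
      else Inl (a `` {(fst u, if snd u = 2 then 1 else 0)}))" for u
  have h1: "h (i, 1) = (if i \<in> J then Inl (\<phi> i) else Inr (i, 1))"
    and h2: "h (i, 2) = Inl (a `` {(i, 1)})" and h0: "h (i, 0) = Inl (a `` {(i, 0)})" for i
    by (simp_all add: h_def)
  have "d_prod n ?x ?y = kern n (\<lambda>u. h (face 1 u))"
  proof (rule kern_prod)
    fix u v assume uv: "u \<in> vertices n" "v \<in> vertices n" "half 0 a J \<phi> u = half 0 a J \<phi> v"
    have "half 0 a J \<phi> x = h x" if "x \<in> vertices n" for x
      using that by (cases rule: vertices_cases) (simp_all add: half_def h_def)
    then show "h u = h v" using uv by metis
  next
    fix u v assume uv: "u \<in> vertices n" "v \<in> vertices n" "half 1 a J \<phi> u = half 1 a J \<phi> v"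
    have "h (face 0 x) = (case half 1 a J \<phi> x of Inl q \<Rightarrow> Inl q | Inr w \<Rightarrow> Inr (fst w, 1))"
      if "x \<in> vertices n" for x
      using that by (cases rule: vertices_cases) (simp_all only: face_simps h1 h2, simp_all add: half_def)
    then show "h (face 0 u) = h (face 0 v)" using uv by metis
  next
    fix u v assume uv: "u \<in> vertices n" "v \<in> vertices n" "h (face 1 u) = h (face 1 v)"
    note sym = symD[OF glue_sym[OF kern_partition kern_partition]]
    have hf: "h (face 1 x) = Inl (a `` {x})" if "x \<in> vertices n" for x
      using that by (cases rule: vertices_cases) (simp_all only: face_simps h0 h2)
    have auv: "(u, v) \<in> a" using uv hf class_eq[OF a uv(1,2)] by simp
    have mixed: "(face 1 (i, 0), face 1 (j, 1)) \<in> glue ?x ?y"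
      if ij: "((i, 0), (j, 1)) \<in> a" "i \<in> {1..n}" "j \<in> {1..n}" for i j
    proof -
      have "a `` {(i, 0)} \<in> prop_parts n a"
      proof -
        have "(i, 0) \<in> row n 0" "(j, 1) \<in> row n (1 - 0)" using ij by simp_all
        then show ?thesis unfolding mem_prop_parts[OF a le0] using ij(1) by blast
      qed
      then obtain m where m: "m \<in> J" "\<phi> m = a `` {(i, 0)}" using \<phi> by (metis imageE)
      have "a `` {(i, 0)} = a `` {(j, 1)}" using ij class_eq[OF a] by simp
      then have "((i, 0), (m, 1)) \<in> ?x" "((m, 0), (j, 1)) \<in> ?y"
        using ij m J unfolding mem_kern half_def by auto
      from glue_left[OF this(1)] glue_right[OF this(2)] show ?thesis
        unfolding face_simps using transD[OF glue_trans] by metis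
    qed
    show "(face 1 u, face 1 v) \<in> glue ?x ?y"
      using uv(1)
    proof (cases rule: vertices_cases)
      case u: (1 i)
      show ?thesis
        using uv(2)
      proof (cases rule: vertices_cases)
        case v: (1 j)
        have "(u, v) \<in> ?x" using auv class_eq[OF a uv(1,2)] uv u v unfolding mem_kern half_def by simp
        from glue_left[OF this] show ?thesis unfolding u v face_simps .
      next
        case v: (2 j)
        then show ?thesis using mixed auv u by simp
      qed
    next
      case u: (2 i)
      show ?thesis
        using uv(2)
      proof (cases rule: vertices_cases)
        case v: (1 j)
        then show ?thesis using sym[OF mixed] partitionsD(3)[OF a auv] u by simp
      next
        case v: (2 j)
        have "(u, v) \<in> ?y" using auv class_eq[OF a uv(1,2)] uv u v unfolding mem_kern half_def by simp
        from glue_right[OF this] show ?thesis unfolding u v face_simps .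
      qed
    qed
  qed
  also have "\<dots> = kern n (\<lambda>u. a `` {u})"
  proof (rule rel_eqI)
    have hf: "h (face 1 x) = Inl (a `` {x})" if "x \<in> vertices n" for x
      using that by (cases rule: vertices_cases) (simp_all only: face_simps h0 h2)
    show "(u, v) \<in> kern n (\<lambda>u. h (face 1 u)) \<longleftrightarrow> (u, v) \<in> kern n (\<lambda>u. a `` {u})" for u v
      unfolding mem_kern using hf by (metis sum.inject(1))
  qed
  finally show ?thesis unfolding part_kern[OF a] .
qed

text \<open>In the product the upper vertex w i, with label N (w i) = \<tau> (N i), is joined to the
  lower vertex i; twisting the labels of the lower row by \<tau> has the same effect. This
  recognises the normal form of \<open>matching\<close> as a product.\<close>

lemma perm_unit:
  assumes w: "w permutes {1..n}" and J: "\<And>i. w i \<in> J \<longleftrightarrow> i \<in> J"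
    and N: "\<And>i. i \<in> J \<Longrightarrow> N (w i) = \<tau> (N i)" and inj: "inj_on \<tau> (N ` J)"
  shows "d_prod n (perm_partition n w) (unit_kern n J N) = kern n (strands 1 J N \<tau>)"
proof (rule rel_eqI)
  fix u v
  let ?l = "d_prod n (perm_partition n w) (unit_kern n J N)"
  note p = perm_partition_in[OF w]
  show "(u, v) \<in> ?l \<longleftrightarrow> (u, v) \<in> kern n (strands 1 J N \<tau>)"
  proof (cases "u \<in> vertices n \<and> v \<in> vertices n")
    case True
    have "\<exists>u'. u = move_top w u'" for u
      using permutes_surj[OF w] unfolding move_top_def
      by (intro exI[of _ "(if snd u = 0 then inv_into UNIV w (fst u) else fst u, snd u)"])
        (simp add: surj_f_inv_f prod_eq_iff)
    then obtain x y where xy: "u = move_top w x" "v = move_top w y" by metis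
    then have V: "x \<in> vertices n" "y \<in> vertices n" using True move_vertices(1)[OF w] by simp_all
    have good: "strands 1 J N \<tau> (move_top w z) = Inl (\<tau> (N (fst z)))" if "z \<in> vertices n" "fst z \<in> J" for z
      using that(1) by (cases rule: vertices_cases) (use that(2) J N in \<open>auto simp: strands_def move_top_def\<close>)
    have bad: "strands 1 J N \<tau> (move_top w z) = Inr (move_top w z)" if "fst z \<notin> J" for z
      using that J[of "fst z"] by (simp add: strands_def move_top_def)
    have mi: "move_top w x = move_top w y \<longleftrightarrow> x = y"
      using permutes_inj[OF w] by (cases x; cases y) (auto simp: move_top_def dest: injD)
    have "strands 1 J N \<tau> (move_top w x) = strands 1 J N \<tau> (move_top w y) \<longleftrightarrow>
        strands 1 J N id x = strands 1 J N id y"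
      using good[OF V(1)] good[OF V(2)] bad[of x] bad[of y] mi inj_on_eq_iff[OF inj, of "N (fst x)" "N (fst y)"]
      by (cases "fst x \<in> J"; cases "fst y \<in> J") (simp_all add: strands_id)
    then show ?thesis
      using True V perm_left[OF w kern_partition V] unfolding xy mem_kern by simp
  qed (use partitionsD(7,8)[OF d_prod_partition[OF p kern_partition]] in \<open>unfold mem_kern, blast\<close>)
qed

lemma perm_unit_commute:
  assumes w: "w permutes {1..n}" and J: "\<And>i. w i \<in> J \<longleftrightarrow> i \<in> J"
    and N: "\<And>i j. i \<in> J \<Longrightarrow> j \<in> J \<Longrightarrow> N (w i) = N (w j) \<longleftrightarrow> N i = N j"
  shows "d_prod n (perm_partition n w) (unit_kern n J N) = d_prod n (unit_kern n J N) (perm_partition n w)"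
proof (rule rel_eqI)
  fix u v
  let ?l = "d_prod n (perm_partition n w) (unit_kern n J N)"
  let ?r = "d_prod n (unit_kern n J N) (perm_partition n w)"
  note p = perm_partition_in[OF w]
  show "(u, v) \<in> ?l \<longleftrightarrow> (u, v) \<in> ?r"
  proof (cases "u \<in> vertices n \<and> v \<in> vertices n")
    case True
    have "\<exists>u'. u = move_top w u'" for u
      using permutes_surj[OF w] unfolding move_top_def
      by (intro exI[of _ "(if snd u = 0 then inv_into UNIV w (fst u) else fst u, snd u)"])
        (simp add: surj_f_inv_f prod_eq_iff)
    then obtain x y where xy: "u = move_top w x" "v = move_top w y" by metis
    then have V: "x \<in> vertices n" "y \<in> vertices n" using True move_vertices(1)[OF w] by simp_all
    have move: "move_bot w (move_top w z) = (w (fst z), snd z)" if "z \<in> vertices n" for z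
      using that by (cases rule: vertices_cases) (simp_all add: move_top_def move_bot_def)
    have V': "(w (fst x), snd x) \<in> vertices n" "(w (fst y), snd y) \<in> vertices n"
      using V permutes_in_image[OF w] by (cases x; cases y; auto)+
    have wi: "w i = w j \<longleftrightarrow> i = j" for i j using permutes_inj[OF w] by (auto dest: injD)
    have "(u, v) \<in> ?l \<longleftrightarrow> strands 1 J N id x = strands 1 J N id y"
      using V perm_left[OF w kern_partition V] unfolding xy mem_kern by simp
    also have "\<dots> \<longleftrightarrow> strands 1 J N id (w (fst x), snd x) = strands 1 J N id (w (fst y), snd y)"
      using J N wi by (auto simp: strands_id prod_eq_iff)
    also have "\<dots> \<longleftrightarrow> (move_bot w u, move_bot w v) \<in> unit_kern n J N"
      unfolding xy move[OF V(1)] move[OF V(2)] mem_kern using V' by blast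
    also have "\<dots> \<longleftrightarrow> (u, v) \<in> ?r"
      using True by (intro perm_right[OF w kern_partition, symmetric]) blast+
    finally show ?thesis .
  qed (use partitionsD(7,8)[OF d_prod_partition[OF p kern_partition]]
      partitionsD(7,8)[OF d_prod_partition[OF kern_partition p]] in blast)
qed

text \<open>The product remembers w up to the grouping by N, because the part of the lower vertex i
  shows where w sends its strand.\<close>

lemma perm_unit_label:
  assumes w: "w permutes {1..n}" and v: "v permutes {1..n}" and J: "J \<subseteq> {1..n}" and i: "i \<in> J"
    and eq: "d_prod n (perm_partition n w) (unit_kern n J N) = d_prod n (perm_partition n v) (unit_kern n J N)"
  shows "inv_into UNIV v (w i) \<in> J \<and> N (inv_into UNIV v (w i)) = N i"
proof -
  let ?j = "inv_into UNIV v (w i)"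
  have in1: "i \<in> {1..n}" using i J by blast
  have V: "(i, 0) \<in> vertices n" "(i, 1) \<in> vertices n" using in1 by auto
  have j: "?j \<in> {1..n}" "v ?j = w i"
    using in1 permutes_in_image[OF w] permutes_in_image[OF permutes_inv[OF v]] permutes_inverses[OF v] by blast+
  have V': "(?j, 0) \<in> vertices n" using j(1) by auto
  have "((i, 0), (i, 1)) \<in> unit_kern n J N" using V i unfolding mem_kern strands_id by simp
  then have "(move_top w (i, 0), move_top w (i, 1)) \<in> d_prod n (perm_partition n v) (unit_kern n J N)"
    using perm_left[OF w kern_partition V] eq by blast
  moreover have "move_top w (i, 0) = move_top v (?j, 0)" "move_top w (i, 1) = move_top v (i, 1)"
    using j(2) by (simp_all add: move_top_def)
  ultimately have "(move_top v (?j, 0), move_top v (i, 1)) \<in> d_prod n (perm_partition n v) (unit_kern n J N)"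
    by metis
  then have "((?j, 0), (i, 1)) \<in> unit_kern n J N"
    by (rule perm_left[OF v kern_partition V' V(2), THEN iffD1])
  then show ?thesis using i unfolding mem_kern strands_id by (auto split: if_splits)
qed

lemma matching:
  assumes c: "c \<in> partitions n" and J: "J \<subseteq> {1..n}"
    and same: "\<And>i j k. i \<in> J \<Longrightarrow> j \<in> J \<Longrightarrow> N i = N j \<Longrightarrow> k \<le> 1 \<Longrightarrow> ((i, k), (j, k)) \<in> c"
    and sing: "\<And>i k u. i \<in> {1..n} - J \<Longrightarrow> k \<le> 1 \<Longrightarrow> ((i, k), u) \<in> c \<Longrightarrow> u = (i, k)"
    and card: "card (prop_parts n c) = card (N ` J)"
  obtains \<tau> where "bij_betw \<tau> (N ` J) (N ` J)" "c = kern n (strands 1 J N \<tau>)"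
proof -
  have finJ: "finite J" using J by (rule finite_subset) simp
  let ?M = "N ` J"
  define r where "r m = (SOME j. j \<in> J \<and> N j = m)" for m
  have r: "r m \<in> J \<and> N (r m) = m" if "m \<in> ?M" for m
    unfolding r_def by (rule someI_ex) (use that in blast)
  define cl where "cl k m = c `` {(r m, k)}" for k :: nat and m
  have cl: "c `` {(i, k)} = cl k (N i)" if "i \<in> J" "k \<le> 1" for i k
  proof -
    have "((i, k), (r (N i), k)) \<in> c" using r[of "N i"] that by (intro same) auto
    then show ?thesis unfolding cl_def using partitionsD(3,4)[OF c] by blast
  qed
  have sub: "prop_parts n c \<subseteq> cl k ` ?M" if k: "k \<le> 1" for k
  proof
    fix q assume "q \<in> prop_parts n c"
    then obtain z z0 where z: "z \<in> row n k" "z0 \<in> row n (1 - k)" "(z, z0) \<in> c" "q = c `` {z}"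
      unfolding mem_prop_parts[OF c k] by blast
    obtain i where i: "z = (i, k)" "i \<in> {1..n}" using z(1) by (cases z) auto
    have "i \<in> J"
    proof (rule ccontr)
      assume "i \<notin> J"
      then have "z0 = (i, k)" using sing[of i k z0] i k z(3) by blast
      then have "k = 1 - k" using z(2) by auto
      then show False using k by presburger
    qed
    then show "q \<in> cl k ` ?M" using cl[OF _ k] z(4) i(1) by blast
  qed
  have eq: "prop_parts n c = cl k ` ?M" and inj: "inj_on (cl k) ?M" if k: "k \<le> 1" for k
  proof -
    have le: "card (cl k ` ?M) \<le> card (prop_parts n c)" using card card_image_le[OF finite_imageI[OF finJ]] by simp
    show "prop_parts n c = cl k ` ?M"
      by (rule card_seteq) (use finJ sub[OF k] le in auto)
    then show "inj_on (cl k) ?M" using card finJ by (intro eq_card_imp_inj_on) auto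
  qed
  \<comment> \<open>Group m in the lower row and group \<tau> m in the upper row belong to the same
    part of c.\<close>
  define \<tau> where "\<tau> = the_inv_into ?M (cl 0) \<circ> cl 1"
  have b0: "bij_betw (cl 0) ?M (prop_parts n c)" and b1: "bij_betw (cl 1) ?M (prop_parts n c)"
    using eq[of 0] eq[of 1] inj[of 0] inj[of 1] by (simp_all add: bij_betw_def)
  have bij: "bij_betw \<tau> ?M ?M"
    unfolding \<tau>_def using b1 bij_betw_the_inv_into[OF b0] by (rule bij_betw_trans)
  have cl\<tau>: "cl 0 (\<tau> m) = cl 1 m" if "m \<in> ?M" for m
    unfolding \<tau>_def comp_def
    by (rule f_the_inv_into_f) (use inj[of 0] that eq[of 0] eq[of 1] in auto)
  have good: "\<exists>m\<in>?M. strands 1 J N \<tau> u = Inl m \<and> c `` {u} = cl 0 m"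
    if u: "u \<in> vertices n" "fst u \<in> J" for u
    using u(1)
  proof (cases rule: vertices_cases)
    case (1 i)
    then show ?thesis using cl[of i 0] u(2) by (intro bexI[of _ "N i"]) (auto simp: strands_def)
  next
    case (2 i)
    have "\<tau> (N i) \<in> ?M" using bij u(2) 2 by (auto simp: bij_betw_def)
    then show ?thesis
      using cl[of i 1] u(2) 2 cl\<tau>[of "N i"] by (intro bexI[of _ "\<tau> (N i)"]) (auto simp: strands_def)
  qed
  have bad: "c `` {u} = {u} \<and> strands 1 J N \<tau> u = Inr u" if u: "u \<in> vertices n" "fst u \<notin> J" for u
  proof -
    have "w = u" if "(u, w) \<in> c" for w
      using sing[of "fst u" "snd u" w] u that by (cases u) auto
    then show ?thesis using partitionsD(2)[OF c u(1)] u(2) by (auto simp: strands_def)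
  qed
  have "c = kern n (strands 1 J N \<tau>)"
  proof (rule rel_eqI)
    fix u v
    show "(u, v) \<in> c \<longleftrightarrow> (u, v) \<in> kern n (strands 1 J N \<tau>)"
    proof (cases "u \<in> vertices n \<and> v \<in> vertices n")
      case True
      then have V: "u \<in> vertices n" "v \<in> vertices n" by blast+
      have "c `` {u} = c `` {v} \<longleftrightarrow> strands 1 J N \<tau> u = strands 1 J N \<tau> v"
      proof (cases "fst u \<in> J \<and> fst v \<in> J")
        case True
        then obtain m m' where "m \<in> ?M" "strands 1 J N \<tau> u = Inl m" "c `` {u} = cl 0 m"
          "m' \<in> ?M" "strands 1 J N \<tau> v = Inl m'" "c `` {v} = cl 0 m'"
          using good[OF V(1)] good[OF V(2)] by blast
        then show ?thesis using inj_on_eq_iff[OF inj[of 0]] by simp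
      next
        case False
        have "c `` {x} \<noteq> {y}" if "x \<in> vertices n" "y \<in> vertices n" "fst x \<in> J" "fst y \<notin> J" for x y
        proof
          assume "c `` {x} = {y}"
          then have "x = y" using partitionsD(2)[OF c that(1)] by blast
          then show False using that(3,4) by simp
        qed
        then show ?thesis
          using False good[OF V(1)] good[OF V(2)] bad[OF V(1)] bad[OF V(2)] V
          by (metis singleton_inject sum.distinct(1) sum.inject(2))
      qed
      then show ?thesis using V class_eq[OF c V] unfolding mem_kern by blast
    qed (use partitionsD(7,8)[OF c] in \<open>unfold mem_kern, blast\<close>)
  qed
  then show thesis using bij that by blast
qed

section \<open>Blocks of an index\<close>

lemma env_take_Suc: "m < length \<nu> \<Longrightarrow> env (take (Suc m) \<nu>) = env (take m \<nu>) + max 1 (\<nu> ! m)"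
  by (simp add: env_def take_Suc_conv_app_nth)

lemma env_take_mono: "m \<le> m' \<Longrightarrow> env (take m \<nu>) \<le> env (take m' \<nu>)"
proof (rule lift_Suc_mono_le[of "\<lambda>m. env (take m \<nu>)"])
  show "env (take m \<nu>) \<le> env (take (Suc m) \<nu>)" for m
    by (cases "m < length \<nu>") (simp_all add: env_take_Suc)
qed

text \<open>Inverse to \<open>block\<close>: by \<open>block_eq\<close> the blocks are its fibres,
  which presents the outer level of \<I>_\<nu> as a \<open>unit_kern\<close>.\<close>

definition block_index :: "nat list \<Rightarrow> nat \<Rightarrow> nat"
  where "block_index \<nu> i = (LEAST m. i \<le> env (take (Suc m) \<nu>))"

lemma block_index:
  assumes "i \<in> {1..env \<nu>}"
  shows "block_index \<nu> i < length \<nu>" "i \<in> block \<nu> (block_index \<nu> i)"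
proof -
  let ?m = "block_index \<nu> i"
  have "\<nu> \<noteq> []" using assms by (auto simp: env_def)
  then have l: "Suc (length \<nu> - 1) = length \<nu>" by simp
  have last: "i \<le> env (take (Suc (length \<nu> - 1)) \<nu>)" unfolding l using assms by simp
  have le: "i \<le> env (take (Suc ?m) \<nu>)"
    unfolding block_index_def by (rule LeastI[of "\<lambda>m. i \<le> env (take (Suc m) \<nu>)", OF last])
  have "?m \<le> length \<nu> - 1"
    unfolding block_index_def by (rule Least_le[of "\<lambda>m. i \<le> env (take (Suc m) \<nu>)", OF last])
  then show "?m < length \<nu>" using l by linarith
  have "env (take ?m \<nu>) < i"
  proof (cases ?m)
    case 0
    then show ?thesis using assms by (simp add: env_def)
  next
    case (Suc m)
    then have "\<not> i \<le> env (take (Suc m) \<nu>)"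
      unfolding block_index_def by (metis lessI not_less_Least)
    then show ?thesis using Suc by simp
  qed
  then show "i \<in> block \<nu> ?m" using le by (simp add: block_def)
qed

lemma block_index_eq:
  assumes "m < length \<nu>" "i \<in> block \<nu> m"
  shows "block_index \<nu> i = m"
  unfolding block_index_def
proof (rule Least_equality)
  show "i \<le> env (take (Suc m) \<nu>)" using assms(2) by (simp add: block_def)
  show "m \<le> y" if "i \<le> env (take (Suc y) \<nu>)" for y
  proof (rule ccontr)
    assume "\<not> m \<le> y"
    then have "env (take (Suc y) \<nu>) \<le> env (take m \<nu>)" by (intro env_take_mono) simp
    then show False using that assms(2) by (simp add: block_def)
  qed
qed

lemma block_subset: "m < length \<nu> \<Longrightarrow> block \<nu> m \<subseteq> {1..env \<nu>}"
  using env_take_mono[of "Suc m" "length \<nu>" \<nu>] by (auto simp: block_def)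

lemma block_eq: "m < length \<nu> \<Longrightarrow> block \<nu> m = {i \<in> {1..env \<nu>}. block_index \<nu> i = m}"
  using block_index block_index_eq block_subset by blast

lemma card_block: "m < length \<nu> \<Longrightarrow> card (block \<nu> m) = max 1 (\<nu> ! m)"
  by (simp add: block_def env_take_Suc)

lemma block_index_image: "block_index \<nu> ` {1..env \<nu>} = {..<length \<nu>}"
proof (intro equalityI subsetI)
  fix m assume "m \<in> {..<length \<nu>}"
  then have m: "m < length \<nu>" by simp
  have "card (block \<nu> m) \<noteq> 0" using card_block[OF m] by simp
  then obtain i where "i \<in> block \<nu> m" by (metis card.empty ex_in_conv)
  then show "m \<in> block_index \<nu> ` {1..env \<nu>}" unfolding block_eq[OF m] by blast
qed (use block_index(1) in auto)

text \<open>An entry 0 still has a block of one vertex, but that vertex carries no inner strand.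
  Hence the number of inner strands in a block is the entry itself and not its maximum with
  1.\<close>

definition inner_set :: "nat list \<Rightarrow> nat set"
  where "inner_set \<nu> = {i \<in> {1..env \<nu>}. \<nu> ! block_index \<nu> i \<ge> 1}"

lemma inner_set_subset: "inner_set \<nu> \<subseteq> {1..env \<nu>}"
  by (auto simp: inner_set_def)

lemma card_inner_block:
  assumes "m < length \<nu>"
  shows "card {i \<in> inner_set \<nu>. block_index \<nu> i = m} = \<nu> ! m"
proof (cases "\<nu> ! m = 0")
  case True
  then have "{i \<in> inner_set \<nu>. block_index \<nu> i = m} = {}" by (auto simp: inner_set_def)
  then show ?thesis unfolding True by (simp only: card.empty)
next
  case False
  then have "{i \<in> inner_set \<nu>. block_index \<nu> i = m} = block \<nu> m"
    unfolding block_eq[OF assms] by (auto simp: inner_set_def)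
  then show ?thesis using card_block[OF assms] False by simp
qed

lemma card_inner_set: "card (inner_set \<nu>) = sum_list \<nu>"
proof -
  have fin: "finite (inner_set \<nu>)" by (simp add: inner_set_def)
  have "block_index \<nu> ` inner_set \<nu> \<subseteq> {..<length \<nu>}"
    using inner_set_subset[of \<nu>] block_index_image[of \<nu>] by blast
  from sum_fun_comp[OF fin _ this, of "\<lambda>_. 1 :: nat"]
  have "card (inner_set \<nu>) = (\<Sum>m<length \<nu>. card {i \<in> inner_set \<nu>. block_index \<nu> i = m})" by simp
  also have "\<dots> = (\<Sum>m<length \<nu>. \<nu> ! m)"
    by (intro sum.cong) (simp_all add: card_inner_block)
  finally show ?thesis by (simp add: sum_list_sum_nth atLeast0LessThan)
qed

lemma mem_rel_of_parts: "(u, v) \<in> rel_of_parts C \<longleftrightarrow> (\<exists>X\<in>C. u \<in> X \<and> v \<in> X)"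
  by (auto simp: rel_of_parts_def)

text \<open>Brings the inner level into the common form, each strand being its own group;
  \<open>index_outer_eq\<close> does so for the outer level with strands grouped by blocks.\<close>

lemma index_inner_eq:
  assumes "env \<nu> \<le> n"
  shows "index_inner n \<nu> = unit_kern n (inner_set \<nu>) id"
proof (rule rel_eqI)
  fix u v :: vertex
  let ?J = "inner_set \<nu>"
  have J: "\<Union>{block \<nu> i | i. i < length \<nu> \<and> \<nu> ! i \<ge> 1} = ?J"
  proof (intro equalityI subsetI)
    fix j assume "j \<in> \<Union>{block \<nu> i | i. i < length \<nu> \<and> \<nu> ! i \<ge> 1}"
    then obtain i where i: "i < length \<nu>" "\<nu> ! i \<ge> 1" "j \<in> block \<nu> i" by blast
    then show "j \<in> ?J" unfolding block_eq[OF i(1)] inner_set_def by blast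
  next
    fix j assume "j \<in> ?J"
    then have "j \<in> {1..env \<nu>}" "\<nu> ! block_index \<nu> j \<ge> 1" by (auto simp: inner_set_def)
    then show "j \<in> \<Union>{block \<nu> i | i. i < length \<nu> \<and> \<nu> ! i \<ge> 1}" using block_index by blast
  qed
  have 1: "(\<exists>X\<in>{{(j, 0), (j, 1)} | j. j \<in> ?J}. u \<in> X \<and> v \<in> X) \<longleftrightarrow>
      (\<exists>j\<in>?J. u \<in> {(j, 0), (j, 1)} \<and> v \<in> {(j, 0), (j, 1)})"
    by blast
  have 2: "(\<exists>X\<in>{{(j, l)} | j l. j \<in> {1..n} - ?J \<and> l \<in> {0, 1}}. u \<in> X \<and> v \<in> X) \<longleftrightarrow>
      (\<exists>j\<in>{1..n} - ?J. \<exists>l\<in>{0, 1}. u = (j, l) \<and> v = (j, l))"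
    by blast
  have "(u, v) \<in> index_inner n \<nu> \<longleftrightarrow>
      (\<exists>j\<in>?J. u \<in> {(j, 0), (j, 1)} \<and> v \<in> {(j, 0), (j, 1)}) \<or>
      (\<exists>j\<in>{1..n} - ?J. \<exists>l\<in>{0, 1}. u = (j, l) \<and> v = (j, l))"
    unfolding index_inner_def Let_def mem_rel_of_parts J bex_Un 1 2 ..
  also have "\<dots> \<longleftrightarrow> (u, v) \<in> unit_kern n ?J id"
  proof
    assume "(\<exists>j\<in>?J. u \<in> {(j, 0), (j, 1)} \<and> v \<in> {(j, 0), (j, 1)}) \<or>
      (\<exists>j\<in>{1..n} - ?J. \<exists>l\<in>{0, 1}. u = (j, l) \<and> v = (j, l))"
    then show "(u, v) \<in> unit_kern n ?J id"
    proof
      assume "\<exists>j\<in>?J. u \<in> {(j, 0), (j, 1)} \<and> v \<in> {(j, 0), (j, 1)}"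
      then obtain j where j: "j \<in> ?J" "u \<in> {(j, 0), (j, 1)}" "v \<in> {(j, 0), (j, 1)}" by blast
      then have "j \<in> {1..n}" using inner_set_subset[of \<nu>] assms by auto
      then show ?thesis using j unfolding mem_kern strands_id by auto
    next
      assume "\<exists>j\<in>{1..n} - ?J. \<exists>l\<in>{0, 1}. u = (j, l) \<and> v = (j, l)"
      then show ?thesis unfolding mem_kern by auto
    qed
  next
    assume "(u, v) \<in> unit_kern n ?J id"
    then have *: "u \<in> vertices n" "v \<in> vertices n" "strands 1 ?J id id u = strands 1 ?J id id v"
      unfolding mem_kern by blast+
    have uv: "fst u \<in> {1..n}" "u = (fst u, 0) \<or> u = (fst u, 1)" "v = (fst v, 0) \<or> v = (fst v, 1)"
      using *(1,2) by (cases u; cases v; auto)+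
    show "(\<exists>j\<in>?J. u \<in> {(j, 0), (j, 1)} \<and> v \<in> {(j, 0), (j, 1)}) \<or>
      (\<exists>j\<in>{1..n} - ?J. \<exists>l\<in>{0, 1}. u = (j, l) \<and> v = (j, l))"
    proof (cases "fst u \<in> ?J")
      case True
      then have "fst v = fst u" using *(3) unfolding strands_id by (auto split: if_splits)
      then show ?thesis using uv True by auto
    next
      case False
      then have "v = u" using *(3) unfolding strands_id by (auto split: if_splits)
      then show ?thesis using uv(1,2) False by (metis DiffI insertI1 insertI2)
    qed
  qed
  finally show "(u, v) \<in> index_inner n \<nu> \<longleftrightarrow> (u, v) \<in> unit_kern n ?J id" .
qed

lemma index_outer_eq:
  assumes "env \<nu> \<le> n"
  shows "index_outer n \<nu> = unit_kern n {1..env \<nu>} (block_index \<nu>)"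
proof (rule rel_eqI)
  fix u v :: vertex
  let ?J = "{1..env \<nu>}"
  have "(u, v) \<in> index_outer n \<nu> \<longleftrightarrow>
      (\<exists>i<length \<nu>. u \<in> block \<nu> i \<times> {0, 1} \<and> v \<in> block \<nu> i \<times> {0, 1}) \<or>
      (\<exists>j l. env \<nu> < j \<and> j \<le> n \<and> l \<in> {0, 1} \<and> u = (j, l) \<and> v = (j, l))"
    unfolding index_outer_def mem_rel_of_parts by blast
  also have "\<dots> \<longleftrightarrow> (u, v) \<in> unit_kern n ?J (block_index \<nu>)"
  proof
    assume "(\<exists>i<length \<nu>. u \<in> block \<nu> i \<times> {0, 1} \<and> v \<in> block \<nu> i \<times> {0, 1}) \<or>
      (\<exists>j l. env \<nu> < j \<and> j \<le> n \<and> l \<in> {0, 1} \<and> u = (j, l) \<and> v = (j, l))"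
    then show "(u, v) \<in> unit_kern n ?J (block_index \<nu>)"
    proof
      assume "\<exists>i<length \<nu>. u \<in> block \<nu> i \<times> {0, 1} \<and> v \<in> block \<nu> i \<times> {0, 1}"
      then obtain i where i: "i < length \<nu>" "fst u \<in> block \<nu> i" "fst v \<in> block \<nu> i"
        "snd u \<in> {0, 1}" "snd v \<in> {0, 1}" by auto
      then have J: "fst u \<in> ?J" "fst v \<in> ?J" "block_index \<nu> (fst u) = block_index \<nu> (fst v)"
        unfolding block_eq[OF i(1)] by auto
      then have "u \<in> vertices n" "v \<in> vertices n" using i(4,5) assms by (cases u; cases v; auto)+
      then show ?thesis using J unfolding mem_kern strands_id by simp
    next
      assume "\<exists>j l. env \<nu> < j \<and> j \<le> n \<and> l \<in> {0, 1} \<and> u = (j, l) \<and> v = (j, l)"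
      then show ?thesis unfolding mem_kern by auto
    qed
  next
    assume "(u, v) \<in> unit_kern n ?J (block_index \<nu>)"
    then have *: "u \<in> vertices n" "v \<in> vertices n"
      "strands 1 ?J (block_index \<nu>) id u = strands 1 ?J (block_index \<nu>) id v"
      unfolding mem_kern by blast+
    have uv: "fst u \<in> {1..n}" "snd u \<in> {0, 1}" "snd v \<in> {0, 1}"
      using *(1,2) by (cases u; cases v; auto)+
    show "(\<exists>i<length \<nu>. u \<in> block \<nu> i \<times> {0, 1} \<and> v \<in> block \<nu> i \<times> {0, 1}) \<or>
      (\<exists>j l. env \<nu> < j \<and> j \<le> n \<and> l \<in> {0, 1} \<and> u = (j, l) \<and> v = (j, l))"
    proof (cases "fst u \<in> ?J")
      case True
      then have v: "fst v \<in> ?J" "block_index \<nu> (fst u) = block_index \<nu> (fst v)"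
        using *(3) unfolding strands_id by (auto split: if_splits)
      have "u \<in> block \<nu> (block_index \<nu> (fst u)) \<times> {0, 1}"
        "v \<in> block \<nu> (block_index \<nu> (fst u)) \<times> {0, 1}"
        using uv block_index(2)[OF True] block_index(2)[OF v(1)] v(2) by (simp_all add: mem_Times_iff)
      then show ?thesis using block_index(1)[OF True] by blast
    next
      case False
      then have "v = u" using *(3) unfolding strands_id by (auto split: if_splits)
      then show ?thesis proof -
        have "env \<nu> < fst u \<and> fst u \<le> n \<and> snd u \<in> {0, 1} \<and> u = (fst u, snd u) \<and> v = (fst u, snd u)"
          using uv(1,2) False \<open>v = u\<close> by auto
        then show ?thesis by blast
      qed
    qed
  qed
  finally show "(u, v) \<in> index_outer n \<nu> \<longleftrightarrow> (u, v) \<in> unit_kern n ?J (block_index \<nu>)" .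
qed

lemma unit_subset:
  assumes "env \<nu> \<le> n"
  shows "unit_kern n (inner_set \<nu>) id \<subseteq> unit_kern n {1..env \<nu>} (block_index \<nu>)"
proof (rule subrelI)
  fix u v assume *: "(u, v) \<in> unit_kern n (inner_set \<nu>) id"
  then have s: "strands 1 (inner_set \<nu>) id id u = strands 1 (inner_set \<nu>) id id v"
    unfolding mem_kern by blast
  have "fst u = fst v \<and> fst u \<in> inner_set \<nu> \<or> u = v"
    using s unfolding strands_id by (auto split: if_splits)
  then show "(u, v) \<in> unit_kern n {1..env \<nu>} (block_index \<nu>)"
    using * inner_set_subset[of \<nu>] unfolding mem_kern strands_id by auto
qed

lemma index_elem_t:
  assumes "env \<nu> \<le> n"
  shows "index_elem n \<nu> 1 = unit_kern n (inner_set \<nu>) id"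
    "index_elem n \<nu> 2 = unit_kern n {1..env \<nu>} (block_index \<nu>)"
    "index_elem n \<nu> \<in> extensional two"
  unfolding index_elem_def using index_inner_eq[OF assms] index_outer_eq[OF assms] by simp_all

lemma index_elem_closed: "env \<nu> \<le> n \<Longrightarrow> index_elem n \<nu> \<in> pair_partitions n"
  unfolding pair_partitions_iff
  by (simp only: index_elem_t kern_partition unit_subset simp_thms)

lemma inner_set_subset_n: "env \<nu> \<le> n \<Longrightarrow> inner_set \<nu> \<subseteq> {1..n}"
  using inner_set_subset[of \<nu>] by auto

lemma index_elem_idem:
  assumes "env \<nu> \<le> n"
  shows "pair_mult n (index_elem n \<nu>) (index_elem n \<nu>) = index_elem n \<nu>"
proof -
  have "{1..env \<nu>} \<subseteq> {1..n}" using assms by auto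
  then show ?thesis
    using index_elem_t[OF assms] unit_idem[OF inner_set_subset_n[OF assms]] unit_idem
    by (intro pair_eqI) simp_all
qed

section \<open>Counting propagating parts\<close>

lemma prop_parts_unit:
  assumes J: "J \<subseteq> {1..n}"
  shows "bij_betw (\<lambda>m. {u \<in> vertices n. fst u \<in> J \<and> N (fst u) = m}) (N ` J)
    (prop_parts n (unit_kern n J N))"
proof -
  let ?e = "unit_kern n J N" and ?Q = "\<lambda>m. {u \<in> vertices n. fst u \<in> J \<and> N (fst u) = m}"
  have cls: "?e `` {(i, 0)} = ?Q (N i)" if "i \<in> J" for i
  proof -
    have "(i, 0) \<in> vertices n" using that J by auto
    then have "((i, 0), v) \<in> ?e \<longleftrightarrow> v \<in> ?Q (N i)" for v
      using that unfolding mem_kern strands_id by (cases "fst v \<in> J") auto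
    then show ?thesis by blast
  qed
  have "inj_on ?Q (N ` J)"
  proof (rule inj_onI)
    fix m m' assume "m \<in> N ` J" "m' \<in> N ` J" and eq: "?Q m = ?Q m'"
    then obtain i where i: "i \<in> J" "m = N i" by blast
    then have "(i, 0) \<in> ?Q m" using J by auto
    then have "(i, 0) \<in> ?Q m'" unfolding eq .
    then show "m = m'" using i by simp
  qed
  moreover have "?Q ` N ` J = prop_parts n ?e"
  proof (intro equalityI subsetI)
    fix q assume "q \<in> ?Q ` N ` J"
    then obtain i where i: "i \<in> J" "q = ?Q (N i)" by blast
    then have V: "(i, 0) \<in> row n 0" "(i, 1) \<in> row n (1 - 0)" using J by auto
    then have "((i, 0), (i, 1)) \<in> ?e" using i(1) unfolding mem_kern strands_id by simp
    then show "q \<in> prop_parts n ?e"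
      unfolding mem_prop_parts[OF kern_partition le0] i(2) cls[OF i(1), symmetric] using V by blast
  next
    fix q assume "q \<in> prop_parts n ?e"
    then obtain z z0 where z: "z \<in> row n 0" "z0 \<in> row n (1 - 0)" "(z, z0) \<in> ?e" "q = ?e `` {z}"
      unfolding mem_prop_parts[OF kern_partition le0] by blast
    have "z \<noteq> z0" using z(1,2) by (cases z) auto
    then have "fst z \<in> J" using z(3) unfolding mem_kern strands_id by (auto split: if_splits)
    moreover have "z = (fst z, 0)" using z(1) by (cases z) auto
    ultimately have J': "fst z \<in> J" and q: "q = ?Q (N (fst z))" using cls[of "fst z"] z(4) by metis+
    show "q \<in> ?Q ` N ` J" unfolding q using J' by (intro imageI)
  qed
  ultimately show ?thesis by (simp add: bij_betw_def)
qed

lemma prop_index_index_elem: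
  assumes "\<nu> \<in> prop_indices" "env \<nu> \<le> n"
  shows "prop_index n (index_elem n \<nu>) = \<nu>"
proof -
  let ?I = "index_elem n \<nu>" and ?Q = "\<lambda>m. {u \<in> vertices n. fst u \<in> {1..env \<nu>} \<and> block_index \<nu> (fst u) = m}"
  let ?R = "\<lambda>j. {u \<in> vertices n. fst u \<in> inner_set \<nu> \<and> id (fst u) = j}"
  note It = index_elem_t[OF assms(2)]
  have sub: "{1..env \<nu>} \<subseteq> {1..n}" using assms(2) by auto
  have Q: "bij_betw ?Q {..<length \<nu>} (prop_parts n (?I 2))"
    using prop_parts_unit[OF sub, of "block_index \<nu>"] unfolding It block_index_image .
  have R: "bij_betw ?R (inner_set \<nu>) (prop_parts n (?I 1))"
    using prop_parts_unit[OF inner_set_subset_n[OF assms(2)], of id] unfolding It by simp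
  have cnt: "inner_count n ?I (?Q m) = \<nu> ! m" if m: "m < length \<nu>" for m
  proof -
    have "?R j \<subseteq> ?Q m \<longleftrightarrow> block_index \<nu> j = m" if j: "j \<in> inner_set \<nu>" for j
    proof
      have V: "(j, 0) \<in> vertices n" using j inner_set_subset_n[OF assms(2)] by auto
      assume "?R j \<subseteq> ?Q m"
      moreover have "(j, 0) \<in> ?R j" using V j by simp
      ultimately have "(j, 0) \<in> ?Q m" by blast
      then show "block_index \<nu> j = m" by simp
    next
      assume "block_index \<nu> j = m"
      then show "?R j \<subseteq> ?Q m" using inner_set_subset[of \<nu>] j by auto
    qed
    then have "{r \<in> prop_parts n (?I 1). r \<subseteq> ?Q m} = ?R ` {j \<in> inner_set \<nu>. block_index \<nu> j = m}"
      unfolding bij_betw_imp_surj_on[OF R, symmetric] by blast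
    moreover have "inj_on ?R {j \<in> inner_set \<nu>. block_index \<nu> j = m}"
      using bij_betw_imp_inj_on[OF R] by (rule inj_on_subset) blast
    ultimately show ?thesis
      unfolding inner_count_def by (simp only: card_image card_inner_block[OF m])
  qed
  have "mset_set (prop_parts n (?I 2)) = image_mset ?Q (mset_set {..<length \<nu>})"
    using image_mset_mset_set[OF bij_betw_imp_inj_on[OF Q]] bij_betw_imp_surj_on[OF Q] by simp
  then have "image_mset (inner_count n ?I) (mset_set (prop_parts n (?I 2))) =
      image_mset (\<lambda>m. inner_count n ?I (?Q m)) (mset_set {..<length \<nu>})"
    by (simp add: image_mset.compositionality comp_def)
  also have "\<dots> = image_mset (\<lambda>m. \<nu> ! m) (mset_set {..<length \<nu>})"
    using cnt by (intro image_mset_cong) simp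
  also have "\<dots> = mset (map ((!) \<nu>) [0..<length \<nu>])"
    unfolding mset_map mset_upt atLeast0LessThan ..
  also have "\<dots> = mset \<nu>" by (simp only: map_nth)
  finally show ?thesis using desc_list_mset[OF assms(1)] by (simp add: prop_index_eq)
qed

lemma inner_in_outer:
  assumes a: "a \<in> pair_partitions n" and r: "r \<in> prop_parts n (a 1)"
  obtains q where "q \<in> prop_parts n (a 2)" "r \<subseteq> q"
proof -
  obtain z z0 where z: "z \<in> row n 0" "z0 \<in> row n (1 - 0)" "(z, z0) \<in> a 1" "r = a 1 `` {z}"
    using r unfolding mem_prop_parts[OF pairD(1)[OF a] le0] by blast
  then have "a 2 `` {z} \<in> prop_parts n (a 2)"
    unfolding mem_prop_parts[OF pairD(2)[OF a] le0] using pairD(3)[OF a] by blast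
  moreover have "r \<subseteq> a 2 `` {z}" using z(4) pairD(3)[OF a] by blast
  ultimately show thesis by (rule that)
qed

lemma prop_part_meets:
  assumes "a \<in> partitions n" "q \<in> prop_parts n a"
  obtains z where "z \<in> q" "z \<in> row n 0"
  using assms(2) unfolding prop_parts_def by blast

text \<open>Refinement puts each propagating inner part into a propagating outer part, and into only
  one because outer parts are disjoint.\<close>

lemma sum_inner_count:
  assumes a: "a \<in> pair_partitions n"
  shows "(\<Sum>q\<in>prop_parts n (a 2). inner_count n a q) = card (prop_parts n (a 1))"
proof -
  let ?P1 = "prop_parts n (a 1)" and ?P2 = "prop_parts n (a 2)"
  have fin: "finite ?P1" "finite ?P2" using finite_prop_parts pairD(1,2)[OF a] by blast+
  have "?P1 = (\<Union>q\<in>?P2. {r \<in> ?P1. r \<subseteq> q})" using inner_in_outer[OF a] by blast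
  moreover have "card (\<Union>q\<in>?P2. {r \<in> ?P1. r \<subseteq> q}) = (\<Sum>q\<in>?P2. card {r \<in> ?P1. r \<subseteq> q})"
  proof (rule card_UN_disjoint)
    show "\<forall>q\<in>?P2. \<forall>q'\<in>?P2. q \<noteq> q' \<longrightarrow> {r \<in> ?P1. r \<subseteq> q} \<inter> {r \<in> ?P1. r \<subseteq> q'} = {}"
    proof (intro ballI impI equals0I)
      fix q q' r assume q: "q \<in> ?P2" "q' \<in> ?P2" "q \<noteq> q'"
        and r: "r \<in> {r \<in> ?P1. r \<subseteq> q} \<inter> {r \<in> ?P1. r \<subseteq> q'}"
      then have "r \<in> ?P1" by blast
      then obtain z where "z \<in> r" by (rule prop_part_meets[OF pairD(1)[OF a]])
      then have "z \<in> q" "z \<in> q'" using r by blast+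
      then show False using prop_parts_eqI[OF pairD(2)[OF a]] q by metis
    qed
  qed (use fin in auto)
  ultimately show ?thesis unfolding inner_count_def by simp
qed

text \<open>Numbers the propagating outer parts in the order of the entries of \<nu>, so that they
  can be matched with blocks; ties are broken arbitrarily.\<close>

lemma prop_index_enum:
  assumes a: "a \<in> pair_partitions n" and \<nu>: "prop_index n a = \<nu>"
  obtains q where "bij_betw q {..<length \<nu>} (prop_parts n (a 2))"
    "\<And>m. m < length \<nu> \<Longrightarrow> inner_count n a (q m) = \<nu> ! m"
proof -
  let ?P2 = "prop_parts n (a 2)"
  obtain xs where xs: "set xs = ?P2" "distinct xs"
    using finite_distinct_list[OF finite_prop_parts[OF pairD(2)[OF a]]] by blast
  have "mset \<nu> = mset (map (inner_count n a) xs)"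
    using \<nu> mset_set_set[OF xs(2)] xs(1) unfolding prop_index_eq by auto
  then obtain g where g: "bij_betw g {..<length \<nu>} {..<length (map (inner_count n a) xs)}"
    "\<forall>i<length \<nu>. \<nu> ! i = map (inner_count n a) xs ! g i"
    using permutation_Ex_bij by blast
  have "bij_betw ((!) xs) {..<length xs} ?P2" using bij_betw_nth[OF xs(2) HOL.refl xs(1)[symmetric]] .
  then have "bij_betw (\<lambda>m. xs ! g m) {..<length \<nu>} ?P2"
    using bij_betw_trans[OF g(1)] by (simp add: comp_def)
  moreover have "inner_count n a (xs ! g m) = \<nu> ! m" if "m < length \<nu>" for m
  proof -
    have "g m < length xs" using g(1) that by (auto simp: bij_betw_def)
    then show ?thesis using g(2) that by simp
  qed
  ultimately show thesis by (rule that)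
qed

lemma prop_index_in: "prop_index n a \<in> prop_indices"
  by (simp add: prop_index_eq)

text \<open>A propagating outer part has at least one vertex in the top row, and at least one for
  each inner propagating part inside it. The parts are disjoint and the row has n vertices.\<close>

lemma env_prop_index:
  assumes a: "a \<in> pair_partitions n"
  shows "env (prop_index n a) \<le> n"
proof -
  let ?\<nu> = "prop_index n a" and ?P2 = "prop_parts n (a 2)"
  note a1 = pairD(1)[OF a] and a2 = pairD(2)[OF a]
  obtain q where q: "bij_betw q {..<length ?\<nu>} ?P2"
    "\<And>m. m < length ?\<nu> \<Longrightarrow> inner_count n a (q m) = ?\<nu> ! m"
    using prop_index_enum[OF a HOL.refl] by blast
  have le: "max 1 (inner_count n a p) \<le> card (p \<inter> row n 0)" if p: "p \<in> ?P2" for p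
  proof -
    obtain z where "z \<in> p" "z \<in> row n 0" by (rule prop_part_meets[OF a2 p])
    then have "p \<inter> row n 0 \<noteq> {}" by blast
    then have "1 \<le> card (p \<inter> row n 0)" by (simp add: Suc_le_eq card_gt_0_iff)
    moreover have "inner_count n a p \<le> card (p \<inter> row n 0)"
      unfolding inner_count_def
    proof (rule card_inj_on_le)
      let ?z = "\<lambda>r. SOME z. z \<in> r \<and> z \<in> row n 0"
      have z: "?z r \<in> r \<and> ?z r \<in> row n 0" if "r \<in> prop_parts n (a 1)" for r
        by (rule someI_ex) (use prop_part_meets[OF a1 that] in blast)
      show "inj_on ?z {r \<in> prop_parts n (a 1). r \<subseteq> p}"
      proof (rule inj_onI)
        fix r s assume r: "r \<in> {r \<in> prop_parts n (a 1). r \<subseteq> p}" "s \<in> {r \<in> prop_parts n (a 1). r \<subseteq> p}"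
          and eq: "?z r = ?z s"
        then show "r = s"
          using z[of r] z[of s] prop_parts_eqI[OF a1, of r "?z r"] prop_parts_eqI[OF a1, of s "?z s"] by auto
      qed
      show "?z ` {r \<in> prop_parts n (a 1). r \<subseteq> p} \<subseteq> p \<inter> row n 0" using z by blast
    qed simp
    ultimately show ?thesis by simp
  qed
  have "env ?\<nu> = (\<Sum>m<length ?\<nu>. max 1 (?\<nu> ! m))"
    by (simp add: env_def sum_list_sum_nth atLeast0LessThan)
  also have "\<dots> = (\<Sum>m<length ?\<nu>. max 1 (inner_count n a (q m)))" using q(2) by simp
  also have "\<dots> = (\<Sum>p\<in>?P2. max 1 (inner_count n a p))"
    using sum.reindex_bij_betw[OF q(1), of "\<lambda>p. max 1 (inner_count n a p)"] .
  also have "\<dots> \<le> (\<Sum>p\<in>?P2. card (p \<inter> row n 0))" using le by (rule sum_mono)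
  also have "\<dots> = card (\<Union>p\<in>?P2. p \<inter> row n 0)"
  proof (rule card_UN_disjoint[symmetric])
    show "\<forall>p\<in>?P2. \<forall>p'\<in>?P2. p \<noteq> p' \<longrightarrow> p \<inter> row n 0 \<inter> (p' \<inter> row n 0) = {}"
      using prop_parts_eqI[OF a2] by blast
  qed (use finite_prop_parts[OF a2] in auto)
  also have "\<dots> \<le> card (row n 0)" by (intro card_mono) auto
  also have "\<dots> = n" by (simp add: row_def card_cartesian_product)
  finally show ?thesis .
qed

section \<open>The monoid of pairs of partitions\<close>

lemma pair_mult_assoc:
  assumes "a \<in> pair_partitions n" "b \<in> pair_partitions n" "c \<in> pair_partitions n"
  shows "pair_mult n (pair_mult n a b) c = pair_mult n a (pair_mult n b c)"
  using pairD(1,2)[OF assms(1)] pairD(1,2)[OF assms(2)] pairD(1,2)[OF assms(3)]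
  by (intro pair_eqI) (simp_all add: d_prod_assoc)

text \<open>Makes the two halves of a pair again pairs: the inner part attached to a strand lies in
  the outer part attached to the same strand.\<close>

lemma half_mono:
  assumes a: "a \<in> pair_partitions n" and J: "J1 \<subseteq> J2"
    and \<phi>1: "\<phi>1 ` J1 = prop_parts n (a 1)" and \<phi>2: "\<phi>2 ` J2 = prop_parts n (a 2)"
    and sub: "\<And>j. j \<in> J1 \<Longrightarrow> \<phi>1 j \<subseteq> \<phi>2 j"
  shows "kern n (half k (a 1) J1 \<phi>1) \<subseteq> kern n (half k (a 2) J2 \<phi>2)"
proof (rule subrelI)
  fix u v assume *: "(u, v) \<in> kern n (half k (a 1) J1 \<phi>1)"
  note a1 = pairD(1)[OF a] and a2 = pairD(2)[OF a]
  have in2: "\<phi>2 j = a 2 `` {z}" if "j \<in> J1" "z \<in> \<phi>1 j" for j z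
    using that sub \<phi>2 J prop_parts_eqI[OF a2, of "\<phi>2 j" z] by blast
  have good: "half k (a 2) J2 \<phi>2 x = Inl (a 2 `` {z})"
    if "x \<in> vertices n" "half k (a 1) J1 \<phi>1 x = Inl p" "z \<in> p" for x p z
  proof (cases "snd x = k")
    case True
    then have "(x, z) \<in> a 1" using that by (auto simp: half_def)
    then have "(x, z) \<in> a 2" using pairD(3)[OF a] by blast
    then have "a 2 `` {x} = a 2 `` {z}" using partitionsD(3,4)[OF a2] by blast
    then show ?thesis using True by (simp add: half_def)
  next
    case False
    then have "fst x \<in> J1" "p = \<phi>1 (fst x)" using that(2) by (auto simp: half_def split: if_splits)
    then show ?thesis using in2[of "fst x" z] that(3) J False by (auto simp: half_def)
  qed
  have ne: "\<exists>z. z \<in> p" if "x \<in> vertices n" "half k (a 1) J1 \<phi>1 x = Inl p" for x p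
  proof (cases "snd x = k")
    case True
    then have "p = a 1 `` {x}" using that(2) by (simp add: half_def)
    then show ?thesis using partitionsD(2)[OF a1 that(1)] by blast
  next
    case False
    then have "fst x \<in> J1" "p = \<phi>1 (fst x)" using that(2) by (auto simp: half_def split: if_splits)
    then have "p \<in> prop_parts n (a 1)" using \<phi>1 by blast
    then show ?thesis using prop_part_meets[OF a1] by blast
  qed
  have V: "u \<in> vertices n" "v \<in> vertices n" and eq: "half k (a 1) J1 \<phi>1 u = half k (a 1) J1 \<phi>1 v"
    using * unfolding mem_kern by blast+
  have "half k (a 2) J2 \<phi>2 u = half k (a 2) J2 \<phi>2 v"
  proof (cases "half k (a 1) J1 \<phi>1 u")
    case (Inl p)
    then obtain z where "z \<in> p" using ne V(1) by blast
    then show ?thesis using good V Inl eq by metis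
  next
    case (Inr w)
    then have "u = v" using eq by (auto simp: half_def split: if_splits)
    then show ?thesis by simp
  qed
  then show "(u, v) \<in> kern n (half k (a 2) J2 \<phi>2)" using V unfolding mem_kern by blast
qed

text \<open>Each block of \<I>_\<nu> is attached to one propagating outer part of a, and the inner
  strands of the block to the inner propagating parts inside it. The numbers match because an entry
  of \<nu> counts both. Cutting a along these strands gives the two outer factors.\<close>

lemma index_factor:
  assumes a: "a \<in> pair_partitions n" and \<nu>: "prop_index n a = \<nu>"
  obtains x y where "x \<in> pair_partitions n" "y \<in> pair_partitions n"
    "a = pair_mult n x (pair_mult n (index_elem n \<nu>) y)"
proof -
  have env: "env \<nu> \<le> n" using env_prop_index[OF a] \<nu> by simp
  note a1 = pairD(1)[OF a] and a2 = pairD(2)[OF a]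
  let ?J1 = "inner_set \<nu>" and ?J2 = "{1..env \<nu>}"
  have J: "?J1 \<subseteq> {1..n}" "?J2 \<subseteq> {1..n}" "?J1 \<subseteq> ?J2"
    using inner_set_subset_n[OF env] env inner_set_subset by auto
  obtain q where q: "bij_betw q {..<length \<nu>} (prop_parts n (a 2))"
    "\<And>m. m < length \<nu> \<Longrightarrow> inner_count n a (q m) = \<nu> ! m"
    using prop_index_enum[OF a \<nu>] by blast
  define \<phi>2 where "\<phi>2 = q \<circ> block_index \<nu>"
  have \<phi>2: "\<phi>2 ` ?J2 = prop_parts n (a 2)"
    unfolding \<phi>2_def image_comp[symmetric] block_index_image using q(1) by (simp add: bij_betw_def)
  have "\<forall>m\<in>{..<length \<nu>}.
      \<exists>f. bij_betw f {i \<in> ?J1. block_index \<nu> i = m} {r \<in> prop_parts n (a 1). r \<subseteq> q m}"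
  proof (rule ballI, rule finite_same_card_bij)
    fix m assume "m \<in> {..<length \<nu>}"
    then have m: "m < length \<nu>" by simp
    show "finite {i \<in> ?J1. block_index \<nu> i = m}" by (simp add: inner_set_def)
    show "finite {r \<in> prop_parts n (a 1). r \<subseteq> q m}" using finite_prop_parts[OF a1] by simp
    show "card {i \<in> ?J1. block_index \<nu> i = m} = card {r \<in> prop_parts n (a 1). r \<subseteq> q m}"
      using card_inner_block[OF m] q(2)[OF m] unfolding inner_count_def by simp
  qed
  from bchoice[OF this] obtain f where f': "\<forall>m\<in>{..<length \<nu>}.
      bij_betw (f m) {i \<in> ?J1. block_index \<nu> i = m} {r \<in> prop_parts n (a 1). r \<subseteq> q m}" ..
  have f: "bij_betw (f m) {i \<in> ?J1. block_index \<nu> i = m} {r \<in> prop_parts n (a 1). r \<subseteq> q m}"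
    if "m < length \<nu>" for m
    by (rule bspec[OF f']) (use that in simp)
  \<comment> \<open>The matchings of the single blocks are combined; each strand uses the one of its
    own block.\<close>
  define \<phi>1 where "\<phi>1 i = f (block_index \<nu> i) i" for i
  have len: "block_index \<nu> i < length \<nu>" if "i \<in> ?J1" for i
    using that J(3) block_index(1) by blast
  have \<phi>1_in: "\<phi>1 i \<in> prop_parts n (a 1) \<and> \<phi>1 i \<subseteq> \<phi>2 i" if "i \<in> ?J1" for i
  proof -
    have "\<phi>1 i \<in> {r \<in> prop_parts n (a 1). r \<subseteq> q (block_index \<nu> i)}"
      unfolding \<phi>1_def by (rule bij_betw_apply[OF f[OF len[OF that]]]) (use that in simp)
    then show ?thesis by (simp add: \<phi>2_def)
  qed
  have \<phi>1: "\<phi>1 ` ?J1 = prop_parts n (a 1)"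
  proof (intro equalityI subsetI)
    fix r assume r: "r \<in> prop_parts n (a 1)"
    obtain p where p: "p \<in> prop_parts n (a 2)" "r \<subseteq> p" by (rule inner_in_outer[OF a r])
    then have "p \<in> q ` {..<length \<nu>}" using bij_betw_imp_surj_on[OF q(1)] by simp
    then obtain m where m: "m < length \<nu>" "p = q m" by auto
    then have "r \<in> f m ` {i \<in> ?J1. block_index \<nu> i = m}"
      using f[OF m(1)] r p(2) by (auto simp: bij_betw_def)
    then show "r \<in> \<phi>1 ` ?J1" by (auto simp: \<phi>1_def)
  qed (use \<phi>1_in in blast)
  define x where "x = mk_pair (kern n (half 0 (a 1) ?J1 \<phi>1)) (kern n (half 0 (a 2) ?J2 \<phi>2))"
  define y where "y = mk_pair (kern n (half 1 (a 1) ?J1 \<phi>1)) (kern n (half 1 (a 2) ?J2 \<phi>2))"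
  have sub: "kern n (half k (a 1) ?J1 \<phi>1) \<subseteq> kern n (half k (a 2) ?J2 \<phi>2)" for k
    using \<phi>1_in by (intro half_mono[OF a J(3) \<phi>1 \<phi>2]) blast
  have x: "x \<in> pair_partitions n" and y: "y \<in> pair_partitions n"
    unfolding x_def y_def by (intro mk_pair_closed kern_partition sub)+
  \<comment> \<open>The left half absorbs \<I>_\<nu>, which may therefore be inserted between the
    two halves.\<close>
  have "pair_mult n x (index_elem n \<nu>) = x"
    using index_elem_t[OF env] factor_unit[OF J(1), of id \<phi>1 "a 1"] factor_unit[OF J(2), of "block_index \<nu>" \<phi>2 "a 2"]
    unfolding x_def by (intro pair_eqI) (simp_all add: \<phi>2_def)
  moreover have "pair_mult n x y = a"
    using factor_prod[OF a1 J(1) \<phi>1] factor_prod[OF a2 J(2) \<phi>2] pairD(5)[OF a]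
    unfolding x_def y_def by (intro pair_eqI) simp_all
  ultimately have "a = pair_mult n x (pair_mult n (index_elem n \<nu>) y)"
    using pair_mult_assoc[OF x index_elem_closed[OF env] y] by simp
  then show thesis using that x y by blast
qed

section \<open>Block permutations inside the monoid\<close>

definition perm_pair :: "nat \<Rightarrow> (nat \<Rightarrow> nat) \<Rightarrow> pair_partition"
  where "perm_pair n w = mk_pair (perm_partition n w) (perm_partition n w)"

lemma perm_pair_closed: "w permutes {1..n} \<Longrightarrow> perm_pair n w \<in> pair_partitions n"
  unfolding perm_pair_def by (intro mk_pair_closed perm_partition_in) auto

lemma block_permsD:
  assumes w: "w \<in> block_perms \<nu>" and env: "env \<nu> \<le> n"
  shows "w permutes {1..n}" "w i \<in> {1..env \<nu>} \<longleftrightarrow> i \<in> {1..env \<nu>}"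
    "w i \<in> inner_set \<nu> \<longleftrightarrow> i \<in> inner_set \<nu>"
    "i \<in> {1..env \<nu>} \<Longrightarrow> j \<in> {1..env \<nu>} \<Longrightarrow>
      block_index \<nu> (w i) = block_index \<nu> (w j) \<longleftrightarrow> block_index \<nu> i = block_index \<nu> j"
proof -
  have p: "w permutes {1..env \<nu>}" using w by (simp add: block_perms_def)
  show "w permutes {1..n}" using p by (rule permutes_subset) (use env in auto)
  show in_env: "w i \<in> {1..env \<nu>} \<longleftrightarrow> i \<in> {1..env \<nu>}" for i by (rule permutes_in_image[OF p])
  have blk: "\<exists>k<length \<nu>. \<nu> ! block_index \<nu> i = \<nu> ! k \<and> w ` block \<nu> (block_index \<nu> i) = block \<nu> k"
    if "i \<in> {1..env \<nu>}" for i
    using w block_index(1)[OF that] by (simp add: block_perms_def)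
  have wi: "\<nu> ! block_index \<nu> (w i) = \<nu> ! block_index \<nu> i \<and>
      w ` block \<nu> (block_index \<nu> i) = block \<nu> (block_index \<nu> (w i))" if i: "i \<in> {1..env \<nu>}" for i
  proof -
    obtain k where k: "k < length \<nu>" "\<nu> ! block_index \<nu> i = \<nu> ! k"
      "w ` block \<nu> (block_index \<nu> i) = block \<nu> k" using blk[OF i] by blast
    have "w i \<in> block \<nu> k" using k(3) block_index(2)[OF i] by blast
    then have "block_index \<nu> (w i) = k" by (rule block_index_eq[OF k(1)])
    then show ?thesis using k by simp
  qed
  show "w i \<in> inner_set \<nu> \<longleftrightarrow> i \<in> inner_set \<nu>" for i
    using wi[of i] in_env[of i] unfolding inner_set_def by (cases "i \<in> {1..env \<nu>}") auto
  show "block_index \<nu> (w i) = block_index \<nu> (w j) \<longleftrightarrow> block_index \<nu> i = block_index \<nu> j"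
    if i: "i \<in> {1..env \<nu>}" and j: "j \<in> {1..env \<nu>}"
  proof
    assume "block_index \<nu> (w i) = block_index \<nu> (w j)"
    then have "w ` block \<nu> (block_index \<nu> i) = w ` block \<nu> (block_index \<nu> j)"
      using wi[OF i] wi[OF j] by simp
    then have "block \<nu> (block_index \<nu> i) = block \<nu> (block_index \<nu> j)"
      using permutes_inj[OF p] by (simp add: inj_image_eq_iff)
    then have "i \<in> block \<nu> (block_index \<nu> j)" using block_index(2)[OF i] by simp
    then show "block_index \<nu> i = block_index \<nu> j" by (rule block_index_eq[OF block_index(1)[OF j]])
  next
    assume eq: "block_index \<nu> i = block_index \<nu> j"
    then have "w j \<in> block \<nu> (block_index \<nu> (w i))" using wi[OF i] block_index(2)[OF j] by (metis imageI)
    moreover have "block_index \<nu> (w i) < length \<nu>" using block_index(1) in_env i by blast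
    ultimately show "block_index \<nu> (w i) = block_index \<nu> (w j)" using block_index_eq by metis
  qed
qed

lemma perm_commute:
  assumes w: "w \<in> block_perms \<nu>" and env: "env \<nu> \<le> n"
  shows "pair_mult n (perm_pair n w) (index_elem n \<nu>) = pair_mult n (index_elem n \<nu>) (perm_pair n w)"
proof -
  note D = block_permsD[OF w env]
  have wi: "id (w i) = id (w j) \<longleftrightarrow> id i = id j" for i j
    using permutes_inj[OF D(1)] by (auto dest: injD)
  have 1: "d_prod n (perm_partition n w) (unit_kern n (inner_set \<nu>) id) =
      d_prod n (unit_kern n (inner_set \<nu>) id) (perm_partition n w)"
    by (rule perm_unit_commute[OF D(1)]) (rule D(3), rule wi)
  have 2: "d_prod n (perm_partition n w) (unit_kern n {1..env \<nu>} (block_index \<nu>)) =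
      d_prod n (unit_kern n {1..env \<nu>} (block_index \<nu>)) (perm_partition n w)"
    by (rule perm_unit_commute[OF D(1)]) (rule D(2), rule D(4))
  show ?thesis
    unfolding perm_pair_def
    by (rule pair_eqI) (simp_all only: pair_mult_simps mk_pair_simps index_elem_t[OF env] 1 2)
qed

text \<open>The inner level determines w on the inner strands. Elsewhere the entry is 0, the block
  has a single vertex, and the outer level, which determines w up to blocks, suffices.\<close>

lemma perm_unit_inj:
  assumes w: "w \<in> block_perms \<nu>" and v: "v \<in> block_perms \<nu>" and env: "env \<nu> \<le> n"
    and eq: "pair_mult n (perm_pair n w) (index_elem n \<nu>) = pair_mult n (perm_pair n v) (index_elem n \<nu>)"
  shows "w = v"
proof
  fix i
  note W = block_permsD[OF w env] and V = block_permsD[OF v env]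
  let ?j = "inv_into UNIV v (w i)"
  have vj: "v ?j = w i" using permutes_inverses(1)[OF V(1)] .
  have sub: "{1..env \<nu>} \<subseteq> {1..n}" using env by auto
  have eq1: "d_prod n (perm_partition n w) (unit_kern n (inner_set \<nu>) id) =
      d_prod n (perm_partition n v) (unit_kern n (inner_set \<nu>) id)"
    using arg_cong[OF eq, of "\<lambda>f. f 1"] index_elem_t[OF env] by (simp add: perm_pair_def)
  have eq2: "d_prod n (perm_partition n w) (unit_kern n {1..env \<nu>} (block_index \<nu>)) =
      d_prod n (perm_partition n v) (unit_kern n {1..env \<nu>} (block_index \<nu>))"
    using arg_cong[OF eq, of "\<lambda>f. f 2"] index_elem_t[OF env] by (simp add: perm_pair_def)
  show "w i = v i"
  proof (cases "i \<in> {1..env \<nu>}")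
    case False
    moreover have "w permutes {1..env \<nu>}" "v permutes {1..env \<nu>}" using w v by (simp_all add: block_perms_def)
    ultimately show ?thesis using permutes_not_in by metis
  next
    case i: True
    have "?j = i"
    proof (cases "i \<in> inner_set \<nu>")
      case True
      then show ?thesis
        using perm_unit_label[OF W(1) V(1) inner_set_subset_n[OF env] True eq1] by simp
    next
      case False
      then have "\<nu> ! block_index \<nu> i = 0" using i by (auto simp: inner_set_def)
      then have "card (block \<nu> (block_index \<nu> i)) = 1" using card_block[OF block_index(1)[OF i]] by simp
      then obtain b where b: "block \<nu> (block_index \<nu> i) = {b}" by (rule card_1_singletonE)
      have "?j \<in> {1..env \<nu>}" "block_index \<nu> ?j = block_index \<nu> i"
        using perm_unit_label[OF W(1) V(1) sub i eq2] by blast+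
      then have "?j \<in> block \<nu> (block_index \<nu> i)" using block_index(2) by metis
      then show ?thesis using b block_index(2)[OF i] by simp
    qed
    then show ?thesis using vj by simp
  qed
qed

text \<open>The elements of \<open>\<I> p_n \<I>\<close> of full index form a copy of the group \<open>S[\<nu>]\<close>: both levels
  are perfect matchings, and refinement together with equality of the total number of inner
  propagating parts forces matched blocks to have equal entries.\<close>

lemma corner_perm:
  assumes a: "a \<in> pair_partitions n" and env: "env \<nu> \<le> n"
    and c: "c = pair_mult n (index_elem n \<nu>) (pair_mult n a (index_elem n \<nu>))"
    and idx: "prop_index n c = \<nu>"
  obtains w where "w \<in> block_perms \<nu>" "c = pair_mult n (perm_pair n w) (index_elem n \<nu>)"
proof -
  let ?I = "index_elem n \<nu>" and ?J1 = "inner_set \<nu>" and ?J2 = "{1..env \<nu>}" and ?b = "block_index \<nu>"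
  note I = index_elem_closed[OF env] and It = index_elem_t[OF env]
  have J: "?J1 \<subseteq> {1..n}" "?J2 \<subseteq> {1..n}" "?J1 \<subseteq> ?J2"
    using inner_set_subset_n[OF env] env inner_set_subset by auto
  have cP: "c \<in> pair_partitions n" unfolding c by (intro pair_mult_closed I a)
  have c': "c = pair_mult n (pair_mult n ?I a) ?I" unfolding c by (rule pair_mult_assoc[OF I a I, symmetric])
  have ct: "c t = d_prod n (?I t) (d_prod n (a t) (?I t))" "c t = d_prod n (d_prod n (?I t) (a t)) (?I t)"
    if "t \<in> two" for t
    using that arg_cong[OF c, of "\<lambda>f. f t"] arg_cong[OF c', of "\<lambda>f. f t"] by (simp_all add: pair_mult_t)
  \<comment> \<open>As c begins and ends with \<I>_\<nu>, each of its rows has the identifications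
    of \<I>_\<nu> and, by the next fact, its singletons. These are the hypotheses of
    \<open>matching\<close>.\<close>
  have struct: "((i, k), (j, k)) \<in> c t"
    if t: "t \<in> two" "?I t = unit_kern n J N" "J \<subseteq> {1..n}" "i \<in> J" "j \<in> J" "N i = N j" "k \<le> 1" for t J N i j k
  proof -
    note it = pairD(4)[OF I t(1)] and at = pairD(4)[OF a t(1)]
    have V: "(i, k) \<in> row n k" "(j, k) \<in> row n k" using t by auto
    have "(i, k) \<in> vertices n" "(j, k) \<in> vertices n" using t(3-5,7) by auto
    then have e: "((i, k), (j, k)) \<in> ?I t" unfolding t(2) mem_kern strands_id using t by simp
    consider "k = 0" | "k = 1" using t(7) by linarith
    then show ?thesis
    proof cases
      case 1
      then show ?thesis
        unfolding ct(1)[OF t(1)] using d_prod_top[OF it d_prod_partition[OF at it] e] V by simp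
    next
      case 2
      then show ?thesis
        unfolding ct(2)[OF t(1)] using d_prod_bot[OF d_prod_partition[OF it at] it e] V by simp
    qed
  qed
  have sing: "u = (i, k)"
    if t: "t \<in> two" "?I t = unit_kern n J N" "i \<in> {1..n} - J" "k \<le> 1" "((i, k), u) \<in> c t" for t J N i k u
  proof -
    note it = pairD(4)[OF I t(1)] and at = pairD(4)[OF a t(1)]
    have V: "(i, k) \<in> row n k" using t by auto
    have cls: "w = (i, k)" if "((i, k), w) \<in> ?I t" for w
      using that t(3) unfolding t(2) mem_kern strands_id by (auto split: if_splits)
    then have row: "?I t `` {(i, k)} \<subseteq> row n k" using V by blast
    consider "k = 0" | "k = 1" using t(4) by linarith
    then have "((i, k), u) \<in> ?I t"
    proof cases
      case 1
      show ?thesis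
        by (rule d_prod_top_part[OF it d_prod_partition[OF at it]])
          (use V row 1 t(5) ct(1)[OF t(1)] in simp_all)
    next
      case 2
      show ?thesis
        by (rule d_prod_bot_part[OF d_prod_partition[OF it at] it])
          (use V row 2 t(5) ct(2)[OF t(1)] in simp_all)
    qed
    then show ?thesis by (rule cls)
  qed
  have tt: "1 \<in> two" "2 \<in> two" by (simp_all add: two_def)
  obtain q where q: "bij_betw q {..<length \<nu>} (prop_parts n (c 2))"
    "\<And>m. m < length \<nu> \<Longrightarrow> inner_count n c (q m) = \<nu> ! m"
    using prop_index_enum[OF cP idx] by blast
  \<comment> \<open>Full index means that on each level as many parts propagate as \<I>_\<nu> has
    groups of strands; on the inner level only the total is compared.\<close>
  have card2: "card (prop_parts n (c 2)) = card (?b ` ?J2)"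
    unfolding block_index_image using bij_betw_same_card[OF q(1)] by simp
  have "card (prop_parts n (c 1)) = (\<Sum>m<length \<nu>. inner_count n c (q m))"
    using sum.reindex_bij_betw[OF q(1), of "inner_count n c"] sum_inner_count[OF cP] by simp
  then have card1: "card (prop_parts n (c 1)) = card (id ` ?J1)"
    using q(2) by (simp add: card_inner_set sum_list_sum_nth atLeast0LessThan)
  have "\<exists>\<tau>. bij_betw \<tau> (?b ` ?J2) (?b ` ?J2) \<and> c 2 = kern n (strands 1 ?J2 ?b \<tau>)"
  proof (rule matching[OF pairD(2)[OF cP] J(2), where N = "?b"])
    show "((i, k), (j, k)) \<in> c 2" if "i \<in> ?J2" "j \<in> ?J2" "?b i = ?b j" "k \<le> 1" for i j k
      by (rule struct[OF tt(2) It(2) J(2) that])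
    show "u = (i, k)" if "i \<in> {1..n} - ?J2" "k \<le> 1" "((i, k), u) \<in> c 2" for i k u
      by (rule sing[OF tt(2) It(2) that])
    show "card (prop_parts n (c 2)) = card (?b ` ?J2)" by (rule card2)
  qed blast
  then obtain \<tau>2 where \<tau>2: "bij_betw \<tau>2 (?b ` ?J2) (?b ` ?J2)"
    "c 2 = kern n (strands 1 ?J2 ?b \<tau>2)" by blast
  have "\<exists>\<tau>. bij_betw \<tau> (id ` ?J1) (id ` ?J1) \<and> c 1 = kern n (strands 1 ?J1 id \<tau>)"
  proof (rule matching[OF pairD(1)[OF cP] J(1), where N = "id"])
    show "((i, k), (j, k)) \<in> c 1" if "i \<in> ?J1" "j \<in> ?J1" "id i = id j" "k \<le> 1" for i j k
      by (rule struct[OF tt(1) It(1) J(1) that])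
    show "u = (i, k)" if "i \<in> {1..n} - ?J1" "k \<le> 1" "((i, k), u) \<in> c 1" for i k u
      by (rule sing[OF tt(1) It(1) that])
    show "card (prop_parts n (c 1)) = card (id ` ?J1)" by (rule card1)
  qed blast
  then obtain \<tau>1 where \<tau>1: "bij_betw \<tau>1 (id ` ?J1) (id ` ?J1)"
    "c 1 = kern n (strands 1 ?J1 id \<tau>1)" by blast
  have b1: "bij_betw \<tau>1 ?J1 ?J1" using \<tau>1(1) by simp
  have b2: "bij_betw \<tau>2 {..<length \<nu>} {..<length \<nu>}" using \<tau>2(1) unfolding block_index_image .
  have \<tau>1_in: "\<tau>1 i \<in> ?J1" if "i \<in> ?J1" for i using b1 that by (rule bij_betw_apply)
  have \<tau>2_in: "\<tau>2 m < length \<nu>" if "m < length \<nu>" for m using bij_betw_apply[OF b2, of m] that by simp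
  \<comment> \<open>The inner pair of the upper end \<tau>1 i and the lower end i is also an outer
    pair, so the inner matching lies over the outer one.\<close>
  have compat: "?b (\<tau>1 i) = \<tau>2 (?b i)" if i: "i \<in> ?J1" for i
  proof -
    have V: "(\<tau>1 i, 0) \<in> vertices n" "(i, 1) \<in> vertices n" using i \<tau>1_in[OF i] J(1) by auto
    have "((\<tau>1 i, 0), (i, 1)) \<in> c 1"
      unfolding \<tau>1(2) mem_kern using V i \<tau>1_in[OF i] by (simp add: strands_def)
    then have "((\<tau>1 i, 0), (i, 1)) \<in> c 2" using pairD(3)[OF cP] by blast
    then have "strands 1 ?J2 ?b \<tau>2 (\<tau>1 i, 0) = strands 1 ?J2 ?b \<tau>2 (i, 1)"
      unfolding \<tau>2(2) mem_kern by blast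
    moreover have "i \<in> ?J2" "\<tau>1 i \<in> ?J2" using i \<tau>1_in[OF i] J(3) by blast+
    ultimately show ?thesis by (simp add: strands_def)
  qed
  \<comment> \<open>The inner matching embeds the strands of block m into those of block \<tau>2 m,
    so entries can only grow along \<tau>2. As \<tau>2 permutes the blocks, the sum of the entries
    is unchanged and equality holds throughout.\<close>
  have entry: "\<nu> ! \<tau>2 m = \<nu> ! m" if m: "m < length \<nu>" for m
  proof -
    have le: "\<nu> ! m \<le> \<nu> ! \<tau>2 m" if m: "m \<in> {..<length \<nu>}" for m
    proof -
      have m: "m < length \<nu>" using m by simp
      have "card {i \<in> ?J1. ?b i = m} \<le> card {i \<in> ?J1. ?b i = \<tau>2 m}"
      proof (rule card_inj_on_le)
        show "inj_on \<tau>1 {i \<in> ?J1. ?b i = m}" using bij_betw_imp_inj_on[OF b1] by (rule inj_on_subset) blast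
        show "\<tau>1 ` {i \<in> ?J1. ?b i = m} \<subseteq> {i \<in> ?J1. ?b i = \<tau>2 m}" using \<tau>1_in compat by blast
        show "finite {i \<in> ?J1. ?b i = \<tau>2 m}" by (simp add: inner_set_def)
      qed
      then show ?thesis using card_inner_block[OF m] card_inner_block[OF \<tau>2_in[OF m]] by simp
    qed
    have "(\<Sum>m<length \<nu>. \<nu> ! m) = (\<Sum>m<length \<nu>. \<nu> ! \<tau>2 m)"
      using sum.reindex_bij_betw[OF b2, of "\<lambda>m. \<nu> ! m"] by simp
    from sum_mono_inv[OF this le] m show ?thesis by simp
  qed
  \<comment> \<open>A vertex without inner strand is the only one of its block and goes to the first
    vertex of the target block, which is also its only one because the entries agree.\<close>
  define w where "w i = (if i \<in> ?J1 then \<tau>1 i else if i \<in> ?J2 then env (take (\<tau>2 (?b i)) \<nu>) + 1 else i)" for i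
  have w_blk: "w i \<in> block \<nu> (\<tau>2 (?b i))" if i: "i \<in> ?J2" for i
  proof (cases "i \<in> ?J1")
    case True
    have "w i = \<tau>1 i" by (simp add: w_def True)
    moreover have "\<tau>1 i \<in> ?J2" using \<tau>1_in[OF True] J(3) by blast
    ultimately show ?thesis using block_index(2)[of "\<tau>1 i" \<nu>] compat[OF True] by simp
  next
    case False
    have "\<tau>2 (?b i) < length \<nu>" using \<tau>2_in block_index(1)[OF i] by blast
    then show ?thesis using False i by (simp add: w_def block_def env_take_Suc)
  qed
  have w_img: "w ` block \<nu> m = block \<nu> (\<tau>2 m)" if m: "m < length \<nu>" for m
  proof (rule card_subset_eq)
    show "finite (block \<nu> (\<tau>2 m))" by (simp add: block_def)
    show "w ` block \<nu> m \<subseteq> block \<nu> (\<tau>2 m)" using w_blk unfolding block_eq[OF m] by blast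
    have "inj_on w (block \<nu> m)"
    proof (cases "\<nu> ! m = 0")
      case True
      then have "card (block \<nu> m) = 1" using card_block[OF m] by simp
      then obtain x where "block \<nu> m = {x}" by (rule card_1_singletonE)
      then show ?thesis by simp
    next
      case False
      then have "block \<nu> m \<subseteq> ?J1" unfolding block_eq[OF m] by (auto simp: inner_set_def)
      then have "inj_on \<tau>1 (block \<nu> m)" "\<And>i. i \<in> block \<nu> m \<Longrightarrow> \<tau>1 i = w i"
        using inj_on_subset[OF bij_betw_imp_inj_on[OF b1]] by (blast, auto simp: w_def)
      then show ?thesis using inj_on_cong[of "block \<nu> m" \<tau>1 w] by blast
    qed
    then have "card (w ` block \<nu> m) = max 1 (\<nu> ! m)" using card_image card_block[OF m] by metis
    then show "card (w ` block \<nu> m) = card (block \<nu> (\<tau>2 m))"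
      using card_block[OF \<tau>2_in[OF m]] entry[OF m] by simp
  qed
  have U: "(\<Union>m<length \<nu>. block \<nu> m) = ?J2"
  proof (rule equalityI)
    show "(\<Union>m<length \<nu>. block \<nu> m) \<subseteq> ?J2"
    proof (rule UN_least)
      show "block \<nu> m \<subseteq> ?J2" if "m \<in> {..<length \<nu>}" for m
        using block_subset[of m \<nu>] that by simp
    qed
    show "?J2 \<subseteq> (\<Union>m<length \<nu>. block \<nu> m)"
    proof
      show "i \<in> (\<Union>m<length \<nu>. block \<nu> m)" if "i \<in> ?J2" for i
        by (rule UN_I[of "?b i"]) (simp_all only: lessThan_iff block_index[OF that])
    qed
  qed
  have w_onto: "w ` ?J2 = ?J2"
  proof -
    have "w ` ?J2 = (\<Union>m<length \<nu>. w ` block \<nu> m)" unfolding U[symmetric] by blast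
    also have "\<dots> = (\<Union>m<length \<nu>. block \<nu> (\<tau>2 m))" using w_img by (intro SUP_cong) simp_all
    also have "\<dots> = (\<Union>m\<in>\<tau>2 ` {..<length \<nu>}. block \<nu> m)" by blast
    also have "\<dots> = ?J2" unfolding bij_betw_imp_surj_on[OF b2] U ..
    finally show ?thesis .
  qed
  have w_perm: "w permutes ?J2"
  proof (rule bij_imp_permutes)
    have "inj_on w ?J2" by (rule eq_card_imp_inj_on) (simp_all only: w_onto finite_atLeastAtMost)
    then show "bij_betw w ?J2 ?J2" using w_onto by (simp add: bij_betw_def)
    show "w i = i" if "i \<notin> ?J2" for i using that J(3) by (auto simp: w_def)
  qed
  have wG: "w \<in> block_perms \<nu>"
    unfolding block_perms_def
  proof (intro CollectI conjI w_perm allI impI)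
    fix m assume m: "m < length \<nu>"
    show "\<exists>j<length \<nu>. \<nu> ! m = \<nu> ! j \<and> w ` block \<nu> m = block \<nu> j"
      by (rule exI[of _ "\<tau>2 m"]) (simp only: \<tau>2_in[OF m] entry[OF m] w_img[OF m])
  qed
  note D = block_permsD[OF wG env]
  have "c 1 = d_prod n (perm_partition n w) (unit_kern n ?J1 id)"
    unfolding \<tau>1(2) by (rule perm_unit[OF D(1,3), symmetric])
      (use bij_betw_imp_inj_on[OF b1] in \<open>auto simp: w_def\<close>)
  moreover have "c 2 = d_prod n (perm_partition n w) (unit_kern n ?J2 ?b)"
    unfolding \<tau>2(2)
  proof (rule perm_unit[OF D(1,2), symmetric])
    show "?b (w i) = \<tau>2 (?b i)" if "i \<in> ?J2" for i
      using block_index_eq[OF \<tau>2_in[OF block_index(1)[OF that]] w_blk[OF that]] .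
    show "inj_on \<tau>2 (?b ` ?J2)" using \<tau>2(1) by (rule bij_betw_imp_inj_on)
  qed
  ultimately have "c = pair_mult n (perm_pair n w) ?I"
    using It pairD(5)[OF cP] by (intro pair_eqI) (simp_all add: perm_pair_def)
  then show thesis using wG that by blast
qed

section \<open>Twisted monoid algebras\<close>

lemma sum_basis_elem:
  assumes "finite B" "x \<in> B"
  shows "(\<Sum>c\<in>B. basis_elem x c * (g c :: 'k::field)) = g x"
  using assms by (simp add: basis_elem_def if_distrib[of "\<lambda>y. y * _"] sum.delta' cong: if_cong)

text \<open>A finite monoid with a 2-cocycle normalised at the unit; \<open>cocycle\<close> is what
  associativity of the scaled product needs. Covers the pair algebra and, with s = 1, the group
  algebras.\<close>

locale twisted_monoid =
  fixes B :: "'b set" and s :: "'b \<Rightarrow> 'b \<Rightarrow> 'k::field" and m :: "'b \<Rightarrow> 'b \<Rightarrow> 'b" and u :: 'b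
  assumes fin: "finite B"
    and m_closed: "a \<in> B \<Longrightarrow> b \<in> B \<Longrightarrow> m a b \<in> B" and u_closed: "u \<in> B"
    and m_assoc: "a \<in> B \<Longrightarrow> b \<in> B \<Longrightarrow> c \<in> B \<Longrightarrow> m (m a b) c = m a (m b c)"
    and cocycle: "a \<in> B \<Longrightarrow> b \<in> B \<Longrightarrow> c \<in> B \<Longrightarrow> s a b * s (m a b) c = s b c * s a (m b c)"
    and unit: "b \<in> B \<Longrightarrow> m u b = b" "b \<in> B \<Longrightarrow> m b u = b" "b \<in> B \<Longrightarrow> s u b = 1" "b \<in> B \<Longrightarrow> s b u = 1"
begin

abbreviation P where "P \<equiv> basis_algebra B s m u"

lemma P_simps:
  "carrier P = {f. \<forall>c. c \<notin> B \<longrightarrow> f c = 0}" "\<one>\<^bsub>P\<^esub> = basis_elem u" "\<zero>\<^bsub>P\<^esub> = (\<lambda>_. 0)"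
  "f \<oplus>\<^bsub>P\<^esub> g = (\<lambda>c. f c + g c)"
  "f \<otimes>\<^bsub>P\<^esub> g = (\<lambda>c. \<Sum>a\<in>B. \<Sum>b\<in>B. f a * g b * s a b * basis_elem (m a b) c)"
  by (simp_all add: basis_algebra_def)

text \<open>Evaluates a linear functional on a product. Applied to nested products, it reduces
  associativity to rearranging triple sums.\<close>

lemma sum_mult:
  "(\<Sum>c\<in>B. (f \<otimes>\<^bsub>P\<^esub> g) c * h c) = (\<Sum>a\<in>B. \<Sum>b\<in>B. f a * g b * s a b * h (m a b))"
proof -
  have "(\<Sum>c\<in>B. (f \<otimes>\<^bsub>P\<^esub> g) c * h c) =
      (\<Sum>c\<in>B. \<Sum>a\<in>B. \<Sum>b\<in>B. f a * g b * s a b * (basis_elem (m a b) c * h c))"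
    unfolding P_simps by (simp add: sum_distrib_right mult.assoc)
  also have "\<dots> = (\<Sum>a\<in>B. \<Sum>c\<in>B. \<Sum>b\<in>B. f a * g b * s a b * (basis_elem (m a b) c * h c))"
    by (rule sum.swap)
  also have "\<dots> = (\<Sum>a\<in>B. \<Sum>b\<in>B. \<Sum>c\<in>B. f a * g b * s a b * (basis_elem (m a b) c * h c))"
    by (rule sum.cong[OF HOL.refl], rule sum.swap)
  also have "\<dots> = (\<Sum>a\<in>B. \<Sum>b\<in>B. f a * g b * s a b * h (m a b))"
    by (intro sum.cong HOL.refl)
      (simp add: sum_distrib_left[symmetric] sum_basis_elem[OF fin] m_closed)
  finally show ?thesis .
qed

lemma mult_nonzero:
  assumes "(f \<otimes>\<^bsub>P\<^esub> g) c \<noteq> 0"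
  obtains a b where "a \<in> B" "b \<in> B" "f a \<noteq> 0" "g b \<noteq> 0" "c = m a b"
proof -
  obtain a where a: "a \<in> B" "(\<Sum>b\<in>B. f a * g b * s a b * basis_elem (m a b) c) \<noteq> 0"
    using assms unfolding P_simps by (meson sum.neutral)
  then obtain b where b: "b \<in> B" "f a * g b * s a b * basis_elem (m a b) c \<noteq> 0"
    by (meson sum.neutral)
  then have "f a \<noteq> 0" "g b \<noteq> 0" "c = m a b" by (auto simp: basis_elem_def split: if_splits)
  then show thesis using that a(1) b(1) by blast
qed

lemma mult_basis_right:
  assumes "x \<in> B"
  shows "(f \<otimes>\<^bsub>P\<^esub> (\<lambda>c. k * basis_elem x c)) d = (\<Sum>a\<in>B. f a * k * s a x * basis_elem (m a x) d)"
  unfolding P_simps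
proof (rule sum.cong[OF HOL.refl])
  fix a
  have "(\<Sum>b\<in>B. f a * (k * basis_elem x b) * s a b * basis_elem (m a b) d) =
      (\<Sum>b\<in>B. basis_elem x b * (f a * k * s a b * basis_elem (m a b) d))"
    by (simp add: ac_simps)
  then show "(\<Sum>b\<in>B. f a * (k * basis_elem x b) * s a b * basis_elem (m a b) d) =
      f a * k * s a x * basis_elem (m a x) d"
    by (simp only: sum_basis_elem[OF fin assms])
qed

lemma mult_basis_left:
  assumes "x \<in> B"
  shows "((\<lambda>c. k * basis_elem x c) \<otimes>\<^bsub>P\<^esub> f) d = (\<Sum>b\<in>B. k * f b * s x b * basis_elem (m x b) d)"
proof -
  have "((\<lambda>c. k * basis_elem x c) \<otimes>\<^bsub>P\<^esub> f) d =
      (\<Sum>a\<in>B. basis_elem x a * (\<Sum>b\<in>B. k * f b * s a b * basis_elem (m a b) d))"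
    unfolding P_simps by (simp add: sum_distrib_left ac_simps)
  then show ?thesis by (simp only: sum_basis_elem[OF fin assms])
qed

lemma basis_mult:
  assumes "x \<in> B" "y \<in> B"
  shows "(\<lambda>c. k * basis_elem x c) \<otimes>\<^bsub>P\<^esub> (\<lambda>c. l * basis_elem y c) =
    (\<lambda>c. k * l * s x y * basis_elem (m x y) c)"
proof
  fix d
  have "((\<lambda>c. k * basis_elem x c) \<otimes>\<^bsub>P\<^esub> (\<lambda>c. l * basis_elem y c)) d =
      (\<Sum>b\<in>B. basis_elem y b * (k * l * s x b * basis_elem (m x b) d))"
    unfolding mult_basis_left[OF assms(1)] by (simp add: ac_simps)
  then show "((\<lambda>c. k * basis_elem x c) \<otimes>\<^bsub>P\<^esub> (\<lambda>c. l * basis_elem y c)) d =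
      k * l * s x y * basis_elem (m x y) d"
    by (simp only: sum_basis_elem[OF fin assms(2)])
qed

lemma basis_closed: "x \<in> B \<Longrightarrow> (\<lambda>c. k * basis_elem x c) \<in> carrier P"
  by (auto simp: P_simps basis_elem_def)

lemma mult_closed: "f \<in> carrier P \<Longrightarrow> g \<in> carrier P \<Longrightarrow> f \<otimes>\<^bsub>P\<^esub> g \<in> carrier P"
proof -
  have "c \<in> B" if nz: "(f \<otimes>\<^bsub>P\<^esub> g) c \<noteq> 0" for c
  proof -
    obtain a b where "a \<in> B" "b \<in> B" "c = m a b" using nz by (rule mult_nonzero)
    then show ?thesis using m_closed by simp
  qed
  then show ?thesis unfolding P_simps(1) by blast
qed

lemma ring_P: "ring P"
proof (rule ringI)
  show "abelian_group P"
  proof (rule abelian_groupI)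
    show "\<exists>g\<in>carrier P. g \<oplus>\<^bsub>P\<^esub> f = \<zero>\<^bsub>P\<^esub>" if "f \<in> carrier P" for f
      using that by (intro bexI[of _ "\<lambda>c. - f c"]) (simp_all add: P_simps)
  qed (simp_all add: P_simps ac_simps)
  show "monoid P"
  proof (rule monoidI)
    show "\<one>\<^bsub>P\<^esub> \<in> carrier P" using basis_closed[OF u_closed, of 1] by (simp add: P_simps(2))
    fix f assume f: "f \<in> carrier P"
    have f_eq: "(\<Sum>b\<in>B. f b * basis_elem b d) = f d" for d
    proof (cases "d \<in> B")
      case True
      have "(\<Sum>b\<in>B. f b * basis_elem b d) = (\<Sum>b\<in>B. basis_elem d b * f b)"
        by (intro sum.cong) (simp_all add: basis_elem_def)
      then show ?thesis using sum_basis_elem[OF fin True] by simp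
    next
      case False
      then have "(\<Sum>b\<in>B. f b * basis_elem b d) = 0"
        by (intro sum.neutral) (auto simp: basis_elem_def)
      then show ?thesis using False f by (simp add: P_simps)
    qed
    show "\<one>\<^bsub>P\<^esub> \<otimes>\<^bsub>P\<^esub> f = f"
    proof
      fix d
      have "((\<lambda>c. 1 * basis_elem u c) \<otimes>\<^bsub>P\<^esub> f) d = (\<Sum>b\<in>B. f b * basis_elem b d)"
        unfolding mult_basis_left[OF u_closed] by (intro sum.cong) (simp_all add: unit)
      then show "(\<one>\<^bsub>P\<^esub> \<otimes>\<^bsub>P\<^esub> f) d = f d" using f_eq by (simp add: P_simps(2))
    qed
    show "f \<otimes>\<^bsub>P\<^esub> \<one>\<^bsub>P\<^esub> = f"
    proof
      fix d
      have "(f \<otimes>\<^bsub>P\<^esub> (\<lambda>c. 1 * basis_elem u c)) d = (\<Sum>b\<in>B. f b * basis_elem b d)"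
        unfolding mult_basis_right[OF u_closed] by (intro sum.cong) (simp_all add: unit)
      then show "(f \<otimes>\<^bsub>P\<^esub> \<one>\<^bsub>P\<^esub>) d = f d" using f_eq by (simp add: P_simps(2))
    qed
    fix g h
    show "f \<otimes>\<^bsub>P\<^esub> g \<otimes>\<^bsub>P\<^esub> h = f \<otimes>\<^bsub>P\<^esub> (g \<otimes>\<^bsub>P\<^esub> h)"
    proof
      fix d :: 'b
      let ?e = "\<lambda>x. basis_elem x d"
      have "(f \<otimes>\<^bsub>P\<^esub> g \<otimes>\<^bsub>P\<^esub> h) d = (\<Sum>c\<in>B. (f \<otimes>\<^bsub>P\<^esub> g) c * (\<Sum>z\<in>B. h z * s c z * ?e (m c z)))"
        unfolding P_simps(5)[of "f \<otimes>\<^bsub>P\<^esub> g"] by (simp add: sum_distrib_left mult.assoc)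
      also have "\<dots> = (\<Sum>a\<in>B. \<Sum>b\<in>B. \<Sum>z\<in>B. f a * g b * h z * (s a b * s (m a b) z) * ?e (m (m a b) z))"
        unfolding sum_mult by (simp add: sum_distrib_left ac_simps)
      also have "\<dots> = (\<Sum>a\<in>B. \<Sum>b\<in>B. \<Sum>z\<in>B. f a * g b * h z * (s b z * s a (m b z)) * ?e (m a (m b z)))"
        by (intro sum.cong HOL.refl) (simp add: cocycle m_assoc)
      also have "\<dots> = (\<Sum>a\<in>B. \<Sum>b\<in>B. \<Sum>z\<in>B. g b * h z * s b z * (f a * s a (m b z) * ?e (m a (m b z))))"
        by (simp add: ac_simps)
      also have "\<dots> = (\<Sum>a\<in>B. \<Sum>c\<in>B. (g \<otimes>\<^bsub>P\<^esub> h) c * (f a * s a c * ?e (m a c)))"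
        unfolding sum_mult ..
      also have "\<dots> = (f \<otimes>\<^bsub>P\<^esub> (g \<otimes>\<^bsub>P\<^esub> h)) d"
        unfolding P_simps(5)[of f] by (simp add: ac_simps)
      finally show "(f \<otimes>\<^bsub>P\<^esub> g \<otimes>\<^bsub>P\<^esub> h) d = (f \<otimes>\<^bsub>P\<^esub> (g \<otimes>\<^bsub>P\<^esub> h)) d" .
    qed
  qed (rule mult_closed)
qed (simp_all add: P_simps algebra_simps sum.distrib)

sublocale P: ring P by (rule ring_P)

lemma minus_P: "f \<in> carrier P \<Longrightarrow> g \<in> carrier P \<Longrightarrow> f \<ominus>\<^bsub>P\<^esub> g = (\<lambda>c. f c - g c)"
proof -
  assume g: "f \<in> carrier P" "g \<in> carrier P"
  have "\<ominus>\<^bsub>P\<^esub> g = (\<lambda>c. - g c)"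
    by (rule P.minus_equality) (use g in \<open>simp_all add: P_simps\<close>)
  then show ?thesis by (simp add: a_minus_def P_simps)
qed

text \<open>Only basis elements in the support of f are tested, so the support condition of an ideal
  such as \<open>lower_ideal\<close> can be used.\<close>

lemma span_induct:
  assumes f: "f \<in> carrier P" and zero: "(\<lambda>_. 0) \<in> K"
    and add: "\<And>g h. g \<in> K \<Longrightarrow> h \<in> K \<Longrightarrow> (\<lambda>c. g c + h c) \<in> K"
    and basis: "\<And>x k. x \<in> B \<Longrightarrow> f x \<noteq> 0 \<Longrightarrow> (\<lambda>c. k * basis_elem x c) \<in> K"
  shows "f \<in> K"
proof -
  have "(\<lambda>c. if c \<in> S then f c else 0) \<in> K" if "finite S" "S \<subseteq> B" for S
    using that
  proof (induction S rule: finite_induct)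
    case (insert x S)
    have "(\<lambda>c. f x * basis_elem x c) \<in> K"
      using insert.prems basis zero by (cases "f x = 0") auto
    moreover have "(\<lambda>c. if c \<in> insert x S then f c else 0) =
        (\<lambda>c. (if c \<in> S then f c else 0) + f x * basis_elem x c)"
      using insert.hyps by (auto simp: basis_elem_def)
    ultimately show ?case using insert add by simp
  qed (use zero in simp)
  from this[OF fin subset_refl] have "(\<lambda>c. if c \<in> B then f c else 0) \<in> K" .
  moreover have "(\<lambda>c. if c \<in> B then f c else 0) = f" using f by (auto simp: P_simps)
  ultimately show ?thesis by simp
qed

end

text \<open>What the combinatorics has to deliver for one apex: a copy of G on which the twist is
  trivial, an element x that is idempotent up to a nonzero scalar, and an ideal \<open>Low\<close>
  of the monoid outside which every x a x is a translate of x by a unique element of G.\<close>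

locale monoid_apex = twisted_monoid B s m u
  for B :: "'b set" and s :: "'b \<Rightarrow> 'b \<Rightarrow> 'k::field" and m u +
  fixes G :: "('i \<Rightarrow> 'i) set" and h :: "('i \<Rightarrow> 'i) \<Rightarrow> 'b" and x :: 'b and Low :: "'b set"
  assumes G: "finite G" "id \<in> G" "\<And>w v. w \<in> G \<Longrightarrow> v \<in> G \<Longrightarrow> w \<circ> v \<in> G"
    and h: "\<And>w. w \<in> G \<Longrightarrow> h w \<in> B" "h id = u"
      "\<And>w v. w \<in> G \<Longrightarrow> v \<in> G \<Longrightarrow> h (w \<circ> v) = m (h w) (h v)"
      "\<And>w b. w \<in> G \<Longrightarrow> b \<in> B \<Longrightarrow> s (h w) b = 1 \<and> s b (h w) = 1"
    and x: "x \<in> B" "m x x = x" "s x x \<noteq> 0"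
      "\<And>w. w \<in> G \<Longrightarrow> m (h w) x = m x (h w)"
      "\<And>w v. w \<in> G \<Longrightarrow> v \<in> G \<Longrightarrow> m (h w) x = m (h v) x \<Longrightarrow> w = v"
    and Low: "Low \<subseteq> B" "\<And>a b. a \<in> B \<Longrightarrow> b \<in> Low \<Longrightarrow> m a b \<in> Low \<and> m b a \<in> Low"
      "\<And>w. w \<in> G \<Longrightarrow> m (h w) x \<notin> Low"
      "\<And>a. a \<in> B \<Longrightarrow> m x (m a x) \<in> Low \<or> (\<exists>w\<in>G. m x (m a x) = m (h w) x)"
begin

sublocale G: twisted_monoid G "\<lambda>_ _. 1 :: 'k" "(\<circ>)" id
  by unfold_locales (use G in \<open>auto simp: comp_assoc\<close>)

definition J where "J = {f \<in> carrier P. \<forall>a. f a \<noteq> 0 \<longrightarrow> a \<in> Low}"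

definition e where "e = (\<lambda>c. inverse (s x x) * basis_elem x c)"

definition \<phi> :: "(('i \<Rightarrow> 'i) \<Rightarrow> 'k) \<Rightarrow> 'b \<Rightarrow> 'k"
  where "\<phi> f = (\<lambda>c. \<Sum>w\<in>G. f w * basis_elem (h w) c)"

lemma phi_sum: "(\<Sum>c\<in>B. \<phi> f c * g c) = (\<Sum>w\<in>G. f w * g (h w))"
proof -
  have "(\<Sum>c\<in>B. \<phi> f c * g c) = (\<Sum>c\<in>B. \<Sum>w\<in>G. f w * (basis_elem (h w) c * g c))"
    by (simp add: \<phi>_def sum_distrib_right mult.assoc)
  also have "\<dots> = (\<Sum>w\<in>G. \<Sum>c\<in>B. f w * (basis_elem (h w) c * g c))" by (rule sum.swap)
  also have "\<dots> = (\<Sum>w\<in>G. f w * g (h w))"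
    by (intro sum.cong HOL.refl) (simp add: sum_distrib_left[symmetric] sum_basis_elem[OF fin] h)
  finally show ?thesis .
qed

lemma phi_closed: "\<phi> f \<in> carrier P"
proof -
  have "\<phi> f c = 0" if "c \<notin> B" for c
    unfolding \<phi>_def using that h(1) by (intro sum.neutral) (auto simp: basis_elem_def)
  then show ?thesis by (simp add: P_simps)
qed

lemma e_closed: "e \<in> carrier P"
  unfolding e_def by (rule basis_closed[OF x(1)])

lemma e_idem: "e \<otimes>\<^bsub>P\<^esub> e = e"
  unfolding e_def basis_mult[OF x(1) x(1)] x(2) using x(3) by (simp add: mult.assoc)

lemma phi_e:
  "(\<phi> f \<otimes>\<^bsub>P\<^esub> e) d = (\<Sum>w\<in>G. f w * (inverse (s x x) * basis_elem (m (h w) x) d))"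
  "(e \<otimes>\<^bsub>P\<^esub> \<phi> f) d = (\<Sum>w\<in>G. f w * (inverse (s x x) * basis_elem (m x (h w)) d))"
proof -
  have "(\<phi> f \<otimes>\<^bsub>P\<^esub> e) d = (\<Sum>a\<in>B. \<phi> f a * (inverse (s x x) * s a x * basis_elem (m a x) d))"
    unfolding e_def mult_basis_right[OF x(1)] by (simp add: mult.assoc)
  also have "\<dots> = (\<Sum>w\<in>G. f w * (inverse (s x x) * basis_elem (m (h w) x) d))"
    unfolding phi_sum by (intro sum.cong) (simp_all add: h x)
  finally show "(\<phi> f \<otimes>\<^bsub>P\<^esub> e) d = (\<Sum>w\<in>G. f w * (inverse (s x x) * basis_elem (m (h w) x) d))" .
  have "(e \<otimes>\<^bsub>P\<^esub> \<phi> f) d = (\<Sum>a\<in>B. \<phi> f a * (inverse (s x x) * s x a * basis_elem (m x a) d))"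
    unfolding e_def mult_basis_left[OF x(1)] by (simp add: ac_simps)
  also have "\<dots> = (\<Sum>w\<in>G. f w * (inverse (s x x) * basis_elem (m x (h w)) d))"
    unfolding phi_sum by (intro sum.cong) (simp_all add: h x)
  finally show "(e \<otimes>\<^bsub>P\<^esub> \<phi> f) d = (\<Sum>w\<in>G. f w * (inverse (s x x) * basis_elem (m x (h w)) d))" .
qed

lemma phi_e_at:
  assumes "w \<in> G"
  shows "(\<phi> f \<otimes>\<^bsub>P\<^esub> e) (m (h w) x) = f w * inverse (s x x)"
proof -
  have "(\<phi> f \<otimes>\<^bsub>P\<^esub> e) (m (h w) x) = (\<Sum>v\<in>G. basis_elem w v * (f v * inverse (s x x)))"
    unfolding phi_e using x(5) assms by (intro sum.cong) (auto simp: basis_elem_def)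
  then show ?thesis by (simp only: sum_basis_elem[OF G(1) assms])
qed

lemma phi_hom: "\<phi> \<in> ring_hom (group_algebra G) P"
proof (rule ring_hom_memI)
  fix f g
  show "\<phi> f \<in> carrier P" by (rule phi_closed)
  show "\<phi> (f \<otimes>\<^bsub>group_algebra G\<^esub> g) = \<phi> f \<otimes>\<^bsub>P\<^esub> \<phi> g"
  proof
    fix d
    have "\<phi> (f \<otimes>\<^bsub>group_algebra G\<^esub> g) d =
        (\<Sum>v\<in>G. \<Sum>w\<in>G. f v * g w * basis_elem (h (v \<circ> w)) d)"
      unfolding \<phi>_def group_algebra_def G.sum_mult by simp
    also have "\<dots> = (\<Sum>v\<in>G. f v * (\<Sum>w\<in>G. g w * (s (h v) (h w) * basis_elem (m (h v) (h w)) d)))"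
      by (simp add: sum_distrib_left mult.assoc h)
    also have "\<dots> = (\<Sum>a\<in>B. \<phi> f a * (\<Sum>b\<in>B. \<phi> g b * (s a b * basis_elem (m a b) d)))"
      unfolding phi_sum ..
    also have "\<dots> = (\<phi> f \<otimes>\<^bsub>P\<^esub> \<phi> g) d"
      unfolding P_simps(5) by (simp add: sum_distrib_left mult.assoc)
    finally show "\<phi> (f \<otimes>\<^bsub>group_algebra G\<^esub> g) d = (\<phi> f \<otimes>\<^bsub>P\<^esub> \<phi> g) d" .
  qed
  show "\<phi> (f \<oplus>\<^bsub>group_algebra G\<^esub> g) = \<phi> f \<oplus>\<^bsub>P\<^esub> \<phi> g"
    by (auto simp: \<phi>_def group_algebra_def G.P_simps P_simps algebra_simps sum.distrib)
next
  show "\<phi> \<one>\<^bsub>group_algebra G\<^esub> = \<one>\<^bsub>P\<^esub>"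
    unfolding group_algebra_def G.P_simps P_simps \<phi>_def sum_basis_elem[OF G(1,2)] h(2) by simp
qed

lemma ideal_J: "ideal J P"
proof (intro ideal.intro ideal_axioms.intro additive_subgroupI ring_P subgroup.intro)
  fix f assume f: "f \<in> J"
  then have "\<zero>\<^bsub>P\<^esub> \<ominus>\<^bsub>P\<^esub> f = (\<lambda>c. \<zero>\<^bsub>P\<^esub> c - f c)"
    by (intro minus_P) (simp_all add: J_def del: P_simps)
  then have "\<zero>\<^bsub>P\<^esub> \<ominus>\<^bsub>P\<^esub> f = (\<lambda>c. - f c)" by (simp only: P_simps(3) diff_0)
  moreover have "\<zero>\<^bsub>P\<^esub> \<ominus>\<^bsub>P\<^esub> f = \<ominus>\<^bsub>P\<^esub> f" using f by (simp add: a_minus_def J_def)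
  ultimately show "inv\<^bsub>add_monoid P\<^esub> f \<in> J"
    using f unfolding a_inv_def[symmetric] by (simp add: J_def P_simps(1))
next
  fix f g assume "f \<in> J" "g \<in> carrier P"
  then show "g \<otimes>\<^bsub>P\<^esub> f \<in> J" "f \<otimes>\<^bsub>P\<^esub> g \<in> J"
    using Low(2) mult_closed unfolding J_def by (auto elim!: mult_nonzero)
next
  fix f g assume "f \<in> J" "g \<in> J"
  then have "f a = 0" "g a = 0" if "a \<notin> Low" for a using that unfolding J_def by blast+
  then have "f a + g a = 0" if "a \<notin> Low" for a using that by simp
  then show "f \<otimes>\<^bsub>add_monoid P\<^esub> g \<in> J"
    using \<open>f \<in> J\<close> \<open>g \<in> J\<close> by (fastforce simp: J_def P_simps(1,4))
qed (auto simp: J_def P_simps)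

lemma e_mult_nonzero:
  assumes "(e \<otimes>\<^bsub>P\<^esub> r \<otimes>\<^bsub>P\<^esub> e) c \<noteq> 0"
  shows "\<exists>a\<in>B. c = m x (m a x)"
proof -
  obtain a b where ab: "a \<in> B" "b \<in> B" "(e \<otimes>\<^bsub>P\<^esub> r) a \<noteq> 0" "e b \<noteq> 0" "c = m a b"
    using assms by (rule mult_nonzero)
  obtain a' b' where ab': "a' \<in> B" "b' \<in> B" "e a' \<noteq> 0" "a = m a' b'" using ab(3) by (rule mult_nonzero)
  have "a' = x" "b = x" using ab(4) ab'(3) by (auto simp: e_def basis_elem_def split: if_splits)
  then show ?thesis using ab ab' x(1) m_assoc by auto
qed

lemma apex: "apex J P (group_algebra G) \<phi> e"
proof (intro apex.intro ideal_J apex_axioms.intro e_closed e_idem phi_hom)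
  show "ring (group_algebra G :: (('i \<Rightarrow> 'i) \<Rightarrow> 'k) ring)"
    unfolding group_algebra_def by (rule G.ring_P)
  show "\<phi> f \<otimes>\<^bsub>P\<^esub> e = e \<otimes>\<^bsub>P\<^esub> \<phi> f" for f
    unfolding phi_e[abs_def] fun_eq_iff phi_e by (intro allI sum.cong HOL.refl) (simp add: x(4))
  show "\<exists>f\<in>carrier (group_algebra G). e \<otimes>\<^bsub>P\<^esub> r \<otimes>\<^bsub>P\<^esub> e \<ominus>\<^bsub>P\<^esub> \<phi> f \<otimes>\<^bsub>P\<^esub> e \<in> J"
    if r: "r \<in> carrier P" for r
  proof
    let ?y = "e \<otimes>\<^bsub>P\<^esub> r \<otimes>\<^bsub>P\<^esub> e"
    \<comment> \<open>The coefficient of f at w is read off at the basis element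
      \<open>m (h w) x\<close>; the factor \<open>s x x\<close> compensates the inverse in
      e.\<close>
    define f where "f = (\<lambda>w. if w \<in> G then ?y (m (h w) x) * s x x else 0)"
    show "f \<in> carrier (group_algebra G)" by (simp add: f_def group_algebra_def G.P_simps)
    have y: "?y \<in> carrier P" and fe: "\<phi> f \<otimes>\<^bsub>P\<^esub> e \<in> carrier P"
      using r e_closed phi_closed mult_closed by auto
    have "c \<in> Low" if "?y c - (\<phi> f \<otimes>\<^bsub>P\<^esub> e) c \<noteq> 0" for c
    proof (rule ccontr)
      assume c: "c \<notin> Low"
      have "\<exists>w\<in>G. c = m (h w) x"
      proof (cases "?y c = 0")
        case True
        then have "(\<phi> f \<otimes>\<^bsub>P\<^esub> e) c \<noteq> 0" using that by simp
        then obtain w where "w \<in> G" "f w * (inverse (s x x) * basis_elem (m (h w) x) c) \<noteq> 0"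
          unfolding phi_e by (meson sum.neutral)
        then show ?thesis by (auto simp: basis_elem_def split: if_splits)
      next
        case False
        then obtain a where "a \<in> B" "c = m x (m a x)" using e_mult_nonzero by blast
        then show ?thesis using Low(4) c by blast
      qed
      then obtain w where w: "w \<in> G" "c = m (h w) x" by blast
      then have "(\<phi> f \<otimes>\<^bsub>P\<^esub> e) c = ?y c" using phi_e_at[OF w(1)] x(3) by (simp add: f_def)
      then show False using that by simp
    qed
    then show "?y \<ominus>\<^bsub>P\<^esub> \<phi> f \<otimes>\<^bsub>P\<^esub> e \<in> J"
      using P.minus_closed[OF y fe] unfolding J_def minus_P[OF y fe] by blast
  qed
  show "f = \<zero>\<^bsub>group_algebra G\<^esub>"
    if f: "f \<in> carrier (group_algebra G)" and J: "\<phi> f \<otimes>\<^bsub>P\<^esub> e \<in> J" for f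
  proof -
    have "f w = 0" for w
    proof (cases "w \<in> G")
      case True
      then have "(\<phi> f \<otimes>\<^bsub>P\<^esub> e) (m (h w) x) = 0" using J Low(3)[OF True] unfolding J_def by blast
      then show ?thesis using phi_e_at[OF True] x(3) by simp
    qed (use f in \<open>simp add: group_algebra_def G.P_simps\<close>)
    then show ?thesis by (auto simp: group_algebra_def G.P_simps)
  qed
qed

text \<open>The bimodule is defined with the basis element x, the apex with its multiple e; the
  scalar between them is invertible.\<close>

lemma left_ideal_e: "{y \<otimes>\<^bsub>P\<^esub> basis_elem x | y. y \<in> carrier P} = {y \<otimes>\<^bsub>P\<^esub> e | y. y \<in> carrier P}"
proof (intro equalityI subsetI)
  have scale: "(\<lambda>c. k * f c) \<otimes>\<^bsub>P\<^esub> g = f \<otimes>\<^bsub>P\<^esub> (\<lambda>c. k * g c)" for k and f g :: "'b \<Rightarrow> 'k"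
    unfolding P_simps by (simp add: ac_simps)
  have closed: "(\<lambda>c. k * f c) \<in> carrier P" if "f \<in> carrier P" for k and f :: "'b \<Rightarrow> 'k"
    using that by (simp add: P_simps)
  fix z
  show "z \<in> {y \<otimes>\<^bsub>P\<^esub> e | y. y \<in> carrier P}" if "z \<in> {y \<otimes>\<^bsub>P\<^esub> basis_elem x | y. y \<in> carrier P}"
  proof -
    obtain y where y: "y \<in> carrier P" "z = y \<otimes>\<^bsub>P\<^esub> basis_elem x" using \<open>z \<in> _\<close> by blast
    have "(\<lambda>c. s x x * e c) = basis_elem x" using x(3) by (auto simp: e_def)
    then have "z = (\<lambda>c. s x x * y c) \<otimes>\<^bsub>P\<^esub> e" using y(2) scale by metis
    then show ?thesis using closed[OF y(1)] by blast
  qed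
  show "z \<in> {y \<otimes>\<^bsub>P\<^esub> basis_elem x | y. y \<in> carrier P}" if "z \<in> {y \<otimes>\<^bsub>P\<^esub> e | y. y \<in> carrier P}"
  proof -
    obtain y where y: "y \<in> carrier P" "z = y \<otimes>\<^bsub>P\<^esub> e" using \<open>z \<in> _\<close> by blast
    then have "z = (\<lambda>c. inverse (s x x) * y c) \<otimes>\<^bsub>P\<^esub> basis_elem x" unfolding e_def scale by simp
    then show ?thesis using closed[OF y(1)] by blast
  qed
qed

end

section \<open>Algebras of dimension one\<close>

text \<open>Every nonzero element is invertible, so the regular module is simple, and acting on a
  nonzero vector identifies it with any other simple module.\<close>

lemma simple_classes_one_dim:
  assumes "twisted_monoid {u} (s :: 'b \<Rightarrow> 'b \<Rightarrow> 'k::field) m u"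
  shows "card (simple_classes (basis_algebra {u} s m u)) = 1"
proof -
  interpret twisted_monoid "{u}" s m u by fact
  let ?M = "regular_module P"
  have M: "left_module P ?M" by (rule left_module_regular[OF ring_P])
  interpret M: left_module P ?M by (rule M)
  have M_simps: "carrier ?M = carrier P" "\<zero>\<^bsub>?M\<^esub> = \<zero>\<^bsub>P\<^esub>" "add ?M = add P" "smult ?M = monoid.mult P"
    by (simp_all add: regular_module_def mk_module_def)
  have mem: "f = (\<lambda>c. f u * basis_elem u c)" if "f \<in> carrier P" for f
    using that by (auto simp: P_simps basis_elem_def)
  \<comment> \<open>The only basis element is the unit, so an element is a scalar and its inverse is
    the inverse scalar.\<close>
  have invert: "\<exists>g\<in>carrier P. g \<otimes>\<^bsub>P\<^esub> f = \<one>\<^bsub>P\<^esub>" if f: "f \<in> carrier P" "f \<noteq> \<zero>\<^bsub>P\<^esub>" for f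
  proof
    have "f u \<noteq> 0" using f mem[OF f(1)] by (auto simp: P_simps)
    then have "(\<lambda>c. inverse (f u) * basis_elem u c) \<otimes>\<^bsub>P\<^esub> (\<lambda>c. f u * basis_elem u c) = \<one>\<^bsub>P\<^esub>"
      unfolding basis_mult[OF u_closed u_closed] by (simp add: unit P_simps)
    then show "(\<lambda>c. inverse (f u) * basis_elem u c) \<otimes>\<^bsub>P\<^esub> f = \<one>\<^bsub>P\<^esub>" using mem[OF f(1)] by simp
    show "(\<lambda>c. inverse (f u) * basis_elem u c) \<in> carrier P" by (rule basis_closed[OF u_closed])
  qed
  have iso: "module_iso P ?M N" if N: "simple_module P N" for N :: "('b \<Rightarrow> 'k, 'z) module"
  proof -
    interpret N: left_module P N using N by (simp add: simple_module_def)
    obtain x where x: "x \<in> carrier N" "x \<noteq> \<zero>\<^bsub>N\<^esub>"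
      using N N.M.zero_closed unfolding simple_module_def by blast
    let ?f = "\<lambda>r. r \<odot>\<^bsub>N\<^esub> x"
    have "inj_on ?f (carrier P)"
    proof (rule inj_onI)
      fix r r' assume r: "r \<in> carrier P" "r' \<in> carrier P" "?f r = ?f r'"
      then have d: "(r \<ominus>\<^bsub>P\<^esub> r') \<odot>\<^bsub>N\<^esub> x = \<zero>\<^bsub>N\<^esub>"
        using x by (simp add: N.smult_diff_left N.M.minus_eq_zero_iff)
      show "r = r'"
      proof (rule ccontr)
        assume "r \<noteq> r'"
        then obtain g where g: "g \<in> carrier P" "g \<otimes>\<^bsub>P\<^esub> (r \<ominus>\<^bsub>P\<^esub> r') = \<one>\<^bsub>P\<^esub>"
          using invert[of "r \<ominus>\<^bsub>P\<^esub> r'"] r P.minus_eq_zero_iff by blast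
        have "x = (g \<otimes>\<^bsub>P\<^esub> (r \<ominus>\<^bsub>P\<^esub> r')) \<odot>\<^bsub>N\<^esub> x" unfolding g(2) using x by simp
        also have "\<dots> = g \<odot>\<^bsub>N\<^esub> ((r \<ominus>\<^bsub>P\<^esub> r') \<odot>\<^bsub>N\<^esub> x)"
          using g(1) r x by (intro N.smult_assoc) simp_all
        also have "\<dots> = \<zero>\<^bsub>N\<^esub>" unfolding d using g(1) by simp
        finally show False using x by simp
      qed
    qed
    moreover have "?f ` carrier P = carrier N"
    proof (intro equalityI subsetI)
      fix y assume "y \<in> carrier N"
      then obtain r where "r \<in> carrier P" "y = r \<odot>\<^bsub>N\<^esub> x" by (rule simple_generated[OF N x])
      then show "y \<in> ?f ` carrier P" by blast
    qed (use x in auto)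
    ultimately show ?thesis
      unfolding module_iso_def bij_betw_def M_simps
      by (intro exI[of _ ?f]) (use x in \<open>simp_all add: N.smult_l_distr N.smult_assoc\<close>)
  qed
  have simple: "simple_module P ?M"
    unfolding simple_module_def
  proof (intro conjI allI impI M)
    have "\<one>\<^bsub>P\<^esub> \<noteq> \<zero>\<^bsub>P\<^esub>" by (auto simp: P_simps basis_elem_def fun_eq_iff)
    then show "carrier ?M \<noteq> {\<zero>\<^bsub>?M\<^esub>}" unfolding M_simps using P.one_closed by blast
    fix N assume N: "submodule N P ?M"
    note HN = M.submoduleD[OF N, unfolded M_simps]
    show "N = {\<zero>\<^bsub>?M\<^esub>} \<or> N = carrier ?M"
    proof (cases "N \<subseteq> {\<zero>\<^bsub>P\<^esub>}")
      case True
      then show ?thesis using HN(2) unfolding M_simps by blast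
    next
      case False
      then obtain f where f: "f \<in> N" "f \<noteq> \<zero>\<^bsub>P\<^esub>" by blast
      then obtain g where g: "g \<in> carrier P" "g \<otimes>\<^bsub>P\<^esub> f = \<one>\<^bsub>P\<^esub>" using invert HN(1) by blast
      then have "\<one>\<^bsub>P\<^esub> \<in> N" using HN(5)[OF g(1) f(1)] by simp
      then have "r \<in> N" if "r \<in> carrier P" for r using HN(5)[OF that, of "\<one>\<^bsub>P\<^esub>"] that by simp
      then show ?thesis using HN(1) unfolding M_simps by blast
    qed
  qed
  obtain L :: "('b \<Rightarrow> 'k, ('b \<Rightarrow> 'k) set) module" where L: "simple_module P L" "module_iso P ?M L"
    using simple_module_copy[OF simple] .
  have "\<exists>f. bij_betw f {()} (simple_classes P)"
  proof (rule simple_classes_classification[where h = "\<lambda>_. L"])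
    show "\<exists>t\<in>{()}. module_iso P N L" if "simple_module P N" for N :: "('b \<Rightarrow> 'k, ('b \<Rightarrow> 'k) set) module"
      using module_iso_trans[OF module_iso_sym[OF iso[OF that] M] L(2)] by blast
  qed (use L in auto)
  then show ?thesis using bij_betw_same_card by fastforce
qed

lemma partitions_0: "partitions 0 = {{}}"
  unfolding partitions_def by (auto simp: row_def equiv_def refl_on_def sym_def trans_def)

lemma simple_classes_partition_algebra_0:
  assumes "finite T"
  shows "card (simple_classes (partition_algebra T leq (Q :: 't \<Rightarrow> 'k::field) 0)) = 1"
proof -
  let ?u = "\<lambda>t\<in>T. {} :: vertex rel"
  have e: "{} \<in> partitions 0" by (simp add: partitions_0)
  have B: "poset_partitions T leq 0 = {?u}"
  proof -
    have "(T \<rightarrow>\<^sub>E {{} :: vertex rel}) = {?u}" unfolding PiE_eq_singleton by simp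
    moreover have "refinement 0 a b" for a b by (simp add: refinement_def row_def)
    ultimately show ?thesis
      unfolding poset_partitions_def partitions_0 by (simp only: case_prod_unfold) simp
  qed
  have d: "d_prod 0 {} {} = {}" using d_prod_partition[OF e e] by (simp add: partitions_0)
  have p: "perm_partition 0 id = {}" by (simp add: perm_partition_def rel_of_parts_def)
  have c: "closed_parts 0 {} {} = 0" by (simp add: closed_parts_eq[OF e e] closed_classes_def row_def)
  have "partition_algebra T leq Q 0 = basis_algebra {?u}
    (\<lambda>a b. \<Prod>t\<in>T. Q t ^ closed_parts 0 (a t) (b t)) (\<lambda>a b. \<lambda>t\<in>T. d_prod 0 (a t) (b t)) ?u"
    unfolding partition_algebra_def B p ..
  moreover have "twisted_monoid {?u} (\<lambda>a b. \<Prod>t\<in>T. Q t ^ closed_parts 0 (a t) (b t))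
    (\<lambda>a b. \<lambda>t\<in>T. d_prod 0 (a t) (b t)) ?u"
  proof -
    have m: "(\<lambda>t\<in>T. d_prod 0 (?u t) (?u t)) = ?u" by (rule restrict_ext) (simp add: d)
    have s: "(\<Prod>t\<in>T. Q t ^ closed_parts 0 (?u t) (?u t)) = 1" by (intro prod.neutral) (simp add: c)
    show ?thesis
      by unfold_locales (simp_all only: singleton_iff m s mult_1 finite.emptyI finite_insert)
  qed
  ultimately show ?thesis by (simp only: simple_classes_one_dim)
qed

section \<open>The pair algebra\<close>

definition twist :: "(nat \<Rightarrow> 'k::field) \<Rightarrow> nat \<Rightarrow> pair_partition \<Rightarrow> pair_partition \<Rightarrow> 'k"
  where "twist Q n a b = (\<Prod>t\<in>two. Q t ^ closed_parts n (a t) (b t))"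

lemma twist_eq: "twist Q n a b = Q 1 ^ closed_parts n (a 1) (b 1) * Q 2 ^ closed_parts n (a 2) (b 2)"
  by (simp add: twist_def two_def)

lemma pair_algebra_eq:
  "pair_algebra Q n = basis_algebra (pair_partitions n) (twist Q n) (pair_mult n) (perm_pair n id)"
proof -
  have "(\<lambda>t\<in>two. perm_partition n id) = perm_pair n id"
    by (rule pair_eqI) (simp_all add: perm_pair_def, simp_all add: two_def)
  then show ?thesis
    unfolding partition_algebra_def twist_def[abs_def] pair_mult_def[abs_def] by simp
qed

lemma twist_perm:
  assumes "w permutes {1..n}" "b \<in> pair_partitions n"
  shows "twist Q n (perm_pair n w) b = 1 \<and> twist Q n b (perm_pair n w) = 1"
  using closed_parts_perm[OF assms(1) pairD(1)[OF assms(2)]] closed_parts_perm[OF assms(1) pairD(2)[OF assms(2)]]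
  by (simp add: twist_eq perm_pair_def)

text \<open>The additive identity \<open>closed_parts_cocycle\<close> holds on each level and
  becomes multiplicative in the exponents of Q.\<close>

lemma twisted_monoid_pairs:
  "twisted_monoid (pair_partitions n) (twist Q n) (pair_mult n) (perm_pair n id)"
proof
  fix a b c assume a: "a \<in> pair_partitions n" and b: "b \<in> pair_partitions n" and c: "c \<in> pair_partitions n"
  show "pair_mult n (pair_mult n a b) c = pair_mult n a (pair_mult n b c)"
    by (rule pair_mult_assoc[OF a b c])
  have "closed_parts n (a t) (b t) + closed_parts n (d_prod n (a t) (b t)) (c t) =
      closed_parts n (b t) (c t) + closed_parts n (a t) (d_prod n (b t) (c t))" if "t \<in> two" for t
    by (rule closed_parts_cocycle[OF pairD(4)[OF a that] pairD(4)[OF b that] pairD(4)[OF c that]])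
  then have *: "Q t ^ closed_parts n (a t) (b t) * Q t ^ closed_parts n (d_prod n (a t) (b t)) (c t) =
      Q t ^ closed_parts n (b t) (c t) * Q t ^ closed_parts n (a t) (d_prod n (b t) (c t))"
    if "t \<in> two" for t using that by (simp flip: power_add)
  show "twist Q n a b * twist Q n (pair_mult n a b) c = twist Q n b c * twist Q n a (pair_mult n b c)"
    unfolding twist_def by (simp add: * pair_mult_t flip: prod.distrib)
next
  fix b assume b: "b \<in> pair_partitions n"
  note perm_id[OF pairD(1)[OF b]] perm_id[OF pairD(2)[OF b]]
  then show "pair_mult n (perm_pair n id) b = b" "pair_mult n b (perm_pair n id) = b"
    using pairD(5)[OF b] by (auto intro!: pair_eqI simp: perm_pair_def)
  show "twist Q n (perm_pair n id) b = 1" "twist Q n b (perm_pair n id) = 1"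
    using twist_perm[OF permutes_id b] by blast+
qed (rule finite_pair_partitions pair_mult_closed perm_pair_closed permutes_id; assumption?)+

section \<open>The group of block permutations and the lower indices\<close>

lemma finite_block_perms: "finite (block_perms \<nu>)"
  by (rule finite_subset[OF _ finite_permutations[of "{1..env \<nu>}"]]) (auto simp: block_perms_def)

lemma block_perms_id: "id \<in> block_perms \<nu>"
  by (auto simp: block_perms_def permutes_id)

lemma block_perms_comp:
  assumes "w \<in> block_perms \<nu>" "v \<in> block_perms \<nu>"
  shows "w \<circ> v \<in> block_perms \<nu>"
  unfolding block_perms_def mem_Collect_eq
proof (intro conjI allI impI)
  show "w \<circ> v permutes {1..env \<nu>}" using assms by (auto simp: block_perms_def intro: permutes_compose)
  fix i assume "i < length \<nu>"
  then obtain j where j: "j < length \<nu>" "\<nu> ! i = \<nu> ! j" "v ` block \<nu> i = block \<nu> j"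
    using assms(2) unfolding block_perms_def by blast
  obtain k where k: "k < length \<nu>" "\<nu> ! j = \<nu> ! k" "w ` block \<nu> j = block \<nu> k"
    using assms(1) j(1) unfolding block_perms_def by blast
  show "\<exists>k<length \<nu>. \<nu> ! i = \<nu> ! k \<and> (w \<circ> v) ` block \<nu> i = block \<nu> k"
    using j k by (metis image_comp)
qed

definition lower :: "nat \<Rightarrow> nat list \<Rightarrow> pair_partition set"
  where "lower n \<nu> = {a \<in> pair_partitions n. index_less (prop_index n a) \<nu>}"

text \<open>No multiplication raises an index, and multiplication by a permutation can be
  undone.\<close>

lemma prop_index_perm_unit:
  assumes "w permutes {1..n}" "b \<in> pair_partitions n"
  shows "prop_index n (pair_mult n (perm_pair n w) b) = prop_index n b"
proof (rule index_le_antisym)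
  let ?w = "perm_pair n w" and ?v = "perm_pair n (inv_into UNIV w)"
  note w = perm_pair_closed[OF assms(1)] and v = perm_pair_closed[OF permutes_inv[OF assms(1)]]
  show "index_le (prop_index n (pair_mult n ?w b)) (prop_index n b)"
    by (rule prop_index_mult_right[OF w assms(2)])
  have "pair_mult n ?v ?w = perm_pair n id"
    using perm_prod[OF permutes_inv[OF assms(1)] assms(1)] permutes_inv_o(2)[OF assms(1)]
    by (intro pair_eqI) (simp_all add: perm_pair_def)
  then have "pair_mult n ?v (pair_mult n ?w b) = b"
    using pair_mult_assoc[OF v w assms(2)] twisted_monoid.unit(1)[OF twisted_monoid_pairs assms(2)] by simp
  then show "index_le (prop_index n b) (prop_index n (pair_mult n ?w b))"
    using prop_index_mult_right[OF v pair_mult_closed[OF w assms(2)]] by simp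
qed

lemma index_less_trans: "index_le \<mu> \<nu> \<Longrightarrow> index_less \<nu> \<rho> \<Longrightarrow> index_less \<mu> \<rho>"
  unfolding index_less_iff using index_le_antisym by (metis rtranclp_trans)

section \<open>The apexes of the pair algebra\<close>

locale pair_apex =
  fixes Q :: "nat \<Rightarrow> 'k::field" and n :: nat
  assumes Q: "Q 1 * Q 2 \<noteq> 0"
begin

lemma twist_nonzero: "twist Q n a b \<noteq> 0"
  using Q by (simp add: twist_eq)

abbreviation indices where "indices \<equiv> {\<nu> \<in> prop_indices. env \<nu> \<le> n}"

lemma monoid_apex:
  assumes "\<nu> \<in> indices"
  shows "monoid_apex (pair_partitions n) (twist Q n) (pair_mult n) (perm_pair n id)
    (block_perms \<nu>) (perm_pair n) (index_elem n \<nu>) (lower n \<nu>)"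
proof (intro monoid_apex.intro twisted_monoid_pairs monoid_apex_axioms.intro)
  have env: "env \<nu> \<le> n" and \<nu>: "\<nu> \<in> prop_indices" using assms by auto
  let ?I = "index_elem n \<nu>"
  note I = index_elem_closed[OF env]
  have perm: "w permutes {1..n}" if "w \<in> block_perms \<nu>" for w using block_permsD(1)[OF that env] .
  show "finite (block_perms \<nu>)" "id \<in> block_perms \<nu>" by (rule finite_block_perms block_perms_id)+
  show "w \<circ> v \<in> block_perms \<nu>" if "w \<in> block_perms \<nu>" "v \<in> block_perms \<nu>" for w v
    using that by (rule block_perms_comp)
  show "perm_pair n w \<in> pair_partitions n" if "w \<in> block_perms \<nu>" for w
    using perm[OF that] by (rule perm_pair_closed)
  show "perm_pair n (w \<circ> v) = pair_mult n (perm_pair n w) (perm_pair n v)"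
    if "w \<in> block_perms \<nu>" "v \<in> block_perms \<nu>" for w v
    using perm_prod[OF perm[OF that(1)] perm[OF that(2)]]
    by (intro pair_eqI) (simp_all add: perm_pair_def)
  show "twist Q n (perm_pair n w) b = 1 \<and> twist Q n b (perm_pair n w) = 1"
    if "w \<in> block_perms \<nu>" "b \<in> pair_partitions n" for w b
    using perm[OF that(1)] that(2) by (rule twist_perm)
  show "?I \<in> pair_partitions n" by (rule I)
  show "pair_mult n ?I ?I = ?I" by (rule index_elem_idem[OF env])
  show "twist Q n ?I ?I \<noteq> 0" by (rule twist_nonzero)
  show "pair_mult n (perm_pair n w) ?I = pair_mult n ?I (perm_pair n w)" if "w \<in> block_perms \<nu>" for w
    using that env by (rule perm_commute)
  show "w = v" if "w \<in> block_perms \<nu>" "v \<in> block_perms \<nu>"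
    "pair_mult n (perm_pair n w) ?I = pair_mult n (perm_pair n v) ?I" for w v
    using that(1,2) env that(3) by (rule perm_unit_inj)
  show "lower n \<nu> \<subseteq> pair_partitions n" by (auto simp: lower_def)
  show "pair_mult n a b \<in> lower n \<nu> \<and> pair_mult n b a \<in> lower n \<nu>"
    if "a \<in> pair_partitions n" "b \<in> lower n \<nu>" for a b
    using that pair_mult_closed prop_index_mult_left prop_index_mult_right index_less_trans
    unfolding lower_def by blast
  show "pair_mult n (perm_pair n w) ?I \<notin> lower n \<nu>" if "w \<in> block_perms \<nu>" for w
    using prop_index_perm_unit[OF perm[OF that] I] prop_index_index_elem[OF \<nu> env]
    by (simp add: lower_def index_less_iff)
  show "pair_mult n ?I (pair_mult n a ?I) \<in> lower n \<nu> \<or>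
      (\<exists>w\<in>block_perms \<nu>. pair_mult n ?I (pair_mult n a ?I) = pair_mult n (perm_pair n w) ?I)"
    if a: "a \<in> pair_partitions n" for a
  proof (cases "prop_index n (pair_mult n ?I (pair_mult n a ?I)) = \<nu>")
    case True
    then show ?thesis using corner_perm[OF a env HOL.refl] by blast
  next
    case False
    have aI: "pair_mult n a ?I \<in> pair_partitions n" by (rule pair_mult_closed[OF a I])
    have "index_le (prop_index n (pair_mult n ?I (pair_mult n a ?I))) \<nu>"
      using prop_index_mult_left[OF I aI] prop_index_index_elem[OF \<nu> env] by simp
    then show ?thesis
      using False pair_mult_closed[OF I aI] by (simp add: lower_def index_less_iff)
  qed
qed (rule HOL.refl)

abbreviation A where "A \<equiv> pair_algebra Q n"

definition idem where
  "idem \<nu> = (\<lambda>c. inverse (twist Q n (index_elem n \<nu>) (index_elem n \<nu>)) * basis_elem (index_elem n \<nu>) c)"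

lemma lower_ideal_eq: "lower_ideal Q n \<nu> = {f \<in> carrier A. \<forall>a. f a \<noteq> 0 \<longrightarrow> a \<in> lower n \<nu>}"
  unfolding lower_ideal_def lower_def with_index_def using prop_index_in by blast

lemma embed_eq: "embed n \<nu> = (\<lambda>f c. \<Sum>w\<in>block_perms \<nu>. f w * basis_elem (perm_pair n w) c)"
  by (simp add: embed_def[abs_def] perm_pair_def)

lemma apex_pair:
  assumes "\<nu> \<in> indices"
  shows "apex (lower_ideal Q n \<nu>) A (block_algebra \<nu>) (embed n \<nu>) (idem \<nu>)"
proof -
  interpret monoid_apex "pair_partitions n" "twist Q n" "pair_mult n" "perm_pair n id"
    "block_perms \<nu>" "perm_pair n" "index_elem n \<nu>" "lower n \<nu>"
    by (rule monoid_apex[OF assms])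
  show ?thesis
    using apex
    unfolding J_def e_def \<phi>_def[abs_def] lower_ideal_eq embed_eq idem_def pair_algebra_eq .
qed

text \<open>By \<open>index_factor\<close> a basis element is, up to a nonzero scalar, a two-sided
  multiple of the idempotent of its own index.\<close>

lemma ideal_contains:
  assumes K: "ideal K A" and a: "a \<in> pair_partitions n" and e: "idem (prop_index n a) \<in> K"
  shows "(\<lambda>c. k * basis_elem a c) \<in> K"
proof -
  interpret twisted_monoid "pair_partitions n" "twist Q n" "pair_mult n" "perm_pair n id"
    by (rule twisted_monoid_pairs)
  interpret K: ideal K P using K unfolding pair_algebra_eq .
  let ?\<nu> = "prop_index n a"
  let ?I = "index_elem n ?\<nu>"
  note I = index_elem_closed[OF env_prop_index[OF a]]
  obtain x y where x: "x \<in> pair_partitions n" and y: "y \<in> pair_partitions n"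
    and xy: "a = pair_mult n x (pair_mult n ?I y)"
    by (rule index_factor[OF a HOL.refl])
  \<comment> \<open>Chosen to cancel the inverse twist in the idempotent and the twists of the two
    products in x (\<I>_\<nu> y), so that the basis element a appears with coefficient k.\<close>
  define k' where "k' = k * twist Q n ?I ?I / (twist Q n ?I y * twist Q n x (pair_mult n ?I y))"
  have "(\<lambda>c. k' * basis_elem x c) \<otimes>\<^bsub>P\<^esub> (idem ?\<nu> \<otimes>\<^bsub>P\<^esub> (\<lambda>c. 1 * basis_elem y c)) \<in> K"
    by (rule K.I_l_closed[OF K.I_r_closed[OF e basis_closed[OF y]] basis_closed[OF x]])
  also have "(\<lambda>c. k' * basis_elem x c) \<otimes>\<^bsub>P\<^esub> (idem ?\<nu> \<otimes>\<^bsub>P\<^esub> (\<lambda>c. 1 * basis_elem y c)) =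
      (\<lambda>c. k * basis_elem a c)"
    unfolding idem_def basis_mult[OF I y] basis_mult[OF x m_closed[OF I y]] xy[symmetric]
    using twist_nonzero by (simp add: k'_def)
  finally show ?thesis .
qed

lemma index_in: "a \<in> pair_partitions n \<Longrightarrow> prop_index n a \<in> indices"
  using env_prop_index prop_index_in by blast

lemma apex_family_pair:
  "apex_family A indices index_le index_size (lower_ideal Q n) block_algebra (embed n) idem"
proof (intro apex_family.intro apex_family_axioms.intro)
  interpret twisted_monoid "pair_partitions n" "twist Q n" "pair_mult n" "perm_pair n id"
    by (rule twisted_monoid_pairs)
  note A = pair_algebra_eq[of Q n]
  show "ring A" unfolding A by (rule ring_P)
  show "apex (lower_ideal Q n \<nu>) A (block_algebra \<nu>) (embed n \<nu>) (idem \<nu>)" if "\<nu> \<in> indices" for \<nu>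
    using that by (rule apex_pair)
  show "\<nu> = \<mu>" if "index_le \<nu> \<mu>" "index_le \<mu> \<nu>" for \<nu> \<mu>
    using that by (rule index_le_antisym)
  have idem_closed: "idem \<nu> \<in> carrier P" if "\<nu> \<in> indices" for \<nu>
    unfolding idem_def using that index_elem_closed by (intro basis_closed) blast
  show "idem \<mu> \<otimes>\<^bsub>A\<^esub> r \<otimes>\<^bsub>A\<^esub> idem \<nu> \<in> lower_ideal Q n \<nu>"
    if \<nu>: "\<nu> \<in> indices" and \<mu>: "\<mu> \<in> indices" and r: "r \<in> carrier A" and le: "\<not> index_le \<nu> \<mu>" for \<nu> \<mu> r
  proof -
    \<comment> \<open>Nonzero coefficients occur only at products \<I>_\<mu> b \<I>_\<nu>, whose
      index is below both \<mu> and \<nu>. Were it \<nu> itself, \<nu> would be below \<mu>.\<close>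
    have "c \<in> lower n \<nu>" if nz: "(idem \<mu> \<otimes>\<^bsub>P\<^esub> r \<otimes>\<^bsub>P\<^esub> idem \<nu>) c \<noteq> 0" for c
    proof -
      obtain a b where ab: "a \<in> pair_partitions n" "b \<in> pair_partitions n" "(idem \<mu> \<otimes>\<^bsub>P\<^esub> r) a \<noteq> 0"
        "idem \<nu> b \<noteq> 0" "c = pair_mult n a b" using nz by (rule mult_nonzero)
      obtain a' b' where ab': "a' \<in> pair_partitions n" "b' \<in> pair_partitions n" "idem \<mu> a' \<noteq> 0"
        "a = pair_mult n a' b'" using ab(3) by (rule mult_nonzero)
      have I: "a' = index_elem n \<mu>" "b = index_elem n \<nu>"
        using ab(4) ab'(3) by (auto simp: idem_def basis_elem_def split: if_splits)
      have ix: "prop_index n a' = \<mu>" "prop_index n b = \<nu>"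
        unfolding I using \<mu> \<nu> prop_index_index_elem by blast+
      have "index_le (prop_index n c) \<nu>"
        unfolding ab(5) using prop_index_mult_right[OF ab(1,2)] ix by simp
      moreover have "index_le (prop_index n c) \<mu>"
        using prop_index_mult_left[OF ab(1,2)] prop_index_mult_left[OF ab'(1,2)] ix
        unfolding ab(5) ab'(4) by (metis rtranclp_trans)
      ultimately show ?thesis
        using le m_closed[OF ab(1,2)] unfolding lower_def index_less_iff ab(5) by blast
    qed
    moreover have "idem \<mu> \<otimes>\<^bsub>P\<^esub> r \<otimes>\<^bsub>P\<^esub> idem \<nu> \<in> carrier P"
      using idem_closed[OF \<mu>] idem_closed[OF \<nu>] r unfolding A by (intro mult_closed)
    ultimately show ?thesis unfolding lower_ideal_eq unfolding A by blast
  qed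
  show "lower_ideal Q n \<nu> \<subseteq> K"
    if \<nu>: "\<nu> \<in> indices" and K: "ideal K A"
      and e: "\<And>\<mu>. \<mu> \<in> indices \<Longrightarrow> index_size \<mu> < index_size \<nu> \<Longrightarrow> idem \<mu> \<in> K" for \<nu> K
  proof
    interpret K: ideal K P using K unfolding A .
    fix f assume f: "f \<in> lower_ideal Q n \<nu>"
    then have fP: "f \<in> carrier P" unfolding lower_ideal_eq A by blast
    show "f \<in> K"
    proof (rule span_induct[OF fP])
      show "(\<lambda>_. 0) \<in> K" using additive_subgroup.zero_closed[OF K.is_additive_subgroup] by (simp add: P_simps(3))
      show "(\<lambda>c. g c + g' c) \<in> K" if "g \<in> K" "g' \<in> K" for g g'
        using additive_subgroup.a_closed[OF K.is_additive_subgroup that] by (simp add: P_simps(4))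
      fix a k assume a: "a \<in> pair_partitions n" "f a \<noteq> 0"
      then have "index_less (prop_index n a) \<nu>" using f unfolding lower_ideal_eq lower_def by blast
      \<comment> \<open>A strictly smaller index has strictly smaller size, so the idempotent that
        generates this basis element is already in K.\<close>
      then have "index_size (prop_index n a) < index_size \<nu>"
        using index_le_size unfolding index_less_iff by blast
      then show "(\<lambda>c. k * basis_elem a c) \<in> K"
        by (intro ideal_contains[OF K a(1)] e index_in[OF a(1)])
    qed
  qed
  show "\<one>\<^bsub>A\<^esub> \<in> K" if K: "ideal K A" and e: "\<And>\<mu>. \<mu> \<in> indices \<Longrightarrow> idem \<mu> \<in> K" for K
    using ideal_contains[OF K u_closed e[OF index_in[OF u_closed]], of 1]
    by (simp add: A P_simps(2))
qed

text \<open>\<I>_\<nu> and its idempotent multiple generate the same left ideal, so the standard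
  module, which is defined with \<I>_\<nu>, is the induced module of the apex.\<close>

lemma standard_module_eq:
  assumes "\<nu> \<in> indices"
  shows "standard_module Q n \<nu> L =
    apex_family.std A (lower_ideal Q n) block_algebra (embed n) idem \<nu> L"
proof -
  interpret monoid_apex "pair_partitions n" "twist Q n" "pair_mult n" "perm_pair n id"
    "block_perms \<nu>" "perm_pair n" "index_elem n \<nu>" "lower n \<nu>"
    by (rule monoid_apex[OF assms])
  have "{x \<otimes>\<^bsub>A\<^esub> basis_elem (index_elem n \<nu>) | x. x \<in> carrier A} = {x \<otimes>\<^bsub>A\<^esub> idem \<nu> | x. x \<in> carrier A}"
    using left_ideal_e unfolding e_def idem_def pair_algebra_eq .
  then show ?thesis
    unfolding standard_module_def index_bimodule_def apex_family.std_def[OF apex_family_pair]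
      ideal_bimodule_def Let_def by simp
qed

lemma labels_eq:
  "(\<Union>i\<le>n. labels i :: 'k simple_label set) =
    {(\<nu>, C). \<nu> \<in> indices \<and> C \<in> simple_classes (block_algebra \<nu>)}"
  by (auto simp: labels_def)

lemma heads:
  fixes L :: "'k simple_label \<Rightarrow> 'k block_module"
  defines "hds \<equiv> \<lambda>\<Theta>. module_head A (standard_module Q n (fst \<Theta>) (L \<Theta>))"
  assumes L: "\<And>\<Theta>. \<Theta> \<in> (\<Union>i\<le>n. labels i) \<Longrightarrow> L \<Theta> \<in> snd \<Theta>"
  shows "\<And>\<Theta>. \<Theta> \<in> (\<Union>i\<le>n. labels i) \<Longrightarrow> simple_module A (hds \<Theta>)"
    and "\<And>\<Theta> \<Theta>'. \<Theta> \<in> (\<Union>i\<le>n. labels i) \<Longrightarrow> \<Theta>' \<in> (\<Union>i\<le>n. labels i) \<Longrightarrow>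
      module_iso A (hds \<Theta>) (hds \<Theta>') \<Longrightarrow> \<Theta> = \<Theta>'"
    and "\<And>M :: (pair_partition \<Rightarrow> 'k, 'm) module. simple_module A M \<Longrightarrow>
      \<exists>\<Theta>\<in>(\<Union>i\<le>n. labels i). module_iso A M (hds \<Theta>)"
proof -
  interpret apex_family A indices index_le index_size "lower_ideal Q n" block_algebra "embed n" idem
    by (rule apex_family_pair)
  have hds: "hds \<Theta> = module_head A (std (fst \<Theta>) (L \<Theta>))" if "\<Theta> \<in> (\<Union>i\<le>n. labels i)" for \<Theta>
    using that standard_module_eq unfolding hds_def labels_eq by auto
  note c = simple_modules_classified[of L, folded labels_eq, OF L]
  show "simple_module A (hds \<Theta>)" if "\<Theta> \<in> (\<Union>i\<le>n. labels i)" for \<Theta>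
    unfolding hds[OF that] using that by (rule c(1)[rotated])
  show "\<Theta> = \<Theta>'" if "\<Theta> \<in> (\<Union>i\<le>n. labels i)" "\<Theta>' \<in> (\<Union>i\<le>n. labels i)" "module_iso A (hds \<Theta>) (hds \<Theta>')" for \<Theta> \<Theta>'
    using that(3) unfolding hds[OF that(1)] hds[OF that(2)] by (rule c(2)[OF _ that(1,2), rotated])
  show "\<exists>\<Theta>\<in>(\<Union>i\<le>n. labels i). module_iso A M (hds \<Theta>)"
    if "simple_module A M" for M :: "(pair_partition \<Rightarrow> 'k, 'm) module"
    using c(3)[OF _ that] hds by auto
qed

lemma labels_bij: "\<exists>f. bij_betw f (\<Union>i\<le>n. labels i :: 'k simple_label set) (simple_classes A)"
proof -
  have "\<exists>L. L \<in> snd \<Theta>" if "\<Theta> \<in> (\<Union>i\<le>n. labels i :: 'k simple_label set)" for \<Theta>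
    using that simple_classesD(1) unfolding labels_eq by fastforce
  then obtain L where L: "\<And>\<Theta>. \<Theta> \<in> (\<Union>i\<le>n. labels i :: 'k simple_label set) \<Longrightarrow> L \<Theta> \<in> snd \<Theta>"
    by metis
  show ?thesis
    by (rule simple_classes_classification[where h = "\<lambda>\<Theta>. module_head A (standard_module Q n (fst \<Theta>) (L \<Theta>))"])
      (rule heads[OF L]; assumption)+
qed

end

theorem proposition16:
  shows
    "(\<forall>(T :: 't set) leq (Q :: 't \<Rightarrow> 'k::field).
        finite T \<and> partial_order_on T leq \<longrightarrow>
        card (simple_classes (partition_algebra T leq Q 0)) = 1) \<and>
     (\<forall>n (Q :: nat \<Rightarrow> 'k).
        n \<ge> 1 \<and> Q 1 * Q 2 \<noteq> 0 \<and>
        (\<forall>\<nu>\<in>prop_indices. env \<nu> \<le> n \<longrightarrow>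
           semisimple_ring (block_algebra \<nu> :: ((nat \<Rightarrow> nat) \<Rightarrow> 'k) ring)) \<longrightarrow>
        (let P = pair_algebra Q;
             \<Lambda> = (\<lambda>m. \<Union>i\<le>m. labels i :: 'k simple_label set)
         in
          (disjoint_family_on (labels :: nat \<Rightarrow> 'k simple_label set) {..n} \<and>
           \<Lambda> n = \<Lambda> (n - 1) \<union> labels n \<and>
           (\<exists>f. bij_betw f (\<Lambda> (n - 1)) (simple_classes (P (n - 1)))) \<and>
           (\<exists>f. bij_betw f (\<Lambda> n) (simple_classes (P n)))) \<and>
          (\<forall>L. (\<forall>\<Theta>\<in>\<Lambda> n. L \<Theta> \<in> snd \<Theta>) \<longrightarrow>
             (let hd_S = (\<lambda>\<Theta>. module_head (P n) (standard_module Q n (fst \<Theta>) (L \<Theta>)))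
              in
               (\<forall>\<Theta>\<in>\<Lambda> n. simple_module (P n) (hd_S \<Theta>)) \<and>
               (\<forall>\<Theta>\<in>\<Lambda> n. \<forall>\<Theta>'\<in>\<Lambda> n. module_iso (P n) (hd_S \<Theta>) (hd_S \<Theta>') \<longrightarrow> \<Theta> = \<Theta>') \<and>
               (\<forall>M :: (pair_partition \<Rightarrow> 'k, 'm) module. simple_module (P n) M \<longrightarrow>
                  (\<exists>\<Theta>\<in>\<Lambda> n. module_iso (P n) M (hd_S \<Theta>)))))))"
proof (intro conjI allI impI)
  fix T :: "'t set" and leq and Q :: "'t \<Rightarrow> 'k"
  assume "finite T \<and> partial_order_on T leq"
  then show "card (simple_classes (partition_algebra T leq Q 0)) = 1"
    using simple_classes_partition_algebra_0 by blast
next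
  fix n and Q :: "nat \<Rightarrow> 'k"
  assume *: "n \<ge> 1 \<and> Q 1 * Q 2 \<noteq> 0 \<and>
        (\<forall>\<nu>\<in>prop_indices. env \<nu> \<le> n \<longrightarrow>
           semisimple_ring (block_algebra \<nu> :: ((nat \<Rightarrow> nat) \<Rightarrow> 'k) ring))"
  then have Q: "pair_apex Q" by (simp add: pair_apex_def)
  have disj: "disjoint_family_on (labels :: nat \<Rightarrow> 'k simple_label set) {..n}"
    by (auto simp: disjoint_family_on_def labels_def)
  have "{..n} = insert n {..n - 1}" using * by auto
  then have Un: "(\<Union>i\<le>n. labels i :: 'k simple_label set) = (\<Union>i\<le>n - 1. labels i) \<union> labels n" by auto
  show "let P = pair_algebra Q;
             \<Lambda> = (\<lambda>m. \<Union>i\<le>m. labels i :: 'k simple_label set)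
         in
          (disjoint_family_on (labels :: nat \<Rightarrow> 'k simple_label set) {..n} \<and>
           \<Lambda> n = \<Lambda> (n - 1) \<union> labels n \<and>
           (\<exists>f. bij_betw f (\<Lambda> (n - 1)) (simple_classes (P (n - 1)))) \<and>
           (\<exists>f. bij_betw f (\<Lambda> n) (simple_classes (P n)))) \<and>
          (\<forall>L. (\<forall>\<Theta>\<in>\<Lambda> n. L \<Theta> \<in> snd \<Theta>) \<longrightarrow>
             (let hd_S = (\<lambda>\<Theta>. module_head (P n) (standard_module Q n (fst \<Theta>) (L \<Theta>)))
              in
               (\<forall>\<Theta>\<in>\<Lambda> n. simple_module (P n) (hd_S \<Theta>)) \<and>
               (\<forall>\<Theta>\<in>\<Lambda> n. \<forall>\<Theta>'\<in>\<Lambda> n. module_iso (P n) (hd_S \<Theta>) (hd_S \<Theta>') \<longrightarrow> \<Theta> = \<Theta>') \<and>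
               (\<forall>M :: (pair_partition \<Rightarrow> 'k, 'm) module. simple_module (P n) M \<longrightarrow>
                  (\<exists>\<Theta>\<in>\<Lambda> n. module_iso (P n) M (hd_S \<Theta>)))))"
    unfolding Let_def
  \<comment> \<open>The predicate \<open>pair_apex\<close> constrains only Q, so one instance yields
    the bijections for n and for n - 1.\<close>
  proof (intro conjI allI impI disj Un pair_apex.labels_bij[OF Q])
    fix L assume "\<forall>\<Theta>\<in>(\<Union>i\<le>n. labels i :: 'k simple_label set). L \<Theta> \<in> snd \<Theta>"
    then have L: "\<And>\<Theta>. \<Theta> \<in> (\<Union>i\<le>n. labels i :: 'k simple_label set) \<Longrightarrow> L \<Theta> \<in> snd \<Theta>" by (rule bspec)
    note h = pair_apex.heads[OF Q L]
    show "\<forall>\<Theta>\<in>(\<Union>i\<le>n. labels i). simple_module (pair_algebra Q n)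
        (module_head (pair_algebra Q n) (standard_module Q n (fst \<Theta>) (L \<Theta>)))"
      by (intro ballI) (rule h(1))
    show "\<forall>\<Theta>\<in>(\<Union>i\<le>n. labels i). \<forall>\<Theta>'\<in>(\<Union>i\<le>n. labels i).
        module_iso (pair_algebra Q n) (module_head (pair_algebra Q n) (standard_module Q n (fst \<Theta>) (L \<Theta>)))
          (module_head (pair_algebra Q n) (standard_module Q n (fst \<Theta>') (L \<Theta>'))) \<longrightarrow> \<Theta> = \<Theta>'"
      by (intro ballI impI) (rule h(2))
    show "\<exists>\<Theta>\<in>(\<Union>i\<le>n. labels i). module_iso (pair_algebra Q n) M
        (module_head (pair_algebra Q n) (standard_module Q n (fst \<Theta>) (L \<Theta>)))"
      if "simple_module (pair_algebra Q n) M" for M :: "(pair_partition \<Rightarrow> 'k, 'm) module"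
      by (rule h(3)[OF _ that])
  qed
qed

end
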